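(* Let $N\ge2$, $q>1$, $0\le\tau<1$, $\rho,\lambda\in\mathbb R$ and $\theta<-2$. Let $\Omega\subseteq\mathbb R^N$ be a domain with $0\in\Omega$ and let $u$ be any positive solution of $\mathbb L_{\rho,\lambda,\tau}[u]=|x|^\theta u^q$ in $\Omega\setminus\{0\}$. $\bullet$ Assume that $f_\rho(\beta)>0$. ($P_0$) If $\beta\in(\varpi_2(\rho),0)$ in Case $[N_2]$, then exactly one of the following holds as $|x|\to0$: (i) $u(x)\sim a\,|x|^{-\varpi_1(\rho)}$ and $x\cdot\nabla u(x)\sim-a\,\varpi_1(\rho)\,|x|^{-\varpi_1(\rho)}$ for some $a\in\mathbb R_+$; (ii) $u(x)\sim b\,\Phi_{\varpi_2(\rho)}(|x|)$ and $x\cdot\nabla u(x)\sim-b\,\varpi_2(\rho)\,\Phi_{\varpi_2(\rho)}(|x|)$ for some $b\in\mathbb R_+$; (iii) $u(x)\sim U_{\rho,\beta}(|x|)$. ($P_1$) In the remaining situations, $u(x)\sim U_{\rho,\beta}(|x|)$ as $|x|\to0$. $\bullet$ Assume that $f_\rho(\beta)\le0$. ($Z_1$) If $\beta=\varpi_1(\rho)$ in Case $[N_j]$ ($j=1,2$) and, in addition, $\rho\neq\Upsilon$ if Case $[N_2]$ holds, then $$u(x)\sim\left(\frac{|\varpi_1(\rho)|\left(1-\lambda\tau|\varpi_1(\rho)|^{-\tau-1}\right)}{q-1}\right)^{\frac1{q-1}}\frac{|x|^{-\varpi_1(\rho)}}{|\log|x||^{\frac1{q-1}}}\quad\text{as }|x|\to0.$$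 ($Z_2$) If $\rho=\Upsilon$ in Case $[N_2]$ and $\beta=\varpi_1(\rho)=\varpi_2(\rho)=-(\lambda\tau)^{\frac1{\tau+1}}$, then $$u(x)\sim\left(\frac{2(q+\tau)}{(q-1)^2}\right)^{\frac1{q-1}}\frac{|x|^{-\varpi_1(\rho)}}{|\log|x||^{\frac2{q-1}}}\quad\text{as }|x|\to0.$$ ($N$) In the remaining situations, there exists $a\in\mathbb R_+$ such that $u(x)\sim a\,|x|^{-\varpi_1(\rho)}$ and $x\cdot\nabla u(x)\sim-a\,\varpi_1(\rho)\,|x|^{-\varpi_1(\rho)}$ as $|x|\to0$.
   Context: $\mathbb R_+=(0,\infty)$, $\beta=\frac{\theta+2}{q-1}$, and $$\mathbb L_{\rho,\lambda,\tau}[u]=\Delta u-(N-2+2\rho)\frac{x\cdot\nabla u}{|x|^2}+\lambda\,\frac{u^\tau|\nabla u|^{1-\tau}}{|x|^{1+\tau}}$$ (for $\tau=0$ the last term is $\lambda|\nabla u|/|x|$). A positive solution is a positive function $u\in C^1(\Omega\setminus\{0\})$ satisfying the equation in the sense of distributions in $\Omega\setminus\{0\}$ (test functions in $C^1_c(\Omega\setminus\{0\})$). The notation $f\sim g$ as $|x|\to0$ means $f/g\to1$. $f_\rho(t)=t(t+2\rho)+\lambda|t|^{1-\tau}$ for $t\in\mathbb R$. When $f_\rho(\beta)>0$, $U_{\rho,\beta}(r)=[f_\rho(\beta)]^{1/(q-1)}r^{-\beta}$ for $r>0$. For $t<0$ let $\widetilde f_\rho(t)=-t-2\rho+\lambda(-t)^{-\tau}$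 (same sign as $f_\rho(t)$). When $\lambda>0$ and $\tau\in(0,1)$ let $\Upsilon=\frac{\tau+1}{2\tau}(\lambda\tau)^{1/(\tau+1)}$. Cases: - Case $[N_0]$: (a) $\tau=0$, $\lambda\ge2\rho$; or (b) $\lambda>0$, $\tau\in(0,1)$, $\rho<\Upsilon$. Then $\widetilde f_\rho>0$ on $(-\infty,0)$. - Case $[N_1]$: (a) $\tau=0$, $\lambda<2\rho$; or (b) $\lambda<0$, $\tau\in(0,1)$, $\rho\in\mathbb R$. Then $\widetilde f_\rho=0$ has exactly one negative root, $\varpi_1(\rho)$. - Case $[N_2]$: $\lambda>0$, $\tau\in(0,1)$, $\rho\ge\Upsilon$. The negative roots of $\widetilde f_\rho=0$ are $\varpi_1(\rho)\le\varpi_2(\rho)$, with $\varpi_1(\rho)<-(\lambda\tau)^{1/(\tau+1)}<\varpi_2(\rho)$ if $\rho\neq\Upsilon$ and $\varpi_1(\rho)=\varpi_2(\rho)=-(\lambda\tau)^{1/(\tau+1)}$ if $\rho=\Upsilon$. - Convention: if $\lambda=0$, the equation and $f_\rho$ do not depend on $\tau$, and the case distinction is made with $\tau=0$. In Case $[N_2]$, for $r\in(0,1)$: $\Phi_{\varpi_2(\rho)}(r)=r^{-\varpi_2(\rho)}$ if $\rho>\Upsilon$ and $\Phi_{\varpi_2(\rho)}(r)=r^{-\varpi_2(\rho)}|\log r|^{\frac2{1+\tau}}$ if $\rho=\Upsilon$. *)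

theory Defs
  imports "HOL-Analysis.Analysis" "HOL-Library.Landau_Symbols"
begin

definition grad :: "('a::euclidean_space \<Rightarrow> real) \<Rightarrow> 'a \<Rightarrow> 'a"
  where "grad f x = (THE D. GDERIV f x :> D)"

lemma GDERIV_grad:
  fixes f :: "'a::euclidean_space \<Rightarrow> real"
  assumes "f differentiable (at x)"
  shows "GDERIV f x :> grad f x"
proof -
  obtain f' where f': "(f has_derivative f') (at x)"
    using assms unfolding differentiable_def by blast
  have "f' h = h \<bullet> adjoint f' 1" for h
    using adjoint_works[OF has_derivative_linear[OF f'], of h 1] by simp
  then have "f' = (\<lambda>h. h \<bullet> adjoint f' 1)"
    by (rule ext)
  with f' have ex: "GDERIV f x :> adjoint f' 1"
    unfolding gderiv_def by metis
  have uniq: "D = adjoint f' 1" if D: "GDERIV f x :> D" for D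
  proof -
    have "(\<lambda>h. h \<bullet> D) = (\<lambda>h. h \<bullet> adjoint f' 1)"
      using D ex unfolding gderiv_def by (rule has_derivative_unique)
    then have "\<forall>h. h \<bullet> D = h \<bullet> adjoint f' 1"
      by (rule fun_cong[THEN allI])
    then show ?thesis
      by (simp only: vector_eq_ldot)
  qed
  show ?thesis
    unfolding grad_def by (rule theI, rule ex, erule uniq)
qed

definition C1_on :: "'a::euclidean_space set \<Rightarrow> ('a \<Rightarrow> real) \<Rightarrow> bool"
  where "C1_on S f \<longleftrightarrow> (\<forall>x\<in>S. f differentiable (at x)) \<and> continuous_on S (grad f)"

text \<open>Elements of \<open>C\<^sup>1\<^sub>c(S)\<close> for open \<open>S\<close>, extended by zero to the whole space.\<close>

definition test_function_on :: "'a::euclidean_space set \<Rightarrow> ('a \<Rightarrow> real) \<Rightarrow> bool"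
  where "test_function_on S \<phi> \<longleftrightarrow>
    C1_on UNIV \<phi> \<and> compact (closure {x. \<phi> x \<noteq> 0}) \<and> closure {x. \<phi> x \<noteq> 0} \<subseteq> S"

text \<open>The operator is \<open>\<bbbL>[u] = \<Delta>u + lower_order_terms \<rho> lam \<tau> u\<close>, with \<open>N = DIM('a)\<close>
  (the coefficient \<open>\<lambda>\<close> is called \<open>lam\<close>, as \<open>\<lambda>\<close> is the binder). Since
  \<open>1 - \<tau> > 0\<close>, the library convention \<open>0 powr a = 0\<close> is the right one at critical points of \<open>u\<close>.\<close>

definition lower_order_terms ::
    "real \<Rightarrow> real \<Rightarrow> real \<Rightarrow> ('a::euclidean_space \<Rightarrow> real) \<Rightarrow> 'a \<Rightarrow> real"
  where "lower_order_terms \<rho> lam \<tau> u x =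
    - (real (DIM('a)) - 2 + 2 * \<rho>) * (x \<bullet> grad u x) / (norm x)\<^sup>2
    + lam * (u x powr \<tau> * norm (grad u x) powr (1 - \<tau>)) / norm x powr (1 + \<tau>)"

text \<open>Positive solutions of \<open>\<bbbL>[u] = |x|\<^sup>\<theta> u\<^sup>q\<close> in \<open>\<Omega> - {0}\<close>, in the sense of distributions; only the
  values of \<open>u\<close> on \<open>\<Omega> - {0}\<close> matter.\<close>

definition positive_solution ::
    "real \<Rightarrow> real \<Rightarrow> real \<Rightarrow> real \<Rightarrow> real \<Rightarrow> 'a::euclidean_space set \<Rightarrow> ('a \<Rightarrow> real) \<Rightarrow> bool"
  where "positive_solution \<rho> lam \<tau> \<theta> q \<Omega> u \<longleftrightarrow>
    C1_on (\<Omega> - {0}) u \<and> (\<forall>x\<in>\<Omega> - {0}. u x > 0) \<and>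
    (\<forall>\<phi>. test_function_on (\<Omega> - {0}) \<phi> \<longrightarrow>
      (LINT x:\<Omega> - {0}|lborel. - (grad u x \<bullet> grad \<phi> x) + lower_order_terms \<rho> lam \<tau> u x * \<phi> x)
      = (LINT x:\<Omega> - {0}|lborel. norm x powr \<theta> * u x powr q * \<phi> x))"

definition beta_exp :: "real \<Rightarrow> real \<Rightarrow> real"
  where "beta_exp \<theta> q = (\<theta> + 2) / (q - 1)"

definition f_rho :: "real \<Rightarrow> real \<Rightarrow> real \<Rightarrow> real \<Rightarrow> real"
  where "f_rho \<rho> lam \<tau> t = t * (t + 2 * \<rho>) + lam * \<bar>t\<bar> powr (1 - \<tau>)"

definition U_prof :: "real \<Rightarrow> real \<Rightarrow> real \<Rightarrow> real \<Rightarrow> real \<Rightarrow> real \<Rightarrow> real"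
  where "U_prof \<rho> lam \<tau> \<theta> q r =
    f_rho \<rho> lam \<tau> (beta_exp \<theta> q) powr (1 / (q - 1)) * r powr (- beta_exp \<theta> q)"

definition ftilde_rho :: "real \<Rightarrow> real \<Rightarrow> real \<Rightarrow> real \<Rightarrow> real"
  where "ftilde_rho \<rho> lam \<tau> t = - t - 2 * \<rho> + lam * (- t) powr (- \<tau>)"

definition Upsilon :: "real \<Rightarrow> real \<Rightarrow> real"
  where "Upsilon lam \<tau> = (\<tau> + 1) / (2 * \<tau>) * (lam * \<tau>) powr (1 / (\<tau> + 1))"

text \<open>The disjunct \<open>lam = 0\<close> implements the convention that for \<open>lam = 0\<close> the case distinction is made
  with \<open>\<tau> = 0\<close>. Case \<open>[N\<^sub>0]\<close> is what remains when neither \<open>[N\<^sub>1]\<close> nor \<open>[N\<^sub>2]\<close> holds.\<close>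

definition case_N1 :: "real \<Rightarrow> real \<Rightarrow> real \<Rightarrow> bool"
  where "case_N1 \<rho> lam \<tau> \<longleftrightarrow>
    (\<tau> = 0 \<or> lam = 0) \<and> lam < 2 * \<rho> \<or> lam < 0 \<and> 0 < \<tau> \<and> \<tau> < 1"

definition case_N2 :: "real \<Rightarrow> real \<Rightarrow> real \<Rightarrow> bool"
  where "case_N2 \<rho> lam \<tau> \<longleftrightarrow> lam > 0 \<and> 0 < \<tau> \<and> \<tau> < 1 \<and> \<rho> \<ge> Upsilon lam \<tau>"

text \<open>The set of negative roots has one element in Case \<open>[N\<^sub>1]\<close> and one or two in Case \<open>[N\<^sub>2]\<close>, so
  \<open>varpi1\<close> (in both cases) and \<open>varpi2\<close> (in Case \<open>[N\<^sub>2]\<close>) are the roots in increasing order.\<close>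

definition negative_roots :: "real \<Rightarrow> real \<Rightarrow> real \<Rightarrow> real set"
  where "negative_roots \<rho> lam \<tau> = {t. t < 0 \<and> ftilde_rho \<rho> lam \<tau> t = 0}"

definition varpi1 :: "real \<Rightarrow> real \<Rightarrow> real \<Rightarrow> real"
  where "varpi1 \<rho> lam \<tau> = Min (negative_roots \<rho> lam \<tau>)"

definition varpi2 :: "real \<Rightarrow> real \<Rightarrow> real \<Rightarrow> real"
  where "varpi2 \<rho> lam \<tau> = Max (negative_roots \<rho> lam \<tau>)"

definition Phi_varpi2 :: "real \<Rightarrow> real \<Rightarrow> real \<Rightarrow> real \<Rightarrow> real"
  where "Phi_varpi2 \<rho> lam \<tau> r =
    (if \<rho> = Upsilon lam \<tau>
     then r powr (- varpi2 \<rho> lam \<tau>) * \<bar>ln r\<bar> powr (2 / (1 + \<tau>))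
     else r powr (- varpi2 \<rho> lam \<tau>))"

end

theory Submission
  imports Defs
begin

text \<open>In the variables \<open>s = - ln |x|\<close> and \<open>w = ln u\<close>, with \<open>E = |x| \<nabla>w\<close>, the equation reads
  \<open>|x|\<^sup>2 \<Delta>w + |E|\<^sup>2 - (N - 2 + 2\<rho>) x\<cdot>\<nabla>w + \<lambda> |E| powr (1 - \<tau>) = exp ((q - 1) (w - \<beta> s))\<close>, so that a radial
  function \<open>B(s)\<close> is a super- or subsolution according to the sign of
  \<open>B'' + f(B') - exp ((q - 1) (B - \<beta> s))\<close>. No second derivatives of \<open>u\<close> are needed for the comparison with smooth
  barriers: at an extremum of a \<open>C\<^sup>1\<close> function whose distributional Laplacian is continuous, the gradient vanishes and
  the Laplacian has the expected sign. Explicit barriers then give the behaviour of \<open>w\<close> up to bounded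
  terms in all cases, and exactly in the cases \<open>U\<close>, \<open>Z\<^sub>1\<close>, \<open>Z\<^sub>2\<close>.

  Near a root \<open>\<omega>\<close> of \<open>f\<close> the function \<open>w - W\<close> is bounded for the expected profile \<open>W\<close>. Its maxima
  over spheres, corrected by a supersolution asymptotic to \<open>W\<close>, are quasiconvex in \<open>s\<close>, and its minima, corrected by a
  subsolution, are quasiconcave; hence both converge, and a growth lemma of Hopf type shows that the limits
  agree. In case \<open>P\<^sub>0\<close> the same quasiconcavity shows that
  \<open>w - \<beta> s\<close> is bounded below or tends to \<open>-\<infinity>\<close>, and in the latter situation that \<open>w - W\<close>, for the profile \<open>W\<close> of the root
  \<open>\<omega>\<^sub>2\<close>, is bounded or tends to \<open>-\<infinity>\<close>; this is the trichotomy.\<close>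

section \<open>Functions with continuous distributional Laplacian\<close>

text \<open>Every term of the operator has degree one in \<open>u\<close>, so after division by
  \<open>u\<close> constant multiples of a barrier become translates \<open>B + k\<close>, which
  change only the increasing right-hand side. The gradient term has no fixed sign and for \<tau> > 0
  is not Lipschitz where the gradient vanishes; comparison with explicit barriers gets around this
  because gradients coincide at a contact point. It is linearised only to show that two limits
  agree, and there around a radial slope close to a root, hence away from 0.

  As \<open>u\<close> is only C^1, the equation makes its distributional Laplacian continuous but
  need not yield second derivatives. The calculus is therefore weak throughout: test functions are
  multiplied by C^1 functions.

  Exponents and constants come from \<open>B = b s - p ln X\<close> with \<open>X\<close> close to
  \<open>a s\<close>: \<open>p\<close> matches the exponential, a power of \<open>X\<close>, with
  the first nonvanishing Taylor term of \<open>f\<close> at the root (\<open>p = 1 / (q - 1)\<close>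
  for a simple root, \<open>p = 2 / (q - 1)\<close> for a double one), and \<open>a\<close> balances
  the coefficients.\<close>

definition tfun :: "'a::euclidean_space set \<Rightarrow> ('a \<Rightarrow> real) \<Rightarrow> ('a \<Rightarrow> 'a) \<Rightarrow> bool"
  where "tfun S \<phi> \<Phi> \<longleftrightarrow> (\<forall>x. GDERIV \<phi> x :> \<Phi> x) \<and> continuous_on UNIV \<Phi> \<and>
    (\<exists>K. compact K \<and> K \<subseteq> S \<and> (\<forall>x. x \<notin> K \<longrightarrow> \<phi> x = 0 \<and> \<Phi> x = 0))"

text \<open>\<open>v\<close> is \<open>C\<^sup>1\<close> on the open set \<open>S\<close> with gradient \<open>G\<close>, and \<open>\<Delta>v = g\<close> in the sense of distributions.\<close>

definition wlap :: "'a::euclidean_space set \<Rightarrow> ('a \<Rightarrow> real) \<Rightarrow> ('a \<Rightarrow> 'a) \<Rightarrow> ('a \<Rightarrow> real) \<Rightarrow> bool"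
  where "wlap S v G g \<longleftrightarrow> open S \<and> (\<forall>x\<in>S. GDERIV v x :> G x) \<and> continuous_on S G \<and> continuous_on S g \<and>
    (\<forall>\<phi> \<Phi>. tfun S \<phi> \<Phi> \<longrightarrow> (\<integral>x. G x \<bullet> \<Phi> x \<partial>lborel) = - (\<integral>x. g x * \<phi> x \<partial>lborel))"

lemma GDERIV_continuous_on:
  assumes "\<And>x. x \<in> S \<Longrightarrow> GDERIV v x :> G x"
  shows "continuous_on S v"
  using assms by (meson continuous_at_imp_continuous_on gderiv_def has_derivative_continuous)

lemma continuous_on_zero_outside:
  fixes h :: "'a::euclidean_space \<Rightarrow> 'b::real_normed_vector"
  assumes "open S" "continuous_on S h" "compact K" "K \<subseteq> S" "\<And>x. x \<notin> K \<Longrightarrow> h x = 0"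
  shows "continuous_on UNIV h"
proof -
  have "continuous_on (- K) h"
    by (rule continuous_on_eq[where f = "\<lambda>_. 0"]) (use assms in auto)
  moreover have "open (- K)" using assms(3) by (simp add: compact_imp_closed open_Compl)
  moreover have "S \<union> - K = UNIV" using assms(4) by auto
  ultimately show ?thesis
    using continuous_on_open_Un[of S "- K" h] assms(1,2) by simp
qed

lemma integrable_zero_outside:
  fixes h :: "'a::euclidean_space \<Rightarrow> real"
  assumes "open S" "continuous_on S h" "compact K" "K \<subseteq> S" "\<And>x. x \<notin> K \<Longrightarrow> h x = 0"
  shows "integrable lborel h"
proof -
  have "integrable lborel (\<lambda>x. indicator K x *\<^sub>R h x)"
    by (rule borel_integrable_compact) (use assms continuous_on_subset in auto)
  moreover have "(\<lambda>x. indicator K x *\<^sub>R h x) = h"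
    using assms(5) by (auto simp: fun_eq_iff indicator_def)
  ultimately show ?thesis by simp
qed

lemma tfunD:
  assumes "tfun S \<phi> \<Phi>"
  shows "GDERIV \<phi> x :> \<Phi> x" "continuous_on A \<Phi>" "continuous_on A \<phi>"
  using assms GDERIV_continuous_on[of A \<phi> \<Phi>] continuous_on_subset unfolding tfun_def by blast+

lemma wlapD:
  assumes "wlap S v G g"
  shows "open S" "x \<in> S \<Longrightarrow> GDERIV v x :> G x" "continuous_on S G" "continuous_on S g" "continuous_on S v"
    "tfun S \<phi> \<Phi> \<Longrightarrow> (\<integral>x. G x \<bullet> \<Phi> x \<partial>lborel) = - (\<integral>x. g x * \<phi> x \<partial>lborel)"
  using assms GDERIV_continuous_on[of S v G] unfolding wlap_def by blast+

text \<open>\<open>G\<close> and \<open>g\<close> are controlled only on \<open>S\<close>, but their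
  products with a test function vanish off a compact subset of \<open>S\<close>. This makes the
  whole-space integrals in \<open>wlap\<close> meaningful and lets them be split.\<close>

lemma tfun_integrable:
  assumes "tfun S \<phi> \<Phi>" "open S"
  shows "continuous_on S G \<Longrightarrow> integrable lborel (\<lambda>x. G x \<bullet> \<Phi> x)"
    and "continuous_on S g \<Longrightarrow> integrable lborel (\<lambda>x. g x * \<phi> x)"
proof -
  obtain K where K: "compact K" "K \<subseteq> S" "\<And>x. x \<notin> K \<Longrightarrow> \<phi> x = 0 \<and> \<Phi> x = 0"
    using assms(1) unfolding tfun_def by blast
  show "continuous_on S G \<Longrightarrow> integrable lborel (\<lambda>x. G x \<bullet> \<Phi> x)"
    by (rule integrable_zero_outside[OF assms(2) _ K(1,2)])
      (use K(3) tfunD(2)[OF assms(1), of S] in \<open>auto intro!: continuous_intros\<close>)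
  show "continuous_on S g \<Longrightarrow> integrable lborel (\<lambda>x. g x * \<phi> x)"
    by (rule integrable_zero_outside[OF assms(2) _ K(1,2)])
      (use K(3) tfunD(3)[OF assms(1), of S] in \<open>auto intro!: continuous_intros\<close>)
qed

lemma tfun_mono: "tfun S \<phi> \<Phi> \<Longrightarrow> S \<subseteq> T \<Longrightarrow> tfun T \<phi> \<Phi>"
  unfolding tfun_def by blast

lemma wlap_subset: "wlap S v G g \<Longrightarrow> T \<subseteq> S \<Longrightarrow> open T \<Longrightarrow> wlap T v G g"
  unfolding wlap_def by (meson continuous_on_subset subsetD tfun_mono)

lemma GDERIV_cong_open:
  assumes "open S" "x \<in> S" "\<And>y. y \<in> S \<Longrightarrow> v y = w y"
  shows "GDERIV v x :> D \<longleftrightarrow> GDERIV w x :> D"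
  unfolding gderiv_def
  using has_derivative_transform_within_open[of v _ x UNIV S w] has_derivative_transform_within_open[of w _ x UNIV S v] assms
  by auto

lemma wlap_cong:
  assumes "wlap S v G g" "\<And>x. x \<in> S \<Longrightarrow> v x = v' x" "\<And>x. x \<in> S \<Longrightarrow> G x = G' x"
    "\<And>x. x \<in> S \<Longrightarrow> g x = g' x"
  shows "wlap S v' G' g'"
proof -
  have o: "open S" using assms(1) by (rule wlapD)
  have "(\<integral>x. G' x \<bullet> \<Phi> x \<partial>lborel) = - (\<integral>x. g' x * \<phi> x \<partial>lborel)" if t: "tfun S \<phi> \<Phi>" for \<phi> \<Phi>
  proof -
    have "x \<notin> S \<Longrightarrow> \<phi> x = 0 \<and> \<Phi> x = 0" for x using t unfolding tfun_def by blast
    then have "(\<lambda>x. G' x \<bullet> \<Phi> x) = (\<lambda>x. G x \<bullet> \<Phi> x)" "(\<lambda>x. g' x * \<phi> x) = (\<lambda>x. g x * \<phi> x)"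
      using assms(3,4) by (metis inner_zero_right, metis mult_zero_right)
    then show ?thesis using wlapD(6)[OF assms(1) t] by simp
  qed
  moreover have "GDERIV v' x :> G' x" if "x \<in> S" for x
    using GDERIV_cong_open[OF o that assms(2)] wlapD(2)[OF assms(1) that] assms(3) that by auto
  moreover have "continuous_on S G'" "continuous_on S g'"
    using wlapD(3,4)[OF assms(1)] assms(3,4) by (auto intro: continuous_on_eq)
  ultimately show ?thesis using o unfolding wlap_def by blast
qed

lemma wlap_const: "open S \<Longrightarrow> wlap S (\<lambda>_. c) (\<lambda>_. 0) (\<lambda>_. 0)"
  unfolding wlap_def by (auto simp: GDERIV_const)

lemma wlap_add:
  assumes "wlap S v G g" "wlap S w H h"
  shows "wlap S (\<lambda>x. v x + w x) (\<lambda>x. G x + H x) (\<lambda>x. g x + h x)"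
  unfolding wlap_def
proof (intro conjI allI impI ballI)
  show "open S" using assms(1) by (rule wlapD)
  fix x assume "x \<in> S"
  then show "GDERIV (\<lambda>x. v x + w x) x :> G x + H x"
    by (intro GDERIV_add wlapD(2)[OF assms(1)] wlapD(2)[OF assms(2)])
next
  show "continuous_on S (\<lambda>x. G x + H x)" "continuous_on S (\<lambda>x. g x + h x)"
    by (intro continuous_intros wlapD(3,4)[OF assms(1)] wlapD(3,4)[OF assms(2)])+
next
  fix \<phi> \<Phi> assume t: "tfun S \<phi> \<Phi>"
  have o: "open S" using assms(1) by (rule wlapD)
  note i = tfun_integrable[OF t o]
  show "(\<integral>x. (G x + H x) \<bullet> \<Phi> x \<partial>lborel) = - (\<integral>x. (g x + h x) * \<phi> x \<partial>lborel)"
    unfolding inner_add_left distrib_right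
    by (subst (1 2) Bochner_Integration.integral_add)
      (simp_all add: i wlapD(3,4)[OF assms(1)] wlapD(3,4)[OF assms(2)] wlapD(6)[OF assms(1) t] wlapD(6)[OF assms(2) t])
qed

text \<open>Test functions are merely C^1, so a product with a C^1 function on \<open>S\<close> is
  again admissible. The product and chain rules for weak Laplacians rest on this closure
  property.\<close>

lemma tfun_mult:
  assumes t: "tfun S \<phi> \<Phi>" and o: "open S" and a: "\<And>x. x \<in> S \<Longrightarrow> GDERIV a x :> A x" and A: "continuous_on S A"
  shows "tfun S (\<lambda>x. a x * \<phi> x) (\<lambda>x. a x *\<^sub>R \<Phi> x + \<phi> x *\<^sub>R A x)"
proof -
  obtain K where K: "compact K" "K \<subseteq> S" "\<And>x. x \<notin> K \<Longrightarrow> \<phi> x = 0 \<and> \<Phi> x = 0"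
    using t unfolding tfun_def by blast
  have "GDERIV (\<lambda>x. a x * \<phi> x) x :> a x *\<^sub>R \<Phi> x + \<phi> x *\<^sub>R A x" for x
  proof (cases "x \<in> S")
    case True
    then show ?thesis
      using GDERIV_mult[OF a[OF True] tfunD(1)[OF t]] by (simp add: add.commute)
  next
    case False
    then have "x \<in> - K" "open (- K)" using K by (auto simp: compact_imp_closed open_Compl)
    then have "GDERIV (\<lambda>x. a x * \<phi> x) x :> 0 \<longleftrightarrow> GDERIV (\<lambda>x. 0) x :> 0"
      using K(3) by (intro GDERIV_cong_open) auto
    moreover have "x \<notin> K" using K False by auto
    ultimately show ?thesis using K(3)[of x] by (simp add: GDERIV_const)
  qed
  moreover have "continuous_on UNIV (\<lambda>x. a x *\<^sub>R \<Phi> x + \<phi> x *\<^sub>R A x)"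
    by (rule continuous_on_zero_outside[OF o _ K(1,2)])
      (use K(3) in \<open>auto intro!: continuous_intros A tfunD(2,3)[OF t] GDERIV_continuous_on[OF a]\<close>)
  ultimately show ?thesis
    unfolding tfun_def using K by (intro conjI exI[of _ K]) auto
qed

text \<open>The equation of \<open>w\<close> is tested with \<open>v \<phi>\<close> and that of
  \<open>v\<close> with \<open>w \<phi>\<close>; each produces one copy of the integral of
  \<open>(G x \<bullet> H x) * \<phi> x\<close>, hence the factor 2.\<close>

lemma wlap_mult:
  assumes "wlap S v G g" "wlap S w H h"
  shows "wlap S (\<lambda>x. v x * w x) (\<lambda>x. v x *\<^sub>R H x + w x *\<^sub>R G x)
    (\<lambda>x. v x * h x + w x * g x + 2 * (G x \<bullet> H x))"
  unfolding wlap_def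
proof (intro conjI allI impI ballI)
  show o: "open S" using assms(1) by (rule wlapD)
  note [continuous_intros] = wlapD(3-5)[OF assms(1)] wlapD(3-5)[OF assms(2)]
  show "x \<in> S \<Longrightarrow> GDERIV (\<lambda>x. v x * w x) x :> v x *\<^sub>R H x + w x *\<^sub>R G x" for x
    by (intro GDERIV_mult wlapD(2)[OF assms(1)] wlapD(2)[OF assms(2)])
  show "continuous_on S (\<lambda>x. v x *\<^sub>R H x + w x *\<^sub>R G x)"
    "continuous_on S (\<lambda>x. v x * h x + w x * g x + 2 * (G x \<bullet> H x))"
    by (intro continuous_intros)+
  fix \<phi> \<Phi> assume t: "tfun S \<phi> \<Phi>"
  have tv: "tfun S (\<lambda>x. v x * \<phi> x) (\<lambda>x. v x *\<^sub>R \<Phi> x + \<phi> x *\<^sub>R G x)"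
    by (rule tfun_mult[OF t o wlapD(2)[OF assms(1)] wlapD(3)[OF assms(1)]])
  have tw: "tfun S (\<lambda>x. w x * \<phi> x) (\<lambda>x. w x *\<^sub>R \<Phi> x + \<phi> x *\<^sub>R H x)"
    by (rule tfun_mult[OF t o wlapD(2)[OF assms(2)] wlapD(3)[OF assms(2)]])
  note i = tfun_integrable[OF t o]
  have 1: "(\<integral>x. H x \<bullet> (v x *\<^sub>R \<Phi> x) + (G x \<bullet> H x) * \<phi> x \<partial>lborel) = - (\<integral>x. (v x * h x) * \<phi> x \<partial>lborel)"
    using wlapD(6)[OF assms(2) tv] by (simp add: inner_add_right mult_ac inner_commute)
  have 2: "(\<integral>x. G x \<bullet> (w x *\<^sub>R \<Phi> x) + (G x \<bullet> H x) * \<phi> x \<partial>lborel) = - (\<integral>x. (w x * g x) * \<phi> x \<partial>lborel)"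
    using wlapD(6)[OF assms(1) tw] by (simp add: inner_add_right mult_ac)
  have iv: "integrable lborel (\<lambda>x. H x \<bullet> (v x *\<^sub>R \<Phi> x))" "integrable lborel (\<lambda>x. G x \<bullet> (w x *\<^sub>R \<Phi> x))"
    using i(1)[of "\<lambda>x. v x *\<^sub>R H x"] i(1)[of "\<lambda>x. w x *\<^sub>R G x"] by (simp_all add: continuous_intros)
  have ig: "integrable lborel (\<lambda>x. (G x \<bullet> H x) * \<phi> x)" by (intro i(2) continuous_intros)
  have e1: "(\<integral>x. H x \<bullet> (v x *\<^sub>R \<Phi> x) \<partial>lborel) = - (\<integral>x. (v x * h x) * \<phi> x \<partial>lborel) - (\<integral>x. (G x \<bullet> H x) * \<phi> x \<partial>lborel)"
    using 1 iv(1) ig by (simp add: Bochner_Integration.integral_add)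
  have e2: "(\<integral>x. G x \<bullet> (w x *\<^sub>R \<Phi> x) \<partial>lborel) = - (\<integral>x. (w x * g x) * \<phi> x \<partial>lborel) - (\<integral>x. (G x \<bullet> H x) * \<phi> x \<partial>lborel)"
    using 2 iv(2) ig by (simp add: Bochner_Integration.integral_add)
  have "(\<integral>x. (v x *\<^sub>R H x + w x *\<^sub>R G x) \<bullet> \<Phi> x \<partial>lborel)
     = (\<integral>x. H x \<bullet> (v x *\<^sub>R \<Phi> x) + G x \<bullet> (w x *\<^sub>R \<Phi> x) \<partial>lborel)"
    by (simp add: inner_add_left)
  also have "\<dots> = (\<integral>x. H x \<bullet> (v x *\<^sub>R \<Phi> x) \<partial>lborel) + (\<integral>x. G x \<bullet> (w x *\<^sub>R \<Phi> x) \<partial>lborel)"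
    by (rule Bochner_Integration.integral_add[OF iv])
  also have "\<dots> = - ((\<integral>x. (v x * h x) * \<phi> x \<partial>lborel) + (\<integral>x. (w x * g x) * \<phi> x \<partial>lborel)
      + (\<integral>x. (2 * (G x \<bullet> H x)) * \<phi> x \<partial>lborel))"
    unfolding e1 e2 by (simp add: mult.assoc)
  also have "(\<integral>x. (v x * h x) * \<phi> x \<partial>lborel) + (\<integral>x. (w x * g x) * \<phi> x \<partial>lborel)
      + (\<integral>x. (2 * (G x \<bullet> H x)) * \<phi> x \<partial>lborel)
      = (\<integral>x. (v x * h x + w x * g x + 2 * (G x \<bullet> H x)) * \<phi> x \<partial>lborel)"
  proof -
    have "integrable lborel (\<lambda>x. (v x * h x) * \<phi> x)" "integrable lborel (\<lambda>x. (w x * g x) * \<phi> x)"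
      "integrable lborel (\<lambda>x. (2 * (G x \<bullet> H x)) * \<phi> x)"
      by (intro i(2) continuous_intros)+
    then show ?thesis
      unfolding distrib_right by (simp add: Bochner_Integration.integral_add)
  qed
  finally show "(\<integral>x. (v x *\<^sub>R H x + w x *\<^sub>R G x) \<bullet> \<Phi> x \<partial>lborel)
      = - (\<integral>x. (v x * h x + w x * g x + 2 * (G x \<bullet> H x)) * \<phi> x \<partial>lborel)" .
qed

lemma wlap_cmult:
  assumes "wlap S v G g"
  shows "wlap S (\<lambda>x. c * v x) (\<lambda>x. c *\<^sub>R G x) (\<lambda>x. c * g x)"
  using wlap_mult[OF wlap_const[OF wlapD(1)[OF assms], of c] assms] by simp

lemma wlap_diff:
  assumes "wlap S v G g" "wlap S w H h"
  shows "wlap S (\<lambda>x. v x - w x) (\<lambda>x. G x - H x) (\<lambda>x. g x - h x)"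
  using wlap_add[OF assms(1) wlap_cmult[OF assms(2), of "-1"]] by simp

text \<open>The equation of \<open>v\<close> is tested with \<open>F' (v x) * \<phi> x\<close>,
  whose gradient contributes the term with \<open>F''\<close>.\<close>

lemma wlap_compose:
  fixes F F' F'' :: "real \<Rightarrow> real"
  assumes "wlap S v G g"
    and F: "\<And>x. x \<in> S \<Longrightarrow> (F has_real_derivative F' (v x)) (at (v x))"
    and F': "\<And>x. x \<in> S \<Longrightarrow> (F' has_real_derivative F'' (v x)) (at (v x))"
    and F'': "continuous_on (v ` S) F''"
  shows "wlap S (\<lambda>x. F (v x)) (\<lambda>x. F' (v x) *\<^sub>R G x) (\<lambda>x. F'' (v x) * (norm (G x))\<^sup>2 + F' (v x) * g x)"
  unfolding wlap_def
proof (intro conjI allI impI ballI)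
  show o: "open S" using assms(1) by (rule wlapD)
  have D: "GDERIV (\<lambda>x. F (v x)) x :> F' (v x) *\<^sub>R G x" "GDERIV (\<lambda>x. F' (v x)) x :> F'' (v x) *\<^sub>R G x" if "x \<in> S" for x
    using GDERIV_DERIV_compose[OF wlapD(2)[OF assms(1) that] F[OF that]]
      GDERIV_DERIV_compose[OF wlapD(2)[OF assms(1) that] F'[OF that]] by simp_all
  show "x \<in> S \<Longrightarrow> GDERIV (\<lambda>x. F (v x)) x :> F' (v x) *\<^sub>R G x" for x by (rule D)
  have c1: "continuous_on S (\<lambda>x. F' (v x))" by (rule GDERIV_continuous_on) (rule D)
  have c2: "continuous_on S (\<lambda>x. F'' (v x))"
    using continuous_on_compose[OF wlapD(5)[OF assms(1)] F''] by (simp add: o_def)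
  note [continuous_intros] = c1 c2 wlapD(3-5)[OF assms(1)]
  show "continuous_on S (\<lambda>x. F' (v x) *\<^sub>R G x)" "continuous_on S (\<lambda>x. F'' (v x) * (norm (G x))\<^sup>2 + F' (v x) * g x)"
    by (intro continuous_intros)+
  fix \<phi> \<Phi> assume t: "tfun S \<phi> \<Phi>"
  note i = tfun_integrable[OF t o]
  have t': "tfun S (\<lambda>x. F' (v x) * \<phi> x) (\<lambda>x. F' (v x) *\<^sub>R \<Phi> x + \<phi> x *\<^sub>R (F'' (v x) *\<^sub>R G x))"
    by (rule tfun_mult[OF t o D(2)]) (auto intro!: continuous_intros)
  have "(\<integral>x. (F' (v x) *\<^sub>R G x) \<bullet> \<Phi> x \<partial>lborel) + (\<integral>x. (F'' (v x) * (norm (G x))\<^sup>2) * \<phi> x \<partial>lborel)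
     = (\<integral>x. (F' (v x) *\<^sub>R G x) \<bullet> \<Phi> x + (F'' (v x) * (norm (G x))\<^sup>2) * \<phi> x \<partial>lborel)"
    by (subst Bochner_Integration.integral_add)
      (simp_all only: i(1)[of "\<lambda>x. F' (v x) *\<^sub>R G x"] i(2)[of "\<lambda>x. F'' (v x) * (norm (G x))\<^sup>2"] continuous_intros)
  also have "\<dots> = (\<integral>x. G x \<bullet> (F' (v x) *\<^sub>R \<Phi> x + \<phi> x *\<^sub>R (F'' (v x) *\<^sub>R G x)) \<partial>lborel)"
    by (simp add: inner_add_right power2_norm_eq_inner mult_ac)
  also have "\<dots> = - (\<integral>x. (F' (v x) * g x) * \<phi> x \<partial>lborel)"
    unfolding wlapD(6)[OF assms(1) t'] by (simp add: mult_ac)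
  finally have "(\<integral>x. (F' (v x) *\<^sub>R G x) \<bullet> \<Phi> x \<partial>lborel) =
     - ((\<integral>x. (F'' (v x) * (norm (G x))\<^sup>2) * \<phi> x \<partial>lborel) + (\<integral>x. (F' (v x) * g x) * \<phi> x \<partial>lborel))" by linarith
  also have "(\<integral>x. (F'' (v x) * (norm (G x))\<^sup>2) * \<phi> x \<partial>lborel) + (\<integral>x. (F' (v x) * g x) * \<phi> x \<partial>lborel)
      = (\<integral>x. (F'' (v x) * (norm (G x))\<^sup>2 + F' (v x) * g x) * \<phi> x \<partial>lborel)"
    unfolding distrib_right
    by (subst Bochner_Integration.integral_add) (auto intro!: continuous_intros i(2))
  finally show "(\<integral>x. (F' (v x) *\<^sub>R G x) \<bullet> \<Phi> x \<partial>lborel) =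
     - (\<integral>x. (F'' (v x) * (norm (G x))\<^sup>2 + F' (v x) * g x) * \<phi> x \<partial>lborel)" .
qed

section \<open>Explicit weak Laplacians: linear functions, the squared norm and
  \<open>sl\<close>\<close>

lemma integral_cbox_lborel:
  fixes h :: "'a::euclidean_space \<Rightarrow> real"
  assumes "continuous_on (cbox a b) h" "\<And>x. x \<notin> cbox a b \<Longrightarrow> h x = 0"
  shows "(\<integral>x. h x \<partial>lborel) = integral (cbox a b) h"
proof -
  have "set_integrable lborel (cbox a b) h"
    unfolding set_integrable_def by (intro borel_integrable_compact compact_cbox assms(1))
  then have "(LINT x:cbox a b|lborel. h x) = integral (cbox a b) h"
    by (rule set_borel_integral_eq_integral)
  moreover have "(\<lambda>x. indicator (cbox a b) x *\<^sub>R h x) = h"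
    using assms(2) by (auto simp: fun_eq_iff indicator_def)
  ultimately show ?thesis by (simp add: set_lebesgue_integral_def)
qed

lemma lborel_integral_shift:
  fixes h :: "'a::euclidean_space \<Rightarrow> real"
  assumes "h \<in> borel_measurable borel"
  shows "(\<integral>x. h (c + x) \<partial>lborel) = (\<integral>x. h x \<partial>lborel)"
proof -
  have "(\<integral>x. h x \<partial>lborel) = (\<integral>x. h x \<partial>distr lborel borel ((+) c))"
    by (simp add: lborel_distr_plus)
  also have "\<dots> = (\<integral>x. h (c + x) \<partial>lborel)"
    by (rule integral_distr) (use assms in auto)
  finally show ?thesis by simp
qed

lemma lborel_integral_affine:
  fixes h :: "'a::euclidean_space \<Rightarrow> real"
  assumes "h \<in> borel_measurable borel" "r > 0"
  shows "(\<integral>x. h x \<partial>lborel) = r ^ DIM('a) * (\<integral>y. h (c + r *\<^sub>R y) \<partial>lborel)"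
proof -
  have "(\<integral>x. h x \<partial>lborel) = (\<integral>x. h x \<partial>density (distr lborel borel (\<lambda>x. c + r *\<^sub>R x)) (\<lambda>_. ennreal (r ^ DIM('a))))"
    using lborel_affine[of r c] assms(2) by (simp add: ennreal_power)
  also have "\<dots> = (\<integral>x. r ^ DIM('a) * h x \<partial>distr lborel borel (\<lambda>x. c + r *\<^sub>R x))"
    by (subst integral_density) (use assms in auto)
  also have "\<dots> = (\<integral>x. r ^ DIM('a) * h (c + r *\<^sub>R x) \<partial>lborel)"
    by (rule integral_distr) (use assms in auto)
  finally show ?thesis by simp
qed

text \<open>The integral of \<open>\<phi> (x + t *\<^sub>R e)\<close> does not depend on
  \<open>t\<close>, by translation invariance; differentiation under the integral at
  \<open>t = 0\<close> gives the claim.\<close>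

lemma tfun_derivative_integral:
  fixes \<phi> :: "'a::euclidean_space \<Rightarrow> real"
  assumes t: "tfun S \<phi> \<Phi>"
  shows "(\<integral>x. e \<bullet> \<Phi> x \<partial>lborel) = 0"
proof -
  obtain K where K: "compact K" "\<And>x. x \<notin> K \<Longrightarrow> \<phi> x = 0 \<and> \<Phi> x = 0"
    using t unfolding tfun_def by blast
  \<comment> \<open>One box containing the supports of all translates with parameter in
    \<open>{-1..1}\<close>, so that the Leibniz rule runs over a fixed domain.\<close>
  have "compact ((\<lambda>(x, t). x - t *\<^sub>R e) ` (K \<times> {-1..1::real}))"
    by (intro compact_continuous_image compact_Times K compact_Icc)
      (auto simp: case_prod_unfold intro!: continuous_intros)
  then obtain a where a: "(\<lambda>(x, t). x - t *\<^sub>R e) ` (K \<times> {-1..1::real}) \<subseteq> cbox (- a) a"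
    using bounded_subset_cbox_symmetric compact_imp_bounded by metis
  have out: "\<phi> (x + t *\<^sub>R e) = 0 \<and> \<Phi> (x + t *\<^sub>R e) = 0" if "x \<notin> cbox (- a) a" "t \<in> {-1..1}" for x t
  proof (rule K(2), rule notI)
    assume "x + t *\<^sub>R e \<in> K"
    then have "(x + t *\<^sub>R e) - t *\<^sub>R e \<in> (\<lambda>(x, t). x - t *\<^sub>R e) ` (K \<times> {-1..1::real})"
      using that(2) by force
    then show False using a that(1) by auto
  qed
  note ct [continuous_intros] = continuous_on_compose2[OF tfunD(3)[OF t, of UNIV]]
    continuous_on_compose2[OF tfunD(2)[OF t, of UNIV]]
  have T: "integral (cbox (- a) a) (\<lambda>x. \<phi> (x + t *\<^sub>R e)) = (\<integral>x. \<phi> x \<partial>lborel)" if "t \<in> {-1..1}" for t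
  proof -
    have "(\<integral>x. \<phi> x \<partial>lborel) = (\<integral>x. \<phi> (t *\<^sub>R e + x) \<partial>lborel)"
      by (rule lborel_integral_shift[symmetric]) (intro borel_measurable_continuous_onI tfunD(3)[OF t])
    also have "\<dots> = integral (cbox (- a) a) (\<lambda>x. \<phi> (t *\<^sub>R e + x))"
      using out that by (intro integral_cbox_lborel) (auto intro!: continuous_intros simp: add.commute)
    finally show ?thesis by (simp add: add.commute)
  qed
  have D: "((\<lambda>t. integral (cbox (- a) a) (\<lambda>x. \<phi> (x + t *\<^sub>R e))) has_real_derivative
     integral (cbox (- a) a) (\<lambda>x. e \<bullet> \<Phi> (x + 0 *\<^sub>R e))) (at 0 within {-1..1})"
  proof (rule leibniz_rule_field_derivative)
    fix s x
    have "((\<lambda>t. x + t *\<^sub>R e) has_derivative (\<lambda>h. h *\<^sub>R e)) (at s within {-1..1})"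
      by (auto intro!: derivative_eq_intros)
    moreover have "(\<phi> has_derivative (\<lambda>h. h \<bullet> \<Phi> (x + s *\<^sub>R e))) (at (x + s *\<^sub>R e))"
      using tfunD(1)[OF t] unfolding gderiv_def by simp
    ultimately have "((\<lambda>t. \<phi> (x + t *\<^sub>R e)) has_derivative (\<lambda>h. (h *\<^sub>R e) \<bullet> \<Phi> (x + s *\<^sub>R e))) (at s within {-1..1})"
      by (rule has_derivative_compose)
    then show "((\<lambda>t. \<phi> (x + t *\<^sub>R e)) has_field_derivative e \<bullet> \<Phi> (x + s *\<^sub>R e)) (at s within {-1..1})"
      unfolding has_field_derivative_def by (simp add: mult_commute_abs)
  qed (auto simp: case_prod_unfold intro!: integrable_continuous continuous_intros)
  have "((\<lambda>_. \<integral>x. \<phi> x \<partial>lborel) has_real_derivative 0) (at (0::real))" by simp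
  then have "((\<lambda>t. integral (cbox (- a) a) (\<lambda>x. \<phi> (x + t *\<^sub>R e))) has_real_derivative 0) (at 0)"
    by (rule has_field_derivative_transform_within_open[of _ _ _ "{-1<..<1}"]) (use T in auto)
  moreover have "at 0 within {-1..1} = at (0::real)" by (rule at_within_Icc_at) auto
  ultimately have "integral (cbox (- a) a) (\<lambda>x. e \<bullet> \<Phi> (x + 0 *\<^sub>R e)) = 0"
    using D DERIV_unique by metis
  moreover have "(\<integral>x. e \<bullet> \<Phi> x \<partial>lborel) = integral (cbox (- a) a) (\<lambda>x. e \<bullet> \<Phi> x)"
    using out[of _ 0] by (intro integral_cbox_lborel) (auto intro!: continuous_intros tfunD(2)[OF t])
  ultimately show ?thesis by simp
qed

lemma GDERIV_inner_const: "GDERIV (\<lambda>x. x \<bullet> e) x :> e"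
  unfolding gderiv_def by (auto intro!: derivative_eq_intros)

text \<open>The base case of the weak calculus: the explicit functions below, including
  \<open>sl\<close> and \<open>pole\<close>, are built from linear functions by sums, products and
  compositions.\<close>

lemma wlap_linear: "open S \<Longrightarrow> wlap S (\<lambda>x. x \<bullet> e) (\<lambda>_. e) (\<lambda>_. 0)"
  unfolding wlap_def by (auto simp: GDERIV_inner_const tfun_derivative_integral)

lemma wlap_sum:
  assumes "finite I" "open S" "\<And>i. i \<in> I \<Longrightarrow> wlap S (v i) (G i) (g i)"
  shows "wlap S (\<lambda>x. \<Sum>i\<in>I. v i x) (\<lambda>x. \<Sum>i\<in>I. G i x) (\<lambda>x. \<Sum>i\<in>I. g i x)"
  using assms(1,3)
proof (induction I)
  case empty
  then show ?case using wlap_const[OF assms(2), of 0] by simp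
next
  case (insert i I)
  then show ?case using wlap_add[of S "v i" "G i" "g i"] by simp
qed

lemma wlap_inner_self:
  assumes "open (S :: 'a::euclidean_space set)"
  shows "wlap S (\<lambda>x. x \<bullet> x) (\<lambda>x. 2 *\<^sub>R x) (\<lambda>x. 2 * real DIM('a))"
proof -
  have "wlap S (\<lambda>x. \<Sum>b\<in>Basis. (x \<bullet> b) * (x \<bullet> b)) (\<lambda>x. \<Sum>b\<in>Basis. (x \<bullet> b) *\<^sub>R b + (x \<bullet> b) *\<^sub>R b)
    (\<lambda>x. \<Sum>b\<in>Basis. (x \<bullet> b) * 0 + (x \<bullet> b) * 0 + 2 * (b \<bullet> b))"
    by (intro wlap_sum wlap_mult wlap_linear assms finite_Basis)
  then show ?thesis
    by (rule wlap_cong) (simp_all add: euclidean_inner[symmetric] sum.distrib euclidean_representation scaleR_2)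
qed

definition sl :: "'a::euclidean_space \<Rightarrow> real"
  where "sl x = - ln (norm x)"

text \<open>\<open>sl x\<close> equals \<open>- ln (x \<bullet> x) / 2\<close>, so the chain rule
  applies to the polynomial \<open>x \<bullet> x\<close>.\<close>

lemma wlap_sl:
  assumes "open S" "(0::'a::euclidean_space) \<notin> S"
  shows "wlap S sl (\<lambda>x. (- inverse ((norm x)\<^sup>2)) *\<^sub>R x) (\<lambda>x. (2 - real DIM('a)) / (norm x)\<^sup>2)"
proof -
  have p: "x \<bullet> x > 0" if "x \<in> S" for x using that assms(2) by auto
  have "wlap S (\<lambda>x. - (1/2) * ln (x \<bullet> x)) (\<lambda>x. (- (1/2) * inverse (x \<bullet> x)) *\<^sub>R (2 *\<^sub>R x))
    (\<lambda>x. (1/2) * inverse ((x \<bullet> x)^2) * (norm (2 *\<^sub>R x))\<^sup>2 + (- (1/2) * inverse (x \<bullet> x)) * (2 * real DIM('a)))"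
  proof (rule wlap_compose[OF wlap_inner_self[OF assms(1)]])
    fix x assume "x \<in> S"
    note p[OF this]
    then show "((\<lambda>z. - (1/2) * ln z) has_real_derivative - (1/2) * inverse (x \<bullet> x)) (at (x \<bullet> x))"
      "((\<lambda>z. - (1/2) * inverse z) has_real_derivative (1/2) * inverse ((x \<bullet> x)^2)) (at (x \<bullet> x))"
      by (auto intro!: derivative_eq_intros simp: power2_eq_square field_simps)
  next
    show "continuous_on ((\<lambda>x. x \<bullet> x) ` S) (\<lambda>z. (1/2) * inverse (z^2))"
      using p by (auto intro!: continuous_intros)
  qed
  then show ?thesis
  proof (rule wlap_cong)
    fix x assume x: "x \<in> S"
    then have n: "norm x > 0" using assms(2) by auto
    show "- (1/2) * ln (x \<bullet> x) = sl x"
      using n by (simp add: sl_def power2_norm_eq_inner[symmetric] ln_realpow)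
    show "(- (1/2) * inverse (x \<bullet> x)) *\<^sub>R (2 *\<^sub>R x) = (- inverse ((norm x)\<^sup>2)) *\<^sub>R x"
      by (simp add: power2_norm_eq_inner[symmetric])
    show "(1/2) * inverse ((x \<bullet> x)^2) * (norm (2 *\<^sub>R x))\<^sup>2 + (- (1/2) * inverse (x \<bullet> x)) * (2 * real DIM('a))
      = (2 - real DIM('a)) / (norm x)\<^sup>2"
      using n unfolding power2_norm_eq_inner[symmetric] by (simp add: field_simps power2_eq_square)
  qed
qed

section \<open>Maximum principle and gradient estimate by weighted means over balls\<close>

abbreviation ubox :: "'a::euclidean_space set"
  where "ubox \<equiv> cbox (- One) One"

lemma norm_ubox: "y \<in> ubox \<Longrightarrow> norm (y::'a::euclidean_space) \<le> real DIM('a)"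
proof -
  assume "y \<in> (ubox::'a set)"
  then have "\<bar>y \<bullet> b\<bar> \<le> 1" if "b \<in> Basis" for b
    using that by (auto simp: mem_box abs_le_iff minus_le_iff)
  then have "(\<Sum>b\<in>Basis. \<bar>y \<bullet> b\<bar>) \<le> (\<Sum>b\<in>(Basis::'a set). 1)" by (rule sum_mono)
  then show ?thesis using norm_le_l1[of y] by simp
qed

lemma in_ubox: "norm (y::'a::euclidean_space) \<le> 1 \<Longrightarrow> y \<in> ubox"
proof -
  assume n: "norm y \<le> 1"
  have "\<bar>y \<bullet> b\<bar> \<le> 1" if "b \<in> Basis" for b
    using Basis_le_norm[OF that, of y] n by linarith
  then show ?thesis by (auto simp: mem_box abs_le_iff minus_le_iff)
qed

text \<open>Only Lipschitz itself, but \<open>(bump y)\<^sup>2\<close> is C^1 with gradient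
  \<open>- 4 * bump y\<close> times \<open>y\<close>. Testing with the square thus produces the
  radial derivative of means weighted with \<open>bump\<close>. The integrals run over
  \<open>ubox\<close>, a fixed box containing the support, whose points have norm up to
  \<open>DIM('a)\<close>.\<close>

definition bump :: "'a::euclidean_space \<Rightarrow> real"
  where "bump y = max 0 (1 - y \<bullet> y)"

lemma bump_outside: "norm y \<ge> 1 \<Longrightarrow> bump y = 0"
proof -
  assume "norm y \<ge> 1"
  then have "1 \<le> (norm y)\<^sup>2" by simp
  then show ?thesis by (simp add: bump_def power2_norm_eq_inner max_def)
qed

lemma bump_bounds: "0 \<le> bump y" "bump y \<le> 1"
  by (auto simp: bump_def)

lemma continuous_bump [continuous_intros]: "continuous_on A f \<Longrightarrow> continuous_on A (\<lambda>x. bump (f x))"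
  unfolding bump_def by (intro continuous_intros)

lemma has_derivative_max0_square:
  "((\<lambda>z::real. (max 0 z)\<^sup>2) has_real_derivative 2 * max 0 z) (at z)"
proof (cases "z = 0")
  case True
  have "((\<lambda>h. (max 0 h)\<^sup>2 / h) \<longlongrightarrow> 0) (at (0::real))"
  proof (rule tendsto_sandwich[where f = "\<lambda>h. - \<bar>h\<bar>" and h = "\<lambda>h. \<bar>h\<bar>"])
    show "\<forall>\<^sub>F h in at (0::real). - \<bar>h\<bar> \<le> (max 0 h)\<^sup>2 / h" "\<forall>\<^sub>F h in at (0::real). (max 0 h)\<^sup>2 / h \<le> \<bar>h\<bar>"
      by (auto simp: max_def power2_eq_square intro!: always_eventually)
  qed (auto intro!: tendsto_eq_intros)
  then show ?thesis using True by (simp add: has_field_derivative_iff)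
next
  case False
  then consider "z > 0" | "z < 0" by linarith
  then show ?thesis
  proof cases
    case 1
    have "((\<lambda>z::real. z\<^sup>2) has_real_derivative 2 * max 0 z) (at z)"
      using 1 by (auto intro!: derivative_eq_intros)
    then show ?thesis
      by (rule has_field_derivative_transform_within_open[of _ _ _ "{0<..}"]) (use 1 in auto)
  next
    case 2
    have "((\<lambda>z::real. 0) has_real_derivative 2 * max 0 z) (at z)"
      using 2 by (auto intro!: derivative_eq_intros)
    then show ?thesis
      by (rule has_field_derivative_transform_within_open[of _ _ _ "{..<0}"]) (use 2 in auto)
  qed
qed

lemma GDERIV_bump_square: "GDERIV (\<lambda>y. (bump y)\<^sup>2) y :> (- 4 * bump y) *\<^sub>R y"
proof -
  have "GDERIV (\<lambda>y. 1 - y \<bullet> y) y :> - 2 *\<^sub>R y"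
    unfolding gderiv_def by (auto intro!: derivative_eq_intros simp: inner_commute)
  from GDERIV_DERIV_compose[OF this has_derivative_max0_square]
  show ?thesis unfolding bump_def by (simp add: mult_ac)
qed

text \<open>The weak equation tested with \<open>\<phi> ((x - x0) / r)\<close> and written in the
  scaled variable \<open>y\<close>: the gradient of the test function brings a factor
  \<open>1 / r\<close>, the remaining powers of \<open>r\<close> cancel.\<close>

lemma wlap_scaled:
  fixes v :: "'a::euclidean_space \<Rightarrow> real"
  assumes w: "wlap S v G g" and r: "r > 0" and S: "\<And>y. y \<in> ubox \<Longrightarrow> x0 + r *\<^sub>R y \<in> S"
    and \<phi>: "\<And>y. GDERIV \<phi> y :> \<Phi> y" "continuous_on UNIV \<Phi>"
      "\<And>y. norm y \<ge> 1 \<Longrightarrow> \<phi> y = 0" "\<And>y. norm y \<ge> 1 \<Longrightarrow> \<Phi> y = 0"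
  shows "integral ubox (\<lambda>y. G (x0 + r *\<^sub>R y) \<bullet> \<Phi> y) = - r * integral ubox (\<lambda>y. g (x0 + r *\<^sub>R y) * \<phi> y)"
proof -
  define \<psi> \<Psi> where "\<psi> = (\<lambda>x. \<phi> ((x - x0) /\<^sub>R r))" and "\<Psi> = (\<lambda>x. \<Phi> ((x - x0) /\<^sub>R r) /\<^sub>R r)"
  define K where "K = cball x0 r"
  have nr: "norm ((x - x0) /\<^sub>R r) = dist x0 x / r" for x
    using r by (simp add: dist_norm norm_minus_commute divide_inverse_commute del: scaleR_right_diff_distrib)
  have KS: "K \<subseteq> S"
  proof
    fix x assume "x \<in> K"
    then have "norm ((x - x0) /\<^sub>R r) \<le> 1" using r unfolding nr by (simp add: K_def)
    from S[OF in_ubox[OF this]] r show "x \<in> S" by simp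
  qed
  have out: "norm ((x - x0) /\<^sub>R r) \<ge> 1" if "x \<notin> K" for x
    using that r unfolding nr by (simp add: K_def)
  have c\<phi>: "continuous_on A \<phi>" for A by (rule GDERIV_continuous_on) (rule \<phi>)
  note [continuous_intros] = continuous_on_compose2[OF \<phi>(2)] continuous_on_compose2[OF c\<phi>[of UNIV]]
  have t: "tfun S \<psi> \<Psi>"
    unfolding tfun_def
  proof (intro conjI allI exI[of _ K] impI)
    fix x
    have "((\<lambda>x. (x - x0) /\<^sub>R r) has_derivative (\<lambda>h. h /\<^sub>R r)) (at x)"
      by (auto intro!: derivative_eq_intros)
    moreover have "(\<phi> has_derivative (\<lambda>h. h \<bullet> \<Phi> ((x - x0) /\<^sub>R r))) (at ((x - x0) /\<^sub>R r))"
      using \<phi>(1) unfolding gderiv_def .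
    ultimately have "((\<lambda>x. \<phi> ((x - x0) /\<^sub>R r)) has_derivative (\<lambda>h. (h /\<^sub>R r) \<bullet> \<Phi> ((x - x0) /\<^sub>R r))) (at x)"
      by (rule has_derivative_compose)
    then show "GDERIV \<psi> x :> \<Psi> x" unfolding gderiv_def \<psi>_def \<Psi>_def by simp
  next
    show "continuous_on UNIV \<Psi>" unfolding \<Psi>_def by (auto intro!: continuous_intros)
    show "compact K" "K \<subseteq> S" using KS by (auto simp: K_def)
    fix x assume "x \<notin> K"
    then show "\<psi> x = 0" "\<Psi> x = 0" using out \<phi>(3,4) by (auto simp: \<psi>_def \<Psi>_def)
  qed
  have o: "open S" using w by (rule wlapD)
  have z: "x \<notin> K \<Longrightarrow> \<psi> x = 0 \<and> \<Psi> x = 0" for x using out \<phi>(3,4) by (auto simp: \<psi>_def \<Psi>_def)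
  have cG: "continuous_on UNIV (\<lambda>x. G x \<bullet> \<Psi> x)" and cg: "continuous_on UNIV (\<lambda>x. g x * \<psi> x)"
  proof -
    have "continuous_on S (\<lambda>x. G x \<bullet> \<Psi> x)" "continuous_on S (\<lambda>x. g x * \<psi> x)"
      by (intro continuous_intros wlapD(3,4)[OF w] tfunD(2,3)[OF t])+
    then show "continuous_on UNIV (\<lambda>x. G x \<bullet> \<Psi> x)" "continuous_on UNIV (\<lambda>x. g x * \<psi> x)"
      using z by (auto intro!: continuous_on_zero_outside[OF o _ compact_cball[of x0 r, folded K_def] KS])
  qed
  have sub: "continuous_on ubox (\<lambda>y. h (x0 + r *\<^sub>R y))" if "continuous_on S h" for h :: "'a \<Rightarrow> 'b::real_normed_vector"
    by (rule continuous_on_compose2[OF that]) (use S in \<open>auto intro!: continuous_intros\<close>)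
  have out': "y \<notin> ubox \<Longrightarrow> norm y \<ge> 1" for y :: 'a using in_ubox[of y] by linarith
  have "(\<integral>x. G x \<bullet> \<Psi> x \<partial>lborel) = r ^ DIM('a) * (\<integral>y. G (x0 + r *\<^sub>R y) \<bullet> \<Psi> (x0 + r *\<^sub>R y) \<partial>lborel)"
    by (rule lborel_integral_affine[OF borel_measurable_continuous_onI[OF cG] r])
  also have "(\<integral>y. G (x0 + r *\<^sub>R y) \<bullet> \<Psi> (x0 + r *\<^sub>R y) \<partial>lborel) = (\<integral>y. G (x0 + r *\<^sub>R y) \<bullet> \<Phi> y \<partial>lborel) / r"
    using r by (simp add: \<Psi>_def divide_inverse_commute)
  also have "(\<integral>y. G (x0 + r *\<^sub>R y) \<bullet> \<Phi> y \<partial>lborel) = integral ubox (\<lambda>y. G (x0 + r *\<^sub>R y) \<bullet> \<Phi> y)"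
    by (rule integral_cbox_lborel) (use out' \<phi>(4) in \<open>auto intro!: continuous_intros sub wlapD(3)[OF w]\<close>)
  finally have 1: "(\<integral>x. G x \<bullet> \<Psi> x \<partial>lborel) = r ^ DIM('a) * (integral ubox (\<lambda>y. G (x0 + r *\<^sub>R y) \<bullet> \<Phi> y) / r)" .
  have "(\<integral>x. g x * \<psi> x \<partial>lborel) = r ^ DIM('a) * (\<integral>y. g (x0 + r *\<^sub>R y) * \<psi> (x0 + r *\<^sub>R y) \<partial>lborel)"
    by (rule lborel_integral_affine[OF borel_measurable_continuous_onI[OF cg] r])
  also have "(\<integral>y. g (x0 + r *\<^sub>R y) * \<psi> (x0 + r *\<^sub>R y) \<partial>lborel) = (\<integral>y. g (x0 + r *\<^sub>R y) * \<phi> y \<partial>lborel)"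
    using r by (simp add: \<psi>_def)
  also have "\<dots> = integral ubox (\<lambda>y. g (x0 + r *\<^sub>R y) * \<phi> y)"
    by (rule integral_cbox_lborel) (use out' \<phi>(3) in \<open>auto intro!: continuous_intros sub wlapD(4)[OF w]\<close>)
  finally have 2: "(\<integral>x. g x * \<psi> x \<partial>lborel) = r ^ DIM('a) * integral ubox (\<lambda>y. g (x0 + r *\<^sub>R y) * \<phi> y)" .
  have "r ^ DIM('a) * integral ubox (\<lambda>y. G (x0 + r *\<^sub>R y) \<bullet> \<Phi> y)
    = r ^ DIM('a) * (- r * integral ubox (\<lambda>y. g (x0 + r *\<^sub>R y) * \<phi> y))"
    using wlapD(6)[OF w t] r unfolding 1 2 by (simp add: field_simps)
  then show ?thesis using r by (subst (asm) mult_cancel_left) simp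
qed

lemma leibniz_scaled:
  fixes v :: "'a::euclidean_space \<Rightarrow> real"
  assumes w: "wlap S v G g" and S: "\<And>t y. t \<in> {0..r} \<Longrightarrow> y \<in> ubox \<Longrightarrow> x0 + t *\<^sub>R y \<in> S"
    and \<eta>: "continuous_on ubox \<eta>" and t: "t \<in> {0..r}"
  shows "((\<lambda>t. integral ubox (\<lambda>y. \<eta> y * v (x0 + t *\<^sub>R y))) has_real_derivative
    integral ubox (\<lambda>y. \<eta> y * (y \<bullet> G (x0 + t *\<^sub>R y)))) (at t within {0..r})"
proof (rule leibniz_rule_field_derivative)
  fix s and y :: 'a assume s: "s \<in> {0..r}" "y \<in> ubox"
  have "((\<lambda>t. x0 + t *\<^sub>R y) has_derivative (\<lambda>h. h *\<^sub>R y)) (at s within {0..r})"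
    by (auto intro!: derivative_eq_intros)
  moreover have "(v has_derivative (\<lambda>h. h \<bullet> G (x0 + s *\<^sub>R y))) (at (x0 + s *\<^sub>R y))"
    using wlapD(2)[OF w S[OF s]] unfolding gderiv_def .
  ultimately have "((\<lambda>t. v (x0 + t *\<^sub>R y)) has_derivative (\<lambda>h. (h *\<^sub>R y) \<bullet> G (x0 + s *\<^sub>R y))) (at s within {0..r})"
    by (rule has_derivative_compose)
  then have "((\<lambda>t. v (x0 + t *\<^sub>R y)) has_field_derivative y \<bullet> G (x0 + s *\<^sub>R y)) (at s within {0..r})"
    unfolding has_field_derivative_def by (simp add: mult_commute_abs)
  then show "((\<lambda>t. \<eta> y * v (x0 + t *\<^sub>R y)) has_field_derivative \<eta> y * (y \<bullet> G (x0 + s *\<^sub>R y))) (at s within {0..r})"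
    by (rule DERIV_cmult)
next
  fix s assume s: "s \<in> {0..r}"
  have "continuous_on ubox (\<lambda>y. v (x0 + s *\<^sub>R y))"
    by (rule continuous_on_compose2[OF wlapD(5)[OF w]]) (use S[OF s] in \<open>auto intro!: continuous_intros\<close>)
  then show "(\<lambda>y. \<eta> y * v (x0 + s *\<^sub>R y)) integrable_on ubox"
    by (intro integrable_continuous continuous_intros \<eta>)
next
  have "continuous_on ({0..r} \<times> ubox) (\<lambda>z. G (x0 + fst z *\<^sub>R snd z))"
    by (rule continuous_on_compose2[OF wlapD(3)[OF w]]) (use S in \<open>auto intro!: continuous_intros\<close>)
  moreover have "continuous_on ({0..r} \<times> ubox) (\<lambda>z. \<eta> (snd z))"
    by (rule continuous_on_compose2[OF \<eta>]) (auto intro!: continuous_intros)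
  ultimately show "continuous_on ({0..r} \<times> ubox) (\<lambda>(s, y). \<eta> y * (y \<bullet> G (x0 + s *\<^sub>R y)))"
    unfolding case_prod_unfold by (intro continuous_intros)
qed (use t in auto)

lemma integral_bump_square_pos: "integral (ubox::'a::euclidean_space set) (\<lambda>y. (bump y)\<^sup>2) > 0"
proof -
  have c: "continuous_on ubox (\<lambda>y::'a. (bump y)\<^sup>2)" by (intro continuous_intros)
  have i: "(\<lambda>y::'a. (bump y)\<^sup>2) integrable_on ubox" by (rule integrable_continuous[OF c])
  have "integral ubox (\<lambda>y::'a. (bump y)\<^sup>2) \<ge> 0" by (rule integral_nonneg[OF i]) simp
  moreover have "integral ubox (\<lambda>y::'a. (bump y)\<^sup>2) \<noteq> 0"
  proof
    assume "integral ubox (\<lambda>y::'a. (bump y)\<^sup>2) = 0"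
    then have "((\<lambda>y::'a. (bump y)\<^sup>2) has_integral 0) ubox" using i by (metis integrable_integral)
    from has_integral_0_cbox_imp_0[OF c _ this, of 0] have "(bump (0::'a))\<^sup>2 = 0"
      by (simp add: box_ne_empty in_ubox)
    then show False by (simp add: bump_def)
  qed
  ultimately show ?thesis by simp
qed

text \<open>If \<open>g x0 > 0\<close>, the weighted means of \<open>v\<close> over small balls around \<open>x0\<close> increase with the radius.\<close>

lemma wlap_local_max:
  fixes v :: "'a::euclidean_space \<Rightarrow> real"
  assumes w: "wlap S v G g" and x0: "x0 \<in> S" and le: "\<And>x. x \<in> S \<Longrightarrow> v x \<le> v x0"
  shows "G x0 = 0" "g x0 \<le> 0"
proof -
  have o: "open S" using w by (rule wlapD)
  have "(v has_derivative (\<lambda>h. h \<bullet> G x0)) (at x0)"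
    using wlapD(2)[OF w x0] unfolding gderiv_def .
  from differential_zero_maxmin[OF x0 o this] le have "(\<lambda>h. h \<bullet> G x0) = (\<lambda>v. 0)" by blast
  then have "G x0 \<bullet> G x0 = 0" by metis
  then show "G x0 = 0" by simp
  show "g x0 \<le> 0"
  proof (rule ccontr)
    assume "\<not> g x0 \<le> 0"
    then have g0: "g x0 > 0" by simp
    have "isCont g x0" using wlapD(4)[OF w] o x0 by (simp add: continuous_on_eq_continuous_at)
    then have "\<forall>\<^sub>F x in nhds x0. g x > g x0 / 2"
      using g0 by (intro order_tendstoD) (auto simp: isCont_def tendsto_at_iff_tendsto_nhds)
    moreover have "\<forall>\<^sub>F x in nhds x0. x \<in> S" using o x0 by (rule eventually_nhds_in_open)
    ultimately have "\<forall>\<^sub>F x in nhds x0. g x > g x0 / 2 \<and> x \<in> S" by (rule eventually_conj)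
    then obtain d where d: "d > 0" "\<And>x. dist x x0 < d \<Longrightarrow> g x > g x0 / 2 \<and> x \<in> S"
      unfolding eventually_nhds_metric by blast
    \<comment> \<open>Points of \<open>ubox\<close> have norm at most \<open>DIM('a)\<close>, so
      dilations by \<open>t \<le> r\<close> stay within distance \<open>d / 2\<close> of
      \<open>x0\<close>.\<close>
    define r where "r = d / (2 * real DIM('a))"
    have r: "r > 0" using d by (simp add: r_def)
    have near: "dist (x0 + t *\<^sub>R y) x0 < d" if "t \<in> {0..r}" "y \<in> ubox" for t and y :: 'a
    proof -
      have "dist (x0 + t *\<^sub>R y) x0 = t * norm y" using that by (simp add: dist_norm)
      also have "\<dots> \<le> r * real DIM('a)" using that norm_ubox[OF that(2)] by (intro mult_mono) auto
      also have "\<dots> = d / 2" by (simp add: r_def)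
      finally show ?thesis using d by simp
    qed
    let ?M = "\<lambda>t. integral ubox (\<lambda>y. bump y * v (x0 + t *\<^sub>R y))"
    let ?M' = "\<lambda>t. integral ubox (\<lambda>y. bump y * (y \<bullet> G (x0 + t *\<^sub>R y)))"
    have S: "t \<in> {0..r} \<Longrightarrow> y \<in> ubox \<Longrightarrow> x0 + t *\<^sub>R y \<in> S" for t y using near d by blast
    have "\<exists>\<xi>\<in>{0<..<r}. ?M r - ?M 0 = (\<lambda>h. ?M' \<xi> * h) (r - 0)"
    proof (rule mvt_simple[OF r])
      fix t assume "0 \<le> t" "t \<le> r"
      then show "(?M has_derivative (\<lambda>h. ?M' t * h)) (at t within {0..r})"
        using leibniz_scaled[OF w S, of r bump t] continuous_bump[OF continuous_on_id, of ubox]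
        unfolding has_field_derivative_def by auto
    qed
    then obtain \<xi> where \<xi>: "0 < \<xi>" "\<xi> < r" "?M r - ?M 0 = ?M' \<xi> * r" by auto
    have cv: "continuous_on ubox (\<lambda>y. h (x0 + t *\<^sub>R y))" if "t \<in> {0..r}" "continuous_on S h"
      for t and h :: "'a \<Rightarrow> 'b::real_normed_vector"
      by (rule continuous_on_compose2[OF that(2)]) (use S that in \<open>auto intro!: continuous_intros\<close>)
    \<comment> \<open>Maximality of \<open>v x0\<close> bounds the mean from above; against this,
      the test with the squared bump makes its derivative positive.\<close>
    have "?M r \<le> ?M 0"
      using r x0 le S bump_bounds
      by (intro integral_le integrable_continuous continuous_intros cv wlapD(5)[OF w]) (auto intro!: mult_left_mono)
    moreover have "?M' \<xi> > 0"
    proof -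
      have "integral ubox (\<lambda>y. G (x0 + \<xi> *\<^sub>R y) \<bullet> ((- 4 * bump y) *\<^sub>R y)) = - \<xi> * integral ubox (\<lambda>y. g (x0 + \<xi> *\<^sub>R y) * (bump y)\<^sup>2)"
        using \<xi> by (intro wlap_scaled[OF w] S GDERIV_bump_square)
          (auto simp: bump_outside intro!: continuous_intros)
      also have "(\<lambda>y. G (x0 + \<xi> *\<^sub>R y) \<bullet> ((- 4 * bump y) *\<^sub>R y)) = (\<lambda>y. (- 4) * (bump y * (y \<bullet> G (x0 + \<xi> *\<^sub>R y))))"
        by (auto simp: inner_commute)
      finally have e: "4 * ?M' \<xi> = \<xi> * integral ubox (\<lambda>y. g (x0 + \<xi> *\<^sub>R y) * (bump y)\<^sup>2)" by simp
      have "g x0 / 2 * integral ubox (\<lambda>y::'a. (bump y)\<^sup>2) = integral ubox (\<lambda>y::'a. g x0 / 2 * (bump y)\<^sup>2)" by simp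
      also have "\<dots> \<le> integral ubox (\<lambda>y. g (x0 + \<xi> *\<^sub>R y) * (bump y)\<^sup>2)"
      proof (intro integral_le integrable_continuous continuous_intros cv wlapD(4)[OF w])
        fix y :: 'a assume "y \<in> ubox"
        then have "g x0 / 2 < g (x0 + \<xi> *\<^sub>R y)" using \<xi> near d(2) by simp
        then show "g x0 / 2 * (bump y)\<^sup>2 \<le> g (x0 + \<xi> *\<^sub>R y) * (bump y)\<^sup>2" by (intro mult_right_mono) auto
      qed (use \<xi> in auto)
      finally have "integral ubox (\<lambda>y. g (x0 + \<xi> *\<^sub>R y) * (bump y)\<^sup>2) > 0"
        using g0 integral_bump_square_pos[where 'a='a] by (smt (verit) mult_pos_pos half_gt_zero)
      with e \<xi>(1) show ?thesis by (smt (verit) mult_pos_pos)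
    qed
    ultimately show False using \<xi>(3) r by (smt (verit) mult_pos_pos)
  qed
qed

lemma wlap_local_min:
  fixes v :: "'a::euclidean_space \<Rightarrow> real"
  assumes w: "wlap S v G g" and x0: "x0 \<in> S" and le: "\<And>x. x \<in> S \<Longrightarrow> v x0 \<le> v x"
  shows "G x0 = 0" "g x0 \<ge> 0"
  using wlap_local_max[OF wlap_cmult[OF w, of "-1"] x0] le by auto

text \<open>The gradient estimate follows the weighted mean of \<open>e \<bullet> G\<close> over the ball of radius \<open>t\<close>, whose derivative in \<open>t\<close> is controlled
  by \<open>g\<close>, from \<open>0\<close> to \<open>r\<close>, where an integration by parts replaces \<open>G\<close> by \<open>v\<close>.\<close>

definition grad_const :: "'a::euclidean_space itself \<Rightarrow> real" where
  "grad_const _ = 4 * (real DIM('a))\<^sup>2 * measure lborel (ubox::'a set) / integral (ubox::'a set) (\<lambda>y. (bump y)\<^sup>2)"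

lemma wlap_gradient_bound:
  fixes v :: "'a::euclidean_space \<Rightarrow> real"
  assumes w: "wlap S v G g" and R: "R > 0" "cball x0 R \<subseteq> S"
    and M: "\<And>x. x \<in> cball x0 R \<Longrightarrow> \<bar>v x\<bar> \<le> M" and L: "\<And>x. x \<in> cball x0 R \<Longrightarrow> \<bar>g x\<bar> \<le> L"
  shows "norm (G x0) \<le> grad_const TYPE('a) * (M / R + R * L)"
proof -
  define N where "N = real DIM('a)"
  define A where "A = integral (ubox::'a set) (\<lambda>y. (bump y)\<^sup>2)"
  define \<kappa> where "\<kappa> = measure lborel (ubox::'a set)"
  have N: "N \<ge> 1" using DIM_positive[where 'a='a] unfolding N_def by linarith
  have A: "A > 0" unfolding A_def by (rule integral_bump_square_pos)
  have \<kappa>: "\<kappa> \<ge> 0" unfolding \<kappa>_def by (rule measure_nonneg)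
  have M0: "M \<ge> 0" "L \<ge> 0"
    using abs_ge_zero[of "v x0"] abs_ge_zero[of "g x0"] M[of x0] L[of x0] R(1) by (simp_all del: abs_ge_zero)
  define r where "r = R / N"
  have r: "r > 0" using R N by (simp add: r_def)
  have near: "x0 + t *\<^sub>R y \<in> cball x0 R" if "t \<in> {0..r}" "y \<in> ubox" for t and y :: 'a
  proof -
    have "dist (x0 + t *\<^sub>R y) x0 = t * norm y" using that by (simp add: dist_norm)
    also have "\<dots> \<le> r * N" using that norm_ubox[OF that(2)] by (intro mult_mono) (auto simp: N_def)
    also have "\<dots> = R" using N by (simp add: r_def)
    finally show ?thesis by (simp add: dist_commute)
  qed
  have S: "t \<in> {0..r} \<Longrightarrow> y \<in> ubox \<Longrightarrow> x0 + t *\<^sub>R y \<in> S" for t y using near R by blast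
  have o: "open S" using w by (rule wlapD)
  have cv: "continuous_on ubox (\<lambda>y. h (x0 + t *\<^sub>R y))" if "t \<in> {0..r}" "continuous_on S h"
    for t and h :: "'a \<Rightarrow> 'b::real_normed_vector"
    by (rule continuous_on_compose2[OF that(2)]) (use S that in \<open>auto intro!: continuous_intros\<close>)
  \<comment> \<open>The direction of \<open>G x0\<close>, so that the mean \<open>?D\<close> at
    radius 0 is a fixed multiple of \<open>norm (G x0)\<close>.\<close>
  define e where "e = sgn (G x0)"
  have e1: "norm e \<le> 1" by (simp add: e_def norm_sgn)
  have ye: "\<bar>y \<bullet> e\<bar> \<le> N" if "y \<in> ubox" for y
  proof -
    have "\<bar>y \<bullet> e\<bar> \<le> norm y * norm e" by (rule Cauchy_Schwarz_ineq2)
    also have "\<dots> \<le> N * 1" using that norm_ubox[OF that] e1 by (intro mult_mono) (auto simp: N_def)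
    finally show ?thesis by simp
  qed
  let ?D = "\<lambda>t. integral ubox (\<lambda>y. (bump y)\<^sup>2 * (e \<bullet> G (x0 + t *\<^sub>R y)))"
  let ?J = "\<lambda>t. integral ubox (\<lambda>y. ((y \<bullet> e) * bump y) * v (x0 + t *\<^sub>R y))"
  let ?J' = "\<lambda>t. integral ubox (\<lambda>y. ((y \<bullet> e) * bump y) * (y \<bullet> G (x0 + t *\<^sub>R y)))"
  let ?X = "\<lambda>t. integral ubox (\<lambda>y. g (x0 + t *\<^sub>R y) * ((y \<bullet> e) * (bump y)\<^sup>2))"
  \<comment> \<open>The integral of the \<open>e\<close>-derivative of
    \<open>v (x0 + t *\<^sub>R y) * (bump y)\<^sup>2\<close> vanishes; this trades the gradient for
    \<open>v\<close> itself.\<close>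
  have DJ: "t * ?D t = 4 * ?J t" if t: "t \<in> {0<..r}" for t
  proof -
    have t': "t \<in> {0..r}" using t by auto
    let ?S = "{y. x0 + t *\<^sub>R y \<in> S}"
    have oS: "open ?S"
    proof -
      have "continuous_on UNIV (\<lambda>y::'a. x0 + t *\<^sub>R y)" by (intro continuous_intros)
      from open_vimage[OF o this] show ?thesis by (simp add: vimage_def)
    qed
    have t: "tfun ?S (\<lambda>y. (bump y)\<^sup>2) (\<lambda>y. (- 4 * bump y) *\<^sub>R y)"
      unfolding tfun_def
    proof (intro conjI allI exI[of _ "cball 0 1"] impI)
      show "cball 0 1 \<subseteq> ?S" using S[OF t'] in_ubox by force
      show "continuous_on UNIV (\<lambda>y::'a. (- 4 * bump y) *\<^sub>R y)" by (intro continuous_intros)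
      fix x :: 'a assume "x \<notin> cball 0 1"
      then have "bump x = 0" by (intro bump_outside) simp
      then show "(bump x)\<^sup>2 = 0" "(- 4 * bump x) *\<^sub>R x = 0" by simp_all
    qed (simp_all add: GDERIV_bump_square[simplified])
    have "GDERIV (\<lambda>y. v (x0 + t *\<^sub>R y)) y :> t *\<^sub>R G (x0 + t *\<^sub>R y)" if "y \<in> ?S" for y
    proof -
      have "((\<lambda>y. x0 + t *\<^sub>R y) has_derivative (\<lambda>h. t *\<^sub>R h)) (at y)" by (auto intro!: derivative_eq_intros)
      moreover have "(v has_derivative (\<lambda>h. h \<bullet> G (x0 + t *\<^sub>R y))) (at (x0 + t *\<^sub>R y))"
        using wlapD(2)[OF w, of "x0 + t *\<^sub>R y"] that unfolding gderiv_def by simp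
      ultimately have "((\<lambda>y. v (x0 + t *\<^sub>R y)) has_derivative (\<lambda>h. (t *\<^sub>R h) \<bullet> G (x0 + t *\<^sub>R y))) (at y)"
        by (rule has_derivative_compose)
      then show ?thesis unfolding gderiv_def by (simp add: inner_commute)
    qed
    moreover have "continuous_on ?S (\<lambda>y. t *\<^sub>R G (x0 + t *\<^sub>R y))"
      by (intro continuous_intros continuous_on_compose2[OF wlapD(3)[OF w]]) auto
    ultimately have "tfun ?S (\<lambda>y. v (x0 + t *\<^sub>R y) * (bump y)\<^sup>2)
      (\<lambda>y. v (x0 + t *\<^sub>R y) *\<^sub>R ((- 4 * bump y) *\<^sub>R y) + (bump y)\<^sup>2 *\<^sub>R (t *\<^sub>R G (x0 + t *\<^sub>R y)))"
      by (rule tfun_mult[OF t oS])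
    from tfun_derivative_integral[OF this, of e]
    have "0 = (\<integral>y. e \<bullet> (v (x0 + t *\<^sub>R y) *\<^sub>R ((- 4 * bump y) *\<^sub>R y) + (bump y)\<^sup>2 *\<^sub>R (t *\<^sub>R G (x0 + t *\<^sub>R y))) \<partial>lborel)"
      by simp
    also have "(\<lambda>y. e \<bullet> (v (x0 + t *\<^sub>R y) *\<^sub>R ((- 4 * bump y) *\<^sub>R y) + (bump y)\<^sup>2 *\<^sub>R (t *\<^sub>R G (x0 + t *\<^sub>R y))))
      = (\<lambda>y. - 4 * (((y \<bullet> e) * bump y) * v (x0 + t *\<^sub>R y)) + t * ((bump y)\<^sup>2 * (e \<bullet> G (x0 + t *\<^sub>R y))))"
    proof
      fix y show "e \<bullet> (v (x0 + t *\<^sub>R y) *\<^sub>R ((- 4 * bump y) *\<^sub>R y) + (bump y)\<^sup>2 *\<^sub>R (t *\<^sub>R G (x0 + t *\<^sub>R y)))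
      = - 4 * (((y \<bullet> e) * bump y) * v (x0 + t *\<^sub>R y)) + t * ((bump y)\<^sup>2 * (e \<bullet> G (x0 + t *\<^sub>R y)))"
        using inner_commute[of e y] by (simp add: inner_diff_right)
    qed
    also have "(\<integral>y. - 4 * (((y \<bullet> e) * bump y) * v (x0 + t *\<^sub>R y)) + t * ((bump y)\<^sup>2 * (e \<bullet> G (x0 + t *\<^sub>R y))) \<partial>lborel) = integral ubox (\<lambda>y. - 4 * (((y \<bullet> e) * bump y) * v (x0 + t *\<^sub>R y)) + t * ((bump y)\<^sup>2 * (e \<bullet> G (x0 + t *\<^sub>R y))))"
    proof (rule integral_cbox_lborel)
      fix x :: 'a assume "x \<notin> ubox"
      then have "bump x = 0" using in_ubox[of x] bump_outside by force
      then show "- 4 * (((x \<bullet> e) * bump x) * v (x0 + t *\<^sub>R x)) + t * ((bump x)\<^sup>2 * (e \<bullet> G (x0 + t *\<^sub>R x))) = 0" by simp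
    qed (intro continuous_intros cv[OF t' wlapD(3)[OF w]] cv[OF t' wlapD(5)[OF w]])
    also have "\<dots> = integral ubox (\<lambda>y. - 4 * (((y \<bullet> e) * bump y) * v (x0 + t *\<^sub>R y))) + integral ubox (\<lambda>y. t * ((bump y)\<^sup>2 * (e \<bullet> G (x0 + t *\<^sub>R y))))"
      by (intro integral_add integrable_continuous continuous_intros cv[OF t' wlapD(3)[OF w]] cv[OF t' wlapD(5)[OF w]])
    also have "\<dots> = - 4 * ?J t + t * ?D t" by (simp only: integral_mult_right)
    finally show ?thesis by simp
  qed
  \<comment> \<open>The weak equation tested with
    \<open>(y \<bullet> e) * (bump y)\<^sup>2\<close>.\<close>
  have JX: "4 * ?J' t = ?D t + t * ?X t" if t: "t \<in> {0<..r}" for t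
  proof -
    have t': "t \<in> {0..r}" using t by auto
    have "integral ubox (\<lambda>y. G (x0 + t *\<^sub>R y) \<bullet> ((y \<bullet> e) *\<^sub>R ((- 4 * bump y) *\<^sub>R y) + (bump y)\<^sup>2 *\<^sub>R e)) =
      - t * integral ubox (\<lambda>y. g (x0 + t *\<^sub>R y) * ((y \<bullet> e) * (bump y)\<^sup>2))"
      using t by (intro wlap_scaled[OF w] S GDERIV_mult GDERIV_inner_const GDERIV_bump_square)
        (auto simp: bump_outside intro!: continuous_intros)
    also have "(\<lambda>y. G (x0 + t *\<^sub>R y) \<bullet> ((y \<bullet> e) *\<^sub>R ((- 4 * bump y) *\<^sub>R y) + (bump y)\<^sup>2 *\<^sub>R e))
      = (\<lambda>y. - 4 * (((y \<bullet> e) * bump y) * (y \<bullet> G (x0 + t *\<^sub>R y))) + (bump y)\<^sup>2 * (e \<bullet> G (x0 + t *\<^sub>R y)))"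
      by (rule ext) (simp add: inner_diff_right inner_commute[of "G _"] mult_ac)
    also have "integral ubox (\<lambda>y. - 4 * (((y \<bullet> e) * bump y) * (y \<bullet> G (x0 + t *\<^sub>R y))) + (bump y)\<^sup>2 * (e \<bullet> G (x0 + t *\<^sub>R y)))
      = integral ubox (\<lambda>y. - 4 * (((y \<bullet> e) * bump y) * (y \<bullet> G (x0 + t *\<^sub>R y)))) + ?D t"
      by (intro integral_add integrable_continuous continuous_intros cv[OF t' wlapD(3)[OF w]])
    also have "integral ubox (\<lambda>y. - 4 * (((y \<bullet> e) * bump y) * (y \<bullet> G (x0 + t *\<^sub>R y)))) = - 4 * ?J' t"
      by (rule integral_mult_right)
    finally show ?thesis by simp
  qed
  \<comment> \<open>On differentiating \<open>4 * ?J t / t\<close>, the mean of the gradient cancels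
    between \<open>DJ\<close> and \<open>JX\<close>, and only the mean of \<open>g\<close>
    remains.\<close>
  have dD: "(?D has_real_derivative ?X t) (at t)" if t: "0 < t" "t < r" for t
  proof -
    have "(?J has_real_derivative ?J' t) (at t within {0..r})"
      using t by (intro leibniz_scaled[OF w] S continuous_intros) auto
    then have "(?J has_real_derivative ?J' t) (at t)" using t by (simp add: at_within_Icc_at)
    then have "((\<lambda>t. 4 * ?J t / t) has_real_derivative (4 * ?J' t * t - 4 * ?J t) / (t * t)) (at t)"
      using t by (auto intro!: derivative_eq_intros)
    also have "(4 * ?J' t * t - 4 * ?J t) / (t * t) = ?X t"
      using JX[of t] DJ[of t] t by (simp add: field_simps)
    finally show ?thesis
      by (rule has_field_derivative_transform_within_open[of _ _ _ "{0<..<r}"])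
        (use t DJ in \<open>auto simp: field_simps\<close>)
  qed
  have cD: "continuous_on {0..r} ?D"
  proof (rule integral_continuous_on_param)
    have "continuous_on ({0..r} \<times> ubox) (\<lambda>z. G (x0 + fst z *\<^sub>R snd z))"
      by (rule continuous_on_compose2[OF wlapD(3)[OF w]]) (use S in \<open>auto intro!: continuous_intros\<close>)
    then show "continuous_on ({0..r} \<times> ubox) (\<lambda>(t, y). (bump y)\<^sup>2 * (e \<bullet> G (x0 + t *\<^sub>R y)))"
      unfolding case_prod_unfold by (intro continuous_intros)
  qed
  obtain \<xi> where \<xi>: "0 < \<xi>" "\<xi> < r" "?D r - ?D 0 = ?X \<xi> * (r - 0)"
    using mvt[OF r cD, of "\<lambda>t h. ?X t * h"] dD unfolding has_field_derivative_def by blast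
  have bound: "\<bar>integral (ubox::'a set) h\<bar> \<le> B * \<kappa>" if "continuous_on ubox h" "\<And>y. y \<in> ubox \<Longrightarrow> \<bar>h y\<bar> \<le> B" "B \<ge> 0" for h B
    using has_integral_bound[OF that(3) integrable_integral[OF integrable_continuous[OF that(1)]]] that(2)
    by (simp add: \<kappa>_def)
  have X: "\<bar>?X \<xi>\<bar> \<le> (L * N) * \<kappa>"
  proof (rule bound)
    fix y :: 'a assume y: "y \<in> ubox"
    have "\<bar>g (x0 + \<xi> *\<^sub>R y) * ((y \<bullet> e) * (bump y)\<^sup>2)\<bar> = \<bar>g (x0 + \<xi> *\<^sub>R y)\<bar> * (\<bar>y \<bullet> e\<bar> * (bump y)\<^sup>2)"
      by (simp add: abs_mult)
    also have "\<dots> \<le> L * (N * 1)"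
      using \<xi> y bump_bounds[of y] by (intro mult_mono L near ye) (auto intro!: M0 power_le_one simp: N_def)
    finally show "\<bar>g (x0 + \<xi> *\<^sub>R y) * ((y \<bullet> e) * (bump y)\<^sup>2)\<bar> \<le> L * N" by simp
  next
    show "continuous_on ubox (\<lambda>y. g (x0 + \<xi> *\<^sub>R y) * ((y \<bullet> e) * (bump y)\<^sup>2))"
      by (intro continuous_intros cv wlapD(4)[OF w]) (use \<xi> in auto)
  qed (use M0 N in simp)
  have J: "\<bar>?J r\<bar> \<le> (N * M) * \<kappa>"
  proof (rule bound)
    fix y :: 'a assume y: "y \<in> ubox"
    have "\<bar>((y \<bullet> e) * bump y) * v (x0 + r *\<^sub>R y)\<bar> = (\<bar>y \<bullet> e\<bar> * bump y) * \<bar>v (x0 + r *\<^sub>R y)\<bar>"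
      using bump_bounds[of y] by (simp add: abs_mult)
    also have "\<dots> \<le> (N * 1) * M"
      using r y bump_bounds[of y] by (intro mult_mono M near ye) (auto intro!: M0 simp: N_def)
    finally show "\<bar>((y \<bullet> e) * bump y) * v (x0 + r *\<^sub>R y)\<bar> \<le> N * M" by simp
  next
    show "continuous_on ubox (\<lambda>y. ((y \<bullet> e) * bump y) * v (x0 + r *\<^sub>R y))"
      by (intro continuous_intros cv wlapD(5)[OF w]) (use r in auto)
  qed (use M0 N in simp)
  have D0: "?D 0 = A * norm (G x0)"
  proof -
    have "e \<bullet> G x0 = norm (G x0)"
      by (cases "G x0 = 0") (simp_all add: e_def sgn_div_norm power2_norm_eq_inner[symmetric] power2_eq_square)
    then show ?thesis by (simp add: A_def)
  qed
  define Dr Xi Jr where "Dr = ?D r" and "Xi = ?X \<xi>" and "Jr = ?J r"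
  have f: "Dr - A * norm (G x0) = Xi * r" "r * Dr = 4 * Jr" "\<bar>Xi\<bar> \<le> (L * N) * \<kappa>" "\<bar>Jr\<bar> \<le> (N * M) * \<kappa>"
    unfolding Dr_def Xi_def Jr_def
    subgoal using \<xi>(3) unfolding D0 diff_0_right .
    subgoal by (rule DJ) (use r in simp)
    subgoal by (rule X)
    subgoal by (rule J)
    done
  have "A * norm (G x0) = Dr - Xi * r" using f(1) by linarith
  also have "\<dots> = 4 * Jr / r - Xi * r" using f(2) r by (simp add: field_simps)
  also have "\<dots> \<le> 4 * ((N * M) * \<kappa>) / r + ((L * N) * \<kappa>) * r"
  proof -
    have "4 * Jr / r \<le> 4 * ((N * M) * \<kappa>) / r" using f(4) r by (intro divide_right_mono) auto
    moreover have "- Xi * r \<le> ((L * N) * \<kappa>) * r" using f(3) r by (intro mult_right_mono) auto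
    ultimately show ?thesis by simp
  qed
  also have "\<dots> = 4 * N\<^sup>2 * \<kappa> * (M / R) + \<kappa> * (R * L)"
    using N R by (simp add: r_def field_simps power2_eq_square)
  also have "\<dots> \<le> 4 * N\<^sup>2 * \<kappa> * (M / R) + 4 * N\<^sup>2 * \<kappa> * (R * L)"
  proof -
    have "1 \<le> N\<^sup>2" using N by simp
    then have "\<kappa> * 1 \<le> \<kappa> * (4 * N\<^sup>2)" using \<kappa> by (intro mult_left_mono) auto
    then have "\<kappa> * (R * L) \<le> (\<kappa> * (4 * N\<^sup>2)) * (R * L)" using R M0 by (intro mult_right_mono) auto
    then show ?thesis by (simp add: mult_ac)
  qed
  finally have "A * norm (G x0) \<le> 4 * N\<^sup>2 * \<kappa> * (M / R + R * L)" by (simp add: distrib_left)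
  then have "norm (G x0) \<le> (4 * N\<^sup>2 * \<kappa> * (M / R + R * L)) / A" using A by (simp add: pos_le_divide_eq mult.commute)
  also have "\<dots> = (4 * N\<^sup>2 * \<kappa> / A) * (M / R + R * L)" by simp
  also have "4 * N\<^sup>2 * \<kappa> / A = grad_const TYPE('a)"
    unfolding grad_const_def N_def A_def \<kappa>_def by (rule refl)
  finally show ?thesis .
qed

lemma grad_const_nonneg: "grad_const TYPE('a::euclidean_space) \<ge> 0"
  unfolding grad_const_def
  by (intro divide_nonneg_nonneg mult_nonneg_nonneg measure_nonneg less_imp_le[OF integral_bump_square_pos]) auto

section \<open>Radial comparison in logarithmic variables\<close>

lemma sl_norm: "x \<noteq> 0 \<Longrightarrow> norm x = exp (- sl x)"
  by (simp add: sl_def)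

lemma sl_le_iff: "x \<noteq> 0 \<Longrightarrow> sl x \<le> s \<longleftrightarrow> exp (- s) \<le> norm x"
  using sl_norm[of x] by auto

lemma sl_ge_iff: "x \<noteq> 0 \<Longrightarrow> s \<le> sl x \<longleftrightarrow> norm x \<le> exp (- s)"
  using sl_norm[of x] by auto

lemma compact_annulus: "compact {x::'a::euclidean_space. x \<noteq> 0 \<and> a \<le> sl x \<and> sl x \<le> c}"
proof -
  have "{x::'a. x \<noteq> 0 \<and> a \<le> sl x \<and> sl x \<le> c} = cball 0 (exp (- a)) - ball 0 (exp (- c))"
  proof (rule set_eqI)
    fix x :: 'a
    show "x \<in> {x. x \<noteq> 0 \<and> a \<le> sl x \<and> sl x \<le> c} \<longleftrightarrow> x \<in> cball 0 (exp (- a)) - ball 0 (exp (- c))"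
      by (cases "x = 0") (auto simp: sl_le_iff sl_ge_iff not_less)
  qed
  then show ?thesis by (simp add: compact_diff)
qed

lemma continuous_on_sl: "0 \<notin> A \<Longrightarrow> continuous_on A sl"
  unfolding sl_def by (intro continuous_intros) auto

lemma open_sl_preimage:
  assumes "open T" shows "open {x::'a::euclidean_space. x \<noteq> 0 \<and> sl x \<in> T}"
proof -
  have "open (sl -` T \<inter> (- {0::'a}))"
    using continuous_on_open_vimage[of "- {0::'a}" sl] continuous_on_sl[of "- {0::'a}"] assms by auto
  moreover have "sl -` T \<inter> (- {0::'a}) = {x. x \<noteq> 0 \<and> sl x \<in> T}" by auto
  ultimately show ?thesis by simp
qed

lemma sl_ex: "\<exists>x::'a::euclidean_space. x \<noteq> 0 \<and> sl x = s"
proof -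
  obtain b :: 'a where b: "norm b = 1" using norm_Basis nonempty_Basis by blast
  then have "exp (- s) *\<^sub>R b \<noteq> 0 \<and> sl (exp (- s) *\<^sub>R b) = s" by (auto simp: sl_def)
  then show ?thesis by blast
qed

lemma wlap_radial:
  fixes B B1 B2 :: "real \<Rightarrow> real"
  assumes "open T" and B: "\<And>s. s \<in> T \<Longrightarrow> (B has_real_derivative B1 s) (at s)"
    "\<And>s. s \<in> T \<Longrightarrow> (B1 has_real_derivative B2 s) (at s)" "continuous_on T B2"
  shows "wlap {x::'a::euclidean_space. x \<noteq> 0 \<and> sl x \<in> T} (\<lambda>x. B (sl x))
    (\<lambda>x. (- B1 (sl x) / (norm x)\<^sup>2) *\<^sub>R x) (\<lambda>x. (B2 (sl x) - (real DIM('a) - 2) * B1 (sl x)) / (norm x)\<^sup>2)"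
proof -
  let ?S = "{x::'a. x \<noteq> 0 \<and> sl x \<in> T}"
  have "wlap ?S (\<lambda>x. B (sl x)) (\<lambda>x. B1 (sl x) *\<^sub>R ((- inverse ((norm x)\<^sup>2)) *\<^sub>R x))
    (\<lambda>x. B2 (sl x) * (norm ((- inverse ((norm x)\<^sup>2)) *\<^sub>R x))\<^sup>2 + B1 (sl x) * ((2 - real DIM('a)) / (norm x)\<^sup>2))"
    by (rule wlap_compose[OF wlap_sl[OF open_sl_preimage[OF assms(1)]]])
      (use B in \<open>auto intro: continuous_on_subset\<close>)
  then show ?thesis
  proof (rule wlap_cong)
    fix x :: 'a assume "x \<in> ?S"
    then have n: "norm x > 0" by auto
    show "B2 (sl x) * (norm ((- inverse ((norm x)\<^sup>2)) *\<^sub>R x))\<^sup>2 + B1 (sl x) * ((2 - real DIM('a)) / (norm x)\<^sup>2)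
      = (B2 (sl x) - (real DIM('a) - 2) * B1 (sl x)) / (norm x)\<^sup>2"
      using n by (simp add: field_simps power2_eq_square)
  qed (auto simp: divide_inverse)
qed

locale operator_coefficients =
  fixes \<rho> lam \<tau> :: real
  assumes tau: "0 \<le> \<tau>" "\<tau> < 1"
begin

abbreviation f :: "real \<Rightarrow> real" where "f \<equiv> f_rho \<rho> lam \<tau>"
abbreviation ft :: "real \<Rightarrow> real" where "ft \<equiv> ftilde_rho \<rho> lam \<tau>"

end

text \<open>\<open>w\<close> is the logarithm of a solution on the punctured ball
  \<open>norm x < exp (- a0)\<close>, and \<open>b\<close> stands for \<beta>. Since
  \<open>gw\<close> is continuous, the weak equation can be recorded as a pointwise identity;
  \<open>norm x * norm (Gw x)\<close> is |E|.\<close>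

locale log_solution = operator_coefficients \<rho> lam \<tau> for \<rho> lam \<tau> :: real +
  fixes w :: "'a::euclidean_space \<Rightarrow> real" and Gw :: "'a \<Rightarrow> 'a" and gw :: "'a \<Rightarrow> real"
    and q b a0 :: real
  assumes dim: "DIM('a) \<ge> 2" and q: "q > 1" and b: "b < 0"
    and w: "wlap {x. x \<noteq> 0 \<and> a0 < sl x} w Gw gw"
    and eqn: "\<And>x. x \<noteq> 0 \<Longrightarrow> a0 < sl x \<Longrightarrow>
      (norm x)\<^sup>2 * gw x + (norm x * norm (Gw x))\<^sup>2 - (real DIM('a) - 2 + 2 * \<rho>) * (x \<bullet> Gw x)
      + lam * (norm x * norm (Gw x)) powr (1 - \<tau>) = exp ((q - 1) * (w x - b * sl x))"
begin

lemma continuous_w: "A \<subseteq> {x. x \<noteq> 0 \<and> a0 < sl x} \<Longrightarrow> continuous_on A w"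
  using wlapD(5)[OF w] continuous_on_subset by blast

text \<open>At a contact point the gradients of \<open>w\<close> and \<open>\<psi>\<close> coincide,
  so all gradient terms can be evaluated on \<open>\<psi>\<close> and only the Laplacians have to be
  compared. This is how the gradient term is handled without a sign or a Lipschitz
  condition.\<close>

lemma touch_max:
  assumes S': "wlap S' \<psi> P p" "S' \<subseteq> {x. x \<noteq> 0 \<and> a0 < sl x}" and x0: "x0 \<in> S'"
    and le: "\<And>x. x \<in> S' \<Longrightarrow> w x - \<psi> x \<le> w x0 - \<psi> x0"
  shows "exp ((q - 1) * (w x0 - b * sl x0)) \<le> (norm x0)\<^sup>2 * p x0 + (norm x0 * norm (P x0))\<^sup>2
    - (real DIM('a) - 2 + 2 * \<rho>) * (x0 \<bullet> P x0) + lam * (norm x0 * norm (P x0)) powr (1 - \<tau>)"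
proof -
  have d: "wlap S' (\<lambda>x. w x - \<psi> x) (\<lambda>x. Gw x - P x) (\<lambda>x. gw x - p x)"
    by (intro wlap_diff wlap_subset[OF w] S' wlapD(1)[OF S'(1)])
  have G: "Gw x0 = P x0" and "gw x0 \<le> p x0"
    using wlap_local_max[OF d x0] le by auto
  then have "(norm x0)\<^sup>2 * gw x0 \<le> (norm x0)\<^sup>2 * p x0" by (intro mult_left_mono) auto
  moreover have "x0 \<noteq> 0" "a0 < sl x0" using x0 S'(2) by auto
  ultimately show ?thesis using eqn[of x0, unfolded G] by linarith
qed

lemma touch_min:
  assumes S': "wlap S' \<psi> P p" "S' \<subseteq> {x. x \<noteq> 0 \<and> a0 < sl x}" and x0: "x0 \<in> S'"
    and le: "\<And>x. x \<in> S' \<Longrightarrow> w x0 - \<psi> x0 \<le> w x - \<psi> x"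
  shows "exp ((q - 1) * (w x0 - b * sl x0)) \<ge> (norm x0)\<^sup>2 * p x0 + (norm x0 * norm (P x0))\<^sup>2
    - (real DIM('a) - 2 + 2 * \<rho>) * (x0 \<bullet> P x0) + lam * (norm x0 * norm (P x0)) powr (1 - \<tau>)"
proof -
  have d: "wlap S' (\<lambda>x. w x - \<psi> x) (\<lambda>x. Gw x - P x) (\<lambda>x. gw x - p x)"
    by (intro wlap_diff wlap_subset[OF w] S' wlapD(1)[OF S'(1)])
  have G: "Gw x0 = P x0" and "gw x0 \<ge> p x0"
    using wlap_local_min[OF d x0] le by auto
  then have "(norm x0)\<^sup>2 * gw x0 \<ge> (norm x0)\<^sup>2 * p x0" by (intro mult_left_mono) auto
  moreover have "x0 \<noteq> 0" "a0 < sl x0" using x0 S'(2) by auto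
  ultimately show ?thesis using eqn[of x0, unfolded G] by linarith
qed

text \<open>The dimension cancels: \<open>N - 2\<close> from the Laplacian of a function of
  \<open>sl x\<close> is compensated by the first-order coefficient, which leaves a one-dimensional
  expression.\<close>

lemma radial_terms:
  assumes "x \<noteq> 0"
  shows "(norm x)\<^sup>2 * ((B2 - (real DIM('a) - 2) * B1) / (norm x)\<^sup>2) + (norm x * norm ((- B1 / (norm x)\<^sup>2) *\<^sub>R x))\<^sup>2
    - (real DIM('a) - 2 + 2 * \<rho>) * (x \<bullet> ((- B1 / (norm x)\<^sup>2) *\<^sub>R x))
    + lam * (norm x * norm ((- B1 / (norm x)\<^sup>2) *\<^sub>R x)) powr (1 - \<tau>) = B2 + f B1"
proof -
  have n: "norm x > 0" using assms by simp
  have "norm x * norm ((- B1 / (norm x)\<^sup>2) *\<^sub>R x) = \<bar>B1\<bar>"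
    using n by (simp add: power2_eq_square)
  moreover have "x \<bullet> ((- B1 / (norm x)\<^sup>2) *\<^sub>R x) = - B1"
    using n by (simp add: power2_norm_eq_inner[symmetric])
  moreover have "(norm x)\<^sup>2 * ((B2 - (real DIM('a) - 2) * B1) / (norm x)\<^sup>2) = B2 - (real DIM('a) - 2) * B1"
    using n by simp
  ultimately show ?thesis
    by (simp only:) (simp add: f_rho_def power2_eq_square algebra_simps)
qed

text \<open>If \<open>w - B\<close> had a positive maximum inside, contact there would give an
  inequality between the two exponentials that contradicts their strict monotonicity. Hence
  non-strict differential inequalities suffice. The lower bound is symmetric.\<close>

lemma radial_cmp_aux:
  fixes B B1 B2 :: "real \<Rightarrow> real"
  assumes ac: "a0 < a" "a \<le> c" and cB: "continuous_on {a..c} B"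
    and B: "\<And>s. a < s \<Longrightarrow> s < c \<Longrightarrow> (B has_real_derivative B1 s) (at s)"
      "\<And>s. a < s \<Longrightarrow> s < c \<Longrightarrow> (B1 has_real_derivative B2 s) (at s)" "continuous_on {a<..<c} B2"
  shows "(\<And>s. a < s \<Longrightarrow> s < c \<Longrightarrow> B2 s + f (B1 s) \<le> exp ((q - 1) * (B s - b * s))) \<Longrightarrow>
      (\<And>x. x \<noteq> 0 \<Longrightarrow> sl x = a \<or> sl x = c \<Longrightarrow> w x \<le> B (sl x)) \<Longrightarrow>
      x \<noteq> 0 \<Longrightarrow> a \<le> sl x \<Longrightarrow> sl x \<le> c \<Longrightarrow> w x \<le> B (sl x)"
   and "(\<And>s. a < s \<Longrightarrow> s < c \<Longrightarrow> B2 s + f (B1 s) \<ge> exp ((q - 1) * (B s - b * s))) \<Longrightarrow>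
      (\<And>x. x \<noteq> 0 \<Longrightarrow> sl x = a \<or> sl x = c \<Longrightarrow> w x \<ge> B (sl x)) \<Longrightarrow>
      x \<noteq> 0 \<Longrightarrow> a \<le> sl x \<Longrightarrow> sl x \<le> c \<Longrightarrow> w x \<ge> B (sl x)"
proof -
  let ?K = "{x::'a. x \<noteq> 0 \<and> a \<le> sl x \<and> sl x \<le> c}"
  let ?S = "{x::'a. x \<noteq> 0 \<and> sl x \<in> {a<..<c}}"
  have c: "continuous_on ?K (\<lambda>x. w x - B (sl x))"
    using ac by (intro continuous_intros continuous_w continuous_on_compose2[OF cB] continuous_on_sl) auto
  have wl: "wlap ?S (\<lambda>x. B (sl x)) (\<lambda>x. (- B1 (sl x) / (norm x)\<^sup>2) *\<^sub>R x)
     (\<lambda>x. (B2 (sl x) - (real DIM('a) - 2) * B1 (sl x)) / (norm x)\<^sup>2)"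
    by (rule wlap_radial) (use B in auto)
  have sub: "?S \<subseteq> {x. x \<noteq> 0 \<and> a0 < sl x}" using ac by auto
  {
    assume ineq: "\<And>s. a < s \<Longrightarrow> s < c \<Longrightarrow> B2 s + f (B1 s) \<le> exp ((q - 1) * (B s - b * s))"
      and bd: "\<And>x. x \<noteq> 0 \<Longrightarrow> sl x = a \<or> sl x = c \<Longrightarrow> w x \<le> B (sl x)"
      and x: "x \<noteq> 0" "a \<le> sl x" "sl x \<le> c"
    have "?K \<noteq> {}" using x by blast
    from continuous_attains_sup[OF compact_annulus this c] obtain x0
      where x0: "x0 \<in> ?K" "\<And>y. y \<in> ?K \<Longrightarrow> w y - B (sl y) \<le> w x0 - B (sl x0)" by blast
    have "w x0 \<le> B (sl x0)"
    proof (rule ccontr)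
      assume n: "\<not> w x0 \<le> B (sl x0)"
      then have x0S: "x0 \<in> ?S" using bd[of x0] x0(1) by force
      have "exp ((q - 1) * (w x0 - b * sl x0)) \<le> B2 (sl x0) + f (B1 (sl x0))"
        using touch_max[OF wl sub x0S] radial_terms[of x0 "B2 (sl x0)" "B1 (sl x0)"] x0 x0S by auto
      also have "\<dots> \<le> exp ((q - 1) * (B (sl x0) - b * sl x0))" using ineq x0S by auto
      finally show False using n q by simp
    qed
    then show "w x \<le> B (sl x)" using x0(2)[of x] x by auto
  }
  {
    assume ineq: "\<And>s. a < s \<Longrightarrow> s < c \<Longrightarrow> B2 s + f (B1 s) \<ge> exp ((q - 1) * (B s - b * s))"
      and bd: "\<And>x. x \<noteq> 0 \<Longrightarrow> sl x = a \<or> sl x = c \<Longrightarrow> w x \<ge> B (sl x)"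
      and x: "x \<noteq> 0" "a \<le> sl x" "sl x \<le> c"
    have "?K \<noteq> {}" using x by blast
    from continuous_attains_inf[OF compact_annulus this c] obtain x0
      where x0: "x0 \<in> ?K" "\<And>y. y \<in> ?K \<Longrightarrow> w x0 - B (sl x0) \<le> w y - B (sl y)" by blast
    have "w x0 \<ge> B (sl x0)"
    proof (rule ccontr)
      assume n: "\<not> w x0 \<ge> B (sl x0)"
      then have x0S: "x0 \<in> ?S" using bd[of x0] x0(1) by force
      have "exp ((q - 1) * (w x0 - b * sl x0)) \<ge> B2 (sl x0) + f (B1 (sl x0))"
        using touch_min[OF wl sub x0S] radial_terms[of x0 "B2 (sl x0)" "B1 (sl x0)"] x0 x0S by auto
      moreover have "B2 (sl x0) + f (B1 (sl x0)) \<ge> exp ((q - 1) * (B (sl x0) - b * sl x0))" using ineq x0S by auto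
      ultimately have "exp ((q - 1) * (w x0 - b * sl x0)) \<ge> exp ((q - 1) * (B (sl x0) - b * sl x0))" by linarith
      then show False using n q by simp
    qed
    then show "w x \<ge> B (sl x)" using x0(2)[of x] x by auto
  }
qed

lemmas radial_upper = radial_cmp_aux(1)
lemmas radial_lower = radial_cmp_aux(2)

text \<open>Exhaustion by annuli: domination on spheres with arbitrarily large \<open>sl\<close>
  replaces the second boundary condition.\<close>

lemma radial_upper_at_top:
  fixes B B1 B2 :: "real \<Rightarrow> real"
  assumes a: "a0 < a"
    and B: "\<And>s. a \<le> s \<Longrightarrow> (B has_real_derivative B1 s) (at s)"
      "\<And>s. a \<le> s \<Longrightarrow> (B1 has_real_derivative B2 s) (at s)" "continuous_on {a..} B2"
    and ineq: "\<And>s. a \<le> s \<Longrightarrow> B2 s + f (B1 s) \<le> exp ((q - 1) * (B s - b * s))"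
    and left: "\<And>x. x \<noteq> 0 \<Longrightarrow> sl x = a \<Longrightarrow> w x \<le> B a"
    and right: "\<And>c. \<exists>c'>c. \<forall>x. x \<noteq> 0 \<longrightarrow> sl x = c' \<longrightarrow> w x \<le> B c'"
    and x: "x \<noteq> 0" "a \<le> sl x"
  shows "w x \<le> B (sl x)"
proof -
  obtain c where c: "c > sl x" "\<And>x. x \<noteq> 0 \<Longrightarrow> sl x = c \<Longrightarrow> w x \<le> B c" using right by blast
  have "continuous_on {a..c} B"
    using B(1) by (intro DERIV_continuous_on[of _ B B1]) (auto intro: has_field_derivative_at_within)
  moreover have "continuous_on {a<..<c} B2" using B(3) by (rule continuous_on_subset) auto
  ultimately show ?thesis
    using radial_upper[of a c B B1 B2 x] a c x B(1,2) ineq left by auto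
qed

text \<open>A barrier tending to minus infinity at \<open>c\<close> falls below the minimum of
  \<open>w\<close> on the compact annulus before it reaches \<open>c\<close>, so the comparison at
  that end is automatic.\<close>

lemma radial_lower_blow:
  fixes B B1 B2 :: "real \<Rightarrow> real"
  assumes a: "a0 < a"
    and B: "\<And>s. a \<le> s \<Longrightarrow> s < c \<Longrightarrow> (B has_real_derivative B1 s) (at s)"
      "\<And>s. a \<le> s \<Longrightarrow> s < c \<Longrightarrow> (B1 has_real_derivative B2 s) (at s)" "continuous_on {a..<c} B2"
    and ineq: "\<And>s. a \<le> s \<Longrightarrow> s < c \<Longrightarrow> B2 s + f (B1 s) \<ge> exp ((q - 1) * (B s - b * s))"
    and left: "\<And>x. x \<noteq> 0 \<Longrightarrow> sl x = a \<Longrightarrow> w x \<ge> B a"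
    and blow: "filterlim B at_bot (at_left c)"
    and x: "x \<noteq> 0" "a \<le> sl x" "sl x < c"
  shows "w x \<ge> B (sl x)"
proof -
  let ?K = "{x::'a. x \<noteq> 0 \<and> a \<le> sl x \<and> sl x \<le> c}"
  have "continuous_on ?K w" using a by (intro continuous_w) auto
  moreover have "?K \<noteq> {}" using x by force
  ultimately have "\<exists>x1\<in>?K. \<forall>y\<in>?K. w x1 \<le> w y"
    by (intro continuous_attains_inf compact_annulus)
  then obtain x1 where x1: "\<And>y. y \<in> ?K \<Longrightarrow> w x1 \<le> w y" by blast
  have "\<forall>\<^sub>F s in at_left c. B s \<le> w x1" using blow unfolding filterlim_at_bot by blast
  moreover have "\<forall>\<^sub>F s in at_left c. s \<in> {sl x<..<c}" using x(3) by (rule eventually_at_left_real)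
  ultimately have "\<forall>\<^sub>F s in at_left c. B s \<le> w x1 \<and> s \<in> {sl x<..<c}" by (rule eventually_conj)
  then obtain c' where c': "B c' \<le> w x1" "sl x < c'" "c' < c"
    using eventually_happens'[of "at_left c"] by (auto simp: trivial_limit_at_left_real)
  have "continuous_on {a..c'} B"
    using B(1) c' by (intro DERIV_continuous_on[of _ B B1]) (auto intro: has_field_derivative_at_within)
  moreover have "continuous_on {a<..<c'} B2" by (rule continuous_on_subset[OF B(3)]) (use c' in auto)
  moreover have "w y \<ge> B (sl y)" if "y \<noteq> 0" "sl y = a \<or> sl y = c'" for y
    using that left[of y] x1[of y] c' x by auto
  ultimately show ?thesis
    using radial_lower[of a c' B B1 B2 x] a c' x B(1,2) ineq by auto
qed

end

definition smax :: "('a::euclidean_space \<Rightarrow> real) \<Rightarrow> real \<Rightarrow> real"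
  where "smax V s = Sup (V ` {x. x \<noteq> 0 \<and> sl x = s})"

definition smin :: "('a::euclidean_space \<Rightarrow> real) \<Rightarrow> real \<Rightarrow> real"
  where "smin V s = Inf (V ` {x. x \<noteq> 0 \<and> sl x = s})"

lemma smax_smin:
  fixes V :: "'a::euclidean_space \<Rightarrow> real"
  assumes "continuous_on {x. x \<noteq> 0 \<and> sl x = s} V"
  shows "\<exists>x. x \<noteq> 0 \<and> sl x = s \<and> V x = smax V s" "x \<noteq> 0 \<Longrightarrow> sl x = s \<Longrightarrow> V x \<le> smax V s"
    "\<exists>x. x \<noteq> 0 \<and> sl x = s \<and> V x = smin V s" "x \<noteq> 0 \<Longrightarrow> sl x = s \<Longrightarrow> smin V s \<le> V x"
proof -
  let ?K = "{x::'a. x \<noteq> 0 \<and> sl x = s}"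
  have "?K = {x::'a. x \<noteq> 0 \<and> s \<le> sl x \<and> sl x \<le> s}" by auto
  then have K: "compact ?K" using compact_annulus[of s s, where 'a='a] by simp
  have ne: "?K \<noteq> {}" using sl_ex[of s, where 'a='a] by blast
  obtain y where y: "y \<in> ?K" "\<And>x. x \<in> ?K \<Longrightarrow> V x \<le> V y"
    using continuous_attains_sup[OF K ne assms] by blast
  have "Sup (V ` ?K) = V y" by (rule cSup_eq_maximum) (use y in auto)
  then have "smax V s = V y" unfolding smax_def .
  then show "\<exists>x. x \<noteq> 0 \<and> sl x = s \<and> V x = smax V s" "x \<noteq> 0 \<Longrightarrow> sl x = s \<Longrightarrow> V x \<le> smax V s"
    using y by auto
  obtain z where z: "z \<in> ?K" "\<And>x. x \<in> ?K \<Longrightarrow> V z \<le> V x"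
    using continuous_attains_inf[OF K ne assms] by blast
  have "Inf (V ` ?K) = V z" by (rule cInf_eq_minimum) (use z in auto)
  then have "smin V s = V z" unfolding smin_def .
  then show "\<exists>x. x \<noteq> 0 \<and> sl x = s \<and> V x = smin V s" "x \<noteq> 0 \<Longrightarrow> sl x = s \<Longrightarrow> smin V s \<le> V x"
    using z by auto
qed

section \<open>A growth lemma and the Harnack inequality\<close>

text \<open>\<open>pole x1\<close> behaves like a squared distance to \<open>x1\<close> in the coordinates \<open>(x / |x|, sl x)\<close>. On
  \<open>0 < pole x1 \<le> 3\<close> the function \<open>(pole x1) powr (- g) - 3 powr (- g)\<close> is, for large \<open>g\<close>, a strict subsolution to which positive
  supersolutions can be compared.\<close>

definition pole :: "'a::euclidean_space \<Rightarrow> 'a \<Rightarrow> real"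
  where "pole x1 x = 1 - (x \<bullet> x1) / (norm x * norm x1) + (sl x - sl x1)\<^sup>2 / 4"

text \<open>Let \<open>t\<close> be the cosine of the angle to \<open>x1\<close> and
  \<open>\<sigma> = sl x - sl x1\<close>. The operator |x|^2 Laplacian minus (N - 2) times the
  radial derivative \<open>x \<bullet> P x\<close> is the Laplacian of the cylinder in the
  coordinates \<open>(x / |x|, sl x)\<close>; it maps \<open>1 - t\<close> to
  \<open>(N - 1) t\<close> and \<open>\<sigma>\<^sup>2 / 4\<close> to 1/2.\<close>

lemma wlap_pole:
  fixes x1 :: "'a::euclidean_space"
  assumes x1: "x1 \<noteq> 0"
  shows "\<exists>P p. wlap (- {0}) (pole x1) P p \<and> (\<forall>x. x \<noteq> 0 \<longrightarrow>
    (norm x * norm (P x))\<^sup>2 = 1 - ((x \<bullet> x1) / (norm x * norm x1))\<^sup>2 + (sl x - sl x1)\<^sup>2 / 4 \<and>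
    (norm x)\<^sup>2 * p x - (real DIM('a) - 2) * (x \<bullet> P x) = (real DIM('a) - 1) * ((x \<bullet> x1) / (norm x * norm x1)) + 1 / 2)"
proof -
  define e where "e = x1 /\<^sub>R norm x1"
  have e1: "e \<bullet> e = 1" using x1 by (simp add: e_def power2_norm_eq_inner[symmetric] power2_eq_square)
  let ?S = "- {0::'a}"
  let ?N = "real DIM('a)"
  have o: "open ?S" by (simp add: open_Compl)
  have s: "wlap ?S sl (\<lambda>x. (- inverse ((norm x)\<^sup>2)) *\<^sub>R x) (\<lambda>x. (2 - ?N) / (norm x)\<^sup>2)"
    by (rule wlap_sl) auto
  have E: "wlap ?S (\<lambda>x. exp (sl x)) (\<lambda>x. exp (sl x) *\<^sub>R ((- inverse ((norm x)\<^sup>2)) *\<^sub>R x))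
    (\<lambda>x. exp (sl x) * (norm ((- inverse ((norm x)\<^sup>2)) *\<^sub>R x))\<^sup>2 + exp (sl x) * ((2 - ?N) / (norm x)\<^sup>2))"
    by (rule wlap_compose[OF s]) (auto intro!: derivative_eq_intros continuous_intros)
  have E': "wlap ?S (\<lambda>x. inverse (norm x)) (\<lambda>x. (- inverse (norm x ^ 3)) *\<^sub>R x) (\<lambda>x. (3 - ?N) * inverse (norm x ^ 3))"
  proof (rule wlap_cong[OF E])
    fix x :: 'a assume "x \<in> ?S"
    then have n: "norm x > 0" by simp
    show ex: "exp (sl x) = inverse (norm x)" using n by (simp add: sl_def exp_minus)
    have i3: "inverse (norm x ^ 3) = inverse (norm x) * inverse ((norm x)\<^sup>2)"
      by (simp add: power3_eq_cube power2_eq_square)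
    show "exp (sl x) *\<^sub>R ((- inverse ((norm x)\<^sup>2)) *\<^sub>R x) = (- inverse (norm x ^ 3)) *\<^sub>R x"
      unfolding ex i3 by simp
    show "exp (sl x) * (norm ((- inverse ((norm x)\<^sup>2)) *\<^sub>R x))\<^sup>2 + exp (sl x) * ((2 - ?N) / (norm x)\<^sup>2)
      = (3 - ?N) * inverse (norm x ^ 3)"
    proof -
      have "(norm ((- inverse ((norm x)\<^sup>2)) *\<^sub>R x))\<^sup>2 = inverse ((norm x)\<^sup>2)"
        using n by (simp add: power_mult_distrib) (simp add: power2_eq_square field_simps)
      then show ?thesis unfolding ex i3 by (simp add: divide_inverse algebra_simps)
    qed
  qed
  have t: "wlap ?S (\<lambda>x. (x \<bullet> e) * inverse (norm x)) (\<lambda>x. (x \<bullet> e) *\<^sub>R ((- inverse (norm x ^ 3)) *\<^sub>R x) + inverse (norm x) *\<^sub>R e)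
     (\<lambda>x. (x \<bullet> e) * ((3 - ?N) * inverse (norm x ^ 3)) + inverse (norm x) * 0 + 2 * (e \<bullet> ((- inverse (norm x ^ 3)) *\<^sub>R x)))"
    by (rule wlap_mult[OF wlap_linear[OF o] E'])
  have r: "wlap ?S (\<lambda>x. (sl x - sl x1)\<^sup>2 / 4) (\<lambda>x. ((sl x - sl x1) / 2) *\<^sub>R ((- inverse ((norm x)\<^sup>2)) *\<^sub>R x))
    (\<lambda>x. (1 / 2) * (norm ((- inverse ((norm x)\<^sup>2)) *\<^sub>R x))\<^sup>2 + ((sl x - sl x1) / 2) * ((2 - ?N) / (norm x)\<^sup>2))"
    by (rule wlap_compose[OF s]) (auto intro!: derivative_eq_intros continuous_intros)
  define P where "P = (\<lambda>x::'a. 0 - ((x \<bullet> e) *\<^sub>R ((- inverse (norm x ^ 3)) *\<^sub>R x) + inverse (norm x) *\<^sub>R e)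
     + ((sl x - sl x1) / 2) *\<^sub>R ((- inverse ((norm x)\<^sup>2)) *\<^sub>R x))"
  define p where "p = (\<lambda>x::'a. 0 - ((x \<bullet> e) * ((3 - ?N) * inverse (norm x ^ 3)) + inverse (norm x) * 0 + 2 * (e \<bullet> ((- inverse (norm x ^ 3)) *\<^sub>R x)))
     + ((1 / 2) * (norm ((- inverse ((norm x)\<^sup>2)) *\<^sub>R x))\<^sup>2 + ((sl x - sl x1) / 2) * ((2 - ?N) / (norm x)\<^sup>2)))"
  have "wlap ?S (\<lambda>x. 1 - (x \<bullet> e) * inverse (norm x) + (sl x - sl x1)\<^sup>2 / 4) P p"
    unfolding P_def p_def by (rule wlap_add[OF wlap_diff[OF wlap_const[OF o] t] r])
  then have "wlap ?S (pole x1) P p"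
    by (rule wlap_cong) (simp_all only: pole_def e_def divide_inverse inverse_mult_distrib inner_scaleR_right mult_ac)
  moreover have "(norm x * norm (P x))\<^sup>2 = 1 - ((x \<bullet> x1) / (norm x * norm x1))\<^sup>2 + (sl x - sl x1)\<^sup>2 / 4"
    "(norm x)\<^sup>2 * p x - (?N - 2) * (x \<bullet> P x) = (?N - 1) * ((x \<bullet> x1) / (norm x * norm x1)) + 1 / 2"
    if x: "x \<noteq> 0" for x
  proof -
    define n l g where "n = norm x" and "l = x \<bullet> e" and "g = (sl x - sl x1) / 2"
    have n: "n > 0" using x by (simp add: n_def)
    have xx: "x \<bullet> x = n\<^sup>2" by (simp add: n_def power2_norm_eq_inner)
    have tl: "(x \<bullet> x1) / (norm x * norm x1) = l / n" by (simp add: l_def n_def e_def divide_inverse mult_ac)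
    have Pe: "P x = (l / n ^ 3 - g / n\<^sup>2) *\<^sub>R x - (1 / n) *\<^sub>R e"
      unfolding P_def n_def[symmetric] l_def[symmetric] g_def[symmetric]
      by (simp add: divide_inverse algebra_simps)
    have "P x \<bullet> P x = (l / n ^ 3 - g / n\<^sup>2)\<^sup>2 * n\<^sup>2 - 2 * (l / n ^ 3 - g / n\<^sup>2) * (1 / n) * l + (1 / n)\<^sup>2"
    proof -
      have "(A *\<^sub>R x - B *\<^sub>R e) \<bullet> (A *\<^sub>R x - B *\<^sub>R e) = A\<^sup>2 * (x \<bullet> x) - 2 * A * B * (x \<bullet> e) + B\<^sup>2 * (e \<bullet> e)" for A B
        by (simp add: inner_diff_left inner_diff_right inner_commute[of e x] power2_eq_square algebra_simps)
      then show ?thesis unfolding Pe xx e1 l_def by simp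
    qed
    then have "(n * norm (P x))\<^sup>2 = n\<^sup>2 * ((l / n ^ 3 - g / n\<^sup>2)\<^sup>2 * n\<^sup>2 - 2 * (l / n ^ 3 - g / n\<^sup>2) * (1 / n) * l + (1 / n)\<^sup>2)"
      by (simp add: power_mult_distrib power2_norm_eq_inner)
    also have "\<dots> = 1 - (l / n)\<^sup>2 + g\<^sup>2" using n by (simp add: field_simps) algebra
    finally show "(norm x * norm (P x))\<^sup>2 = 1 - ((x \<bullet> x1) / (norm x * norm x1))\<^sup>2 + (sl x - sl x1)\<^sup>2 / 4"
      unfolding tl by (simp add: n_def[symmetric] g_def power_divide)
    have "x \<bullet> P x = - g"
    proof -
      have "x \<bullet> P x = l / n ^ 3 * n\<^sup>2 - g / n\<^sup>2 * n\<^sup>2 - l / n"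
        unfolding Pe by (simp add: inner_diff_right xx l_def[symmetric] algebra_simps)
      moreover have "l / n ^ 3 * n\<^sup>2 = l / n" using n by (simp add: power3_eq_cube power2_eq_square)
      ultimately show ?thesis using n by simp
    qed
    moreover have "p x = - (l * ((3 - ?N) / n ^ 3) - 2 * l / n ^ 3) + (1 / 2 * (1 / n\<^sup>2) + g * ((2 - ?N) / n\<^sup>2))"
    proof -
      have 1: "(norm ((- inverse (n\<^sup>2)) *\<^sub>R x))\<^sup>2 = 1 / n\<^sup>2"
        using n by (simp add: power_mult_distrib n_def[symmetric]) (simp add: power2_eq_square field_simps)
      have 2: "e \<bullet> ((- inverse (n ^ 3)) *\<^sub>R x) = - (l / n ^ 3)"
        unfolding l_def inner_commute[of x e] by (simp add: divide_inverse mult.commute)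
      show ?thesis
        unfolding p_def n_def[symmetric] l_def[symmetric] g_def[symmetric] 1 2
        by (simp only: divide_inverse)
    qed
    ultimately have "n\<^sup>2 * p x - (?N - 2) * (x \<bullet> P x) = n\<^sup>2 * (- (l * ((3 - ?N) / n ^ 3) - 2 * l / n ^ 3) + (1 / 2 * (1 / n\<^sup>2) + g * ((2 - ?N) / n\<^sup>2))) + (?N - 2) * g"
      by simp
    also have "\<dots> = (?N - 1) * (l / n) + 1 / 2" using n by (simp add: field_simps power3_eq_cube power2_eq_square)
    finally show "(norm x)\<^sup>2 * p x - (?N - 2) * (x \<bullet> P x) = (?N - 1) * ((x \<bullet> x1) / (norm x * norm x1)) + 1 / 2"
      unfolding tl n_def .
  qed
  ultimately show ?thesis by blast
qed

text \<open>Used with \<open>n = N - 1\<close>. The summand \<open>4 * n + 3\<close> and a share of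
  \<open>100 * C\<close> serve the region where the gradient of \<open>pole\<close> is large
  compared with \<open>pole\<close>; \<open>100 * C\<close> and \<open>18 * C\<^sup>2\<close> serve
  the neighbourhood of the antipode.\<close>

definition growth_exp :: "real \<Rightarrow> real \<Rightarrow> real"
  where "growth_exp n C = 4 * n + 3 + 100 * C + 18 * C\<^sup>2"

lemma growth_exp_ge: "n \<ge> 1 \<Longrightarrow> C \<ge> 0 \<Longrightarrow> growth_exp n C \<ge> 7"
  using zero_le_power2[of C] unfolding growth_exp_def by linarith

text \<open>\<open>G\<close>, \<open>Q\<close> and \<open>n * t + 1 / 2\<close> are the values of
  \<open>pole\<close>, of its squared scaled gradient and of its cylinder Laplacian. For
  \<open>t \<ge> - 3 / 4\<close> one has \<open>Q \<ge> G / 4\<close>, so a large exponent wins.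
  Near the antipode \<open>Q\<close> may vanish, but there \<open>n * t + 1 / 2\<close> is negative
  and \<open>G\<close> is bounded below, so the Laplacian term has the good sign.\<close>

lemma growth_exp_ineq:
  fixes n t \<sigma> C :: real
  assumes n: "n \<ge> 1" and t: "\<bar>t\<bar> \<le> 1" and C: "C \<ge> 0"
    and G: "G = 1 - t + \<sigma>\<^sup>2 / 4" "0 < G" "G \<le> 3" and Q: "Q = 1 - t\<^sup>2 + \<sigma>\<^sup>2 / 4" and g: "g = growth_exp n C"
  shows "(g + 1) * Q - G * (n * t + 1 / 2) > C * (G * sqrt Q + G\<^sup>2 / g)"
proof -
  have g1: "g \<ge> 7" using n C growth_exp_ge by (simp add: g)
  have t2: "t\<^sup>2 \<le> 1" using t abs_square_le_1 by blast
  have Q0: "Q \<ge> 0" using t2 Q by simp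
  have Gg: "G\<^sup>2 / g \<le> 3 * G / g"
  proof (intro divide_right_mono)
    show "G\<^sup>2 \<le> 3 * G" unfolding power2_eq_square by (rule mult_right_mono) (use G(2,3) in linarith)+
  qed (use g1 in simp)
  show ?thesis
  proof (cases "t \<ge> - 3 / 4")
    case True
    have QG: "Q \<ge> G / 4"
    proof -
      have "Q = (1 - t) * (1 + t) + \<sigma>\<^sup>2 / 4" unfolding Q by (simp add: power2_eq_square algebra_simps)
      moreover have "(1 - t) * (1 + t) \<ge> (1 - t) * (1 / 4)" using True t by (intro mult_left_mono) auto
      moreover have "\<sigma>\<^sup>2 / 4 / 4 \<le> \<sigma>\<^sup>2 / 4" by simp
      moreover have "(1 - t + \<sigma>\<^sup>2 / 4) / 4 = (1 - t) * (1 / 4) + \<sigma>\<^sup>2 / 4 / 4" by (simp add: field_simps)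
      ultimately show ?thesis unfolding G by linarith
    qed
    have "\<sigma>\<^sup>2 / 4 \<le> 3" using G t by auto
    moreover have "0 \<le> t\<^sup>2" "(2::real)\<^sup>2 = 4" by simp_all
    ultimately have "Q \<le> 2\<^sup>2" unfolding Q by linarith
    then have sQ: "sqrt Q \<le> 2" by (simp add: real_le_lsqrt)
    have "C * (G * sqrt Q + G\<^sup>2 / g) \<le> C * (G * 2 + 3 * G)"
    proof (intro mult_left_mono add_mono C)
      have "3 * G / g \<le> 3 * G / 1" using G g1 by (intro divide_left_mono) auto
      then show "G\<^sup>2 / g \<le> 3 * G" using Gg by simp
    qed (use G sQ in auto)
    moreover have "G * (n * t + 1 / 2) \<le> G * (n + 1 / 2)"
    proof -
      have "n * t \<le> n * 1" using t n by (intro mult_left_mono) auto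
      then show ?thesis using G by (intro mult_left_mono) auto
    qed
    moreover have "(g + 1) * Q \<ge> (g + 1) * (G / 4)" using QG g1 by (intro mult_left_mono) auto
    moreover have "(g + 1) * (G / 4) > C * (G * 2 + 3 * G) + G * (n + 1 / 2)"
    proof -
      have "(g + 1) / 4 > 5 * C + (n + 1 / 2)"
        unfolding g growth_exp_def using C by (simp add: field_simps) (use zero_le_power2[of C] in linarith)
      then have "G * ((g + 1) / 4) > G * (5 * C + (n + 1 / 2))" using G by (intro mult_strict_left_mono) auto
      then show ?thesis by (simp add: algebra_simps)
    qed
    ultimately show ?thesis by linarith
  next
    case False
    have "n * t \<le> 1 * t" using False n by (intro mult_right_mono_neg) auto
    then have a: "n * t + 1 / 2 \<le> - (1 / 4)" using False by linarith
    have G74: "G \<ge> 7 / 4" 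
    proof -
      have "\<sigma>\<^sup>2 / 4 \<ge> 0" by simp
      then show ?thesis using False unfolding G(1) by linarith
    qed
    have "G * (n * t + 1 / 2) \<le> G * (- (1 / 4))" using a G by (intro mult_left_mono) auto
    then have 1: "- (G * (n * t + 1 / 2)) \<ge> 7 / 16" using G74 by simp
    define r where "r = sqrt Q"
    have r: "r \<ge> 0" "r\<^sup>2 = Q" using Q0 by (auto simp: r_def)
    have "C * (G * r) \<le> C * (3 * r)" using C G r by (intro mult_left_mono mult_right_mono) auto
    \<comment> \<open>Completing the square, with \<open>18 * C\<^sup>2 \<le> g\<close>.\<close>
    moreover have "3 * C * r \<le> g * Q + 1 / 8"
    proof (cases "C = 0")
      case True then show ?thesis using Q0 g1 by simp
    next
      case False
      have "18 * C\<^sup>2 * Q \<le> g * Q" using n C Q0 by (intro mult_right_mono) (auto simp: g growth_exp_def)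
      moreover have "0 \<le> 2 * (3 * C * r - 1 / 4)\<^sup>2" by simp
      then have "3 * C * r \<le> 18 * C\<^sup>2 * Q + 1 / 8" unfolding r(2)[symmetric] by (simp add: power2_eq_square algebra_simps)
      ultimately show ?thesis by linarith
    qed
    moreover have "C * (G\<^sup>2 / g) \<le> 9 / 100"
    proof -
      have "G\<^sup>2 \<le> 3\<^sup>2" using G by (intro power_mono) auto
      then have "C * (G\<^sup>2 / g) \<le> C * (9 / g)" using C g1 by (intro mult_left_mono divide_right_mono) auto
      also have "\<dots> \<le> 9 / 100"
      proof -
        have "100 * C \<le> g" using n C by (simp add: g growth_exp_def)
        then show ?thesis using g1 by (simp add: field_simps)
      qed
      finally show ?thesis .
    qed
    moreover have "(g + 1) * Q = g * Q + Q" by (simp add: algebra_simps)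
    ultimately show ?thesis using 1 Q0 unfolding r_def by (simp add: distrib_left)
  qed
qed

lemma pole_cos: "\<bar>(x \<bullet> x1) / (norm x * norm x1)\<bar> \<le> 1"
  using Cauchy_Schwarz_ineq2[of x x1] by (cases "norm x * norm x1 = 0") (auto simp: abs_mult divide_le_eq_1)

lemma pole_sl: "pole x1 x \<le> 3 \<Longrightarrow> \<bar>sl x - sl x1\<bar> \<le> 4"
proof -
  assume "pole x1 x \<le> 3"
  then have "(sl x - sl x1)\<^sup>2 \<le> 4\<^sup>2" using pole_cos[of x x1] unfolding pole_def abs_le_iff by simp
  then show ?thesis by (metis abs_le_square_iff abs_numeral)
qed

text \<open>Minimum principle for \<open>Y - c * h\<close> between the level
  \<open>pole x1 x = \<delta>\<close> and the level 3, where \<open>h\<close> vanishes. At a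
  negative interior minimum the gradient of \<open>Y\<close> is that of the barrier;
  \<open>small\<close> makes its quadratic contribution at most the linear one, and \<open>Y\<close>
  lies below the barrier itself. Both effects are paid for by the \<open>2 * C\<close> in the
  exponent \<open>g\<close>.\<close>

lemma hopf_growth:
  fixes Y :: "'a::euclidean_space \<Rightarrow> real"
  assumes dim: "DIM('a) \<ge> 2" and x1: "x1 \<noteq> 0" and C: "C \<ge> 0" and \<kappa>: "\<kappa> \<ge> 0"
    and g: "g = growth_exp (real DIM('a) - 1) (2 * C)"
    and Y: "wlap S Y GY gY" and S: "\<And>x. x \<noteq> 0 \<Longrightarrow> pole x1 x \<le> 3 \<Longrightarrow> x \<in> S"
    and Y0: "\<And>x. x \<noteq> 0 \<Longrightarrow> pole x1 x \<le> 3 \<Longrightarrow> Y x \<ge> 0"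
    and ineq: "\<And>x. x \<noteq> 0 \<Longrightarrow> pole x1 x \<le> 3 \<Longrightarrow> (norm x)\<^sup>2 * gY x - (real DIM('a) - 2) * (x \<bullet> GY x)
      \<le> C * (norm x * norm (GY x) + \<kappa> * (norm x * norm (GY x))\<^sup>2 + Y x)"
    and \<delta>: "0 < \<delta>" "\<delta> \<le> 1" and c: "c \<ge> 0"
    and near: "\<And>x. x \<noteq> 0 \<Longrightarrow> pole x1 x = \<delta> \<Longrightarrow> Y x \<ge> c * \<delta> powr (- g)"
    and small: "2 * \<kappa> * c * g * \<delta> powr (- g - 1) \<le> 1"
    and x: "x \<noteq> 0" "\<delta> \<le> pole x1 x" "pole x1 x \<le> 3"
  shows "Y x \<ge> c * (pole x1 x powr (- g) - 3 powr (- g))"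
proof -
  let ?N = "real DIM('a)"
  obtain P p where P: "wlap (- {0}) (pole x1) P p"
    and P1: "\<And>x. x \<noteq> 0 \<Longrightarrow> (norm x * norm (P x))\<^sup>2 = 1 - ((x \<bullet> x1) / (norm x * norm x1))\<^sup>2 + (sl x - sl x1)\<^sup>2 / 4"
    and P2: "\<And>x. x \<noteq> 0 \<Longrightarrow> (norm x)\<^sup>2 * p x - (?N - 2) * (x \<bullet> P x) = (?N - 1) * ((x \<bullet> x1) / (norm x * norm x1)) + 1 / 2"
    using wlap_pole[OF x1] by blast
  have g1: "g \<ge> 7" using dim C unfolding g by (intro growth_exp_ge) auto
  define h where "h = (\<lambda>x. pole x1 x powr (- g) - 3 powr (- g))"
  let ?K = "{x. x \<noteq> 0 \<and> \<delta> \<le> pole x1 x \<and> pole x1 x \<le> 3}"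
  let ?A = "{x::'a. x \<noteq> 0 \<and> sl x1 - 4 \<le> sl x \<and> sl x \<le> sl x1 + 4}"
  have K: "compact ?K"
  proof -
    have "closedin (top_of_set ?A) {x\<in>?A. pole x1 x \<in> {\<delta>..3}}"
      by (intro continuous_closedin_preimage_gen[where T = UNIV, simplified, unfolded vimage_def Int_def mem_Collect_eq]
          continuous_closedin_preimage) (auto intro: continuous_on_subset[OF wlapD(5)[OF P]])
    then have "compact {x\<in>?A. pole x1 x \<in> {\<delta>..3}}"
      using compact_annulus closedin_compact by blast
    moreover have "{x\<in>?A. pole x1 x \<in> {\<delta>..3}} = ?K" using pole_sl[of x1] by (auto simp: abs_le_iff; smt (verit))
    ultimately show ?thesis by simp
  qed
  have cK: "continuous_on ?K (\<lambda>x. Y x - c * h x)"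
    unfolding h_def
    by (intro continuous_intros continuous_on_subset[OF wlapD(5)[OF Y]] continuous_on_subset[OF wlapD(5)[OF P]])
      (use S \<delta> in auto)
  have "?K \<noteq> {}" using x by blast
  then have "\<exists>x0\<in>?K. \<forall>y\<in>?K. Y x0 - c * h x0 \<le> Y y - c * h y"
    by (intro continuous_attains_inf K cK)
  then obtain x0 where x0: "x0 \<noteq> 0" "\<delta> \<le> pole x1 x0" "pole x1 x0 \<le> 3"
    and min: "\<And>y. y \<in> ?K \<Longrightarrow> Y x0 - c * h x0 \<le> Y y - c * h y" by blast
  have "Y x0 \<ge> c * h x0"
  proof (rule ccontr)
    assume neg: "\<not> Y x0 \<ge> c * h x0"
    have c0: "c > 0" using neg Y0[OF x0(1,3)] c by (cases "c = 0") auto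
    have d1: "pole x1 x0 \<noteq> \<delta>"
    proof
      assume e: "pole x1 x0 = \<delta>"
      have "c * h x0 \<le> c * \<delta> powr (- g)" using c by (intro mult_left_mono) (auto simp: h_def e)
      then show False using near[OF x0(1) e] neg by simp
    qed
    have d2: "pole x1 x0 \<noteq> 3" using neg Y0[OF x0(1,3)] by (auto simp: h_def)
    let ?T = "{x \<in> - {0}. pole x1 x \<in> {\<delta><..<3}}"
    have oT: "open ?T"
    proof -
      have "open (pole x1 -` {\<delta><..<3} \<inter> - {0})"
        using continuous_on_open_vimage[of "- {0}" "pole x1"] wlapD(5)[OF P] by (simp add: open_Compl)
      moreover have "pole x1 -` {\<delta><..<3} \<inter> - {0} = ?T" by auto
      ultimately show ?thesis by simp
    qed
    have x0T: "x0 \<in> ?T" using x0 d1 d2 by auto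
    have hP: "wlap ?T (\<lambda>x. pole x1 x powr (- g)) (\<lambda>x. (- g * pole x1 x powr (- g - 1)) *\<^sub>R P x)
      (\<lambda>x. (g * (g + 1) * pole x1 x powr (- g - 2)) * (norm (P x))\<^sup>2 + (- g * pole x1 x powr (- g - 1)) * p x)"
    proof (rule wlap_compose[OF wlap_subset[OF P _ oT]])
      fix x assume "x \<in> ?T"
      then have p: "pole x1 x > 0" using \<delta> by auto
      show "((\<lambda>z. z powr (- g)) has_real_derivative - g * pole x1 x powr (- g - 1)) (at (pole x1 x))"
        using p by (auto intro!: derivative_eq_intros)
      show "((\<lambda>z. - g * z powr (- g - 1)) has_real_derivative g * (g + 1) * pole x1 x powr (- g - 2)) (at (pole x1 x))"
        using p by (auto intro!: derivative_eq_intros simp: algebra_simps)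
    next
      show "continuous_on (pole x1 ` ?T) (\<lambda>z. g * (g + 1) * z powr (- g - 2))"
        using \<delta> by (intro continuous_intros) auto
    qed auto
    have "wlap ?T (\<lambda>x. Y x - c * (pole x1 x powr (- g))) (\<lambda>x. GY x - c *\<^sub>R ((- g * pole x1 x powr (- g - 1)) *\<^sub>R P x))
      (\<lambda>x. gY x - c * ((g * (g + 1) * pole x1 x powr (- g - 2)) * (norm (P x))\<^sup>2 + (- g * pole x1 x powr (- g - 1)) * p x))"
      using S by (intro wlap_diff wlap_cmult hP wlap_subset[OF Y _ oT]) auto
    note lm = wlap_local_min[OF this x0T]
    have lmin: "Y x0 - c * (pole x1 x0 powr (- g)) \<le> Y y - c * (pole x1 y powr (- g))" if "y \<in> ?T" for y
      using min[of y] that by (auto simp: h_def algebra_simps)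
    define G Q t where "G = pole x1 x0" and "Q = (norm x0 * norm (P x0))\<^sup>2" and "t = (x0 \<bullet> x1) / (norm x0 * norm x1)"
    have G0: "\<delta> \<le> G" "0 < G" "G \<le> 3" using x0 \<delta> by (auto simp: G_def)
    have GY: "GY x0 = (- c * g * G powr (- g - 1)) *\<^sub>R P x0"
      using lm(1) lmin by (auto simp: G_def eq_neg_iff_add_eq_0 mult.assoc)
    have gY: "gY x0 \<ge> c * ((g * (g + 1) * G powr (- g - 2)) * (norm (P x0))\<^sup>2 + (- g * G powr (- g - 1)) * p x0)"
      using lm(2) lmin by (auto simp: G_def)
    have sQ: "sqrt Q = norm x0 * norm (P x0)" by (simp add: Q_def)
    define a where "a = c * (g * G powr (- g - 1) * sqrt Q)"
    have na: "norm x0 * norm (GY x0) = a"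
      unfolding GY a_def sQ using c0 g1 by (simp add: abs_mult)
    have Q4: "Q \<le> 4" and Qe: "Q = 1 - t\<^sup>2 + (sl x0 - sl x1)\<^sup>2 / 4"
    proof -
      show Qe: "Q = 1 - t\<^sup>2 + (sl x0 - sl x1)\<^sup>2 / 4" using P1[OF x0(1)] by (simp add: Q_def t_def)
      have "(sl x0 - sl x1)\<^sup>2 / 4 \<le> 3" using x0(3) pole_cos[of x0 x1] unfolding pole_def abs_le_iff by simp
      then show "Q \<le> 4" using zero_le_power2[of t] unfolding Qe by linarith
    qed
    have key: "(g + 1) * Q - G * ((?N - 1) * t + 1 / 2) > (2 * C) * (G * sqrt Q + G\<^sup>2 / g)"
      by (rule growth_exp_ineq[where \<sigma> = "sl x0 - sl x1"])
        (use dim C G0 Qe pole_cos[of x0 x1] g in \<open>auto simp: t_def G_def pole_def\<close>)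
    have pw: "G powr (- g - 1) = G powr (- g - 2) * G" "G powr (- g) = G powr (- g - 2) * G\<^sup>2"
    proof -
      have e: "- g - 1 = (- g - 2) + 1" "- g = (- g - 2) + 2" by simp_all
      show "G powr (- g - 1) = G powr (- g - 2) * G" by (subst e(1), subst powr_add) (use G0 in simp)
      show "G powr (- g) = G powr (- g - 2) * G\<^sup>2" by (subst e(2), subst powr_add) (use G0 in simp)
    qed
    have "c * g * G powr (- g - 2) * ((g + 1) * Q - G * ((?N - 1) * t + 1 / 2))
      > c * g * G powr (- g - 2) * ((2 * C) * (G * sqrt Q + G\<^sup>2 / g))"
      using key c0 g1 G0 by (intro mult_strict_left_mono mult_pos_pos) auto
    also have "c * g * G powr (- g - 2) * ((2 * C) * (G * sqrt Q + G\<^sup>2 / g)) = C * (2 * a + 2 * c * G powr (- g))"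
      unfolding a_def pw using g1 by (simp add: field_simps)
    finally have low: "C * (2 * a + 2 * c * G powr (- g)) < c * g * G powr (- g - 2) * ((g + 1) * Q - G * ((?N - 1) * t + 1 / 2))" .
    have "c * g * G powr (- g - 2) * ((g + 1) * Q - G * ((?N - 1) * t + 1 / 2))
      = (norm x0)\<^sup>2 * (c * ((g * (g + 1) * G powr (- g - 2)) * (norm (P x0))\<^sup>2 + (- g * G powr (- g - 1)) * p x0))
        - (?N - 2) * (x0 \<bullet> GY x0)"
      using P2[OF x0(1)] unfolding t_def[symmetric] GY pw Q_def
      by (simp add: power_mult_distrib) algebra
    also have "\<dots> \<le> (norm x0)\<^sup>2 * gY x0 - (?N - 2) * (x0 \<bullet> GY x0)"
      using gY by (intro diff_right_mono mult_left_mono) auto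
    also have "\<dots> \<le> C * (a + \<kappa> * a\<^sup>2 + Y x0)" using ineq[OF x0(1,3)] unfolding na .
    also have "\<dots> \<le> C * (2 * a + 2 * c * G powr (- g))"
    proof (intro mult_left_mono C)
      have a0: "a \<ge> 0" unfolding a_def using c0 g1 by (auto simp: Q_def)
      \<comment> \<open>\<open>a\<close> is the scaled gradient of the barrier. Its power of
        \<open>G\<close> is largest at \<open>G = \<delta>\<close>, and
        \<open>sqrt Q \<le> 2\<close> accounts for the factor 2 in \<open>small\<close>.\<close>
      have "\<kappa> * a \<le> 1"
      proof -
        have "sqrt Q \<le> sqrt 4" using Q4 by (intro real_sqrt_le_mono)
        moreover have "G powr (- g - 1) \<le> \<delta> powr (- g - 1)" using G0 \<delta> g1 by (intro powr_mono2') auto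
        ultimately have "\<kappa> * a \<le> \<kappa> * (c * (g * \<delta> powr (- g - 1) * 2))"
          unfolding a_def using \<kappa> c0 g1 by (intro mult_left_mono mult_mono) (auto simp: Q_def)
        then show ?thesis using small by (simp add: mult_ac)
      qed
      then have "\<kappa> * a * a \<le> 1 * a" using a0 by (intro mult_right_mono) auto
      moreover have "Y x0 \<le> c * G powr (- g)"
      proof -
        have "c * h x0 \<le> c * G powr (- g)" using c by (intro mult_left_mono) (auto simp: h_def G_def)
        then show ?thesis using neg by simp
      qed
      moreover have "c * G powr (- g) \<ge> 0" using c by simp
      ultimately show "a + \<kappa> * a\<^sup>2 + Y x0 \<le> 2 * a + 2 * c * G powr (- g)" by (simp add: power2_eq_square mult.assoc)
    qed
    finally show False using low by simp
  qed
  then show ?thesis using min[of x] x by (auto simp: h_def)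
qed

text \<open>The factor \<open>2 + 4 * grad_const t * A\<close> is the reciprocal of the relative
  radius in \<open>wlap_gradient_absorb\<close>, chosen so that the gradient returns on the
  right-hand side with coefficient 1/2 only.\<close>

definition absorb_const :: "'a::euclidean_space itself \<Rightarrow> real \<Rightarrow> real" where
  "absorb_const t A = 2 * (grad_const t * (2 + 4 * grad_const t * A) + 1)"

lemma absorb_const_pos: "A \<ge> 0 \<Longrightarrow> absorb_const TYPE('a::euclidean_space) A > 0"
  unfolding absorb_const_def using grad_const_nonneg[where 'a='a]
  by (intro mult_pos_pos add_nonneg_pos mult_nonneg_nonneg) auto

text \<open>The gradient on the right-hand side is absorbed by maximizing \<open>(R - |x - x0|) |G x|\<close>.\<close>

lemma wlap_gradient_absorb:
  fixes v :: "'a::euclidean_space \<Rightarrow> real"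
  assumes w: "wlap S v G g" and R: "R > 0" "cball x0 R \<subseteq> S" and A: "A \<ge> 0"
    and M: "\<And>x. x \<in> cball x0 R \<Longrightarrow> \<bar>v x\<bar> \<le> M"
    and g: "\<And>x. x \<in> cball x0 R \<Longrightarrow> \<bar>g x\<bar> \<le> A * (norm (G x) / R + M / R\<^sup>2)"
  shows "norm (G x0) \<le> absorb_const TYPE('a) A * M / R"
proof -
  define C1 where "C1 = grad_const TYPE('a)"
  have C1: "C1 \<ge> 0" unfolding C1_def by (rule grad_const_nonneg)
  define \<epsilon> where "\<epsilon> = 1 / (2 + 4 * C1 * A)"
  have CA: "C1 * A \<ge> 0" using C1 A by simp
  have \<epsilon>: "\<epsilon> > 0" "\<epsilon> \<le> 1 / 2" "C1 * \<epsilon> * A \<le> 1 / 4" "1 / \<epsilon> = 2 + 4 * C1 * A"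
    using CA by (auto simp: \<epsilon>_def field_simps)
  have M0: "M \<ge> 0" using M[of x0] R by (simp add: order_trans[OF abs_ge_zero])
  have "continuous_on (cball x0 R) (\<lambda>x. (R - dist x0 x) * norm (G x))"
    by (intro continuous_intros continuous_on_subset[OF wlapD(3)[OF w] R(2)])
  moreover have "cball x0 R \<noteq> {}" using R by auto
  ultimately have "\<exists>x1\<in>cball x0 R. \<forall>y\<in>cball x0 R. (R - dist x0 y) * norm (G y) \<le> (R - dist x0 x1) * norm (G x1)"
    by (intro continuous_attains_sup compact_cball)
  then obtain x1 where x1: "x1 \<in> cball x0 R"
    and max: "\<And>y. y \<in> cball x0 R \<Longrightarrow> (R - dist x0 y) * norm (G y) \<le> (R - dist x0 x1) * norm (G x1)" by blast
  define d where "d = R - dist x0 x1"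
  define K where "K = d * norm (G x1)"
  have d: "d \<ge> 0" "d \<le> R" using x1 by (auto simp: d_def)
  have KM: "K \<le> absorb_const TYPE('a) A * M"
  proof (cases "d = 0")
    case True
    then show ?thesis using absorb_const_pos[OF A, where 'a='a] M0 by (simp add: K_def)
  next
    case False
    then have d0: "d > 0" using d by simp
    define L where "L = A * (2 * K / (d * R) + M / R\<^sup>2)"
    have K0: "K \<ge> 0" using d by (simp add: K_def)
    have r: "\<epsilon> * d > 0" using \<epsilon> d0 by simp
    \<comment> \<open>On the ball of radius \<open>\<epsilon> * d\<close> around the maximum point
      the weight is at least \<open>d / 2\<close>, so maximality bounds the gradient there by
      \<open>2 * K / d\<close>.\<close>
    have sub: "y \<in> cball x0 R \<and> R - dist x0 y \<ge> d / 2" if "y \<in> cball x1 (\<epsilon> * d)" for y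
    proof -
      have "dist x0 y \<le> dist x0 x1 + dist x1 y" by (rule dist_triangle)
      moreover have "dist x1 y \<le> \<epsilon> * d" using that by simp
      moreover have "\<epsilon> * d \<le> 1 / 2 * d" using \<epsilon> d0 by (intro mult_right_mono) auto
      ultimately have "dist x0 y \<le> dist x0 x1 + d / 2" by linarith
      moreover have "R = d + dist x0 x1" by (simp add: d_def)
      ultimately show ?thesis using d0 by simp
    qed
    have "norm (G x1) \<le> grad_const TYPE('a) * (M / (\<epsilon> * d) + \<epsilon> * d * L)"
    proof (rule wlap_gradient_bound[OF w r])
      show "cball x1 (\<epsilon> * d) \<subseteq> S" using sub R(2) by blast
      fix y assume y: "y \<in> cball x1 (\<epsilon> * d)"
      show "\<bar>v y\<bar> \<le> M" using sub[OF y] M by blast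
      have "d / 2 * norm (G y) \<le> K"
      proof -
        have "d / 2 * norm (G y) \<le> (R - dist x0 y) * norm (G y)" using sub[OF y] by (intro mult_right_mono) auto
        then show ?thesis using max[of y] sub[OF y] unfolding K_def d_def by linarith
      qed
      then have "norm (G y) \<le> 2 * K / d" using d0 by (simp add: field_simps)
      then have "norm (G y) / R \<le> 2 * K / d / R" using R by (intro divide_right_mono) auto
      then have "A * (norm (G y) / R + M / R\<^sup>2) \<le> L" unfolding L_def using A by (intro mult_left_mono) auto
      then show "\<bar>g y\<bar> \<le> L" using g[of y] sub[OF y] by auto
    qed
    then have "K \<le> d * (C1 * (M / (\<epsilon> * d) + \<epsilon> * d * L))"
      unfolding K_def C1_def using d0 by (intro mult_left_mono) auto
    also have "\<dots> = C1 * M * (1 / \<epsilon>) + (C1 * \<epsilon> * A) * (2 * K * (d / R) + M * (d / R)\<^sup>2)"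
      unfolding L_def using d0 \<epsilon>(1) R by (simp add: field_simps power2_eq_square)
    also have "\<dots> \<le> C1 * M * (1 / \<epsilon>) + 1 / 4 * (2 * K * 1 + M * 1)"
    proof -
      have dR: "0 \<le> d / R" "d / R \<le> 1" using d R by auto
      have "(d / R)\<^sup>2 \<le> 1" using dR by (simp add: power_le_one)
      then have "2 * K * (d / R) + M * (d / R)\<^sup>2 \<le> 2 * K * 1 + M * 1"
        using dR K0 M0 by (intro add_mono mult_left_mono) auto
      moreover have "0 \<le> 2 * K * (d / R) + M * (d / R)\<^sup>2"
        by (intro add_nonneg_nonneg mult_nonneg_nonneg dR(1) K0 M0 zero_le_power2) simp
      ultimately have "(C1 * \<epsilon> * A) * (2 * K * (d / R) + M * (d / R)\<^sup>2) \<le> 1 / 4 * (2 * K * 1 + M * 1)"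
        using \<epsilon> by (intro mult_mono) auto
      then show ?thesis by simp
    qed
    finally have "K \<le> C1 * M * (1 / \<epsilon>) + 1 / 4 * (2 * K * 1 + M * 1)" .
    moreover have "K \<le> 2 * X + M / 2" if "K \<le> X + 1 / 4 * (2 * K * 1 + M * 1)" for X
      using that by (simp add: field_simps)
    ultimately have "K \<le> 2 * (C1 * M * (1 / \<epsilon>)) + M / 2" by blast
    also have "\<dots> \<le> absorb_const TYPE('a) A * M"
      unfolding absorb_const_def C1_def[symmetric] \<epsilon>(4) using M0 by (simp add: algebra_simps)
    finally show ?thesis .
  qed
  have "R * norm (G x0) \<le> K" using max[of x0] R by (simp add: K_def d_def)
  then have "R * norm (G x0) \<le> absorb_const TYPE('a) A * M" using KM by simp
  then show ?thesis using R by (simp add: field_simps)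
qed

lemma near_sl:
  fixes x0 x :: "'a::euclidean_space"
  assumes x0: "x0 \<noteq> 0" and d: "0 \<le> d" "d \<le> 1" and x: "dist x0 x \<le> d * norm x0 / 8"
  shows "x \<noteq> 0" "\<bar>sl x - sl x0\<bar> \<le> d / 4" "norm x0 / 2 \<le> norm x"
proof -
  define n n0 where "n = norm x" and "n0 = norm x0"
  have n0: "n0 > 0" using x0 by (simp add: n0_def)
  have dd: "\<bar>n - n0\<bar> \<le> d * n0 / 8"
    using norm_triangle_ineq3[of x x0] x unfolding n_def n0_def by (simp add: dist_norm norm_minus_commute)
  have "d * n0 \<le> 1 * n0" using d n0 by (intro mult_right_mono) auto
  then have n2: "n \<ge> n0 / 2" using dd n0 by linarith
  then have n: "n > 0" using n0 by linarith
  show "norm x0 / 2 \<le> norm x" "x \<noteq> 0" using n2 n by (auto simp: n_def n0_def)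
  have "ln n - ln n0 \<le> (n - n0) / n0" using n n0 by (simp add: ln_diff_le)
  also have "\<dots> \<le> (d * n0 / 8) / n0" using abs_ge_self[of "n - n0"] dd n0 by (intro divide_right_mono) linarith+
  also have "\<dots> \<le> d / 4" using n0 d by simp
  finally have 1: "ln n - ln n0 \<le> d / 4" .
  have "ln n0 - ln n \<le> (n0 - n) / n" using n n0 by (simp add: ln_diff_le)
  also have "\<dots> \<le> (d * n0 / 8) / n" using abs_ge_minus_self[of "n - n0"] dd n by (intro divide_right_mono) linarith+
  also have "\<dots> \<le> (d * n0 / 8) / (n0 / 2)" using n2 n0 n d by (intro divide_left_mono) auto
  also have "\<dots> = d / 4" using n0 by simp
  finally show "\<bar>sl x - sl x0\<bar> \<le> d / 4" using 1 unfolding sl_def n_def n0_def abs_le_iff by linarith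
qed

lemma exp_minus_one_le:
  fixes z :: real
  assumes "\<bar>z\<bar> \<le> 1" shows "\<bar>exp z - 1\<bar> \<le> 2 * \<bar>z\<bar>"
proof (cases "z \<ge> 0")
  case True
  then have "exp z \<le> 1 + z + z\<^sup>2" using assms by (intro exp_bound) auto
  moreover have "z\<^sup>2 \<le> z" using True assms by (simp add: power2_eq_square mult_left_le)
  moreover have "exp z \<ge> 1" using True by simp
  ultimately show ?thesis using True by simp
next
  case False
  have "exp z \<ge> 1 + z" by (rule exp_ge_add_one_self)
  moreover have "exp z \<le> 1" using False by simp
  ultimately have "\<bar>exp z - 1\<bar> \<le> - z" unfolding abs_le_iff by linarith
  then show ?thesis using False by linarith
qed

text \<open>Law of cosines: the squared distance is
  \<open>(n - n0)\<^sup>2 + 2 * (n * n0) * (1 - t)\<close>, and \<open>pole\<close> controls the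
  radial part through \<open>\<sigma>\<close> and the angular part \<open>1 - t\<close> directly.
  The constants add up to 22, rounded up to 25.\<close>

lemma pole_near:
  fixes x0 x :: "'a::euclidean_space"
  assumes x0: "x0 \<noteq> 0" and xn: "x \<noteq> 0" and d: "0 \<le> d" "d \<le> 1 / 4" and x: "pole x0 x \<le> d"
  shows "dist x0 x \<le> 5 * sqrt d * norm x0"
proof -
  define n n0 \<sigma> t where "n = norm x" and "n0 = norm x0" and "\<sigma> = sl x - sl x0"
    and "t = (x \<bullet> x0) / (norm x * norm x0)"
  have n0: "n0 > 0" "n > 0" using x0 xn by (auto simp: n0_def n_def)
  have p: "1 - t + \<sigma>\<^sup>2 / 4 \<le> d" using x unfolding pole_def t_def \<sigma>_def .
  have t1: "\<bar>t\<bar> \<le> 1" unfolding t_def by (rule pole_cos)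
  have "\<sigma>\<^sup>2 / 4 \<ge> 0" by simp
  then have td: "1 - t \<le> d" using p by linarith
  have "\<sigma>\<^sup>2 \<le> 4 * d" using p t1 unfolding abs_le_iff by linarith
  then have "\<bar>\<sigma>\<bar> \<le> sqrt (4 * d)" by (metis real_sqrt_abs real_sqrt_le_iff)
  then have s: "\<bar>\<sigma>\<bar> \<le> 2 * sqrt d" by (simp add: real_sqrt_mult)
  have "sqrt d \<le> sqrt (1 / 4)" using d by (intro real_sqrt_le_mono)
  then have "sqrt d \<le> 1 / 2" by (simp add: real_sqrt_divide)
  then have s1: "\<bar>\<sigma>\<bar> \<le> 1" using s by linarith
  have n: "n = n0 * exp (- \<sigma>)"
    using sl_norm[OF xn] sl_norm[OF x0] by (simp add: n_def n0_def \<sigma>_def exp_add[symmetric])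
  have e: "\<bar>exp (- \<sigma>) - 1\<bar> \<le> 2 * \<bar>\<sigma>\<bar>" using exp_minus_one_le[of "- \<sigma>"] s1 by simp
  have "\<bar>n - n0\<bar> = n0 * \<bar>exp (- \<sigma>) - 1\<bar>"
    unfolding n using n0 by (simp add: abs_mult[symmetric, of n0, simplified] right_diff_distrib abs_mult_pos')
  also have "\<dots> \<le> n0 * (4 * sqrt d)" using e s n0 by (intro mult_left_mono) auto
  finally have nd: "\<bar>n - n0\<bar> \<le> n0 * (4 * sqrt d)" .
  have n3: "n \<le> 3 * n0" unfolding n using e s1 n0 by (simp add: mult.commute)
  have xx: "x \<bullet> x0 = n * n0 * t" unfolding t_def n_def n0_def using x0 xn by simp
  have "(dist x0 x)\<^sup>2 = n0\<^sup>2 + n\<^sup>2 - 2 * (x \<bullet> x0)"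
    unfolding dist_norm power2_norm_eq_inner n_def n0_def
    by (simp add: inner_diff_left inner_diff_right inner_commute[of x0 x])
  also have "\<dots> = (n - n0)\<^sup>2 + 2 * (n * n0) * (1 - t)" unfolding xx by (simp add: power2_eq_square algebra_simps)
  also have "\<dots> \<le> (n0 * (4 * sqrt d))\<^sup>2 + 2 * (3 * n0 * n0) * d"
  proof (intro add_mono mult_mono)
    show "(n - n0)\<^sup>2 \<le> (n0 * (4 * sqrt d))\<^sup>2" using nd by (metis abs_ge_zero power2_abs power_mono)
  qed (use n3 n0 td d t1 in auto)
  also have "\<dots> = 22 * d * n0\<^sup>2" using d by (simp add: power_mult_distrib) (simp add: power2_eq_square algebra_simps)
  also have "\<dots> \<le> (5 * sqrt d * n0)\<^sup>2" using d by (simp add: power_mult_distrib mult_right_mono)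
  finally have "dist x0 x \<le> 5 * sqrt d * n0"
    by (rule power2_le_imp_le) (use d n0 in simp)
  then show ?thesis by (simp only: n0_def)
qed

lemma powr_le_add_one: "0 \<le> (p::real) \<Longrightarrow> 0 \<le> c \<Longrightarrow> c \<le> 1 \<Longrightarrow> p powr c \<le> 1 + p"
proof (cases "p \<le> 1")
  case True
  assume "0 \<le> p" "0 \<le> c" "c \<le> 1"
  then have "p powr c \<le> 1 powr c" using True by (intro powr_mono2) auto
  then show ?thesis using \<open>0 \<le> p\<close> by simp
next
  case False
  assume "0 \<le> p" "0 \<le> c" "c \<le> 1"
  then have "p powr c \<le> p powr 1" using False by (intro powr_mono) auto
  then show ?thesis using False by simp
qed

section \<open>Harnack inequality and logarithmic gradient bound\<close>

context log_solution
begin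

definition "Gu x = exp (w x) *\<^sub>R Gw x"
definition "gu x = exp (w x) * (norm (Gw x))\<^sup>2 + exp (w x) * gw x"

lemma wlap_u: "wlap {x. x \<noteq> 0 \<and> a0 < sl x} (\<lambda>x. exp (w x)) Gu gu"
  unfolding Gu_def gu_def by (rule wlap_compose[OF w]) (auto intro!: derivative_eq_intros continuous_intros)

text \<open>Returning to \<open>u = exp w\<close> removes the term |E|^2: the lower-order terms are
  homogeneous of degree one in \<open>u\<close> and its gradient, and the power of \<open>u\<close>
  is \<open>u\<close> times a potential bounded by \<open>E\<close>. The gradient estimate and the
  Harnack inequality rest on this linear growth.\<close>

lemma u_ineq:
  assumes x: "x \<noteq> 0" "a0 < sl x" and E: "exp ((q - 1) * (w x - b * sl x)) \<le> E"
  shows "\<bar>(norm x)\<^sup>2 * gu x - (real DIM('a) - 2) * (x \<bullet> Gu x)\<bar>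
    \<le> (E + 2 * \<bar>\<rho>\<bar> + \<bar>lam\<bar>) * (norm x * norm (Gu x) + exp (w x))"
proof -
  define p u where "p = norm x * norm (Gw x)" and "u = exp (w x)"
  have p0: "p \<ge> 0" by (simp add: p_def)
  have u0: "u > 0" by (simp add: u_def)
  have E0: "E \<ge> 0" using E by (meson exp_ge_zero order_trans)
  have "(norm x)\<^sup>2 * gu x - (real DIM('a) - 2) * (x \<bullet> Gu x)
    = u * ((norm x)\<^sup>2 * gw x + p\<^sup>2 - (real DIM('a) - 2) * (x \<bullet> Gw x))"
    unfolding gu_def Gu_def p_def u_def by (simp add: power_mult_distrib algebra_simps)
  also have "(norm x)\<^sup>2 * gw x + p\<^sup>2 - (real DIM('a) - 2) * (x \<bullet> Gw x)
    = exp ((q - 1) * (w x - b * sl x)) + 2 * \<rho> * (x \<bullet> Gw x) - lam * p powr (1 - \<tau>)"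
    using eqn[OF x] unfolding p_def by (simp add: algebra_simps)
  finally have e: "(norm x)\<^sup>2 * gu x - (real DIM('a) - 2) * (x \<bullet> Gu x)
    = u * (exp ((q - 1) * (w x - b * sl x)) + 2 * \<rho> * (x \<bullet> Gw x) - lam * p powr (1 - \<tau>))" .
  have "\<bar>exp ((q - 1) * (w x - b * sl x)) + 2 * \<rho> * (x \<bullet> Gw x) - lam * p powr (1 - \<tau>)\<bar>
     \<le> E + 2 * \<bar>\<rho>\<bar> * p + \<bar>lam\<bar> * (1 + p)"
  proof -
    have "\<bar>2 * \<rho> * (x \<bullet> Gw x)\<bar> \<le> 2 * \<bar>\<rho>\<bar> * p"
      using Cauchy_Schwarz_ineq2[of x "Gw x"] unfolding p_def abs_mult by (intro mult_mono) auto
    moreover have "\<bar>lam * p powr (1 - \<tau>)\<bar> \<le> \<bar>lam\<bar> * (1 + p)"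
      unfolding abs_mult using powr_le_add_one[OF p0, of "1 - \<tau>"] tau by (intro mult_mono) auto
    moreover have "\<bar>exp ((q - 1) * (w x - b * sl x))\<bar> \<le> E" using E by simp
    ultimately show ?thesis by linarith
  qed
  also have "\<dots> \<le> (E + 2 * \<bar>\<rho>\<bar> + \<bar>lam\<bar>) * (p + 1)"
    using E0 p0 by (simp add: algebra_simps)
  finally have "\<bar>(norm x)\<^sup>2 * gu x - (real DIM('a) - 2) * (x \<bullet> Gu x)\<bar> \<le> u * ((E + 2 * \<bar>\<rho>\<bar> + \<bar>lam\<bar>) * (p + 1))"
    unfolding e abs_mult using u0 by (simp add: mult_left_mono)
  also have "\<dots> = (E + 2 * \<bar>\<rho>\<bar> + \<bar>lam\<bar>) * (norm x * norm (Gu x) + exp (w x))"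
    unfolding p_def u_def Gu_def by (simp add: algebra_simps)
  finally show ?thesis .
qed

lemma gu_bound:
  assumes x: "x \<noteq> 0" "a0 < sl x" and E: "exp ((q - 1) * (w x - b * sl x)) \<le> E"
    and R: "0 < R" "R \<le> norm x" and M: "exp (w x) \<le> M"
  shows "\<bar>gu x\<bar> \<le> (E + 2 * \<bar>\<rho>\<bar> + \<bar>lam\<bar> + real DIM('a)) * (norm (Gu x) / R + M / R\<^sup>2)"
proof -
  define C n u g where "C = E + 2 * \<bar>\<rho>\<bar> + \<bar>lam\<bar>" and "n = norm x" and "u = exp (w x)" and "g = norm (Gu x)"
  let ?N = "real DIM('a)"
  have E0: "E \<ge> 0" using E by (meson exp_ge_zero order_trans)
  have p: "C \<ge> 0" "n > 0" "u > 0" "g \<ge> 0" "?N \<ge> 2" using x E0 dim by (auto simp: C_def n_def u_def g_def)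
  have "\<bar>(?N - 2) * (x \<bullet> Gu x)\<bar> \<le> (?N - 2) * (n * g)"
    unfolding abs_mult n_def g_def using p Cauchy_Schwarz_ineq2[of x "Gu x"] by (intro mult_mono) auto
  then have "\<bar>n\<^sup>2 * gu x\<bar> \<le> C * (n * g + u) + (?N - 2) * (n * g)"
    using u_ineq[OF x E] unfolding C_def n_def g_def u_def by linarith
  also have "\<dots> \<le> (C + ?N) * (n * g + u)"
  proof -
    have "0 \<le> n * g" using p by simp
    moreover have "0 \<le> ?N * u" using p by simp
    ultimately show ?thesis by (simp add: algebra_simps)
  qed
  finally have "n\<^sup>2 * \<bar>gu x\<bar> \<le> (C + ?N) * (n * g + u)" by (simp add: abs_mult)
  then have "\<bar>gu x\<bar> \<le> ((C + ?N) * (n * g + u)) / n\<^sup>2" using p by (simp add: pos_le_divide_eq mult.commute)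
  also have "\<dots> = (C + ?N) * (g / n + u / n\<^sup>2)" using p by (simp add: field_simps power2_eq_square)
  also have "\<dots> \<le> (C + ?N) * (g / R + M / R\<^sup>2)"
  proof (intro mult_left_mono add_mono)
    show "g / n \<le> g / R" using p R unfolding n_def by (intro divide_left_mono) auto
    have "R\<^sup>2 \<le> n\<^sup>2" using R unfolding n_def by (intro power_mono) auto
    then show "u / n\<^sup>2 \<le> M / R\<^sup>2" using p R M unfolding u_def by (intro frac_le) (auto intro: order_trans[OF exp_ge_zero])
  qed (use p in auto)
  finally show ?thesis unfolding C_def g_def .
qed

end

lemma wlap_lipschitz:
  assumes "wlap S v G g" "cball x0 r \<subseteq> S" "\<And>z. z \<in> cball x0 r \<Longrightarrow> norm (G z) \<le> L" "z \<in> cball x0 r"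
  shows "\<bar>v z - v x0\<bar> \<le> L * dist x0 z"
proof -
  have "norm (v z - v x0) \<le> L * norm (z - x0)"
  proof (rule differentiable_bound)
    fix y assume y: "y \<in> cball x0 r"
    have "(v has_derivative (\<lambda>h. h \<bullet> G y)) (at y)"
      using wlapD(2)[OF assms(1), of y] y assms(2) unfolding gderiv_def by blast
    then show "(v has_derivative (\<lambda>h. h \<bullet> G y)) (at y within cball x0 r)" by (rule has_derivative_at_withinI)
    show "onorm (\<lambda>h. h \<bullet> G y) \<le> L"
    proof (rule onorm_le)
      fix h
      have "norm (h \<bullet> G y) \<le> norm h * norm (G y)" using Cauchy_Schwarz_ineq2[of h "G y"] by simp
      also have "\<dots> \<le> norm h * L" using assms(3)[OF y] by (intro mult_left_mono) auto
      finally show "norm (h \<bullet> G y) \<le> L * norm h" by (simp add: mult.commute)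
    qed
  qed (use assms(4) in \<open>auto intro: order_trans[OF zero_le_dist]\<close>)
  then show ?thesis by (simp add: dist_norm norm_minus_commute)
qed

context log_solution
begin

text \<open>At the maximum \<open>x0\<close> of \<open>u (1 - |s - s1|) powr (2 g)\<close> the gradient estimate keeps \<open>u\<close> above \<open>u x0 / 2\<close> on
  a ball of controlled size, from which the growth lemma spreads the lower bound.\<close>

lemma harnack:
  assumes a1: "a0 \<le> a1" and E: "\<And>x. x \<noteq> 0 \<Longrightarrow> a1 < sl x \<Longrightarrow> exp ((q - 1) * (w x - b * sl x)) \<le> E"
  shows "\<exists>H>0. \<forall>x y. x \<noteq> 0 \<longrightarrow> y \<noteq> 0 \<longrightarrow> a1 + 6 < sl y \<longrightarrow> \<bar>sl x - sl y\<bar> \<le> 1 / 2 \<longrightarrow> exp (w x) \<le> H * exp (w y)"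
proof -
  let ?N = "real DIM('a)"
  obtain z0 :: 'a where "z0 \<noteq> 0" "sl z0 = a1 + 1" using sl_ex by blast
  then have "exp ((q - 1) * (w z0 - b * sl z0)) \<le> E" using E[of z0] by simp
  then have E0: "E \<ge> 0" by (rule order_trans[OF exp_ge_zero])
  define C where "C = E + 2 * \<bar>\<rho>\<bar> + \<bar>lam\<bar>"
  have C: "C \<ge> 0" using E0 by (simp add: C_def)
  define g where "g = growth_exp (?N - 1) (2 * C)"
  have g: "g \<ge> 7" unfolding g_def using dim C by (intro growth_exp_ge) auto
  define AC where "AC = absorb_const TYPE('a) (C + ?N)"
  have AC: "AC > 0" unfolding AC_def using C by (intro absorb_const_pos) auto
  \<comment> \<open>The ratio of the weights when the distance \<open>d\<close> to the end of the
    window is halved; it yields \<open>u \<le> T * u0\<close> on the ball of radius \<open>R\<close>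
    below.\<close>
  define T where "T = (2::real) powr (2 * g)"
  have T: "T > 0" by (simp add: T_def)
  \<comment> \<open>By the gradient estimate, \<open>u\<close> then changes by at most
    \<open>u0 / 2\<close> within distance \<open>\<epsilon> * R\<close> of
    \<open>x0\<close>.\<close>
  define \<epsilon> where "\<epsilon> = 1 / (2 + 4 * AC * T)"
  \<comment> \<open>By \<open>pole_near\<close>, \<open>pole x0 z \<le> (\<eta> * d)\<^sup>2\<close>
    gives distance at most \<open>5 * \<eta> * d * norm x0\<close>, which is
    \<open>\<epsilon> * R\<close>.\<close>
  define \<eta> where "\<eta> = \<epsilon> / 40"
  have \<epsilon>: "\<epsilon> > 0" "\<epsilon> \<le> 1 / 2" "2 * AC * T * \<epsilon> \<le> 1 / 2"
    using AC T by (auto simp: \<epsilon>_def field_simps add_pos_pos)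
  have \<eta>: "\<eta> > 0" "\<eta> \<le> 1 / 80" using \<epsilon> by (auto simp: \<eta>_def)
  \<comment> \<open>The value 9/4 bounds \<open>pole x0 y\<close>: at most 2 from the angle and at
    most 1/4 from \<open>|sl y - sl x0| \<le> 1\<close>.\<close>
  define hm where "hm = (9 / 4 :: real) powr (- g) - 3 powr (- g)"
  have hm: "hm > 0" "hm \<le> 1"
  proof -
    show "hm > 0" unfolding hm_def using g by (simp add: powr_less_mono2_neg)
    have "(9 / 4 :: real) powr (- g) \<le> (9 / 4) powr 0" using g by (intro powr_mono) auto
    then have "(9 / 4 :: real) powr (- g) \<le> 1" by simp
    moreover have "(3::real) powr (- g) \<ge> 0" by simp
    ultimately show "hm \<le> 1" unfolding hm_def by linarith
  qed
  define c0 where "c0 = hm / 2 * \<eta> powr (2 * g) * (1 / 2) powr (2 * g)"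
  have c0: "c0 > 0" using hm \<eta> by (simp add: c0_def)
  have main: "exp (w x) \<le> 1 / c0 * exp (w y)"
    if x: "x \<noteq> 0" and y: "y \<noteq> 0" "a1 + 6 < sl y" and xy: "\<bar>sl x - sl y\<bar> \<le> 1 / 2" for x y
  proof -
    define s1 where "s1 = sl y"
    let ?K = "{x::'a. x \<noteq> 0 \<and> s1 - 1 \<le> sl x \<and> sl x \<le> s1 + 1}"
    let ?P = "\<lambda>x. exp (w x) * (1 - \<bar>sl x - s1\<bar>) powr (2 * g)"
    have K0: "?K \<subseteq> {x. x \<noteq> 0 \<and> a0 < sl x}" using y a1 by (auto simp: s1_def)
    have "continuous_on ?K (\<lambda>x. (1 - \<bar>sl x - s1\<bar>) powr (2 * g))"
      using g by (intro continuous_on_powr' continuous_intros continuous_on_sl) (auto simp: abs_le_iff)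
    then have "continuous_on ?K ?P" by (intro continuous_on_mult continuous_on_exp continuous_w K0)
    moreover have "y \<in> ?K" using y by (simp add: s1_def)
    then have "?K \<noteq> {}" by blast
    ultimately have "\<exists>x0\<in>?K. \<forall>z\<in>?K. ?P z \<le> ?P x0" by (intro continuous_attains_sup compact_annulus)
    then obtain x0 where x0: "x0 \<in> ?K" and max: "\<And>z. z \<in> ?K \<Longrightarrow> ?P z \<le> ?P x0" by blast
    define d where "d = 1 - \<bar>sl x0 - s1\<bar>"
    define u0 where "u0 = exp (w x0)"
    have u0: "u0 > 0" by (simp add: u0_def)
    have x0n: "x0 \<noteq> 0" using x0 by simp
    \<comment> \<open>The weighted value at \<open>y\<close> is positive, so the maximum point does
      not lie on the boundary of the window.\<close>
    have d: "0 < d" "d \<le> 1"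
    proof -
      have "?P y = exp (w y)" by (simp add: s1_def)
      then have "exp (w y) \<le> ?P x0" using max[OF \<open>y \<in> ?K\<close>] by simp
      then have "0 < ?P x0" by (meson exp_gt_zero less_le_trans)
      then have "d \<noteq> 0" by (auto simp: d_def)
      moreover have "d \<ge> 0" using x0 by (auto simp: d_def abs_le_iff)
      ultimately show "0 < d" by simp
    qed (simp add: d_def)
    have Px0: "?P x0 = u0 * d powr (2 * g)" by (simp add: u0_def d_def)
    define R where "R = d * norm x0 / 8"
    have R: "R > 0" "R \<le> norm x0 / 8" using d x0n by (auto simp: R_def mult_left_le_one_le)
    have near: "z \<noteq> 0" "z \<in> ?K" "norm x0 / 2 \<le> norm z" "exp (w z) \<le> T * u0" "a1 < sl z"
      if z: "z \<in> cball x0 R" for z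
    proof -
      have dz: "dist x0 z \<le> d * norm x0 / 8" using z by (simp add: R_def)
      note nz = near_sl[OF x0n _ d(2) dz]
      show z0: "z \<noteq> 0" and "norm x0 / 2 \<le> norm z" using nz d by auto
      have "\<bar>sl z - sl x0\<bar> \<le> d / 4" using nz d by auto
      moreover have "\<bar>sl z - s1\<bar> \<le> \<bar>sl z - sl x0\<bar> + \<bar>sl x0 - s1\<bar>" by simp
      moreover have "\<bar>sl x0 - s1\<bar> = 1 - d" by (simp add: d_def)
      ultimately have dz2: "1 - \<bar>sl z - s1\<bar> \<ge> d / 2" using d by linarith
      then have "\<bar>sl z - s1\<bar> \<le> 1" using d by linarith
      then show zK: "z \<in> ?K" using z0 by (auto simp: abs_le_iff)
      show "a1 < sl z" using zK y unfolding s1_def by auto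
      have "exp (w z) * (d / 2) powr (2 * g) \<le> ?P z"
        using dz2 d g by (intro mult_left_mono powr_mono2) auto
      also have "\<dots> \<le> u0 * d powr (2 * g)" using max[OF zK] Px0 by simp
      finally have "exp (w z) * d powr (2 * g) / T \<le> u0 * d powr (2 * g)"
        unfolding T_def using d by (simp add: powr_divide)
      then show "exp (w z) \<le> T * u0" using d T by (simp add: field_simps)
    qed
    have wl: "wlap {x. x \<noteq> 0 \<and> a0 < sl x} (\<lambda>x. exp (w x)) Gu gu" by (rule wlap_u)
    have sub: "cball x0 R \<subseteq> {x. x \<noteq> 0 \<and> a0 < sl x}" using near(1,5) a1 by fastforce
    have Gz: "norm (Gu z) \<le> 2 * AC * (T * u0) / R" if z: "z \<in> cball x0 (R / 2)" for z
    proof -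
      have zz: "z' \<in> cball x0 R" if "z' \<in> cball z (R / 2)" for z'
        using that z dist_triangle[of x0 z' z] by simp
      have "norm (Gu z) \<le> absorb_const TYPE('a) (C + ?N) * (T * u0) / (R / 2)"
      proof (rule wlap_gradient_absorb[OF wl])
        show "cball z (R / 2) \<subseteq> {x. x \<noteq> 0 \<and> a0 < sl x}" using zz sub by blast
        fix z' assume "z' \<in> cball z (R / 2)"
        note z' = zz[OF this]
        show "\<bar>exp (w z')\<bar> \<le> T * u0" using near(4)[OF z'] by simp
        have "a0 < sl z'" using near(5)[OF z'] a1 by simp
        moreover have "R / 2 \<le> norm z'" using near(3)[OF z'] R norm_ge_zero[of x0] by linarith
        ultimately show "\<bar>gu z'\<bar> \<le> (C + ?N) * (norm (Gu z') / (R / 2) + T * u0 / (R / 2)\<^sup>2)"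
          unfolding C_def using near[OF z'] E R by (intro gu_bound) auto
      qed (use R C in auto)
      then show ?thesis by (simp add: AC_def mult_ac)
    qed
    have half: "exp (w z) \<ge> u0 / 2" if z: "dist x0 z \<le> \<epsilon> * R" for z
    proof -
      have eR: "\<epsilon> * R \<le> R / 2" using \<epsilon> R mult_right_mono[of \<epsilon> "1/2" R] by simp
      have "\<bar>exp (w z) - exp (w x0)\<bar> \<le> (2 * AC * (T * u0) / R) * dist x0 z"
      proof (rule wlap_lipschitz[OF wl])
        show "cball x0 (\<epsilon> * R) \<subseteq> {x. x \<noteq> 0 \<and> a0 < sl x}" using sub eR R by (intro subset_trans[OF _ sub] subset_cball) auto
        show "z' \<in> cball x0 (\<epsilon> * R) \<Longrightarrow> norm (Gu z') \<le> 2 * AC * (T * u0) / R" for z' using Gz eR by simp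
      qed (use z in simp)
      also have "\<dots> \<le> (2 * AC * (T * u0) / R) * (\<epsilon> * R)"
        using AC T u0 R z by (intro mult_left_mono) auto
      also have "\<dots> = (2 * AC * T * \<epsilon>) * u0" using R by simp
      also have "\<dots> \<le> 1 / 2 * u0" using \<epsilon> u0 by (intro mult_right_mono) auto
      finally have "\<bar>exp (w z) - u0\<bar> \<le> 1 / 2 * u0" unfolding u0_def .
      then show ?thesis by linarith
    qed
    define \<delta> where "\<delta> = (\<eta> * d)\<^sup>2"
    have hd: "0 < \<eta> * d" "\<eta> * d \<le> 1 / 80" using \<eta> d mult_mono[of \<eta> "1/80" d 1] by auto
    have "\<delta> \<le> (1 / 80)\<^sup>2" unfolding \<delta>_def using hd by (intro power_mono) auto
    then have \<delta>: "0 < \<delta>" "\<delta> \<le> 1 / 4" "sqrt \<delta> = \<eta> * d" using hd by (auto simp: \<delta>_def power2_eq_square)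
    have small: "exp (w z) \<ge> u0 / 2" if "z \<noteq> 0" "pole x0 z \<le> \<delta>" for z
    proof (rule half)
      have "dist x0 z \<le> 5 * sqrt \<delta> * norm x0" using \<delta> that by (intro pole_near x0n) auto
      also have "\<dots> = \<epsilon> * R" unfolding \<delta>(3) \<eta>_def R_def by simp
      finally show "dist x0 z \<le> \<epsilon> * R" .
    qed
    define c where "c = u0 / 2 * \<delta> powr g"
    have c: "c \<ge> 0" using u0 by (simp add: c_def)
    have cd: "c * \<delta> powr (- g) = u0 / 2" using \<delta> by (simp add: c_def powr_minus)
    have far: "a1 < sl z" if "pole x0 z \<le> 3" for z
      using pole_sl[OF that] x0 y(2) unfolding s1_def abs_le_iff by auto
    have p3: "pole x0 y \<le> 9 / 4"
    proof -
      have "(sl y - sl x0)\<^sup>2 \<le> 1\<^sup>2" using x0 unfolding s1_def by (intro power2_le_iff_abs_le[THEN iffD2]) (auto simp: abs_le_iff)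
      then show ?thesis using pole_cos[of y x0] unfolding pole_def abs_le_iff by simp
    qed
    have "exp (w y) \<ge> c * hm"
    proof (cases "\<delta> \<le> pole x0 y")
      case True
      have "exp (w y) \<ge> c * (pole x0 y powr (- g) - 3 powr (- g))"
      proof (rule hopf_growth[OF dim x0n C order_refl g_def wl])
        fix z :: 'a assume z: "z \<noteq> 0" "pole x0 z \<le> 3"
        have sz: "a0 < sl z" "a1 < sl z" using far[OF z(2)] a1 by auto
        show "z \<in> {x. x \<noteq> 0 \<and> a0 < sl x}" using z sz by simp
        show "(norm z)\<^sup>2 * gu z - (?N - 2) * (z \<bullet> Gu z) \<le> C * (norm z * norm (Gu z) + 0 * (norm z * norm (Gu z))\<^sup>2 + exp (w z))"
          using u_ineq[OF z(1) sz(1) E[OF z(1) sz(2)]] unfolding C_def abs_le_iff by simp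
      next
        fix z :: 'a assume "z \<noteq> 0" "pole x0 z = \<delta>"
        then show "c * \<delta> powr (- g) \<le> exp (w z)" unfolding cd using small by simp
      qed (use \<delta> c True y p3 in auto)
      moreover have "pole x0 y powr (- g) \<ge> (9 / 4) powr (- g)"
        using p3 True \<delta> g by (intro powr_mono2') auto
      then have "c * (pole x0 y powr (- g) - 3 powr (- g)) \<ge> c * hm" unfolding hm_def using c by (intro mult_left_mono) auto
      ultimately show ?thesis by linarith
    next
      case False
      have "\<delta> powr g \<le> 1 powr g" using \<delta> g by (intro powr_mono2) auto
      then have "\<delta> powr g * hm \<le> 1 * 1" using hm by (intro mult_mono) auto
      then have "u0 / 2 * (\<delta> powr g * hm) \<le> u0 / 2 * 1" using u0 by (intro mult_left_mono) auto
      then have "c * hm \<le> u0 / 2" by (simp add: c_def mult.assoc)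
      then show ?thesis using small[of y] y False by auto
    qed
    \<comment> \<open>The unknown \<open>d\<close> disappears here: \<open>\<delta> powr g\<close>
      equals \<open>(\<eta> * d) powr (2 * g)\<close>, which is why the weight carries the exponent
      \<open>2 * g\<close>.\<close>
    moreover have "c * hm = hm / 2 * \<eta> powr (2 * g) * ?P x0"
    proof -
      have "\<delta> = (\<eta> * d) powr 2" unfolding \<delta>_def using hd by simp
      then have "\<delta> powr g = (\<eta> * d) powr (2 * g)" by (simp only: powr_powr)
      also have "\<dots> = \<eta> powr (2 * g) * d powr (2 * g)" using \<eta> d by (simp add: powr_mult)
      finally show ?thesis unfolding c_def Px0 by simp
    qed
    moreover have "?P x0 \<ge> exp (w x) * (1 / 2) powr (2 * g)"
    proof -
      have "x \<in> ?K" using x xy unfolding s1_def abs_le_iff by auto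
      from max[OF this] have "?P x \<le> ?P x0" .
      moreover have "?P x \<ge> exp (w x) * (1 / 2) powr (2 * g)"
        using xy g unfolding s1_def by (intro mult_left_mono powr_mono2) auto
      ultimately show ?thesis by linarith
    qed
    then have "hm / 2 * \<eta> powr (2 * g) * ?P x0 \<ge> hm / 2 * \<eta> powr (2 * g) * (exp (w x) * (1 / 2) powr (2 * g))"
      using hm by (intro mult_left_mono) auto
    ultimately have "c0 * exp (w x) \<le> exp (w y)" unfolding c0_def by (simp add: mult_ac)
    then show ?thesis using c0 by (simp add: field_simps)
  qed
  show ?thesis using main c0 by (intro exI[of _ "1 / c0"]) auto
qed

text \<open>On a ball of radius comparable to \<open>norm y\<close> the Harnack inequality bounds
  \<open>u\<close> by a multiple of its value at \<open>y\<close>; the gradient estimate, divided by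
  that value, is the claim.\<close>

lemma log_gradient_bound:
  assumes a1: "a0 \<le> a1" and E: "\<And>x. x \<noteq> 0 \<Longrightarrow> a1 < sl x \<Longrightarrow> exp ((q - 1) * (w x - b * sl x)) \<le> E"
  shows "\<exists>L\<ge>0. \<forall>y. y \<noteq> 0 \<longrightarrow> a1 + 6 < sl y \<longrightarrow> norm y * norm (Gw y) \<le> L"
proof -
  let ?N = "real DIM('a)"
  obtain z0 :: 'a where "z0 \<noteq> 0" "sl z0 = a1 + 1" using sl_ex by blast
  then have "exp ((q - 1) * (w z0 - b * sl z0)) \<le> E" using E[of z0] by simp
  then have E0: "E \<ge> 0" by (rule order_trans[OF exp_ge_zero])
  define C where "C = E + 2 * \<bar>\<rho>\<bar> + \<bar>lam\<bar>"
  have C: "C \<ge> 0" using E0 by (simp add: C_def)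
  define AC where "AC = absorb_const TYPE('a) (C + ?N)"
  have AC: "AC > 0" unfolding AC_def using C by (intro absorb_const_pos) auto
  obtain H where H: "H > 0" and har: "\<And>x y. x \<noteq> 0 \<Longrightarrow> y \<noteq> 0 \<Longrightarrow> a1 + 6 < sl y \<Longrightarrow> \<bar>sl x - sl y\<bar> \<le> 1 / 2 \<Longrightarrow> exp (w x) \<le> H * exp (w y)"
    using harnack[OF assms] by blast
  have "norm y * norm (Gw y) \<le> 8 * AC * H" if y: "y \<noteq> 0" "a1 + 6 < sl y" for y
  proof -
    define R where "R = norm y / 8"
    have R: "R > 0" using y by (simp add: R_def)
    have near: "z \<noteq> 0" "norm y / 2 \<le> norm z" "exp (w z) \<le> H * exp (w y)" "a1 < sl z" if z: "z \<in> cball y R" for z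
    proof -
      note nz = near_sl[OF y(1), of 1 z]
      show z0: "z \<noteq> 0" and "norm y / 2 \<le> norm z" using nz z by (auto simp: R_def)
      have s: "\<bar>sl z - sl y\<bar> \<le> 1 / 4" using nz z by (auto simp: R_def)
      then show "exp (w z) \<le> H * exp (w y)" using har[OF z0 y] by simp
      show "a1 < sl z" using s y by linarith
    qed
    have "norm (Gu y) \<le> absorb_const TYPE('a) (C + ?N) * (H * exp (w y)) / R"
    proof (rule wlap_gradient_absorb[OF wlap_u R])
      show "cball y R \<subseteq> {x. x \<noteq> 0 \<and> a0 < sl x}" using near(1,4) a1 by fastforce
      fix z assume z: "z \<in> cball y R"
      show "\<bar>exp (w z)\<bar> \<le> H * exp (w y)" using near(3)[OF z] by simp
      have "a0 < sl z" using near(4)[OF z] a1 by simp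
      moreover have "R \<le> norm z" using near(2)[OF z] R unfolding R_def by linarith
      ultimately show "\<bar>gu z\<bar> \<le> (C + ?N) * (norm (Gu z) / R + H * exp (w y) / R\<^sup>2)"
        unfolding C_def using near[OF z] E R by (intro gu_bound) auto
    qed (use C in auto)
    then have "exp (w y) * norm (Gw y) \<le> exp (w y) * (AC * H / R)" by (simp add: AC_def Gu_def mult_ac)
    then have "norm (Gw y) \<le> AC * H / R" by (rule mult_left_le_imp_le) simp
    then show ?thesis using y by (simp add: R_def field_simps)
  qed
  then show ?thesis using AC H by (intro exI[of _ "8 * AC * H"]) auto
qed

end

section \<open>Convergence to a radial profile\<close>

lemma monotone_bounded_tendsto:
  fixes p :: "real \<Rightarrow> real"
  assumes mono: "\<And>r s. t \<le> r \<Longrightarrow> r \<le> s \<Longrightarrow> p r \<le> p s" and bd: "\<And>s. t \<le> s \<Longrightarrow> p s \<le> M"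
  shows "\<exists>L. (p \<longlongrightarrow> L) at_top"
proof -
  let ?L = "Sup (p ` {t..})"
  have bdd: "bdd_above (p ` {t..})" using bd by (intro bdd_aboveI[of _ M]) auto
  have "(p \<longlongrightarrow> ?L) at_top"
  proof (rule order_tendstoI)
    fix a assume "a < ?L"
    then obtain s where s: "t \<le> s" "a < p s" using less_cSup_iff[of "p ` {t..}" a] bdd by auto
    then show "\<forall>\<^sub>F x in at_top. a < p x"
      by (intro eventually_at_top_linorderI[of s]) (use mono in \<open>force intro: less_le_trans\<close>)
  next
    fix a assume "?L < a"
    then show "\<forall>\<^sub>F x in at_top. p x < a"
      by (intro eventually_at_top_linorderI[of t]) (meson atLeast_iff bdd cSup_upper image_eqI le_less_trans)
  qed
  then show ?thesis by blast
qed

text \<open>A single strict increase forces the function to increase from then on; if there is none,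
  it decreases throughout.\<close>

lemma quasiconvex_eventually_monotone:
  fixes p :: "real \<Rightarrow> real"
  assumes qc: "\<And>a s c. A < a \<Longrightarrow> a \<le> s \<Longrightarrow> s \<le> c \<Longrightarrow> p s \<le> max (p a) (p c)"
  shows "\<exists>t>A. (\<forall>r s. t \<le> r \<longrightarrow> r \<le> s \<longrightarrow> p r \<le> p s) \<or> (\<forall>r s. t \<le> r \<longrightarrow> r \<le> s \<longrightarrow> p s \<le> p r)"
proof (cases "\<exists>a t. A < a \<and> a < t \<and> p a < p t")
  case True
  then obtain a t where at: "A < a" "a < t" "p a < p t" by blast
  have 1: "p r \<ge> p t" if "t \<le> r" for r using qc[of a t r] at that by (auto simp: max_def split: if_splits)
  have "p r \<le> p s" if "t \<le> r" "r \<le> s" for r s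
    using qc[of a r s] 1[of r] at that by (auto simp: max_def split: if_splits)
  then show ?thesis using at by (intro exI[of _ t]) auto
next
  case False
  have "p s \<le> p r" if "A + 1 \<le> r" "r \<le> s" for r s
  proof (rule ccontr)
    assume "\<not> p s \<le> p r"
    then have "p r < p s" "r < s" "A < r" using that by (auto simp: less_le)
    then show False using False by blast
  qed
  then show ?thesis by (intro exI[of _ "A + 1"]) auto
qed

lemma quasiconvex_bounded_tendsto:
  fixes p :: "real \<Rightarrow> real"
  assumes qc: "\<And>a s c. A < a \<Longrightarrow> a \<le> s \<Longrightarrow> s \<le> c \<Longrightarrow> p s \<le> max (p a) (p c)"
    and bd: "\<And>s. A < s \<Longrightarrow> \<bar>p s\<bar> \<le> M"
  shows "\<exists>L. (p \<longlongrightarrow> L) at_top"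
proof -
  obtain t where t: "t > A" "(\<forall>r s. t \<le> r \<longrightarrow> r \<le> s \<longrightarrow> p r \<le> p s) \<or> (\<forall>r s. t \<le> r \<longrightarrow> r \<le> s \<longrightarrow> p s \<le> p r)"
    using quasiconvex_eventually_monotone[of A p] qc by blast
  from t(2) show ?thesis
  proof
    assume m: "\<forall>r s. t \<le> r \<longrightarrow> r \<le> s \<longrightarrow> p r \<le> p s"
    show ?thesis
      by (rule monotone_bounded_tendsto[of t p M]) (use m bd t(1) in \<open>auto simp: abs_le_iff\<close>)
  next
    assume m: "\<forall>r s. t \<le> r \<longrightarrow> r \<le> s \<longrightarrow> p s \<le> p r"
    have "\<exists>L. ((\<lambda>s. - p s) \<longlongrightarrow> L) at_top"
      by (rule monotone_bounded_tendsto[of t _ M]) (use m bd t(1) in \<open>auto simp: abs_le_iff\<close>)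
    then obtain L where "((\<lambda>s. - p s) \<longlongrightarrow> L) at_top" by blast
    then have "((\<lambda>s. - (- p s)) \<longlongrightarrow> - L) at_top" by (rule tendsto_minus)
    then show ?thesis by auto
  qed
qed

lemma filterlim_sl: "filterlim sl at_top (at (0::'a::euclidean_space))"
  unfolding filterlim_at_top
proof
  fix Z :: real
  have "\<forall>\<^sub>F x in at (0::'a). x \<in> ball 0 (exp (- Z)) - {0}"
    by (intro eventually_at_in_open) auto
  then show "\<forall>\<^sub>F x in at (0::'a). Z \<le> sl x"
    by (rule eventually_mono) (simp add: sl_ge_iff)
qed

lemma eventually_sl:
  assumes "\<And>x::'a::euclidean_space. x \<noteq> 0 \<Longrightarrow> c < sl x \<Longrightarrow> P x"
  shows "\<forall>\<^sub>F x in at 0. P x"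
proof -
  have "\<forall>\<^sub>F x in at (0::'a). c < sl x"
    using filterlim_sl unfolding filterlim_at_top_dense by blast
  moreover have "\<forall>\<^sub>F x in at (0::'a). x \<noteq> 0" by (simp add: eventually_at_filter)
  ultimately show ?thesis by eventually_elim (rule assms)
qed

text \<open>By scaling this is \<open>|z powr c - 1| \<le> |z - 1|\<close>. The power is Lipschitz
  relative to a positive base point \<open>m\<close>, even for \<open>p\<close> near 0; this
  linearises the gradient term around a nonzero radial slope.\<close>

lemma powr_diff_bound:
  fixes p m c :: real
  assumes "p \<ge> 0" "m > 0" "0 < c" "c \<le> 1"
  shows "\<bar>p powr c - m powr c\<bar> \<le> m powr (c - 1) * \<bar>p - m\<bar>"
proof -
  define z where "z = p / m"
  have z: "z \<ge> 0" and p: "p = z * m" using assms by (auto simp: z_def)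
  have "\<bar>z powr c - 1\<bar> \<le> \<bar>z - 1\<bar>"
  proof (cases "z \<ge> 1")
    case True
    then have "z powr 0 \<le> z powr c" "z powr c \<le> z powr 1" using assms by (intro powr_mono; simp)+
    then show ?thesis using True by simp
  next
    case False
    have "z powr c \<le> 1 powr c" using False z assms by (intro powr_mono2) auto
    moreover have "z \<le> z powr c"
    proof (cases "z = 0")
      case False
      then have "z powr 1 \<le> z powr c" using z \<open>\<not> z \<ge> 1\<close> assms by (intro powr_mono') auto
      then show ?thesis using z by simp
    qed simp
    ultimately show ?thesis using False by simp
  qed
  then have "m powr c * \<bar>z powr c - 1\<bar> \<le> m powr c * \<bar>z - 1\<bar>" by (intro mult_left_mono) auto
  moreover have "\<bar>p powr c - m powr c\<bar> = m powr c * \<bar>z powr c - 1\<bar>"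
  proof -
    have "p powr c - m powr c = m powr c * (z powr c - 1)"
      unfolding p using z assms by (simp add: powr_mult algebra_simps)
    then show ?thesis by (simp add: abs_mult)
  qed
  moreover have "m powr c * \<bar>z - 1\<bar> = m powr (c - 1) * \<bar>p - m\<bar>"
  proof -
    have "p - m = m * (z - 1)" unfolding p by (simp add: algebra_simps)
    then have "\<bar>p - m\<bar> = m * \<bar>z - 1\<bar>" using assms by (simp add: abs_mult)
    moreover have "m powr (c - 1) * m = m powr c" using assms by (simp add: powr_diff)
    ultimately show ?thesis by (metis mult.assoc)
  qed
  ultimately show ?thesis by simp
qed

context log_solution
begin

lemma continuous_f_neg: "continuous_on {..<0} f"
  unfolding f_rho_def using tau by (intro continuous_intros) auto

lemma tendsto_f:
  assumes "(g \<longlongrightarrow> p) F" "p < 0" shows "((\<lambda>x. f (g x)) \<longlongrightarrow> f p) F"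
proof -
  have "isCont f p" using continuous_f_neg assms(2) by (simp add: continuous_on_eq_continuous_at)
  then show ?thesis using assms(1) by (rule isCont_tendsto_compose)
qed

lemma difference_eq:
  assumes x: "x \<noteq> 0" "a0 < sl x"
  defines "n \<equiv> norm x" and "N \<equiv> real DIM('a)"
  shows "n\<^sup>2 * (gw x - (w2 - (N - 2) * w1) / n\<^sup>2) - (N - 2) * (x \<bullet> (Gw x - (- w1 / n\<^sup>2) *\<^sub>R x))
    = exp ((q - 1) * (w x - b * sl x)) - (n * norm (Gw x))\<^sup>2 + 2 * \<rho> * (x \<bullet> Gw x)
      - lam * (n * norm (Gw x)) powr (1 - \<tau>) - w2"
proof -
  have n: "n > 0" using x by (simp add: n_def)
  have "x \<bullet> ((- w1 / n\<^sup>2) *\<^sub>R x) = - w1" using n by (simp add: n_def power2_norm_eq_inner[symmetric])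
  then have 1: "x \<bullet> (Gw x - (- w1 / n\<^sup>2) *\<^sub>R x) = x \<bullet> Gw x + w1" by (simp only: inner_diff_right)
  have 2: "n\<^sup>2 * (gw x - (w2 - (N - 2) * w1) / n\<^sup>2) = n\<^sup>2 * gw x - (w2 - (N - 2) * w1)"
    unfolding right_diff_distrib[of _ "gw x"] using n by simp
  show ?thesis unfolding 1 2 using eqn[OF x] unfolding n_def N_def by (simp add: algebra_simps)
qed

lemma difference_ineq:
  fixes w1 w2 :: real
  assumes x: "x \<noteq> 0" "a0 < sl x" and m0: "0 < m0" "m0 \<le> \<bar>w1\<bar>"
  defines "n \<equiv> norm x" and "N \<equiv> real DIM('a)"
  defines "GV \<equiv> Gw x - (- w1 / n\<^sup>2) *\<^sub>R x" and "gV \<equiv> gw x - (w2 - (N - 2) * w1) / n\<^sup>2"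
  shows "n\<^sup>2 * (- gV) - (N - 2) * (x \<bullet> (- GV)) \<le> (w2 + f w1) + (n * norm GV)\<^sup>2
     + (2 * \<bar>w1\<bar> + 2 * \<bar>\<rho>\<bar> + \<bar>lam\<bar> * m0 powr (- \<tau>)) * (n * norm GV)"
    (is "?lhs \<le> _")
proof -
  define a P z where "a = n * norm GV" and "P = n * norm (Gw x)" and "z = x \<bullet> GV"
  have n: "n > 0" using x by (simp add: n_def)
  have xx: "x \<bullet> ((- w1 / n\<^sup>2) *\<^sub>R x) = - w1" using n by (simp add: n_def power2_norm_eq_inner[symmetric])
  have xG: "x \<bullet> Gw x = z - w1" unfolding z_def GV_def inner_diff_right xx by simp
  have Gw: "Gw x = GV + (- w1 / n\<^sup>2) *\<^sub>R x" by (simp add: GV_def)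
  have nw: "n * norm ((- w1 / n\<^sup>2) *\<^sub>R x) = \<bar>w1\<bar>" using n by (simp add: n_def power2_eq_square)
  have P2: "P\<^sup>2 = a\<^sup>2 - 2 * w1 * z + w1\<^sup>2"
  proof -
    have "(norm (Gw x))\<^sup>2 = (norm GV)\<^sup>2 + 2 * (- w1 / n\<^sup>2) * z + (norm ((- w1 / n\<^sup>2) *\<^sub>R x))\<^sup>2"
    proof -
      have "(A + c *\<^sub>R x) \<bullet> (A + c *\<^sub>R x) = A \<bullet> A + 2 * c * (x \<bullet> A) + (c *\<^sub>R x) \<bullet> (c *\<^sub>R x)" for A c
        by (simp add: inner_add_left inner_add_right inner_commute[of A x] distrib_left)
      then show ?thesis unfolding Gw power2_norm_eq_inner z_def .
    qed
    then have "n\<^sup>2 * (norm (Gw x))\<^sup>2 = n\<^sup>2 * (norm GV)\<^sup>2 + n\<^sup>2 * (2 * (- w1 / n\<^sup>2) * z) + (n * norm ((- w1 / n\<^sup>2) *\<^sub>R x))\<^sup>2"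
      by (simp only: distrib_left power_mult_distrib)
    then show ?thesis unfolding nw P_def a_def using n by (simp add: power_mult_distrib)
  qed
  have za: "\<bar>z\<bar> \<le> a" unfolding z_def a_def n_def by (rule Cauchy_Schwarz_ineq2)
  have a0: "a \<ge> 0" using n by (simp add: a_def)
  have Pa: "\<bar>P - \<bar>w1\<bar>\<bar> \<le> a"
  proof -
    have "\<bar>norm (Gw x) - norm ((- w1 / n\<^sup>2) *\<^sub>R x)\<bar> \<le> norm GV" unfolding Gw
      using norm_triangle_ineq3[of "GV + (- w1 / n\<^sup>2) *\<^sub>R x" "(- w1 / n\<^sup>2) *\<^sub>R x"] by simp
    then have "n * \<bar>norm (Gw x) - norm ((- w1 / n\<^sup>2) *\<^sub>R x)\<bar> \<le> n * norm GV" using n by (intro mult_left_mono) auto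
    moreover have "n * \<bar>norm (Gw x) - norm ((- w1 / n\<^sup>2) *\<^sub>R x)\<bar> = \<bar>P - \<bar>w1\<bar>\<bar>"
      unfolding P_def nw[symmetric] right_diff_distrib[symmetric] abs_mult using n by simp
    ultimately show ?thesis by (simp add: a_def)
  qed
  have pw: "\<bar>P powr (1 - \<tau>) - \<bar>w1\<bar> powr (1 - \<tau>)\<bar> \<le> m0 powr (- \<tau>) * a"
  proof -
    have "\<bar>P powr (1 - \<tau>) - \<bar>w1\<bar> powr (1 - \<tau>)\<bar> \<le> \<bar>w1\<bar> powr (1 - \<tau> - 1) * \<bar>P - \<bar>w1\<bar>\<bar>"
      using tau m0 n by (intro powr_diff_bound) (auto simp: P_def)
    also have "\<dots> \<le> m0 powr (- \<tau>) * a"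
    proof (intro mult_mono Pa)
      show "\<bar>w1\<bar> powr (1 - \<tau> - 1) \<le> m0 powr (- \<tau>)" using tau m0 by (simp add: powr_mono2')
    qed auto
    finally show ?thesis .
  qed
  have "?lhs = - (n\<^sup>2 * gV - (N - 2) * (x \<bullet> GV))" by (simp add: algebra_simps)
  also have "\<dots> = - (exp ((q - 1) * (w x - b * sl x)) - P\<^sup>2 + 2 * \<rho> * (x \<bullet> Gw x) - lam * P powr (1 - \<tau>) - w2)"
    using difference_eq[OF x, of w2 w1] unfolding gV_def GV_def P_def n_def N_def by (simp only:)
  also have "\<dots> = - exp ((q - 1) * (w x - b * sl x)) + (w2 + f w1) + a\<^sup>2 + (- 2 * w1 - 2 * \<rho>) * z
     + lam * (P powr (1 - \<tau>) - \<bar>w1\<bar> powr (1 - \<tau>))"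
    unfolding P2 xG f_rho_def by (simp add: power2_eq_square algebra_simps)
  also have "\<dots> \<le> (w2 + f w1) + a\<^sup>2 + (2 * \<bar>w1\<bar> + 2 * \<bar>\<rho>\<bar>) * a + \<bar>lam\<bar> * (m0 powr (- \<tau>) * a)"
  proof -
    have "(- 2 * w1 - 2 * \<rho>) * z \<le> \<bar>(- 2 * w1 - 2 * \<rho>) * z\<bar>" by simp
    also have "\<dots> \<le> (2 * \<bar>w1\<bar> + 2 * \<bar>\<rho>\<bar>) * a" unfolding abs_mult using za by (intro mult_mono) auto
    finally have 1: "(- 2 * w1 - 2 * \<rho>) * z \<le> (2 * \<bar>w1\<bar> + 2 * \<bar>\<rho>\<bar>) * a" .
    have "lam * (P powr (1 - \<tau>) - \<bar>w1\<bar> powr (1 - \<tau>)) \<le> \<bar>lam * (P powr (1 - \<tau>) - \<bar>w1\<bar> powr (1 - \<tau>))\<bar>" by simp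
    also have "\<dots> \<le> \<bar>lam\<bar> * (m0 powr (- \<tau>) * a)" unfolding abs_mult using pw by (intro mult_left_mono) auto
    finally have 2: "lam * (P powr (1 - \<tau>) - \<bar>w1\<bar> powr (1 - \<tau>)) \<le> \<bar>lam\<bar> * (m0 powr (- \<tau>) * a)" .
    have 3: "exp ((q - 1) * (w x - b * sl x)) > 0" by simp
    show ?thesis using 1 2 3 by linarith
  qed
  finally show ?thesis unfolding a_def by (simp add: algebra_simps)
qed

lemma wlap_difference:
  assumes a1: "a0 \<le> a1"
    and W: "\<And>s. a1 < s \<Longrightarrow> (W0 has_real_derivative W1 s) (at s)" "\<And>s. a1 < s \<Longrightarrow> (W1 has_real_derivative W2 s) (at s)"
      "continuous_on {a1<..} W2"
  shows "wlap {x. x \<noteq> 0 \<and> a1 < sl x} (\<lambda>x. w x - W0 (sl x)) (\<lambda>x. Gw x - (- W1 (sl x) / (norm x)\<^sup>2) *\<^sub>R x)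
    (\<lambda>x. gw x - (W2 (sl x) - (real DIM('a) - 2) * W1 (sl x)) / (norm x)\<^sup>2)"
proof -
  have e: "{x::'a. x \<noteq> 0 \<and> a1 < sl x} = {x. x \<noteq> 0 \<and> sl x \<in> {a1<..}}" by auto
  have o: "open {x::'a. x \<noteq> 0 \<and> a1 < sl x}" unfolding e by (rule open_sl_preimage) simp
  show ?thesis
  proof (rule wlap_diff)
    show "wlap {x. x \<noteq> 0 \<and> a1 < sl x} w Gw gw" by (rule wlap_subset[OF w _ o]) (use a1 in auto)
    show "wlap {x::'a. x \<noteq> 0 \<and> a1 < sl x} (\<lambda>x. W0 (sl x)) (\<lambda>x. (- W1 (sl x) / (norm x)\<^sup>2) *\<^sub>R x)
      (\<lambda>x. (W2 (sl x) - (real DIM('a) - 2) * W1 (sl x)) / (norm x)\<^sup>2)"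
      unfolding e by (rule wlap_radial) (use W in auto)
  qed
qed

lemma smin_bounds:
  assumes "a0 < s"
  shows "\<exists>x. x \<noteq> 0 \<and> sl x = s \<and> w x = smin w s" "x \<noteq> 0 \<Longrightarrow> sl x = s \<Longrightarrow> smin w s \<le> w x"
proof -
  have "continuous_on {x. x \<noteq> 0 \<and> sl x = s} w" by (rule continuous_w) (use assms in auto)
  from smax_smin(3)[OF this] smax_smin(4)[OF this]
  show "\<exists>x. x \<noteq> 0 \<and> sl x = s \<and> w x = smin w s" "x \<noteq> 0 \<Longrightarrow> sl x = s \<Longrightarrow> smin w s \<le> w x" by auto
qed

text \<open>A translate \<open>T + k\<close> with \<open>k \<le> C\<close> is still a subsolution,
  so the bound \<open>w \<ge> T + k\<close> on two spheres carries over to the annulus between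
  them.\<close>

lemma smin_quasiconcave:
  assumes A: "a0 \<le> A"
    and T: "\<And>s. A < s \<Longrightarrow> (T has_real_derivative T1 s) (at s)" "\<And>s. A < s \<Longrightarrow> (T1 has_real_derivative T2 s) (at s)"
      "continuous_on {A<..} T2"
    and sub: "\<And>s. A < s \<Longrightarrow> T2 s + f (T1 s) \<ge> exp ((q - 1) * (T s + C - b * s))"
    and s: "A < a" "a \<le> s" "s \<le> c" and k: "k \<le> C" "k \<le> smin w a - T a" "k \<le> smin w c - T c"
  shows "k \<le> smin w s - T s"
proof -
  obtain x where x: "x \<noteq> 0" "sl x = s" "w x = smin w s" using smin_bounds(1)[of s] s A by auto
  have "w x \<ge> T (sl x) + k"
  proof (rule radial_lower[where a = a and c = c and B = "\<lambda>s. T s + k" and ?B1.0 = T1 and ?B2.0 = T2])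
    have "continuous_on {a..c} T"
      by (rule DERIV_continuous_on[of _ T T1]) (use T(1) s in \<open>auto intro: has_field_derivative_at_within\<close>)
    then show "continuous_on {a..c} (\<lambda>s. T s + k)" by (intro continuous_intros)
    show "continuous_on {a<..<c} T2" by (rule continuous_on_subset[OF T(3)]) (use s in auto)
    fix r assume r: "a < r" "r < c"
    then have r': "A < r" using s by simp
    show "((\<lambda>s. T s + k) has_real_derivative T1 r) (at r)" using DERIV_add[OF T(1)[OF r'] DERIV_const[of k]] by simp
    show "(T1 has_real_derivative T2 r) (at r)" by (rule T(2)[OF r'])
    have "(q - 1) * (T r + k - b * r) \<le> (q - 1) * (T r + C - b * r)" using k q by (intro mult_left_mono) auto
    then have "exp ((q - 1) * (T r + k - b * r)) \<le> exp ((q - 1) * (T r + C - b * r))" by (subst exp_le_cancel_iff)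
    also have "\<dots> \<le> T2 r + f (T1 r)" by (rule sub[OF r'])
    finally show "exp ((q - 1) * (T r + k - b * r)) \<le> T2 r + f (T1 r)" .
  next
    fix v :: 'a assume v: "v \<noteq> 0" "sl v = a \<or> sl v = c"
    then show "T (sl v) + k \<le> w v" using smin_bounds(2)[of "sl v" v] k s A by auto
  qed (use s A x in auto)
  then show ?thesis using x by simp
qed

text \<open>\<open>S0\<close> satisfies its inequality with right-hand side 0, so all its translates
  are supersolutions; \<open>T0\<close> has to beat the exponential, but only for the translates up
  to \<open>M + 1\<close> that can occur. If the limits \<open>Lp\<close> of the maxima and
  \<open>Lm\<close> of the minima differed, the growth lemma would carry the gap from a minimum
  point to the maximum point on the same sphere.\<close>

lemma convergence:
  assumes a1: "a0 \<le> a1" and E: "\<And>x. x \<noteq> 0 \<Longrightarrow> a1 < sl x \<Longrightarrow> exp ((q - 1) * (w x - b * sl x)) \<le> E"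
    and W: "\<And>s. a1 < s \<Longrightarrow> (W0 has_real_derivative W1 s) (at s)" "\<And>s. a1 < s \<Longrightarrow> (W1 has_real_derivative W2 s) (at s)"
      "continuous_on {a1<..} W2"
    and Wlim: "(W1 \<longlongrightarrow> \<omega>) at_top" "(W2 \<longlongrightarrow> 0) at_top" and \<omega>: "\<omega> < 0" "f \<omega> = 0"
    and VM: "\<And>x. x \<noteq> 0 \<Longrightarrow> a1 < sl x \<Longrightarrow> \<bar>w x - W0 (sl x)\<bar> \<le> M"
    and S: "\<And>s. a1 < s \<Longrightarrow> (S0 has_real_derivative S1 s) (at s)" "\<And>s. a1 < s \<Longrightarrow> (S1 has_real_derivative S2 s) (at s)"
      "continuous_on {a1<..} S2"
    and Ssup: "\<And>s. a1 < s \<Longrightarrow> S2 s + f (S1 s) \<le> 0"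
    and SW: "((\<lambda>s. S0 s - W0 s) \<longlongrightarrow> 0) at_top" "\<And>s. a1 < s \<Longrightarrow> \<bar>S0 s - W0 s\<bar> \<le> 1"
    and T: "\<And>s. a1 < s \<Longrightarrow> (T0 has_real_derivative T1 s) (at s)" "\<And>s. a1 < s \<Longrightarrow> (T1 has_real_derivative T2 s) (at s)"
      "continuous_on {a1<..} T2"
    and Tsub: "\<And>s. a1 < s \<Longrightarrow> T2 s + f (T1 s) \<ge> exp ((q - 1) * (T0 s + (M + 1) - b * s))"
    and TW: "((\<lambda>s. T0 s - W0 s) \<longlongrightarrow> 0) at_top" "\<And>s. a1 < s \<Longrightarrow> \<bar>T0 s - W0 s\<bar> \<le> 1"
  shows "\<exists>L. ((\<lambda>x. w x - W0 (sl x)) \<longlongrightarrow> L) (at 0)"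
proof -
  let ?N = "real DIM('a)"
  define V where "V = (\<lambda>x. w x - W0 (sl x))"
  define GV where "GV = (\<lambda>x. Gw x - (- W1 (sl x) / (norm x)\<^sup>2) *\<^sub>R x)"
  define gV where "gV = (\<lambda>x. gw x - (W2 (sl x) - (?N - 2) * W1 (sl x)) / (norm x)\<^sup>2)"
  have wV: "wlap {x. x \<noteq> 0 \<and> a1 < sl x} V GV gV"
    unfolding V_def GV_def gV_def by (rule wlap_difference[OF a1 W])
  have cV: "continuous_on {x. x \<noteq> 0 \<and> sl x = s} V" if "a1 < s" for s
    by (rule continuous_on_subset[OF wlapD(5)[OF wV]]) (use that in auto)
  note sm = smax_smin[OF cV]
  have smM: "\<bar>smax V s\<bar> \<le> M" "\<bar>smin V s\<bar> \<le> M" if as: "a1 < s" for s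
  proof -
    obtain x where "x \<noteq> 0" "sl x = s" "V x = smax V s" using sm(1)[OF as] by blast
    moreover obtain y where "y \<noteq> 0" "sl y = s" "V y = smin V s" using sm(3)[OF as] by blast
    ultimately show "\<bar>smax V s\<bar> \<le> M" "\<bar>smin V s\<bar> \<le> M" using VM[of x] VM[of y] as unfolding V_def by auto
  qed
  define p where "p = (\<lambda>s. smax V s - (S0 s - W0 s))"
  define r where "r = (\<lambda>s. smin V s - (T0 s - W0 s))"
  have cont: "continuous_on {a..c} B" if "\<And>s. a1 < s \<Longrightarrow> (B has_real_derivative B1 s) (at s)" "a1 < a" for a c and B B1 :: "real \<Rightarrow> real"
    using that by (intro DERIV_continuous_on[of _ B B1]) (auto intro: has_field_derivative_at_within)
  have qp: "p s \<le> max (p a) (p c)" if s: "a1 < a" "a \<le> s" "s \<le> c" for a s c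
  proof -
    define k where "k = max (p a) (p c)"
    obtain x where x: "x \<noteq> 0" "sl x = s" "V x = smax V s" using sm(1)[of s] s by auto
    have "w x \<le> S0 (sl x) + k"
    proof (rule radial_upper[where a = a and c = c and ?B1.0 = S1 and ?B2.0 = S2])
      show "continuous_on {a..c} (\<lambda>s. S0 s + k)" using s by (intro continuous_intros cont[OF S(1)]) auto
      show "continuous_on {a<..<c} S2" by (rule continuous_on_subset[OF S(3)]) (use s in auto)
      fix t assume t: "a < t" "t < c"
      show "((\<lambda>s. S0 s + k) has_real_derivative S1 t) (at t)" using S(1)[of t] t s by (auto intro!: derivative_eq_intros)
      show "(S1 has_real_derivative S2 t) (at t)" using S(2)[of t] t s by simp
      show "S2 t + f (S1 t) \<le> exp ((q - 1) * (S0 t + k - b * t))"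
        using Ssup[of t] t s by (intro order_trans[OF _ exp_ge_zero]) auto
    next
      fix y :: 'a assume y: "y \<noteq> 0" "sl y = a \<or> sl y = c"
      then have "V y \<le> smax V (sl y)" using sm(2)[of "sl y" y] s by auto
      moreover have "p (sl y) \<le> k" using y(2) by (auto simp: k_def)
      ultimately show "w y \<le> S0 (sl y) + k" unfolding p_def V_def by linarith
    qed (use s a1 x in auto)
    then show ?thesis using x unfolding p_def k_def V_def by auto
  qed
  have sV: "smin V s = smin w s - W0 s" if as: "a1 < s" for s
  proof -
    obtain x where x: "x \<noteq> 0" "sl x = s" "V x = smin V s" using sm(3)[OF as] by blast
    obtain y where y: "y \<noteq> 0" "sl y = s" "w y = smin w s" using smin_bounds(1)[of s] as a1 by auto
    have "smin w s \<le> w x" "smin V s \<le> V y" using smin_bounds(2)[of s x] sm(4)[OF as y(1,2)] x as a1 by auto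
    then show ?thesis using x y unfolding V_def by auto
  qed
  have qr: "- r s \<le> max (- r a) (- r c)" if s: "a1 < a" "a \<le> s" "s \<le> c" for a s c
  proof -
    define k where "k = min (r a) (r c)"
    have r: "r t = smin w t - T0 t" if "a1 < t" for t using sV[OF that] by (simp add: r_def)
    have k: "k \<le> r a" "k \<le> r c" by (auto simp: k_def)
    have "k \<le> M + 1" using smM(2)[OF s(1)] TW(2)[OF s(1)] k unfolding r_def by linarith
    from smin_quasiconcave[OF a1 T Tsub s this] have "k \<le> r s" using r k s by simp
    then show ?thesis by (auto simp: k_def min_def max_def split: if_splits)
  qed
  have "\<exists>L. (p \<longlongrightarrow> L) at_top"
  proof (rule quasiconvex_bounded_tendsto[where A = a1 and M = "M + 1"])
    show "a1 < s \<Longrightarrow> \<bar>p s\<bar> \<le> M + 1" for s using smM(1)[of s] SW(2)[of s] unfolding p_def by linarith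
  qed (rule qp)
  then obtain Lp where Lp: "(p \<longlongrightarrow> Lp) at_top" by blast
  have "\<exists>L. ((\<lambda>s. - r s) \<longlongrightarrow> L) at_top"
  proof (rule quasiconvex_bounded_tendsto[where A = a1 and M = "M + 1"])
    show "a1 < s \<Longrightarrow> \<bar>- r s\<bar> \<le> M + 1" for s using smM(2)[of s] TW(2)[of s] unfolding r_def by linarith
  qed (rule qr)
  then obtain Lr where Lr: "((\<lambda>s. - r s) \<longlongrightarrow> Lr) at_top" by blast
  define Lm where "Lm = - Lr"
  have smaxL: "(smax V \<longlongrightarrow> Lp) at_top"
    using tendsto_add[OF Lp SW(1)] by (simp add: p_def)
  have sminL: "(smin V \<longlongrightarrow> Lm) at_top"
    using tendsto_add[OF tendsto_minus[OF Lr] TW(1)] by (simp add: r_def Lm_def)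
  have "Lm \<le> Lp"
  proof (rule tendsto_le[OF _ smaxL sminL])
    show "\<forall>\<^sub>F s in at_top. smin V s \<le> smax V s"
      using eventually_gt_at_top[of a1]
    proof eventually_elim
      case (elim s)
      obtain x where "x \<noteq> 0" "sl x = s" "V x = smin V s" using sm(3)[OF elim] by blast
      then show ?case using sm(2)[OF elim, of x] by simp
    qed
  qed simp
  moreover have "\<not> Lm < Lp"
  proof
    assume lt: "Lm < Lp"
    obtain Lg where Lg: "Lg \<ge> 0" "\<And>y. y \<noteq> 0 \<Longrightarrow> a1 + 6 < sl y \<Longrightarrow> norm y * norm (Gw y) \<le> Lg"
      using log_gradient_bound[OF a1 E] by blast
    define m0 where "m0 = \<bar>\<omega>\<bar> / 2"
    have m0: "m0 > 0" using \<omega> by (simp add: m0_def)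
    define C where "C = 1 + 4 * \<bar>\<omega>\<bar> + 2 * \<bar>\<rho>\<bar> + \<bar>lam\<bar> * m0 powr (- \<tau>)"
    have C: "C \<ge> 1" by (simp add: C_def)
    define g where "g = growth_exp (?N - 1) (2 * C)"
    have g: "g \<ge> 7" unfolding g_def using dim C by (intro growth_exp_ge) auto
    define \<eta> where "\<eta> = (Lp - Lm) / 4"
    have \<eta>: "\<eta> > 0" using lt by (simp add: \<eta>_def)
    define LV where "LV = Lg + 2 * \<bar>\<omega>\<bar> + 1"
    have LV: "LV \<ge> 1" using Lg by (simp add: LV_def)
    \<comment> \<open>\<open>10 * LV * \<nu>\<close> bounds the change of \<open>V\<close> over the
      set \<open>pole x1 z \<le> \<nu>\<^sup>2\<close>, by the gradient bound; 1/40 keeps that set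
      within the range of \<open>near_sl\<close>.\<close>
    define \<nu> where "\<nu> = min (1 / 40) (\<eta> / (10 * LV))"
    have \<nu>: "\<nu> > 0" "\<nu> \<le> 1 / 40" "10 * LV * \<nu> \<le> \<eta>"
      using \<eta> LV by (auto simp: \<nu>_def min_def field_simps)
    define \<delta> where "\<delta> = \<nu>\<^sup>2"
    have "\<delta> \<le> (1 / 40)\<^sup>2" unfolding \<delta>_def using \<nu> by (intro power_mono) auto
    then have \<delta>: "0 < \<delta>" "\<delta> \<le> 1 / 4" "sqrt \<delta> = \<nu>" using \<nu> by (auto simp: \<delta>_def power2_eq_square)
    \<comment> \<open>The first bound keeps the barrier below \<open>Y\<close> on the inner level,
      the second is the condition \<open>small\<close> of \<open>hopf_growth\<close> with
      \<open>\<kappa> = 1\<close>.\<close>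
    define c where "c = min (2 * \<eta> * \<delta> powr g) (1 / (2 * g * \<delta> powr (- g - 1)))"
    have c: "c > 0" using \<eta> \<delta> g by (auto simp: c_def)
    have c1: "c * \<delta> powr (- g) \<le> 2 * \<eta>"
    proof -
      have "c * \<delta> powr (- g) \<le> (2 * \<eta> * \<delta> powr g) * \<delta> powr (- g)" by (intro mult_right_mono) (auto simp: c_def)
      also have "\<dots> = 2 * \<eta> * (\<delta> powr g * \<delta> powr (- g))" by simp
      also have "\<delta> powr g * \<delta> powr (- g) = 1" using \<delta> by (simp add: powr_minus)
      finally show ?thesis by simp
    qed
    have c2: "2 * 1 * c * g * \<delta> powr (- g - 1) \<le> 1"
    proof -
      have "c * (2 * g * \<delta> powr (- g - 1)) \<le> 1 / (2 * g * \<delta> powr (- g - 1)) * (2 * g * \<delta> powr (- g - 1))"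
        using g by (intro mult_right_mono) (auto simp: c_def)
      then show ?thesis using g \<delta> by (simp add: mult_ac)
    qed
    define hm where "hm = (2::real) powr (- g) - 3 powr (- g)"
    have hm: "hm > 0" unfolding hm_def using g by (simp add: powr_less_mono2_neg)
    have chm: "c * hm \<le> 2 * \<eta>"
    proof -
      have "hm \<le> 2 powr (- g)" by (simp add: hm_def)
      also have "\<dots> \<le> \<delta> powr (- g)" using \<delta> g by (intro powr_mono2') auto
      finally have "c * hm \<le> c * \<delta> powr (- g)" using c by (intro mult_left_mono) auto
      then show ?thesis using c1 by linarith
    qed
    \<comment> \<open>Fixed only after \<open>c\<close> and \<open>hm\<close>: at the maximum point
      \<open>Y\<close> is at most \<open>3 * \<epsilon>\<close>, which has to contradict the lower
      bound \<open>c * hm\<close>.\<close>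
    define \<epsilon> where "\<epsilon> = min (c * hm / 8) \<eta>"
    have \<epsilon>: "\<epsilon> > 0" "\<epsilon> \<le> c * hm / 8" "\<epsilon> \<le> \<eta>" using c hm \<eta> by (auto simp: \<epsilon>_def)
    have "\<forall>\<^sub>F s in at_top. smax V s < Lp + \<epsilon> \<and> smax V s > Lp - \<epsilon> \<and> smin V s < Lm + \<eta>
       \<and> W2 s + f (W1 s) < \<epsilon> \<and> W1 s > 2 * \<omega> \<and> W1 s < \<omega> / 2"
    proof -
      have "((\<lambda>s. W2 s + f (W1 s)) \<longlongrightarrow> 0 + f \<omega>) at_top" by (intro tendsto_add Wlim tendsto_f \<omega>)
      then have "\<forall>\<^sub>F s in at_top. W2 s + f (W1 s) < \<epsilon>" using \<omega>(2) \<epsilon> by (intro order_tendstoD) auto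
      moreover have "\<forall>\<^sub>F s in at_top. smax V s < Lp + \<epsilon>" "\<forall>\<^sub>F s in at_top. smax V s > Lp - \<epsilon>" "\<forall>\<^sub>F s in at_top. smin V s < Lm + \<eta>"
        using order_tendstoD[OF smaxL] order_tendstoD[OF sminL] \<epsilon> \<eta> by auto
      moreover have "\<forall>\<^sub>F s in at_top. W1 s > 2 * \<omega>" "\<forall>\<^sub>F s in at_top. W1 s < \<omega> / 2"
        subgoal by (rule order_tendstoD(1)[OF Wlim(1)]) (use \<omega> in simp)
        subgoal by (rule order_tendstoD(2)[OF Wlim(1)]) (use \<omega> in simp)
        done
      ultimately show ?thesis by eventually_elim blast
    qed
    then obtain s0 where s0: "\<And>s. s \<ge> s0 \<Longrightarrow> smax V s < Lp + \<epsilon> \<and> smax V s > Lp - \<epsilon> \<and> smin V s < Lm + \<eta>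
       \<and> W2 s + f (W1 s) < \<epsilon> \<and> W1 s > 2 * \<omega> \<and> W1 s < \<omega> / 2"
      unfolding eventually_at_top_linorder by blast
    \<comment> \<open>The offset 5 keeps all \<open>z\<close> with
      \<open>|sl z - s1| \<le> 4\<close>, hence all \<open>z\<close> with
      \<open>pole x1 z \<le> 3\<close>, beyond \<open>s0\<close> and inside the domain of the
      gradient bound.\<close>
    define s1 where "s1 = max s0 (a1 + 6) + 5"
    have s1: "s1 > a1" "s1 - 4 > a1 + 6" "s1 - 4 \<ge> s0" "s1 \<ge> s0" by (auto simp: s1_def)
    obtain x1 where x1: "x1 \<noteq> 0" "sl x1 = s1" "V x1 = smin V s1" using sm(3)[OF s1(1)] by blast
    obtain x2 where x2: "x2 \<noteq> 0" "sl x2 = s1" "V x2 = smax V s1" using sm(1)[OF s1(1)] by blast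
    have far: "a1 + 6 < sl z" "s0 \<le> sl z" if "s1 - 4 \<le> sl z" for z :: 'a
      using that s1 by auto
    have nGV: "norm z * norm (GV z) \<le> LV" if z: "z \<noteq> 0" "s1 - 4 \<le> sl z" for z
    proof -
      have "norm z * norm ((- W1 (sl z) / (norm z)\<^sup>2) *\<^sub>R z) = \<bar>W1 (sl z)\<bar>" using z(1) by (simp add: power2_eq_square)
      moreover have "\<bar>W1 (sl z)\<bar> \<le> 2 * \<bar>\<omega>\<bar>" using s0[OF far(2)[OF z(2)]] \<omega> by auto
      moreover have "norm z * norm (GV z) \<le> norm z * (norm (Gw z) + norm ((- W1 (sl z) / (norm z)\<^sup>2) *\<^sub>R z))"
        unfolding GV_def by (intro mult_left_mono norm_triangle_ineq4) auto
      ultimately show ?thesis using Lg(2)[OF z(1) far(1)[OF z(2)]] by (simp add: LV_def distrib_left)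
    qed
    have close: "V z \<le> V x1 + \<eta>" if z: "z \<noteq> 0" "pole x1 z \<le> \<delta>" for z
    proof -
      have dz: "dist x1 z \<le> 5 * \<nu> * norm x1" using pole_near[OF x1(1) z(1) _ \<delta>(2) z(2)] \<delta> by simp
      define rsqrt where "rsqrt = 5 * \<nu> * norm x1"
      have near: "y \<noteq> 0 \<and> s1 - 4 \<le> sl y \<and> norm x1 / 2 \<le> norm y" if "y \<in> cball x1 rsqrt" for y
      proof -
        have "5 * \<nu> * norm x1 \<le> 1 / 8 * norm x1" using \<nu> by (intro mult_right_mono) auto
        then have "dist x1 y \<le> 1 * norm x1 / 8" using that by (simp add: rsqrt_def)
        from near_sl[OF x1(1) _ _ this] show ?thesis using x1(2) unfolding abs_le_iff by auto
      qed
      have "\<bar>V z - V x1\<bar> \<le> (2 * LV / norm x1) * dist x1 z"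
      proof (rule wlap_lipschitz[OF wV])
        show "cball x1 rsqrt \<subseteq> {x. x \<noteq> 0 \<and> a1 < sl x}" using near far s1 by fastforce
        fix y assume y: "y \<in> cball x1 rsqrt"
        have "norm x1 / 2 * norm (GV y) \<le> norm y * norm (GV y)" using near[OF y] by (intro mult_right_mono) auto
        also have "\<dots> \<le> LV" using near[OF y] by (intro nGV) auto
        finally show "norm (GV y) \<le> 2 * LV / norm x1" using x1 by (simp add: field_simps)
      qed (use dz in \<open>simp add: rsqrt_def\<close>)
      also have "\<dots> \<le> (2 * LV / norm x1) * (5 * \<nu> * norm x1)" using LV dz by (intro mult_left_mono) auto
      also have "\<dots> = 10 * LV * \<nu>" using x1 by simp
      finally show ?thesis using \<nu>(3) by linarith
    qed
    \<comment> \<open>The surplus \<open>2 * \<epsilon>\<close> keeps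
      \<open>Y \<ge> \<epsilon>\<close>, so that the error \<open>W2 + f W1\<close> of the profile
      is absorbed by \<open>Y\<close>.\<close>
    define Y where "Y = (\<lambda>x. (Lp + 2 * \<epsilon>) - V x)"
    have wY: "wlap {x. x \<noteq> 0 \<and> a1 < sl x} Y (\<lambda>x. 0 - GV x) (\<lambda>x. 0 - gV x)"
      unfolding Y_def by (rule wlap_diff[OF wlap_const[OF wlapD(1)[OF wV]] wV])
    have Yeps: "Y x \<ge> \<epsilon>" if x: "x \<noteq> 0" "s1 - 4 \<le> sl x" for x
    proof -
      have "V x \<le> smax V (sl x)" using sm(2)[of "sl x" x] x far[of x] by auto
      then show ?thesis using s0[OF far(2)[OF x(2)]] unfolding Y_def by linarith
    qed
    have win: "s1 - 4 \<le> sl z" if "pole x1 z \<le> 3" for z using pole_sl[OF that] x1(2) by (auto simp: abs_le_iff)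
    have Y2: "Y z \<ge> 2 * \<eta>" if "z \<noteq> 0" "pole x1 z \<le> \<delta>" for z
    proof -
      have "Lp = Lm + 4 * \<eta>" by (simp add: \<eta>_def field_simps)
      then show ?thesis using close[OF that] x1(3) s0[OF s1(4)] \<epsilon> unfolding Y_def by linarith
    qed
    have p2: "pole x1 x2 \<le> 2" using pole_cos[of x2 x1] x1 x2 unfolding pole_def abs_le_iff by simp
    have "Y x2 \<ge> c * hm"
    proof (cases "\<delta> \<le> pole x1 x2")
      case True
      have "Y x2 \<ge> c * (pole x1 x2 powr (- g) - 3 powr (- g))"
      proof (rule hopf_growth[OF dim x1(1) _ _ g_def wY, where \<kappa> = 1])
        fix z :: 'a assume z: "z \<noteq> 0" "pole x1 z \<le> 3"
        note w4 = win[OF z(2)]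
        show "z \<in> {x. x \<noteq> 0 \<and> a1 < sl x}" using z far[OF w4] by simp
        show "Y z \<ge> 0" using Yeps[OF z(1) w4] \<epsilon> by simp
        have W1: "2 * \<omega> < W1 (sl z)" "W1 (sl z) < \<omega> / 2" "W2 (sl z) + f (W1 (sl z)) < \<epsilon>"
          using s0[OF far(2)[OF w4]] by auto
        define a where "a = norm z * norm (GV z)"
        have "(norm z)\<^sup>2 * (- gV z) - (?N - 2) * (z \<bullet> (- GV z)) \<le> (W2 (sl z) + f (W1 (sl z))) + a\<^sup>2
           + (2 * \<bar>W1 (sl z)\<bar> + 2 * \<bar>\<rho>\<bar> + \<bar>lam\<bar> * m0 powr (- \<tau>)) * a"
          unfolding a_def gV_def GV_def using z far[OF w4] a1 W1 \<omega> m0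
          by (intro difference_ineq) (auto simp: m0_def)
        also have "\<dots> \<le> Y z + a\<^sup>2 + (2 * (2 * \<bar>\<omega>\<bar>) + 2 * \<bar>\<rho>\<bar> + \<bar>lam\<bar> * m0 powr (- \<tau>)) * a"
          using W1 Yeps[OF z(1) w4] \<omega> by (intro add_mono mult_right_mono) (auto simp: a_def)
        also have "\<dots> \<le> Y z + a\<^sup>2 + (C - 1) * a" by (simp add: C_def add.assoc)
        also have "\<dots> \<le> C * (a + 1 * a\<^sup>2 + Y z)"
        proof -
          have "a \<ge> 0" "Y z \<ge> 0" using Yeps[OF z(1) w4] \<epsilon> by (auto simp: a_def)
          then have "1 * (a\<^sup>2 + Y z) \<le> C * (a\<^sup>2 + Y z)" using C by (intro mult_right_mono) auto
          then show ?thesis using \<open>a \<ge> 0\<close> by (simp add: algebra_simps)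
        qed
        finally show "(norm z)\<^sup>2 * (0 - gV z) - (?N - 2) * (z \<bullet> (0 - GV z))
          \<le> C * (norm z * norm (0 - GV z) + 1 * (norm z * norm (0 - GV z))\<^sup>2 + Y z)"
          by (simp add: a_def)
      next
        fix z :: 'a assume "z \<noteq> 0" "pole x1 z = \<delta>"
        then show "c * \<delta> powr (- g) \<le> Y z" using Y2[of z] c1 by simp
      qed (use \<delta> c c2 C True p2 x2 in auto)
      moreover have "pole x1 x2 powr (- g) \<ge> 2 powr (- g)"
        using p2 True \<delta> g by (intro powr_mono2') auto
      then have "c * (pole x1 x2 powr (- g) - 3 powr (- g)) \<ge> c * hm" unfolding hm_def using c by (intro mult_left_mono) auto
      ultimately show ?thesis by linarith
    next
      case False
      then show ?thesis using Y2[of x2] x2 chm by simp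
    qed
    moreover have "Y x2 \<le> 3 * \<epsilon>" using x2(3) s0[OF s1(4)] unfolding Y_def by linarith
    ultimately show False using \<epsilon> by linarith
  qed
  ultimately have eq: "Lm = Lp" by simp
  have 1: "((\<lambda>x::'a. smin V (sl x)) \<longlongrightarrow> Lp) (at 0)"
    unfolding eq[symmetric] by (rule filterlim_compose[OF sminL filterlim_sl])
  have 2: "((\<lambda>x::'a. smax V (sl x)) \<longlongrightarrow> Lp) (at 0)"
    by (rule filterlim_compose[OF smaxL filterlim_sl])
  have "(V \<longlongrightarrow> Lp) (at 0)"
  proof (rule tendsto_sandwich[OF _ _ 1 2])
    show "\<forall>\<^sub>F x in at 0. smin V (sl x) \<le> V x"
    proof (rule eventually_sl[of a1])
      fix x :: 'a assume "x \<noteq> 0" "a1 < sl x"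
      then show "smin V (sl x) \<le> V x" using sm(4)[of "sl x" x] by simp
    qed
    show "\<forall>\<^sub>F x in at 0. V x \<le> smax V (sl x)"
    proof (rule eventually_sl[of a1])
      fix x :: 'a assume "x \<noteq> 0" "a1 < sl x"
      then show "V x \<le> smax V (sl x)" using sm(2)[of "sl x" x] by simp
    qed
  qed
  then show ?thesis unfolding V_def by blast
qed

text \<open>The gradient estimate for \<open>V - L\<close> on a ball of radius
  \<open>\<epsilon> * norm x\<close>: with \<open>|V - L| \<le> \<epsilon>\<^sup>2\<close> and a
  bounded scaled Laplacian, both contributions are of order \<open>\<epsilon>\<close>.\<close>

lemma gradient_limit:
  assumes a1: "a0 \<le> a1" and E: "\<And>x. x \<noteq> 0 \<Longrightarrow> a1 < sl x \<Longrightarrow> exp ((q - 1) * (w x - b * sl x)) \<le> E"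
    and W: "\<And>s. a1 < s \<Longrightarrow> (W0 has_real_derivative W1 s) (at s)" "\<And>s. a1 < s \<Longrightarrow> (W1 has_real_derivative W2 s) (at s)"
      "continuous_on {a1<..} W2"
    and Wlim: "(W1 \<longlongrightarrow> \<omega>) at_top" "(W2 \<longlongrightarrow> 0) at_top"
    and L: "((\<lambda>x. w x - W0 (sl x)) \<longlongrightarrow> L) (at 0)"
  shows "((\<lambda>x. x \<bullet> Gw x) \<longlongrightarrow> - \<omega>) (at 0)"
proof -
  let ?N = "real DIM('a)"
  define V where "V = (\<lambda>x. w x - W0 (sl x))"
  define GV where "GV = (\<lambda>x. Gw x - (- W1 (sl x) / (norm x)\<^sup>2) *\<^sub>R x)"
  define gV where "gV = (\<lambda>x. gw x - (W2 (sl x) - (?N - 2) * W1 (sl x)) / (norm x)\<^sup>2)"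
  have wV: "wlap {x. x \<noteq> 0 \<and> a1 < sl x} V GV gV"
    unfolding V_def GV_def gV_def by (rule wlap_difference[OF a1 W])
  obtain Lg where Lg: "Lg \<ge> 0" "\<And>y. y \<noteq> 0 \<Longrightarrow> a1 + 6 < sl y \<Longrightarrow> norm y * norm (Gw y) \<le> Lg"
    using log_gradient_bound[OF a1 E] by blast
  have "\<forall>\<^sub>F s in at_top. \<bar>W1 s\<bar> < \<bar>\<omega>\<bar> + 1 \<and> \<bar>W2 s\<bar> < 1"
  proof -
    have l: "((\<lambda>s. \<bar>W1 s\<bar>) \<longlongrightarrow> \<bar>\<omega>\<bar>) at_top" "((\<lambda>s. \<bar>W2 s\<bar>) \<longlongrightarrow> \<bar>0\<bar>) at_top" by (intro tendsto_intros Wlim)+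
    have "\<forall>\<^sub>F s in at_top. \<bar>W1 s\<bar> < \<bar>\<omega>\<bar> + 1" "\<forall>\<^sub>F s in at_top. \<bar>W2 s\<bar> < 1"
      using order_tendstoD(2)[OF l(1), of "\<bar>\<omega>\<bar> + 1"] order_tendstoD(2)[OF l(2), of 1] by simp_all
    then show ?thesis by eventually_elim blast
  qed
  then obtain s0 where s0: "\<And>s. s \<ge> s0 \<Longrightarrow> \<bar>W1 s\<bar> < \<bar>\<omega>\<bar> + 1 \<and> \<bar>W2 s\<bar> < 1"
    unfolding eventually_at_top_linorder by blast
  define a2 where "a2 = max (a1 + 6) s0"
  have a2: "a2 \<ge> a1 + 6" "a2 \<ge> s0" by (auto simp: a2_def)
  define Cg where "Cg = E + Lg\<^sup>2 + 2 * \<bar>\<rho>\<bar> * Lg + \<bar>lam\<bar> * (1 + Lg) + 1 + ?N * (Lg + \<bar>\<omega>\<bar> + 1)"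
  have bound: "(norm x)\<^sup>2 * \<bar>gV x\<bar> \<le> Cg" if x: "x \<noteq> 0" "a2 < sl x" for x
  proof -
    have x1: "a1 < sl x" "a0 < sl x" "a1 + 6 < sl x" using x a2 a1 by auto
    note W1 = s0[of "sl x"]
    define P where "P = norm x * norm (Gw x)"
    have P: "0 \<le> P" "P \<le> Lg" using Lg(2)[OF x(1) x1(3)] by (auto simp: P_def)
    have xG: "\<bar>x \<bullet> Gw x\<bar> \<le> P" unfolding P_def by (rule Cauchy_Schwarz_ineq2)
    have xGV: "x \<bullet> GV x = x \<bullet> Gw x + W1 (sl x)"
      unfolding GV_def inner_diff_right using x by (simp add: power2_norm_eq_inner[symmetric])
    have "\<bar>x \<bullet> GV x\<bar> \<le> Lg + \<bar>\<omega>\<bar> + 1" using xG P W1 x a2 unfolding xGV by linarith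
    then have 1: "\<bar>(?N - 2) * (x \<bullet> GV x)\<bar> \<le> ?N * (Lg + \<bar>\<omega>\<bar> + 1)"
      unfolding abs_mult using dim Lg(1) by (intro mult_mono) auto
    have 2: "\<bar>exp ((q - 1) * (w x - b * sl x))\<bar> \<le> E" using E[OF x(1) x1(1)] by simp
    have 3: "\<bar>P\<^sup>2\<bar> \<le> Lg\<^sup>2" using P by (simp add: power_mono)
    have 4: "\<bar>2 * \<rho> * (x \<bullet> Gw x)\<bar> \<le> 2 * \<bar>\<rho>\<bar> * Lg"
      unfolding abs_mult using xG P by (intro mult_mono) auto
    have 5: "\<bar>lam * P powr (1 - \<tau>)\<bar> \<le> \<bar>lam\<bar> * (1 + Lg)"
    proof -
      have "P powr (1 - \<tau>) \<le> 1 + Lg" using powr_le_add_one[OF P(1), of "1 - \<tau>"] tau P by linarith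
      then show ?thesis unfolding abs_mult by (intro mult_left_mono) auto
    qed
    have 6: "\<bar>W2 (sl x)\<bar> \<le> 1" using W1 x a2 by auto
    have "(norm x)\<^sup>2 * gV x - (?N - 2) * (x \<bullet> GV x)
      = exp ((q - 1) * (w x - b * sl x)) - P\<^sup>2 + 2 * \<rho> * (x \<bullet> Gw x) - lam * P powr (1 - \<tau>) - W2 (sl x)"
      unfolding gV_def GV_def P_def by (rule difference_eq[OF x(1) x1(2)])
    then have "\<bar>(norm x)\<^sup>2 * gV x\<bar> \<le> Cg" unfolding Cg_def using 1 2 3 4 5 6 unfolding abs_le_iff by linarith
    then show ?thesis by (simp add: abs_mult)
  qed
  obtain z0 :: 'a where z0: "z0 \<noteq> 0" "sl z0 = a2 + 1" using sl_ex by blast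
  have Cg: "Cg \<ge> 0" by (rule order_trans[OF _ bound[OF z0(1)]]) (use z0 in auto)
  define C1 where "C1 = grad_const TYPE('a)"
  have C1: "C1 \<ge> 0" unfolding C1_def by (rule grad_const_nonneg)
  have "((\<lambda>x. norm x * norm (GV x)) \<longlongrightarrow> 0) (at 0)"
    unfolding tendsto_iff
  proof (intro allI impI)
    fix e :: real assume e: "e > 0"
    define \<epsilon> where "\<epsilon> = min (1 / 8) (e / (2 * (C1 * (1 + 4 * Cg) + 1)))"
    have D: "C1 * (1 + 4 * Cg) + 1 > 0" using C1 Cg by (simp add: add_nonneg_pos)
    have \<epsilon>: "\<epsilon> > 0" "\<epsilon> \<le> 1 / 8"
      subgoal using e D by (simp add: \<epsilon>_def)
      subgoal unfolding \<epsilon>_def by (rule min.cobounded1)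
      done
    have e2: "C1 * (\<epsilon> + 4 * Cg * \<epsilon>) < e"
    proof -
      have "\<epsilon> * (2 * (C1 * (1 + 4 * Cg) + 1)) \<le> e / (2 * (C1 * (1 + 4 * Cg) + 1)) * (2 * (C1 * (1 + 4 * Cg) + 1))"
        using D by (intro mult_right_mono) (auto simp: \<epsilon>_def)
      then have "\<epsilon> * (2 * (C1 * (1 + 4 * Cg) + 1)) \<le> e" using D by simp
      moreover have "C1 * (\<epsilon> + 4 * Cg * \<epsilon>) = \<epsilon> * (C1 * (1 + 4 * Cg))" by (simp add: algebra_simps)
      moreover have "\<epsilon> * (C1 * (1 + 4 * Cg)) \<ge> 0" using \<epsilon> C1 Cg by simp
      ultimately show ?thesis using \<epsilon> by (simp add: algebra_simps)
    qed
    have "\<forall>\<^sub>F x in at 0. dist (V x) L < \<epsilon>\<^sup>2" using L \<epsilon> unfolding V_def tendsto_iff by simp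
    then obtain d where d: "d > 0" "\<And>x. x \<noteq> 0 \<Longrightarrow> dist x 0 < d \<Longrightarrow> dist (V x) L < \<epsilon>\<^sup>2"
      unfolding eventually_at by blast
    define a3 where "a3 = max (a2 + 1) (1 - ln d)"
    show "\<forall>\<^sub>F x in at 0. dist (norm x * norm (GV x)) 0 < e"
    proof (rule eventually_sl[of a3])
      fix x :: 'a assume x: "x \<noteq> 0" "a3 < sl x"
      define R where "R = \<epsilon> * norm x"
      have R: "R > 0" using \<epsilon> x by (simp add: R_def)
      have near: "z \<noteq> 0" "a2 < sl z" "norm x / 2 \<le> norm z" "dist (V z) L < \<epsilon>\<^sup>2" if z: "z \<in> cball x R" for z
      proof -
        have "\<epsilon> * norm x \<le> 1 / 8 * norm x" using \<epsilon> by (intro mult_right_mono) auto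
        then have "dist x z \<le> 1 * norm x / 8" using z by (simp add: R_def)
        note nz = near_sl[OF x(1) _ _ this]
        show z0: "z \<noteq> 0" and "norm x / 2 \<le> norm z" using nz by auto
        have "\<bar>sl z - sl x\<bar> \<le> 1 / 4" using nz by auto
        then have s: "sl z > a2" "sl z > - ln d" using x(2) unfolding a3_def abs_le_iff by auto
        then show "a2 < sl z" by simp
        have "norm z < d" using s(2) d(1) z0 by (simp add: sl_def)
        then show "dist (V z) L < \<epsilon>\<^sup>2" using d(2)[of z] z0 by simp
      qed
      have wVL: "wlap {x. x \<noteq> 0 \<and> a1 < sl x} (\<lambda>x. V x - L) (\<lambda>x. GV x - 0) (\<lambda>x. gV x - 0)"
        by (rule wlap_diff[OF wV wlap_const[OF wlapD(1)[OF wV]]])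
      have "norm (GV x - 0) \<le> grad_const TYPE('a) * (\<epsilon>\<^sup>2 / R + R * (4 * Cg / (norm x)\<^sup>2))"
      proof (rule wlap_gradient_bound[OF wVL R])
        show "cball x R \<subseteq> {x. x \<noteq> 0 \<and> a1 < sl x}" using near(1,2) a2 by fastforce
        fix z assume z: "z \<in> cball x R"
        show "\<bar>V z - L\<bar> \<le> \<epsilon>\<^sup>2" using near(4)[OF z] by (simp add: dist_real_def)
        have "(norm x / 2)\<^sup>2 * \<bar>gV z\<bar> \<le> (norm z)\<^sup>2 * \<bar>gV z\<bar>"
          using near(3)[OF z] by (intro mult_right_mono power_mono) auto
        also have "\<dots> \<le> Cg" using bound[OF near(1,2)[OF z]] .
        finally show "\<bar>gV z - 0\<bar> \<le> 4 * Cg / (norm x)\<^sup>2" using x by (simp add: field_simps power2_eq_square)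
      qed
      then have "norm x * norm (GV x) \<le> norm x * (C1 * (\<epsilon>\<^sup>2 / R + R * (4 * Cg / (norm x)\<^sup>2)))"
        unfolding C1_def by (intro mult_left_mono) auto
      also have "\<dots> = C1 * (\<epsilon> + 4 * Cg * \<epsilon>)"
        unfolding R_def using \<epsilon>(1) x by (simp add: field_simps power2_eq_square)
      finally show "dist (norm x * norm (GV x)) 0 < e" using e2 by simp
    qed
  qed
  moreover have "\<bar>x \<bullet> GV x\<bar> \<le> norm x * norm (GV x)" for x by (rule Cauchy_Schwarz_ineq2)
  ultimately have 1: "((\<lambda>x. x \<bullet> GV x) \<longlongrightarrow> 0) (at 0)"
    by (intro Lim_null_comparison[of "\<lambda>x. x \<bullet> GV x" "\<lambda>x. norm x * norm (GV x)"]) auto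
  have 2: "((\<lambda>x::'a. W1 (sl x)) \<longlongrightarrow> \<omega>) (at 0)" by (rule filterlim_compose[OF Wlim(1) filterlim_sl])
  have "((\<lambda>x. x \<bullet> GV x - W1 (sl x)) \<longlongrightarrow> 0 - \<omega>) (at 0)" by (rule tendsto_diff[OF 1 2])
  then have "((\<lambda>x. x \<bullet> Gw x) \<longlongrightarrow> 0 - \<omega>) (at 0)"
  proof (rule Lim_transform_eventually)
    show "\<forall>\<^sub>F x in at 0. x \<bullet> GV x - W1 (sl x) = x \<bullet> Gw x"
      by (rule eventually_sl[of 0]) (simp add: GV_def inner_add_right power2_norm_eq_inner[symmetric])
  qed
  then show ?thesis by simp
qed

end

section \<open>The logarithm of a positive solution\<close>

lemma GDERIV_unique:
  fixes f :: "'a::euclidean_space \<Rightarrow> real"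
  assumes "GDERIV f x :> D" "GDERIV f x :> E" shows "D = E"
proof -
  have "(\<lambda>h. h \<bullet> D) = (\<lambda>h. h \<bullet> E)"
    using assms unfolding gderiv_def by (rule has_derivative_unique)
  then have "\<forall>h. h \<bullet> D = h \<bullet> E" by metis
  then show ?thesis by (simp only: vector_eq_ldot)
qed

lemma GDERIV_imp_grad:
  fixes f :: "'a::euclidean_space \<Rightarrow> real"
  assumes "GDERIV f x :> D" shows "f differentiable (at x)" "grad f x = D"
proof -
  show d: "f differentiable (at x)" using assms unfolding gderiv_def differentiable_def by blast
  show "grad f x = D" by (rule GDERIV_unique[OF GDERIV_grad[OF d] assms])
qed

text \<open>A compactly supported pair in the sense of \<open>tfun\<close> is a test function with
  gradient \<open>\<Phi>\<close>, and the set integrals over \<open>\<Omega> - {0}\<close> become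
  whole-space integrals because it vanishes outside.\<close>

lemma positive_solution_wlap:
  fixes u :: "'a::euclidean_space \<Rightarrow> real"
  assumes sol: "positive_solution \<rho> lam \<tau> \<theta> q \<Omega> u" and \<tau>: "0 \<le> \<tau>" "\<tau> < 1"
    and S: "open S" "S \<subseteq> \<Omega> - {0}"
  shows "wlap S u (grad u) (\<lambda>x. norm x powr \<theta> * u x powr q - lower_order_terms \<rho> lam \<tau> u x)"
proof -
  let ?l = "lower_order_terms \<rho> lam \<tau> u"
  have C1: "C1_on (\<Omega> - {0}) u" and pos: "\<And>x. x \<in> \<Omega> - {0} \<Longrightarrow> u x > 0"
    and eq: "\<And>\<phi>. test_function_on (\<Omega> - {0}) \<phi> \<Longrightarrow>
      (LINT x:\<Omega> - {0}|lborel. - (grad u x \<bullet> grad \<phi> x) + ?l x * \<phi> x) = (LINT x:\<Omega> - {0}|lborel. norm x powr \<theta> * u x powr q * \<phi> x)"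
    using sol unfolding positive_solution_def by auto
  have D: "GDERIV u x :> grad u x" if "x \<in> S" for x
    using C1 S that by (intro GDERIV_grad) (auto simp: C1_on_def)
  have cG: "continuous_on S (grad u)" using C1 S continuous_on_subset unfolding C1_on_def by blast
  have cu: "continuous_on S u" by (rule GDERIV_continuous_on) (rule D)
  have p: "u x > 0" "norm x > 0" if "x \<in> S" for x using that S pos by auto
  have cp: "continuous_on S (\<lambda>x. norm (grad u x) powr (1 - \<tau>))"
    using \<tau> by (intro continuous_on_powr' continuous_intros cG) auto
  have cut: "continuous_on S (\<lambda>x. u x powr \<tau>)" "continuous_on S (\<lambda>x. u x powr q)"
    by (intro continuous_on_powr cu continuous_intros; use p in force)+
  have cn: "continuous_on S (\<lambda>x. norm x powr c)" for c :: real
    by (intro continuous_on_powr continuous_intros) (use p in force)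
  have cl: "continuous_on S ?l"
    unfolding lower_order_terms_def
    by (intro continuous_on_add continuous_on_divide continuous_on_mult cut cG cp cn continuous_on_inner continuous_on_const
        continuous_on_id continuous_on_power continuous_on_norm) (use p in force)+
  have cr: "continuous_on S (\<lambda>x. norm x powr \<theta> * u x powr q)"
    by (intro continuous_on_mult cn cut)
  show ?thesis
    unfolding wlap_def
  proof (intro conjI allI impI ballI)
    show "continuous_on S (\<lambda>x. norm x powr \<theta> * u x powr q - ?l x)" by (intro continuous_intros cr cl)
    fix \<phi> \<Phi> assume t: "tfun S \<phi> \<Phi>"
    then obtain K where K: "compact K" "K \<subseteq> S" "\<And>x. x \<notin> K \<Longrightarrow> \<phi> x = 0 \<and> \<Phi> x = 0"
      unfolding tfun_def by blast
    have g: "grad \<phi> = \<Phi>" using GDERIV_imp_grad(2)[OF tfunD(1)[OF t]] by blast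
    have sub: "closure {x. \<phi> x \<noteq> 0} \<subseteq> K"
      by (rule closure_minimal) (use K in \<open>auto intro: compact_imp_closed\<close>)
    have "test_function_on (\<Omega> - {0}) \<phi>"
      unfolding test_function_on_def C1_on_def
    proof (intro conjI ballI)
      show "\<phi> differentiable at x" for x using GDERIV_imp_grad(1)[OF tfunD(1)[OF t]] .
      show "continuous_on UNIV (grad \<phi>)" unfolding g by (rule tfunD(2)[OF t])
      show "closure {x. \<phi> x \<noteq> 0} \<subseteq> \<Omega> - {0}" using sub K S by auto
      show "compact (closure {x. \<phi> x \<noteq> 0})"
        using compact_Int_closed[OF K(1) closed_closure, of "{x. \<phi> x \<noteq> 0}"] sub by (simp add: Int_absorb1)
    qed
    from eq[OF this] have e: "(LINT x:\<Omega> - {0}|lborel. - (grad u x \<bullet> \<Phi> x) + ?l x * \<phi> x) = (LINT x:\<Omega> - {0}|lborel. norm x powr \<theta> * u x powr q * \<phi> x)"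
      unfolding g .
    have out: "x \<notin> \<Omega> - {0} \<Longrightarrow> \<phi> x = 0 \<and> \<Phi> x = 0" for x using K S by blast
    have r: "(LINT x:\<Omega> - {0}|lborel. F x) = (\<integral>x. F x \<partial>lborel)" if "\<And>x. x \<notin> \<Omega> - {0} \<Longrightarrow> F x = 0" for F :: "'a \<Rightarrow> real"
      unfolding set_lebesgue_integral_def
      by (rule Bochner_Integration.integral_cong) (use that in \<open>auto simp: indicator_def\<close>)
    note i = tfun_integrable[OF t S(1)]
    have iG: "integrable lborel (\<lambda>x. grad u x \<bullet> \<Phi> x)" by (rule i(1)[OF cG])
    have il: "integrable lborel (\<lambda>x. ?l x * \<phi> x)" by (rule i(2)[OF cl])
    have ir: "integrable lborel (\<lambda>x. (norm x powr \<theta> * u x powr q) * \<phi> x)" by (rule i(2)[OF cr])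
    have "- (\<integral>x. grad u x \<bullet> \<Phi> x \<partial>lborel) + (\<integral>x. ?l x * \<phi> x \<partial>lborel) = (\<integral>x. - (grad u x \<bullet> \<Phi> x) + ?l x * \<phi> x \<partial>lborel)"
      using iG il by simp
    also have "\<dots> = (\<integral>x. (norm x powr \<theta> * u x powr q) * \<phi> x \<partial>lborel)"
      using e by (subst (asm) (1 2) r) (use out in auto)
    finally have "(\<integral>x. grad u x \<bullet> \<Phi> x \<partial>lborel) = (\<integral>x. ?l x * \<phi> x \<partial>lborel) - (\<integral>x. (norm x powr \<theta> * u x powr q) * \<phi> x \<partial>lborel)"
      by simp
    also have "\<dots> = - (\<integral>x. (norm x powr \<theta> * u x powr q - ?l x) * \<phi> x \<partial>lborel)"
      unfolding left_diff_distrib using il ir by simp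
    finally show "(\<integral>x. grad u x \<bullet> \<Phi> x \<partial>lborel) = - (\<integral>x. (norm x powr \<theta> * u x powr q - ?l x) * \<phi> x \<partial>lborel)" .
  qed (use D cG S in auto)
qed

text \<open>The equation is multiplied by \<open>|x|\<^sup>2 / u\<close>: the lower-order terms have
  degree one in \<open>u\<close>, and \<open>(q - 1) * beta_exp \<theta> q = \<theta> + 2\<close>
  turns \<open>|x|^(\<theta> + 2) u^(q - 1)\<close> into the exponential. The domain is a punctured
  ball inside \<open>\<Omega>\<close>.\<close>

lemma positive_solution_log:
  fixes u :: "'a::euclidean_space \<Rightarrow> real"
  assumes dim: "DIM('a) \<ge> 2" and q: "q > 1" and \<tau>: "0 \<le> \<tau>" "\<tau> < 1" and \<theta>: "\<theta> < - 2"
    and \<Omega>: "open \<Omega>" "0 \<in> \<Omega>" and sol: "positive_solution \<rho> lam \<tau> \<theta> q \<Omega> u"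
  shows "\<exists>gw a0. log_solution \<rho> lam \<tau> (\<lambda>x. ln (u x)) (\<lambda>x. inverse (u x) *\<^sub>R grad u x) gw q (beta_exp \<theta> q) a0 \<and>
    (\<forall>x. x \<noteq> 0 \<longrightarrow> a0 < sl x \<longrightarrow> u x > 0)"
proof -
  obtain R where R: "R > 0" "ball 0 R \<subseteq> \<Omega>" using \<Omega> open_contains_ball by blast
  define a0 where "a0 = - ln R"
  let ?S = "{x::'a. x \<noteq> 0 \<and> a0 < sl x}"
  have S\<Omega>: "?S \<subseteq> \<Omega> - {0}"
  proof
    fix x assume "x \<in> ?S"
    then have "x \<noteq> 0" "norm x < R" using R by (auto simp: a0_def sl_def)
    then show "x \<in> \<Omega> - {0}" using R by auto
  qed
  have e: "?S = {x. x \<noteq> 0 \<and> sl x \<in> {a0<..}}" by auto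
  have oS: "open ?S" unfolding e by (rule open_sl_preimage) simp
  have pos: "u x > 0" if "x \<in> ?S" for x using sol S\<Omega> that unfolding positive_solution_def by blast
  define g where "g = (\<lambda>x. norm x powr \<theta> * u x powr q - lower_order_terms \<rho> lam \<tau> u x)"
  have w: "wlap ?S u (grad u) g" unfolding g_def by (rule positive_solution_wlap[OF sol \<tau> oS S\<Omega>])
  define gw where "gw = (\<lambda>x. - inverse ((u x)\<^sup>2) * (norm (grad u x))\<^sup>2 + inverse (u x) * g x)"
  have wl: "wlap ?S (\<lambda>x. ln (u x)) (\<lambda>x. inverse (u x) *\<^sub>R grad u x) gw"
    unfolding gw_def
  proof (rule wlap_compose[OF w])
    fix x assume "x \<in> ?S"
    note p = pos[OF this]
    show "(ln has_real_derivative inverse (u x)) (at (u x))"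
      "(inverse has_real_derivative - inverse ((u x)\<^sup>2)) (at (u x))"
      using p by (auto intro!: derivative_eq_intros simp: power2_eq_square divide_inverse)
  next
    show "continuous_on (u ` ?S) (\<lambda>z. - inverse (z\<^sup>2))"
      by (intro continuous_intros) (use pos in force)
  qed
  have \<beta>: "(q - 1) * beta_exp \<theta> q = \<theta> + 2" using q by (simp add: beta_exp_def)
  have "log_solution \<rho> lam \<tau> (\<lambda>x. ln (u x)) (\<lambda>x. inverse (u x) *\<^sub>R grad u x) gw q (beta_exp \<theta> q) a0"
  proof unfold_locales
    show "beta_exp \<theta> q < 0" using \<theta> q by (simp add: beta_exp_def divide_less_0_iff)
    fix x :: 'a assume x: "x \<noteq> 0" "a0 < sl x"
    define n U G z where "n = norm x" and "U = u x" and "G = norm (grad u x)" and "z = x \<bullet> grad u x"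
    have U: "U > 0" using pos x by (simp add: U_def)
    have n: "n > 0" using x by (simp add: n_def)
    have G: "G \<ge> 0" by (simp add: G_def)
    let ?N = "real DIM('a)"
    have l: "n\<^sup>2 * lower_order_terms \<rho> lam \<tau> u x = - (?N - 2 + 2 * \<rho>) * z + lam * (U * (n * (inverse U * G)) powr (1 - \<tau>))"
    proof -
      have "n\<^sup>2 / n powr (1 + \<tau>) = n powr (1 - \<tau>)"
      proof -
        have "n\<^sup>2 = n powr 2" using n by simp
        then show ?thesis by (simp add: powr_diff[symmetric])
      qed
      moreover have "U * (n * (inverse U * G)) powr (1 - \<tau>) = n powr (1 - \<tau>) * (U powr \<tau> * G powr (1 - \<tau>))"
      proof -
        have "(n * (inverse U * G)) powr (1 - \<tau>) = n powr (1 - \<tau>) * (inverse U powr (1 - \<tau>) * G powr (1 - \<tau>))"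
          using n U G by (simp add: powr_mult)
        moreover have "U * inverse U powr (1 - \<tau>) = U powr \<tau>"
        proof -
          have "U * inverse U powr (1 - \<tau>) = U powr 1 * U powr (- (1 - \<tau>))"
            using U by (simp only: powr_minus inverse_powr powr_one)
          also have "\<dots> = U powr (1 + - (1 - \<tau>))" by (rule powr_add[symmetric])
          finally show ?thesis by simp
        qed
        ultimately show ?thesis by (simp add: mult_ac)
      qed
      ultimately have "n\<^sup>2 * (lam * (U powr \<tau> * G powr (1 - \<tau>)) / n powr (1 + \<tau>)) = lam * (U * (n * (inverse U * G)) powr (1 - \<tau>))"
        by (metis (no_types, opaque_lifting) mult.assoc mult.commute times_divide_eq_left times_divide_eq_right)
      moreover have "n\<^sup>2 * (- (?N - 2 + 2 * \<rho>) * z / n\<^sup>2) = - (?N - 2 + 2 * \<rho>) * z" using n by simp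
      ultimately show ?thesis
        unfolding lower_order_terms_def n_def[symmetric] U_def[symmetric] G_def[symmetric] z_def[symmetric]
        by (simp only: distrib_left)
    qed
    have r: "n\<^sup>2 * (n powr \<theta> * U powr q) = U * exp ((q - 1) * (ln U - beta_exp \<theta> q * sl x))"
    proof -
      have "(q - 1) * (ln U - beta_exp \<theta> q * sl x) = (q - 1) * ln U + (\<theta> + 2) * ln n"
        unfolding right_diff_distrib mult.assoc[symmetric] \<beta> by (simp add: sl_def n_def)
      moreover have "n\<^sup>2 * (n powr \<theta> * U powr q) = exp (ln U) * exp ((q - 1) * ln U + (\<theta> + 2) * ln n)"
      proof -
        have "n\<^sup>2 = exp (2 * ln n)" using n by (simp add: exp_double)
        then have "n\<^sup>2 * (n powr \<theta> * U powr q) = exp (2 * ln n + (\<theta> * ln n + q * ln U))"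
          using n U by (simp add: powr_def exp_add)
        also have "2 * ln n + (\<theta> * ln n + q * ln U) = ln U + ((q - 1) * ln U + (\<theta> + 2) * ln n)" by (simp add: algebra_simps)
        finally show ?thesis by (simp only: exp_add)
      qed
      ultimately show ?thesis using U by simp
    qed
    have "n\<^sup>2 * g x = U * exp ((q - 1) * (ln U - beta_exp \<theta> q * sl x)) + (?N - 2 + 2 * \<rho>) * z - lam * (U * (n * (inverse U * G)) powr (1 - \<tau>))"
      unfolding g_def U_def[symmetric] n_def[symmetric] right_diff_distrib[of "n\<^sup>2"] l r by (simp only: minus_mult_left[symmetric] diff_diff_eq2 diff_add_eq_diff_diff_swap diff_minus_eq_add)
    then have fA: "inverse U * (n\<^sup>2 * g x) = exp ((q - 1) * (ln U - beta_exp \<theta> q * sl x)) + (?N - 2 + 2 * \<rho>) * (inverse U * z)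
        - lam * (n * (inverse U * G)) powr (1 - \<tau>)"
      using U by (simp add: right_diff_distrib distrib_left) (simp add: field_simps)
    have fB: "n\<^sup>2 * gw x = inverse U * (n\<^sup>2 * g x) - (n * (inverse U * G))\<^sup>2"
      unfolding gw_def U_def[symmetric] G_def[symmetric] by (simp add: power_mult_distrib power_inverse algebra_simps)
    have fC: "norm (inverse U *\<^sub>R grad u x) = inverse U * G" using U by (simp add: G_def)
    have fD: "x \<bullet> (inverse U *\<^sub>R grad u x) = inverse U * z" by (simp add: z_def)
    show "(norm x)\<^sup>2 * gw x + (norm x * norm (inverse (u x) *\<^sub>R grad u x))\<^sup>2
        - (?N - 2 + 2 * \<rho>) * (x \<bullet> (inverse (u x) *\<^sub>R grad u x))
        + lam * (norm x * norm (inverse (u x) *\<^sub>R grad u x)) powr (1 - \<tau>)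
      = exp ((q - 1) * (ln (u x) - beta_exp \<theta> q * sl x))"
      unfolding U_def[symmetric] n_def[symmetric] fB fA fC fD by simp
  qed (use dim q \<tau> wl in auto)
  then show ?thesis using pos by blast
qed

lemma asymp_equiv_of_log:
  fixes u :: "'a::euclidean_space \<Rightarrow> real"
  assumes "((\<lambda>x. ln (u x) - W0 (sl x)) \<longlongrightarrow> L) (at 0)" "\<And>x. x \<noteq> 0 \<Longrightarrow> a0 < sl x \<Longrightarrow> u x > 0"
    and g: "\<And>x. x \<noteq> 0 \<Longrightarrow> c < sl x \<Longrightarrow> g x = exp L * exp (W0 (sl x))"
  shows "u \<sim>[at 0] g"
proof (rule asymp_equivI')
  have "((\<lambda>x. exp (ln (u x) - W0 (sl x) - L)) \<longlongrightarrow> exp (L - L)) (at 0)"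
    by (intro tendsto_intros assms(1))
  moreover have "exp (L - L) = 1" by simp
  ultimately have "((\<lambda>x. exp (ln (u x) - W0 (sl x) - L)) \<longlongrightarrow> 1) (at 0)" by metis
  then show "((\<lambda>x. u x / g x) \<longlongrightarrow> 1) (at 0)"
  proof (rule Lim_transform_eventually)
    show "\<forall>\<^sub>F x in at 0. exp (ln (u x) - W0 (sl x) - L) = u x / g x"
    proof (rule eventually_sl[of "max a0 c"])
      fix x :: 'a assume "x \<noteq> 0" "max a0 c < sl x"
      then show "exp (ln (u x) - W0 (sl x) - L) = u x / g x"
        using assms(2)[of x] g[of x] by (simp add: exp_diff)
    qed
  qed
qed

lemma asymp_equiv_gradient:
  fixes u :: "'a::euclidean_space \<Rightarrow> real"
  assumes "((\<lambda>x. x \<bullet> (inverse (u x) *\<^sub>R G x)) \<longlongrightarrow> - p) (at 0)" and p: "p \<noteq> 0"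
    and u: "u \<sim>[at 0] g"
  shows "(\<lambda>x. x \<bullet> G x) \<sim>[at 0] (\<lambda>x. - p * g x)"
proof -
  have "(\<lambda>x. x \<bullet> (inverse (u x) *\<^sub>R G x)) \<sim>[at 0] (\<lambda>_. - p)"
    using assms(1) p by (intro tendsto_imp_asymp_equiv_const) auto
  then have 1: "(\<lambda>x. x \<bullet> (inverse (u x) *\<^sub>R G x) * u x) \<sim>[at 0] (\<lambda>x. - p * g x)"
    by (rule asymp_equiv_mult[OF _ u])
  \<comment> \<open>As \<open>inverse 0 = 0\<close>, a nonzero product certifies
    \<open>u x \<noteq> 0\<close> and lets \<open>u x\<close> cancel.\<close>
  have nz: "\<forall>\<^sub>F x in at 0. x \<bullet> (inverse (u x) *\<^sub>R G x) \<noteq> 0"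
    by (rule tendsto_imp_eventually_ne[OF assms(1)]) (use p in simp)
  have "\<forall>\<^sub>F x in at 0. x \<bullet> (inverse (u x) *\<^sub>R G x) * u x = x \<bullet> G x"
    using nz by eventually_elim auto
  from asymp_equiv_cong[OF this always_eventually[OF allI[OF refl]]] show ?thesis using 1 by blast
qed

section \<open>The function f and its negative roots\<close>

context operator_coefficients
begin

text \<open>\<open>f1\<close>, \<open>f2\<close> and \<open>f3\<close> are the successive
  derivatives of \<open>f\<close> on the negative axis, where \<open>|t| = - t\<close>.\<close>

definition f1 :: "real \<Rightarrow> real"
  where "f1 t = 2 * t + 2 * \<rho> - lam * (1 - \<tau>) * (- t) powr (- \<tau>)"

definition f2 :: "real \<Rightarrow> real"
  where "f2 t = 2 - lam * \<tau> * (1 - \<tau>) * (- t) powr (- \<tau> - 1)"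

definition f3 :: "real \<Rightarrow> real"
  where "f3 t = - (lam * \<tau> * (1 - \<tau>) * (1 + \<tau>) * (- t) powr (- \<tau> - 2))"

lemma f_rho_neg: "t < 0 \<Longrightarrow> f t = t * (t + 2 * \<rho>) + lam * (- t) powr (1 - \<tau>)"
  by (simp add: f_rho_def)

lemma f_rho_ftilde: "t < 0 \<Longrightarrow> f t = - t * ft t"
  by (simp add: f_rho_def ftilde_rho_def powr_diff powr_minus field_simps)

lemma f_rho_derivs:
  assumes "t < 0"
  shows "(f has_real_derivative f1 t) (at t)"
    "(f1 has_real_derivative f2 t) (at t)"
    "(f2 has_real_derivative f3 t) (at t)"
proof -
  have "((\<lambda>t. t * (t + 2 * \<rho>) + lam * (- t) powr (1 - \<tau>)) has_real_derivative f1 t) (at t)"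
    using assms by (auto intro!: derivative_eq_intros simp: f1_def)
  then show "(f has_real_derivative f1 t) (at t)"
    by (rule has_field_derivative_transform_within_open[of _ _ _ "{..<0}"]) (use assms in \<open>auto simp: f_rho_neg\<close>)
  show "(f1 has_real_derivative f2 t) (at t)"
    unfolding f1_def f2_def using assms by (auto intro!: derivative_eq_intros simp: algebra_simps)
  show "(f2 has_real_derivative f3 t) (at t)"
    unfolding f2_def f3_def using assms by (auto intro!: derivative_eq_intros simp: algebra_simps)
qed

definition f_diff :: "nat \<Rightarrow> real \<Rightarrow> real"
  where "f_diff m = (if m = 0 then f else if m = 1 then f1 else if m = 2 then f2 else f3)"

lemma f_rho_taylor:
  assumes "c < 0" "x < 0" and n: "n = 2 \<or> n = 3"
  shows "\<exists>t. (min c x \<le> t \<and> t \<le> max c x) \<and>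
    f x = (\<Sum>m<n. f_diff m c / fact m * (x - c) ^ m) + f_diff n t / fact n * (x - c) ^ n"
proof (cases "x = c")
  case True
  then show ?thesis using n by (intro exI[of _ c]) (auto simp: f_diff_def eval_nat_numeral)
next
  case False
  have "\<exists>t. (if x < c then x < t \<and> t < c else c < t \<and> t < x) \<and>
      f x = (\<Sum>m<n. f_diff m c / fact m * (x - c) ^ m) + f_diff n t / fact n * (x - c) ^ n"
  proof (rule Taylor[where diff = f_diff and a = "min c x" and b = "max c x"])
    show "\<forall>m t. m < n \<and> min c x \<le> t \<and> t \<le> max c x \<longrightarrow> (f_diff m has_real_derivative f_diff (Suc m) t) (at t)"
    proof (intro allI impI)
      fix m t assume "m < n \<and> min c x \<le> t \<and> t \<le> max c x"
      then have "t < 0" "m = 0 \<or> m = 1 \<or> m = 2" using assms by auto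
      then show "(f_diff m has_real_derivative f_diff (Suc m) t) (at t)" using f_rho_derivs[of t] by (auto simp: f_diff_def)
    qed
  qed (use False n in \<open>auto simp: f_diff_def\<close>)
  then obtain t where "if x < c then x < t \<and> t < c else c < t \<and> t < x"
    "f x = (\<Sum>m<n. f_diff m c / fact m * (x - c) ^ m) + f_diff n t / fact n * (x - c) ^ n" by blast
  then show ?thesis by (intro exI[of _ t]) (simp split: if_splits)
qed

lemma f_rho_taylor2:
  assumes "c < 0" "x < 0"
  shows "\<exists>t. (min c x \<le> t \<and> t \<le> max c x) \<and> f x = f c + f1 c * (x - c) + f2 t / 2 * (x - c)\<^sup>2"
  using f_rho_taylor[OF assms, of 2] by (simp add: f_diff_def eval_nat_numeral)

lemma f_rho_taylor3:
  assumes "c < 0" "x < 0"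
  shows "\<exists>t. (min c x \<le> t \<and> t \<le> max c x) \<and>
    f x = f c + f1 c * (x - c) + f2 c / 2 * (x - c)\<^sup>2 + f3 t / 6 * (x - c) ^ 3"
  using f_rho_taylor[OF assms, of 3] by (simp add: f_diff_def eval_nat_numeral)

lemma f2_upper: "t \<le> c \<Longrightarrow> c < 0 \<Longrightarrow> f2 t / 2 \<le> 1 + \<bar>lam\<bar> * (- c) powr (- \<tau> - 1)"
proof -
  assume t: "t \<le> c" "c < 0"
  have "\<bar>\<tau> * (1 - \<tau>)\<bar> \<le> 1 * 1" unfolding abs_mult using tau by (intro mult_mono) auto
  then have "\<bar>lam\<bar> * \<bar>\<tau> * (1 - \<tau>)\<bar> * (- t) powr (- \<tau> - 1) \<le> \<bar>lam\<bar> * 1 * (- c) powr (- \<tau> - 1)"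
    using tau t by (intro mult_mono powr_mono2') auto
  moreover have "- (lam * \<tau> * (1 - \<tau>) * (- t) powr (- \<tau> - 1)) \<le> \<bar>lam * \<tau> * (1 - \<tau>) * (- t) powr (- \<tau> - 1)\<bar>" by simp
  moreover have "\<bar>lam * \<tau> * (1 - \<tau>) * (- t) powr (- \<tau> - 1)\<bar> = \<bar>lam\<bar> * \<bar>\<tau> * (1 - \<tau>)\<bar> * (- t) powr (- \<tau> - 1)"
    by (simp add: abs_mult)
  moreover have "0 \<le> \<bar>lam\<bar> * (- c) powr (- \<tau> - 1)" by simp
  moreover have "(2 - X) / 2 \<le> 1 + A" if "- X \<le> A" "0 \<le> A" for X A :: real
    using that by (simp add: field_simps)
  ultimately show ?thesis unfolding f2_def by simp
qed

lemma f3_abs: "t \<le> c \<Longrightarrow> c < 0 \<Longrightarrow> \<bar>f3 t\<bar> \<le> 2 * \<bar>lam\<bar> * (- c) powr (- \<tau> - 2)"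
proof -
  assume t: "t \<le> c" "c < 0"
  have "\<bar>\<tau> * (1 - \<tau>) * (1 + \<tau>)\<bar> \<le> 1 * 1 * 2" unfolding abs_mult using tau by (intro mult_mono) auto
  then have "\<bar>lam\<bar> * \<bar>\<tau> * (1 - \<tau>) * (1 + \<tau>)\<bar> * (- t) powr (- \<tau> - 2) \<le> \<bar>lam\<bar> * 2 * (- c) powr (- \<tau> - 2)"
    using tau t by (intro mult_mono powr_mono2') auto
  moreover have "\<bar>f3 t\<bar> = \<bar>lam\<bar> * \<bar>\<tau> * (1 - \<tau>) * (1 + \<tau>)\<bar> * (- t) powr (- \<tau> - 2)"
    unfolding f3_def by (simp add: abs_mult)
  ultimately show ?thesis by simp
qed

text \<open>The root equation eliminates \<open>\<rho>\<close>. Up to sign, the result is the number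
  in the profile of case Z_1; it vanishes exactly at a double root.\<close>

lemma f1_root:
  assumes "\<omega> < 0" "ft \<omega> = 0"
  shows "f1 \<omega> = - (\<bar>\<omega>\<bar> * (1 - lam * \<tau> * \<bar>\<omega>\<bar> powr (- \<tau> - 1)))"
proof -
  have "(- \<omega>) powr (- \<tau> - 1) * (- \<omega>) = (- \<omega>) powr (- \<tau>)"
    using assms powr_add[of "- \<omega>" "- \<tau> - 1" 1] by simp
  then have "\<bar>\<omega>\<bar> * (1 - lam * \<tau> * \<bar>\<omega>\<bar> powr (- \<tau> - 1)) = - \<omega> - lam * \<tau> * (- \<omega>) powr (- \<tau>)"
    using assms(1) by (simp add: algebra_simps)
  moreover have "2 * \<rho> = - \<omega> + lam * (- \<omega>) powr (- \<tau>)" using assms(2) by (simp add: ftilde_rho_def)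
  ultimately show ?thesis unfolding f1_def by (simp add: algebra_simps)
qed

lemma f_left_lower:
  assumes \<omega>: "\<omega> < 0" "ft \<omega> = 0"
    and k: "lam * \<tau> * \<bar>\<omega>\<bar> powr (- \<tau> - 1) \<le> 1" and y: "y \<ge> 0"
  shows "f (\<omega> - y) \<ge> \<bar>\<omega>\<bar> * (1 - lam * \<tau> * \<bar>\<omega>\<bar> powr (- \<tau> - 1)) * y + (1 + \<tau>) / 2 * y\<^sup>2"
proof -
  obtain t where t: "t \<le> \<omega>" and e: "f (\<omega> - y) = f \<omega> + f1 \<omega> * (\<omega> - y - \<omega>) + f2 t / 2 * (\<omega> - y - \<omega>)\<^sup>2"
    using f_rho_taylor2[of \<omega> "\<omega> - y"] \<omega> y by auto
  have "f2 t \<ge> 1 + \<tau>"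
  proof (cases "lam \<ge> 0")
    case True
    have "(- t) powr (- \<tau> - 1) \<le> \<bar>\<omega>\<bar> powr (- \<tau> - 1)" using t \<omega> tau by (intro powr_mono2') auto
    then have "lam * \<tau> * (- t) powr (- \<tau> - 1) \<le> lam * \<tau> * \<bar>\<omega>\<bar> powr (- \<tau> - 1)" using True tau by (intro mult_left_mono) auto
    then have "lam * \<tau> * (- t) powr (- \<tau> - 1) \<le> 1" using k by linarith
    then have "(1 - \<tau>) * (lam * \<tau> * (- t) powr (- \<tau> - 1)) \<le> (1 - \<tau>) * 1" using tau by (intro mult_left_mono) auto
    then show ?thesis unfolding f2_def by (simp add: mult_ac)
  next
    case False
    then have "lam * (\<tau> * (1 - \<tau>) * (- t) powr (- \<tau> - 1)) \<le> 0" using tau by (intro mult_nonpos_nonneg) auto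
    then show ?thesis unfolding f2_def using tau by (simp add: mult_ac)
  qed
  then have "f2 t / 2 * y\<^sup>2 \<ge> (1 + \<tau>) / 2 * y\<^sup>2" by (intro mult_right_mono) auto
  then show ?thesis unfolding e f1_root[OF \<omega>] using \<omega> by (simp add: f_rho_ftilde)
qed

lemma f_left_upper:
  assumes \<omega>: "\<omega> < 0" "ft \<omega> = 0" and y: "y \<ge> 0"
  shows "f (\<omega> - y) \<le> \<bar>\<omega>\<bar> * (1 - lam * \<tau> * \<bar>\<omega>\<bar> powr (- \<tau> - 1)) * y
    + (1 + \<bar>lam\<bar> * \<bar>\<omega>\<bar> powr (- \<tau> - 1)) * y\<^sup>2"
proof -
  obtain t where t: "t \<le> \<omega>" and e: "f (\<omega> - y) = f \<omega> + f1 \<omega> * (\<omega> - y - \<omega>) + f2 t / 2 * (\<omega> - y - \<omega>)\<^sup>2"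
    using f_rho_taylor2[of \<omega> "\<omega> - y"] \<omega> y by auto
  have "f2 t / 2 \<le> 1 + \<bar>lam\<bar> * \<bar>\<omega>\<bar> powr (- \<tau> - 1)" using f2_upper[OF t \<omega>(1)] \<omega> by simp
  then have "f2 t / 2 * y\<^sup>2 \<le> (1 + \<bar>lam\<bar> * \<bar>\<omega>\<bar> powr (- \<tau> - 1)) * y\<^sup>2" by (intro mult_right_mono) auto
  then show ?thesis unfolding e f1_root[OF \<omega>] using \<omega> by (simp add: f_rho_ftilde)
qed

lemma f_right_upper:
  assumes \<omega>: "\<omega> < 0" "ft \<omega> = 0" and y: "0 \<le> y" "y \<le> \<bar>\<omega>\<bar> / 2"
  shows "f (\<omega> + y) \<le> - (\<bar>\<omega>\<bar> * (1 - lam * \<tau> * \<bar>\<omega>\<bar> powr (- \<tau> - 1))) * y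
    + (1 + \<bar>lam\<bar> * (\<bar>\<omega>\<bar> / 2) powr (- \<tau> - 1)) * y\<^sup>2"
proof -
  have oy: "\<omega> + y < 0" "\<omega> + y \<le> - (\<bar>\<omega>\<bar> / 2)" using \<omega> y by auto
  obtain t where t: "t \<le> \<omega> + y" and e: "f (\<omega> + y) = f \<omega> + f1 \<omega> * (\<omega> + y - \<omega>) + f2 t / 2 * (\<omega> + y - \<omega>)\<^sup>2"
    using f_rho_taylor2[of \<omega> "\<omega> + y"] \<omega> y oy by auto
  have "f2 t / 2 \<le> 1 + \<bar>lam\<bar> * (\<bar>\<omega>\<bar> / 2) powr (- \<tau> - 1)"
    using f2_upper[of t "- (\<bar>\<omega>\<bar> / 2)"] t oy \<omega> by simp
  then have "f2 t / 2 * y\<^sup>2 \<le> (1 + \<bar>lam\<bar> * (\<bar>\<omega>\<bar> / 2) powr (- \<tau> - 1)) * y\<^sup>2" by (intro mult_right_mono) auto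
  then show ?thesis unfolding e f1_root[OF \<omega>] using \<omega> by (simp add: f_rho_ftilde)
qed

text \<open>\<open>f\<close> need not be differentiable at 0, so the Taylor bound is used only for
  \<open>y\<close> up to half the distance to 0. Beyond that, \<open>y\<close> is bounded below by
  \<open>m\<close>, and crude quadratic growth is absorbed by the two powers of
  \<open>y\<close>.\<close>

lemma f_growth:
  assumes b: "b < 0"
  shows "\<exists>K\<ge>0. \<forall>y. f (b + y) \<le> f b + K * (\<bar>y\<bar> + y\<^sup>2)"
proof -
  define K1 where "K1 = 1 + \<bar>lam\<bar> * (- b / 2) powr (- \<tau> - 1)"
  have K1: "K1 \<ge> 1" by (simp add: K1_def)
  define m where "m = - b / 2"
  have m: "m > 0" "b = - 2 * m" using b by (auto simp: m_def)
  define D where "D = b\<^sup>2 + 2 * \<bar>\<rho>\<bar> * \<bar>b\<bar> + \<bar>lam\<bar> * (1 + \<bar>b\<bar>) + \<bar>f b\<bar>"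
  have D: "D \<ge> 0" by (simp add: D_def)
  define K where "K = \<bar>f1 b\<bar> + K1 + D / m + (2 * \<bar>b\<bar> + 2 * \<bar>\<rho>\<bar> + \<bar>lam\<bar> + 1)"
  have Dm: "D / m \<ge> 0" using D m by simp
  have "f (b + y) \<le> f b + K * (\<bar>y\<bar> + y\<^sup>2)" for y
  proof (cases "y \<le> m")
    case True
    then have by': "b + y < 0" using m by simp
    obtain t where t: "t \<le> max b (b + y)" and e: "f (b + y) = f b + f1 b * (b + y - b) + f2 t / 2 * (b + y - b)\<^sup>2"
      using f_rho_taylor2[of b "b + y"] b by' by auto
    have "t \<le> - m" using t True m by auto
    then have "f2 t / 2 \<le> 1 + \<bar>lam\<bar> * (- (- m)) powr (- \<tau> - 1)" using m by (intro f2_upper) auto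
    then have "f2 t / 2 \<le> K1" by (simp add: K1_def m_def)
    then have "f2 t / 2 * y\<^sup>2 \<le> K1 * y\<^sup>2" by (intro mult_right_mono) auto
    moreover have "f1 b * y \<le> \<bar>f1 b\<bar> * \<bar>y\<bar>" by (metis abs_ge_self abs_mult)
    ultimately have "f (b + y) \<le> f b + (\<bar>f1 b\<bar> * \<bar>y\<bar> + K1 * y\<^sup>2)" unfolding e by simp
    also have "\<bar>f1 b\<bar> * \<bar>y\<bar> + K1 * y\<^sup>2 \<le> K * \<bar>y\<bar> + K * y\<^sup>2"
      using K1 Dm unfolding K_def by (intro add_mono mult_right_mono) auto
    finally show ?thesis by (simp add: distrib_left)
  next
    case False
    then have y: "y > m" "y > 0" using m by auto
    have l: "\<bar>b + y\<bar> powr (1 - \<tau>) \<le> 1 + \<bar>b + y\<bar>" using tau by (intro powr_le_add_one) auto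
    have "f (b + y) \<le> (b + y)\<^sup>2 + 2 * \<bar>\<rho>\<bar> * \<bar>b + y\<bar> + \<bar>lam\<bar> * (1 + \<bar>b + y\<bar>)"
    proof -
      have "2 * \<rho> * (b + y) \<le> \<bar>2 * \<rho> * (b + y)\<bar>" by simp
      then have 1: "2 * \<rho> * (b + y) \<le> 2 * \<bar>\<rho>\<bar> * \<bar>b + y\<bar>" by (simp add: abs_mult)
      have "lam * \<bar>b + y\<bar> powr (1 - \<tau>) \<le> \<bar>lam * \<bar>b + y\<bar> powr (1 - \<tau>)\<bar>" by simp
      also have "\<dots> \<le> \<bar>lam\<bar> * (1 + \<bar>b + y\<bar>)" unfolding abs_mult using l by (intro mult_left_mono) auto
      finally show ?thesis using 1 unfolding f_rho_def by (simp add: power2_eq_square algebra_simps)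
    qed
    also have "\<dots> \<le> (\<bar>b\<bar> + y)\<^sup>2 + 2 * \<bar>\<rho>\<bar> * (\<bar>b\<bar> + y) + \<bar>lam\<bar> * (1 + (\<bar>b\<bar> + y))"
    proof -
      have a: "\<bar>b + y\<bar> \<le> \<bar>b\<bar> + y" using y by simp
      then have "(b + y)\<^sup>2 \<le> (\<bar>b\<bar> + y)\<^sup>2" by (metis abs_ge_zero power2_abs power_mono)
      then show ?thesis using a by (intro add_mono mult_left_mono) auto
    qed
    also have "\<dots> = (b\<^sup>2 + 2 * \<bar>\<rho>\<bar> * \<bar>b\<bar> + \<bar>lam\<bar> * (1 + \<bar>b\<bar>)) + (2 * \<bar>b\<bar> + 2 * \<bar>\<rho>\<bar> + \<bar>lam\<bar>) * y + y\<^sup>2"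
      by (simp add: power2_eq_square algebra_simps)
    also have "\<dots> \<le> f b + D + (2 * \<bar>b\<bar> + 2 * \<bar>\<rho>\<bar> + \<bar>lam\<bar>) * y + y\<^sup>2" by (simp add: D_def)
    also have "D \<le> (D / m) * y" using y m D by (simp add: field_simps mult_left_mono)
    finally have "f (b + y) \<le> f b + ((D / m) * y + (2 * \<bar>b\<bar> + 2 * \<bar>\<rho>\<bar> + \<bar>lam\<bar>) * y + 1 * y\<^sup>2)" by simp
    also have "(D / m) * y + (2 * \<bar>b\<bar> + 2 * \<bar>\<rho>\<bar> + \<bar>lam\<bar>) * y + 1 * y\<^sup>2 \<le> K * y + K * y\<^sup>2"
      unfolding distrib_right[symmetric] using y K1 Dm by (intro add_mono mult_right_mono) (auto simp: K_def)
    finally show ?thesis using y by (simp add: distrib_left)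
  qed
  moreover have "K \<ge> 0" using K1 Dm by (simp add: K_def)
  ultimately show ?thesis by blast
qed

section \<open>Roots and signs of \<open>ft\<close> in the three cases\<close>

lemma ftilde_derivs:
  assumes "t < 0"
  shows "(ft has_real_derivative (- 1 + lam * \<tau> * (- t) powr (- \<tau> - 1))) (at t)"
    "((\<lambda>t. - 1 + lam * \<tau> * (- t) powr (- \<tau> - 1)) has_real_derivative (lam * \<tau> * (\<tau> + 1) * (- t) powr (- \<tau> - 2))) (at t)"
  using assms unfolding ftilde_rho_def by (auto intro!: derivative_eq_intros simp: algebra_simps)

lemma ftilde_mvt:
  assumes "x < y" "y < 0"
  shows "\<exists>t. x < t \<and> t < y \<and> ft y - ft x = (y - x) * (- 1 + lam * \<tau> * (- t) powr (- \<tau> - 1))"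
  using MVT2[of x y ft "\<lambda>t. - 1 + lam * \<tau> * (- t) powr (- \<tau> - 1)"] ftilde_derivs(1)[of _] assms
  by auto

lemma continuous_ftilde: "continuous_on {..<0} ft"
  by (rule DERIV_continuous_on[OF has_field_derivative_at_within[OF ftilde_derivs(1)]]) simp

lemma small_powr:
  assumes "\<tau> > 0" "M > 0" "c > 0"
  shows "\<exists>d>0. d \<le> c \<and> d powr (- \<tau>) \<ge> (M::real)"
proof -
  define d where "d = min c (M powr (- (1 / \<tau>)))"
  have d: "d > 0" "d \<le> c" using assms by (auto simp: d_def)
  have "(M powr (- (1 / \<tau>))) powr (- \<tau>) \<le> d powr (- \<tau>)"
    using assms d by (intro powr_mono2') (auto simp: d_def)
  moreover have "(M powr (- (1 / \<tau>))) powr (- \<tau>) = M" using assms by (simp add: powr_powr)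
  ultimately show ?thesis using d by auto
qed

lemma ftilde_cont: "y < 0 \<Longrightarrow> continuous_on {x..y} ft"
  by (rule continuous_on_subset[OF continuous_ftilde]) auto

text \<open>Here \<open>lam * \<tau> \<le> 0\<close>, so the derivative of \<open>ft\<close> is at
  most -1; this gives uniqueness of the root and the linear bound to its right.\<close>

lemma N1_roots:
  assumes N1: "case_N1 \<rho> lam \<tau>"
  shows "\<exists>\<omega><0. negative_roots \<rho> lam \<tau> = {\<omega>} \<and> (\<forall>t<0. t < \<omega> \<longrightarrow> ft t > 0)
    \<and> (\<forall>t<0. \<omega> \<le> t \<longrightarrow> ft t \<le> - (t - \<omega>)) \<and> lam * \<tau> \<le> 0"
proof -
  have lt: "lam * \<tau> \<le> 0" using N1 tau by (auto simp: case_N1_def mult_nonpos_nonneg)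
  have step: "ft y - ft x \<le> - (y - x)" if xy: "x < y" "y < 0" for x y
  proof -
    obtain t where t: "ft y - ft x = (y - x) * (- 1 + lam * \<tau> * (- t) powr (- \<tau> - 1))"
      using ftilde_mvt[OF xy] by blast
    have "lam * \<tau> * (- t) powr (- \<tau> - 1) \<le> 0" by (rule mult_nonpos_nonneg[OF lt]) simp
    then have "(y - x) * (- 1 + lam * \<tau> * (- t) powr (- \<tau> - 1)) \<le> (y - x) * (- 1)" using xy by (intro mult_left_mono) auto
    then show ?thesis unfolding t by simp
  qed
  have "\<exists>\<omega><0. ft \<omega> = 0"
  proof (cases "(\<tau> = 0 \<or> lam = 0) \<and> lam < 2 * \<rho>")
    case True
    then show ?thesis by (intro exI[of _ "lam - 2 * \<rho>"]) (auto simp: ftilde_rho_def)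
  next
    case False
    then have l: "lam < 0" "\<tau> > 0" using N1 tau by (auto simp: case_N1_def)
    define a where "a = - (2 * \<bar>\<rho>\<bar> + \<bar>lam\<bar> + 1)"
    have "(- a) powr (- \<tau>) \<le> 1 powr (- \<tau>)" using tau by (intro powr_mono2') (auto simp: a_def)
    then have "lam * 1 \<le> lam * (- a) powr (- \<tau>)" using l by (intro mult_left_mono_neg) auto
    moreover have "- a = 2 * \<bar>\<rho>\<bar> + \<bar>lam\<bar> + 1" by (simp add: a_def)
    ultimately have fa: "ft a \<ge> 0" using l unfolding ftilde_rho_def by linarith
    have "(2 + 2 * \<bar>\<rho>\<bar>) / \<bar>lam\<bar> > 0" using l by (intro divide_pos_pos) auto
    then obtain d where d: "d > 0" "d \<le> 1" "d powr (- \<tau>) \<ge> (2 + 2 * \<bar>\<rho>\<bar>) / \<bar>lam\<bar>"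
      using small_powr[of "(2 + 2 * \<bar>\<rho>\<bar>) / \<bar>lam\<bar>" 1] l by auto
    have "lam * d powr (- \<tau>) \<le> lam * ((2 + 2 * \<bar>\<rho>\<bar>) / \<bar>lam\<bar>)" using d l by (intro mult_left_mono_neg) auto
    also have "\<dots> = - (2 + 2 * \<bar>\<rho>\<bar>)" using l by (simp add: field_simps)
    finally have fd: "ft (- d) \<le> 0" using d unfolding ftilde_rho_def by simp
    have "a \<le> - d" using d by (simp add: a_def)
    then obtain x where "a \<le> x" "x \<le> - d" "ft x = 0"
      using IVT2'[of ft "- d" 0 a] fa fd ftilde_cont[of "- d" a] d by auto
    then show ?thesis using d by (intro exI[of _ x]) auto
  qed
  then obtain \<omega> where \<omega>: "\<omega> < 0" "ft \<omega> = 0" by blast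
  have 1: "ft t > 0" if "t < \<omega>" for t using step[OF that \<omega>(1)] that \<omega>(2) by simp
  have 2: "ft t \<le> - (t - \<omega>)" if "t < 0" "\<omega> \<le> t" for t
    using step[of \<omega> t] that \<omega> by (cases "\<omega> = t") auto
  have "t = \<omega>" if "t < 0" "ft t = 0" for t
    using 1[of t] 2[of t] that by force
  then have "negative_roots \<rho> lam \<tau> = {\<omega>}" unfolding negative_roots_def using \<omega> by blast
  then show ?thesis using \<omega> 1 2 lt by (intro exI[of _ \<omega>]) auto
qed

text \<open>For \<open>lam > 0\<close> and \<open>\<tau> > 0\<close>, \<open>- xstar\<close> is the
  minimum point of \<open>ft\<close> on the negative axis. The minimum is
  \<open>2 * Upsilon lam \<tau> - 2 * \<rho>\<close>, which is the origin of
  \<open>Upsilon\<close>.\<close>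

definition xstar :: real
  where "xstar = (lam * \<tau>) powr (1 / (\<tau> + 1))"

lemma xstar:
  assumes "lam > 0" "0 < \<tau>" "\<tau> < 1"
  shows "xstar > 0" "lam * \<tau> * xstar powr (- \<tau> - 1) = 1"
    "ft (- xstar) = 2 * Upsilon lam \<tau> - 2 * \<rho>"
    "t < - xstar \<Longrightarrow> lam * \<tau> * (- t) powr (- \<tau> - 1) < 1"
    "- xstar < t \<Longrightarrow> t < 0 \<Longrightarrow> lam * \<tau> * (- t) powr (- \<tau> - 1) > 1"
proof -
  define X where "X = xstar"
  show X: "xstar > 0" using assms by (simp add: xstar_def)
  have "X powr (- \<tau> - 1) = (lam * \<tau>) powr (1 / (\<tau> + 1) * (- \<tau> - 1))"
    unfolding X_def xstar_def by (simp add: powr_powr)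
  also have "1 / (\<tau> + 1) * (- \<tau> - 1) = - 1" using assms by (simp add: field_simps)
  finally have e: "X powr (- \<tau> - 1) = inverse (lam * \<tau>)" using assms by (simp add: powr_minus)
  then show 1: "lam * \<tau> * xstar powr (- \<tau> - 1) = 1" using assms unfolding X_def by (simp add: field_simps)
  have "X powr (- \<tau>) = X powr (- \<tau> - 1) * X" using X powr_add[of X "- \<tau> - 1" 1] by (simp add: X_def)
  then have "lam * X powr (- \<tau>) = X / \<tau>" unfolding e using assms by (simp add: field_simps)
  then show "ft (- xstar) = 2 * Upsilon lam \<tau> - 2 * \<rho>"
    unfolding ftilde_rho_def Upsilon_def X_def[symmetric] xstar_def[symmetric] using assms by (simp add: field_simps)
  show "lam * \<tau> * (- t) powr (- \<tau> - 1) < 1" if "t < - xstar"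
  proof -
    have "(- t) powr (- \<tau> - 1) < xstar powr (- \<tau> - 1)" using that X assms by (intro powr_less_mono2_neg) auto
    then have "lam * \<tau> * (- t) powr (- \<tau> - 1) < lam * \<tau> * xstar powr (- \<tau> - 1)" using assms by (intro mult_strict_left_mono) auto
    then show ?thesis using 1 by simp
  qed
  show "lam * \<tau> * (- t) powr (- \<tau> - 1) > 1" if "- xstar < t" "t < 0"
  proof -
    have "(- t) powr (- \<tau> - 1) > xstar powr (- \<tau> - 1)" using that X assms by (intro powr_less_mono2_neg) auto
    then have "lam * \<tau> * (- t) powr (- \<tau> - 1) > lam * \<tau> * xstar powr (- \<tau> - 1)" using assms by (intro mult_strict_left_mono) auto
    then show ?thesis using 1 by simp
  qed
qed

lemma N2_monotone:
  assumes "lam > 0" "0 < \<tau>" "\<tau> < 1"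
  shows "x < y \<Longrightarrow> y \<le> - xstar \<Longrightarrow> ft y < ft x"
    "- xstar \<le> x \<Longrightarrow> x < y \<Longrightarrow> y < 0 \<Longrightarrow> ft x < ft y"
proof -
  note X = xstar[OF assms]
  show "ft y < ft x" if xy: "x < y" "y \<le> - xstar"
  proof -
    obtain t where t: "x < t" "t < y" "ft y - ft x = (y - x) * (- 1 + lam * \<tau> * (- t) powr (- \<tau> - 1))"
      using ftilde_mvt[of x y] xy X(1) by force
    have "(y - x) * (- 1 + lam * \<tau> * (- t) powr (- \<tau> - 1)) < 0" using X(4)[of t] t xy by (intro mult_pos_neg) auto
    then show ?thesis using t by simp
  qed
  show "ft x < ft y" if xy: "- xstar \<le> x" "x < y" "y < 0"
  proof -
    obtain t where t: "x < t" "t < y" "ft y - ft x = (y - x) * (- 1 + lam * \<tau> * (- t) powr (- \<tau> - 1))"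
      using ftilde_mvt[of x y] xy by force
    have "(y - x) * (- 1 + lam * \<tau> * (- t) powr (- \<tau> - 1)) > 0" using X(5)[of t] t xy by (intro mult_pos_pos) auto
    then show ?thesis using t by simp
  qed
qed

text \<open>One root on each of the two monotone branches of \<open>ft\<close>, by intermediate
  values: \<open>ft\<close> is nonnegative far to the left and near 0, and at most 0 at
  \<open>- xstar\<close>. The two roots merge exactly when this minimum is 0.\<close>

lemma N2_roots:
  assumes N2: "case_N2 \<rho> lam \<tau>"
  shows "\<exists>\<omega>1 \<omega>2. \<omega>1 \<le> - xstar \<and> - xstar \<le> \<omega>2 \<and> \<omega>2 < 0 \<and> negative_roots \<rho> lam \<tau> = {\<omega>1, \<omega>2}
    \<and> (\<forall>t<\<omega>1. ft t > 0) \<and> (\<forall>t<0. \<omega>2 < t \<longrightarrow> ft t > 0)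
    \<and> (\<forall>t. \<omega>1 < t \<longrightarrow> t < \<omega>2 \<longrightarrow> ft t < 0)
    \<and> (\<rho> = Upsilon lam \<tau> \<longrightarrow> \<omega>1 = - xstar \<and> \<omega>2 = - xstar)
    \<and> (\<rho> \<noteq> Upsilon lam \<tau> \<longrightarrow> \<omega>1 < - xstar \<and> - xstar < \<omega>2)"
proof -
  have l: "lam > 0" "0 < \<tau>" "\<tau> < 1" and \<rho>: "\<rho> \<ge> Upsilon lam \<tau>" using N2 by (auto simp: case_N2_def)
  define X where "X = xstar"
  note xs = xstar[OF l, folded X_def]
  note mono = N2_monotone[OF l, folded X_def]
  have FX: "ft (- X) \<le> 0" using xs(3) \<rho> by simp
  have "\<exists>\<omega>1 \<le> - X. ft \<omega>1 = 0"
  proof -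
    define a where "a = - (2 * \<bar>\<rho>\<bar> + 1 + X)"
    have "lam * (- a) powr (- \<tau>) \<ge> 0" using l by simp
    then have "ft a \<ge> 0" using xs(1) unfolding ftilde_rho_def a_def by simp
    moreover have "a \<le> - X" by (simp add: a_def)
    ultimately show ?thesis
      using IVT2'[of ft "- X" 0 a] FX ftilde_cont[of "- X" a] xs(1) by auto
  qed
  then obtain \<omega>1 where \<omega>1: "\<omega>1 \<le> - X" "ft \<omega>1 = 0" by blast
  have "\<exists>\<omega>2 \<ge> - X. \<omega>2 < 0 \<and> ft \<omega>2 = 0"
  proof -
    have "(1 + 2 * \<bar>\<rho>\<bar>) / lam > 0" using l by (intro divide_pos_pos) auto
    then obtain d where d: "d > 0" "d \<le> X" "d powr (- \<tau>) \<ge> (1 + 2 * \<bar>\<rho>\<bar>) / lam"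
      using small_powr[of "(1 + 2 * \<bar>\<rho>\<bar>) / lam" X] l xs(1) by auto
    have "lam * d powr (- \<tau>) \<ge> lam * ((1 + 2 * \<bar>\<rho>\<bar>) / lam)" using d l by (intro mult_left_mono) auto
    then have "ft (- d) \<ge> 0" using d l unfolding ftilde_rho_def by simp
    then obtain x where "- X \<le> x" "x \<le> - d" "ft x = 0"
      using IVT'[of ft "- X" 0 "- d"] FX ftilde_cont[of "- d" "- X"] d by auto
    then show ?thesis using d by (intro exI[of _ x]) auto
  qed
  then obtain \<omega>2 where \<omega>2: "\<omega>2 \<ge> - X" "\<omega>2 < 0" "ft \<omega>2 = 0" by blast
  have 1: "ft t > 0" if "t < \<omega>1" for t using mono(1)[OF that \<omega>1(1)] \<omega>1(2) by simp
  have 2: "ft t > 0" if "t < 0" "\<omega>2 < t" for t using mono(2)[OF \<omega>2(1) that(2,1)] \<omega>2(3) by simp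
  have 3: "ft t < 0" if "\<omega>1 < t" "t < \<omega>2" for t
  proof (cases "t \<le> - X")
    case True then show ?thesis using mono(1)[OF that(1) True] \<omega>1(2) by simp
  next
    case False then show ?thesis using mono(2)[of t \<omega>2] that \<omega>2 by simp
  qed
  have nr: "negative_roots \<rho> lam \<tau> = {\<omega>1, \<omega>2}"
  proof -
    have "t = \<omega>1 \<or> t = \<omega>2" if "t < 0" "ft t = 0" for t using 1[of t] 2[of t] 3[of t] that by force
    moreover have "\<omega>1 < 0" using \<omega>1 xs(1) by simp
    ultimately show ?thesis unfolding negative_roots_def using \<omega>1 \<omega>2 by auto
  qed
  have eq: "\<omega>1 = - X \<and> \<omega>2 = - X" if "\<rho> = Upsilon lam \<tau>"
  proof -
    have "ft (- X) = 0" using xs(3) that by simp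
    then show ?thesis using mono(1)[of \<omega>1 "- X"] mono(2)[of "- X" \<omega>2] \<omega>1 \<omega>2 by force
  qed
  have ne: "\<omega>1 < - X \<and> - X < \<omega>2" if "\<rho> \<noteq> Upsilon lam \<tau>"
  proof -
    have "ft (- X) \<noteq> 0" using xs(3) that by simp
    then show ?thesis using \<omega>1 \<omega>2 by (metis order_le_less)
  qed
  show ?thesis unfolding X_def[symmetric]
    using \<omega>1 \<omega>2 1 2 3 nr eq ne by (intro exI[of _ \<omega>1] exI[of _ \<omega>2]) auto
qed

lemma N0_positive:
  assumes "\<not> case_N1 \<rho> lam \<tau>" "\<not> case_N2 \<rho> lam \<tau>" and t: "t < 0"
  shows "ft t > 0"
proof (cases "\<tau> = 0 \<or> lam = 0")
  case True
  then show ?thesis using assms by (auto simp: case_N1_def ftilde_rho_def)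
next
  case False
  then have l: "lam > 0" "0 < \<tau>" and \<rho>: "\<rho> < Upsilon lam \<tau>" using assms tau by (auto simp: case_N1_def case_N2_def)
  have "ft (- xstar) > 0" using xstar(3)[OF l tau(2)] \<rho> by simp
  then show ?thesis
    using N2_monotone(1)[OF l tau(2), of t "- xstar"] N2_monotone(2)[OF l tau(2), of "- xstar" t] t
    by (cases t "- xstar" rule: linorder_cases) auto
qed

text \<open>Compactness up to \<open>Y\<close> and quadratic growth beyond. In a barrier the
  constant 1 pays for the exponential and \<open>y\<^sup>2\<close> for the second
  derivative.\<close>

lemma f_positive_left:
  assumes b: "b < 0" and pos: "\<And>t. t \<le> b \<Longrightarrow> ft t > 0"
  shows "\<exists>\<kappa>>0. \<forall>y\<ge>0. f (b - y) \<ge> \<kappa> * (1 + y\<^sup>2)"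
proof -
  define A where "A = 2 * \<bar>\<rho>\<bar> + \<bar>lam\<bar> * (- b) powr (- \<tau>)"
  have A0: "A \<ge> 0" by (simp add: A_def)
  define Y where "Y = 2 * A + 1"
  have big: "f (b - y) \<ge> 1 / 4 * (1 + y\<^sup>2)" if y: "y \<ge> Y" for y
  proof -
    have y0: "y \<ge> 1" "y \<ge> 0" using y A0 by (auto simp: Y_def)
    have "(- (b - y)) powr (- \<tau>) \<le> (- b) powr (- \<tau>)" using b y0 tau by (intro powr_mono2') auto
    then have "\<bar>lam * (- (b - y)) powr (- \<tau>)\<bar> \<le> \<bar>lam\<bar> * (- b) powr (- \<tau>)" unfolding abs_mult by (intro mult_mono) auto
    then have "ft (b - y) \<ge> y - A" using b unfolding ftilde_rho_def A_def by linarith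
    then have "ft (b - y) \<ge> y / 2" using y by (simp add: Y_def)
    then have "- (b - y) * ft (b - y) \<ge> y * (y / 2)" using b y0 by (intro mult_mono) auto
    then have "f (b - y) \<ge> y\<^sup>2 / 2" using b y0 by (simp add: f_rho_ftilde power2_eq_square)
    moreover have "1 \<le> y\<^sup>2" using y0 by simp
    ultimately show ?thesis by simp
  qed
  have "continuous_on {0..Y} (\<lambda>y. f (b - y))"
  proof -
    have "continuous_on {0..Y} (\<lambda>y. - (b - y) * ft (b - y))"
      by (intro continuous_intros continuous_on_compose2[OF continuous_ftilde]) (use b in auto)
    then show ?thesis by (rule continuous_on_eq) (use b in \<open>auto simp: f_rho_ftilde\<close>)
  qed
  moreover have "{0..Y} \<noteq> {}" using A0 by (auto simp: Y_def)
  ultimately have "\<exists>x\<in>{0..Y}. \<forall>y\<in>{0..Y}. f (b - x) \<le> f (b - y)"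
    by (intro continuous_attains_inf compact_Icc)
  then obtain x where x: "x \<in> {0..Y}" "\<And>y. y \<in> {0..Y} \<Longrightarrow> f (b - x) \<le> f (b - y)" by blast
  define \<mu> where "\<mu> = f (b - x)"
  have \<mu>: "\<mu> > 0" unfolding \<mu>_def using x(1) b pos[of "b - x"] by (simp add: f_rho_ftilde mult_neg_pos)
  have D: "1 + Y\<^sup>2 > 0" by (simp add: add_pos_nonneg)
  define \<kappa> where "\<kappa> = min (1 / 4) (\<mu> / (1 + Y\<^sup>2))"
  have \<kappa>: "\<kappa> > 0" using \<mu> D by (simp add: \<kappa>_def)
  have "f (b - y) \<ge> \<kappa> * (1 + y\<^sup>2)" if y: "y \<ge> 0" for y
  proof (cases "y \<ge> Y")
    case True
    have "\<kappa> * (1 + y\<^sup>2) \<le> 1 / 4 * (1 + y\<^sup>2)"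
      unfolding \<kappa>_def by (intro mult_right_mono min.cobounded1) auto
    then show ?thesis using big[OF True] by simp
  next
    case False
    then have "y\<^sup>2 \<le> Y\<^sup>2" using y by (intro power_mono) auto
    then have "\<kappa> * (1 + y\<^sup>2) \<le> \<mu> / (1 + Y\<^sup>2) * (1 + Y\<^sup>2)" using \<kappa> \<mu> D by (intro mult_mono) (auto simp: \<kappa>_def)
    also have "\<dots> = \<mu>" using D by simp
    also have "\<dots> \<le> f (b - y)" unfolding \<mu>_def using x(2)[of y] False y by simp
    finally show ?thesis .
  qed
  then show ?thesis using \<kappa> by blast
qed

text \<open>The bound has the form of a logistic equation between the slopes \<open>\<omega>\<close>
  and \<open>p\<close>, which \<open>upper_simple\<close> integrates explicitly. It follows from the
  linear bound on \<open>ft\<close>.\<close>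

lemma N1_between:
  assumes ft: "\<And>t. t < 0 \<Longrightarrow> \<omega> \<le> t \<Longrightarrow> ft t \<le> - (t - \<omega>)" and p: "\<omega> < p" "p < 0"
  shows "\<exists>\<kappa>>0. \<forall>t. \<omega> \<le> t \<longrightarrow> t \<le> p \<longrightarrow> f t \<le> - (\<kappa> * (t - \<omega>) * (p - t))"
proof -
  define \<kappa> where "\<kappa> = - p / (p - \<omega>)"
  have \<kappa>: "\<kappa> > 0" using p by (simp add: \<kappa>_def divide_neg_pos)
  have "f t \<le> - (\<kappa> * (t - \<omega>) * (p - t))" if t: "\<omega> \<le> t" "t \<le> p" for t
  proof -
    have "\<kappa> * (p - t) \<le> \<kappa> * (p - \<omega>)" using t \<kappa> by (intro mult_left_mono) auto
    also have "\<dots> = - p" using p by (simp add: \<kappa>_def)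
    also have "\<dots> \<le> - t" using t by simp
    finally have "(\<kappa> * (p - t)) * (t - \<omega>) \<le> - t * (t - \<omega>)" using t by (intro mult_right_mono) auto
    moreover have "- t * ft t \<le> - t * (- (t - \<omega>))" using ft[of t] t p by (intro mult_left_mono) auto
    moreover have "f t = - t * ft t" using t p by (intro f_rho_ftilde) auto
    moreover have "- t * (- (t - \<omega>)) = - (- t * (t - \<omega>))" by (simp only: mult_minus_right)
    moreover have "(\<kappa> * (p - t)) * (t - \<omega>) = \<kappa> * (t - \<omega>) * (p - t)" by simp
    ultimately show ?thesis by linarith
  qed
  then show ?thesis using \<kappa> by blast
qed

text \<open>\<open>ft\<close> is convex with second derivative smallest at \<open>\<omega>\<close>.
  Adding the parabola \<open>c * (t - \<omega>) * (p - t)\<close>, with \<open>c\<close> half of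
  that smallest value, keeps convexity, and the sum is nonpositive at both ends.\<close>

lemma N2_between:
  assumes l: "lam > 0" "0 < \<tau>" "\<tau> < 1" and F1: "ft \<omega> = 0" and Fp: "ft p \<le> 0"
    and p: "\<omega> < p" "p < 0"
  shows "\<exists>\<kappa>>0. \<forall>t. \<omega> \<le> t \<longrightarrow> t \<le> p \<longrightarrow> f t \<le> - (\<kappa> * (t - \<omega>) * (p - t))"
proof -
  define c where "c = lam * \<tau> * (\<tau> + 1) * (- \<omega>) powr (- \<tau> - 2) / 2"
  have c: "c > 0" using l p by (simp add: c_def)
  let ?G = "\<lambda>t. ft t + c * (t - \<omega>) * (p - t)"
  have conv: "convex_on {\<omega>..p} ?G"
  proof (rule f''_ge0_imp_convex)
    fix t assume t: "t \<in> {\<omega>..p}"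
    show "(?G has_real_derivative ((- 1 + lam * \<tau> * (- t) powr (- \<tau> - 1)) + c * (p + \<omega> - 2 * t))) (at t)"
      using t p by (auto intro!: derivative_eq_intros ftilde_derivs(1) simp: algebra_simps)
    show "((\<lambda>t. (- 1 + lam * \<tau> * (- t) powr (- \<tau> - 1)) + c * (p + \<omega> - 2 * t)) has_real_derivative
      (lam * \<tau> * (\<tau> + 1) * (- t) powr (- \<tau> - 2) - 2 * c)) (at t)"
    proof -
      have "((\<lambda>t. c * (p + \<omega> - 2 * t)) has_real_derivative - 2 * c) (at t)" by (auto intro!: derivative_eq_intros)
      from DERIV_add[OF ftilde_derivs(2)[of t] this] show ?thesis using t p by simp
    qed
    have "(- \<omega>) powr (- \<tau> - 2) \<le> (- t) powr (- \<tau> - 2)" using t p l by (intro powr_mono2') auto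
    then have "lam * \<tau> * (\<tau> + 1) * (- \<omega>) powr (- \<tau> - 2) \<le> lam * \<tau> * (\<tau> + 1) * (- t) powr (- \<tau> - 2)"
      using l by (intro mult_left_mono) auto
    then show "0 \<le> lam * \<tau> * (\<tau> + 1) * (- t) powr (- \<tau> - 2) - 2 * c" by (simp add: c_def)
  qed auto
  have FG: "ft t \<le> - (c * (t - \<omega>) * (p - t))" if t: "\<omega> \<le> t" "t \<le> p" for t
  proof -
    define z where "z = (p - t) / (p - \<omega>)"
    have z: "0 \<le> z" "z \<le> 1" using t p by (auto simp: z_def)
    have tz: "t = z * \<omega> + (1 - z) * p"
    proof -
      have "z * (p - \<omega>) = p - t" using p by (simp add: z_def)
      then show ?thesis by (simp add: algebra_simps)
    qed
    have "?G (z * \<omega> + (1 - z) * p) \<le> z * ?G \<omega> + (1 - z) * ?G p"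
      using convex_onD[OF conv, of "1 - z" \<omega> p] z p by simp
    also have "\<dots> \<le> 0" using F1 Fp z by (simp add: mult_nonneg_nonpos)
    finally show ?thesis unfolding tz[symmetric] by simp
  qed
  have "f t \<le> - ((- p * c) * (t - \<omega>) * (p - t))" if t: "\<omega> \<le> t" "t \<le> p" for t
  proof -
    have q0: "c * (t - \<omega>) * (p - t) \<ge> 0" using c t by simp
    have "- t * ft t \<le> - t * (- (c * (t - \<omega>) * (p - t)))" using FG[OF t] t p by (intro mult_left_mono) auto
    moreover have "- p * (c * (t - \<omega>) * (p - t)) \<le> - t * (c * (t - \<omega>) * (p - t))" using q0 t by (intro mult_right_mono) auto
    ultimately show ?thesis using t p by (simp add: f_rho_ftilde mult_ac)
  qed
  moreover have "- p * c > 0" using c p by (simp add: mult_neg_pos)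
  ultimately show ?thesis by blast
qed

text \<open>To the right of its minimum point \<open>ft\<close> has positive increasing derivative,
  hence grows at least with the slope \<open>s\<close> at \<open>\<omega>\<close>; the factor
  \<open>- t \<ge> - p\<close> transfers this to \<open>f\<close>.\<close>

lemma N2_right:
  assumes l: "lam > 0" "0 < \<tau>" "\<tau> < 1" and w: "- xstar < \<omega>" "\<omega> < p" "p < 0" and F: "ft \<omega> \<ge> 0"
  shows "\<exists>\<kappa>>0. \<forall>t. \<omega> \<le> t \<longrightarrow> t \<le> p \<longrightarrow> f t \<ge> \<kappa> * (t - \<omega>)"
proof -
  define s where "s = - 1 + lam * \<tau> * (- \<omega>) powr (- \<tau> - 1)"
  have s: "s > 0" using xstar(5)[OF l w(1)] w unfolding s_def by simp
  have "f t \<ge> (- p * s) * (t - \<omega>)" if t: "\<omega> \<le> t" "t \<le> p" for t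
  proof -
    have "ft t \<ge> s * (t - \<omega>)"
    proof (cases "t = \<omega>")
      case False
      then obtain z where z: "\<omega> < z" "z < t" "ft t - ft \<omega> = (t - \<omega>) * (- 1 + lam * \<tau> * (- z) powr (- \<tau> - 1))"
        using ftilde_mvt[of \<omega> t] t w by force
      have "(- \<omega>) powr (- \<tau> - 1) \<le> (- z) powr (- \<tau> - 1)" using z t w l by (intro powr_mono2') auto
      then have "lam * \<tau> * (- \<omega>) powr (- \<tau> - 1) \<le> lam * \<tau> * (- z) powr (- \<tau> - 1)" using l by (intro mult_left_mono) auto
      then have "(t - \<omega>) * s \<le> (t - \<omega>) * (- 1 + lam * \<tau> * (- z) powr (- \<tau> - 1))" using t by (intro mult_left_mono) (auto simp: s_def)
      then have "s * (t - \<omega>) \<le> ft t - ft \<omega>" unfolding z(3) by (simp only: mult.commute)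
      then show ?thesis using F by linarith
    qed (use F in simp)
    then have "- t * ft t \<ge> - t * (s * (t - \<omega>))" using t w by (intro mult_left_mono) auto
    moreover have "- p * (s * (t - \<omega>)) \<le> - t * (s * (t - \<omega>))" using s t by (intro mult_right_mono) auto
    moreover have "f t = - t * ft t" using t w by (intro f_rho_ftilde) auto
    moreover have "(- p * s) * (t - \<omega>) = - p * (s * (t - \<omega>))" by simp
    ultimately show ?thesis by linarith
  qed
  moreover have "- p * s > 0" using s w by (simp add: mult_neg_pos)
  ultimately show ?thesis by blast
qed

end

section \<open>Barriers\<close>

context log_solution
begin

text \<open>The barrier blows up at both ends of a window of length \<open>2 L\<close>; as \<open>L\<close> grows it flattens at the centre.\<close>

lemma upper_sharp:
  assumes K: "K \<ge> 0" "\<And>y. f (b + y) \<le> f b + K * (\<bar>y\<bar> + y\<^sup>2)" and E: "E > max 0 (f b)"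
  shows "\<exists>s0\<ge>a0. \<forall>x. x \<noteq> 0 \<longrightarrow> s0 < sl x \<longrightarrow> exp ((q - 1) * (w x - b * sl x)) \<le> E"
proof -
  define m where "m = max 0 (f b)"
  have m: "m \<ge> 0" "f b \<le> m" "E > m" "E > 0" using E by (auto simp: m_def)
  \<comment> \<open>With this \<open>A\<close>, \<open>exp (- (q - 1) * A * ln P)\<close> is
    \<open>1 / P\<^sup>2\<close>, the order of the second derivative and of the squared slope of the
    barrier.\<close>
  define A where "A = 2 / (q - 1)"
  have A: "A > 0" "(q - 1) * A = 2" using q by (auto simp: A_def field_simps)
  define c where "c = ln E / (q - 1)"
  have c: "exp ((q - 1) * c) = E" using q m by (simp add: c_def)
  define \<kappa> where "\<kappa> = K * (2 * A + 4 * A\<^sup>2) + 6 * A"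
  have \<kappa>: "\<kappa> > 0" using K A by (simp add: \<kappa>_def add_nonneg_pos)
  define L where "L = max 1 (\<kappa> / (E - m))"
  have L: "L \<ge> 1" "\<kappa> / L \<le> E - m"
  proof -
    show L1: "L \<ge> 1" by (simp add: L_def)
    have "\<kappa> / (E - m) \<le> L" by (simp add: L_def)
    then show "\<kappa> / L \<le> E - m" using m L1 by (simp add: field_simps)
  qed
  have "exp ((q - 1) * (w x - b * sl x)) \<le> E" if x: "x \<noteq> 0" "a0 + 2 * L < sl x" for x
  proof -
    define s1 where "s1 = sl x"
    have s1: "a0 < s1 - L" using x L by (simp add: s1_def)
    let ?K = "{x::'a. x \<noteq> 0 \<and> s1 - L \<le> sl x \<and> sl x \<le> s1 + L}"
    have "continuous_on ?K w" using s1 by (intro continuous_w) auto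
    moreover have "x \<in> ?K" using x L by (simp add: s1_def)
    then have "?K \<noteq> {}" by blast
    ultimately have "\<exists>z\<in>?K. \<forall>y\<in>?K. w y \<le> w z" by (intro continuous_attains_sup compact_annulus)
    then obtain z where z: "\<And>y. y \<in> ?K \<Longrightarrow> w y \<le> w z" by blast
    \<comment> \<open>The value of \<open>P\<close> at the ends of a slightly shortened window,
      small enough for the barrier to exceed the maximum of \<open>w\<close> there.\<close>
    define \<eta> where "\<eta> = min (1 / 2) (exp (- ((w z - c - b * (s1 + L)) / A)))"
    have \<eta>: "\<eta> > 0" "\<eta> \<le> 1 / 2" by (auto simp: \<eta>_def)
    have \<eta>A: "- (A * ln \<eta>) \<ge> w z - c - b * (s1 + L)"
    proof -
      have "ln \<eta> \<le> ln (exp (- ((w z - c - b * (s1 + L)) / A)))" using \<eta> by (subst ln_le_cancel_iff) (auto simp: \<eta>_def)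
      then have "A * ln \<eta> \<le> A * (- ((w z - c - b * (s1 + L)) / A))" using A by (intro mult_left_mono) auto
      then show ?thesis using A by simp
    qed
    define d where "d = L * sqrt (1 - \<eta>)"
    have d: "0 < d" "d < L" "(d / L)\<^sup>2 = 1 - \<eta>"
      using \<eta> L by (auto simp: d_def)
    define P where "P = (\<lambda>s. 1 - ((s - s1) / L)\<^sup>2)"
    have P: "P s \<ge> \<eta>" "P s \<le> 1" if "\<bar>s - s1\<bar> \<le> d" for s
    proof -
      have "\<bar>(s - s1) / L\<bar> \<le> d / L" using that L by (simp add: abs_divide divide_right_mono)
      then have "((s - s1) / L)\<^sup>2 \<le> (d / L)\<^sup>2" by (metis abs_ge_zero power2_abs power_mono)
      then show "P s \<ge> \<eta>" "P s \<le> 1" unfolding P_def d(3) by auto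
    qed
    \<comment> \<open>At the centre \<open>P = 1\<close>, so that \<open>w x \<le> B (sl x)\<close>
      says \<open>w x - b * sl x \<le> c\<close>.\<close>
    define B where "B = (\<lambda>s. b * s + c - A * ln (P s))"
    define y where "y = (\<lambda>s. A * (2 * ((s - s1) / L) / L) / P s)"
    define B2 where "B2 = (\<lambda>s. A * (2 / L\<^sup>2) / P s + A * (2 * ((s - s1) / L) / L)\<^sup>2 / (P s)\<^sup>2)"
    have dP: "(P has_real_derivative - (2 * ((s - s1) / L) / L)) (at s)" for s
      unfolding P_def using L by (auto intro!: derivative_eq_intros simp: field_simps power2_eq_square)
    have contP: "continuous_on T P" for T unfolding P_def using L by (intro continuous_intros) auto
    have "w x \<le> B (sl x)"
    proof (rule radial_upper[where a = "s1 - d" and c = "s1 + d" and ?B1.0 = "\<lambda>s. b + y s" and ?B2.0 = B2])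
      have Pp: "P s \<noteq> 0" if "s \<in> {s1 - d..s1 + d}" for s using P(1)[of s] \<eta> that by (auto simp: abs_le_iff)
      have Pp': "P s \<noteq> 0" if "s \<in> {s1 - d<..<s1 + d}" for s using Pp[of s] that by auto
      show "continuous_on {s1 - d..s1 + d} B"
        unfolding B_def by (intro continuous_intros contP) (use Pp in auto)
      show "continuous_on {s1 - d<..<s1 + d} B2"
        unfolding B2_def using L by (intro continuous_intros contP) (use Pp' in auto)
      fix s assume s: "s1 - d < s" "s < s1 + d"
      define z where "z = (s - s1) / L"
      have ps: "P s \<ge> \<eta>" "P s \<le> 1" using P[of s] s by (auto simp: abs_le_iff)
      then have p0: "P s > 0" using \<eta> by linarith
      show "(B has_real_derivative b + y s) (at s)"
        unfolding B_def y_def using p0 by (auto intro!: derivative_eq_intros dP simp: divide_inverse)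
      show "((\<lambda>s. b + y s) has_real_derivative B2 s) (at s)"
        unfolding y_def B2_def using p0 L by (auto intro!: derivative_eq_intros dP simp: field_simps power2_eq_square)
      have z1: "\<bar>z\<bar> \<le> 1"
      proof -
        have "\<bar>z\<bar> = \<bar>s - s1\<bar> / L" unfolding z_def using L by simp
        also have "\<dots> \<le> 1" using s d L by (simp add: abs_le_iff)
        finally show ?thesis .
      qed
      define r where "r = 1 / (P s)\<^sup>2"
      have r: "r \<ge> 1" "1 / P s \<le> r"
      proof -
        have "(P s)\<^sup>2 \<le> 1" using ps p0 by (simp add: power_le_one)
        then show "r \<ge> 1" unfolding r_def using p0 by simp
        have "(P s)\<^sup>2 \<le> P s" using ps p0 by (simp add: power2_eq_square mult_left_le)
        then show "1 / P s \<le> r" unfolding r_def using p0 by (intro divide_left_mono) auto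
      qed
      have ys: "\<bar>y s\<bar> \<le> 2 * A / L * (1 / P s)"
      proof -
        have "\<bar>y s\<bar> = 2 * A / L * (1 / P s) * \<bar>z\<bar>"
          unfolding y_def z_def[symmetric] using A L p0 by (simp add: abs_mult)
        also have "\<dots> \<le> 2 * A / L * (1 / P s) * 1" using z1 A L p0 by (intro mult_left_mono) auto
        finally show ?thesis by simp
      qed
      have y1: "\<bar>y s\<bar> \<le> 2 * A / L * r"
        using ys mult_left_mono[OF r(2), of "2 * A / L"] A L by simp
      have y2: "(y s)\<^sup>2 \<le> 4 * A\<^sup>2 / L * r"
      proof -
        have "(y s)\<^sup>2 \<le> (2 * A / L * (1 / P s))\<^sup>2" using ys by (metis abs_ge_zero power2_abs power_mono)
        also have "\<dots> = 4 * A\<^sup>2 * r / L / L" unfolding r_def by (simp add: power2_eq_square)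
        also have "\<dots> \<le> 4 * A\<^sup>2 * r / L / 1" using L r by (intro divide_left_mono) auto
        finally show ?thesis by simp
      qed
      have b2: "B2 s \<le> 6 * A / L * r"
      proof -
        have "B2 s = (2 * A / L) * (1 / P s) / L + (4 * A / L) * r * z\<^sup>2 / L"
          unfolding B2_def z_def[symmetric] r_def using L p0 by (simp add: field_simps power2_eq_square)
        also have "\<dots> \<le> (2 * A / L) * r / 1 + (4 * A / L) * r * 1 / 1"
        proof (intro add_mono frac_le mult_left_mono)
          show "z\<^sup>2 \<le> 1" using z1 by (simp add: abs_square_le_1)
        qed (use A L r in auto)
        also have "\<dots> = 6 * A / L * r" by (simp add: field_simps)
        finally show ?thesis .
      qed
      have "B2 s + f (b + y s) \<le> 6 * A / L * r + (f b + K * (\<bar>y s\<bar> + (y s)\<^sup>2))"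
        using b2 K(2)[of "y s"] by linarith
      also have "\<dots> \<le> 6 * A / L * r + (m * r + K * (2 * A / L * r + 4 * A\<^sup>2 / L * r))"
      proof -
        have "f b \<le> m * 1" using m by simp
        also have "m * 1 \<le> m * r" using m r by (intro mult_left_mono) auto
        finally have 1: "f b \<le> m * r" .
        have "K * (\<bar>y s\<bar> + (y s)\<^sup>2) \<le> K * (2 * A / L * r + 4 * A\<^sup>2 / L * r)"
          using K y1 y2 by (intro mult_left_mono add_mono)
        then show ?thesis using 1 by linarith
      qed
      also have "\<dots> = (\<kappa> / L + m) * r" unfolding \<kappa>_def using L by (simp add: field_simps)
      also have "\<dots> \<le> E * r" using L(2) r by (intro mult_right_mono) auto
      also have "E * r = exp ((q - 1) * (B s - b * s))"
      proof -
        have "(q - 1) * (B s - b * s) = (q - 1) * c + (- ((q - 1) * A)) * ln (P s)" unfolding B_def by (simp add: algebra_simps)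
        then have "exp ((q - 1) * (B s - b * s)) = E * exp (- 2 * ln (P s))" by (simp only: A(2) exp_add c)
        also have "exp (- 2 * ln (P s)) = r" unfolding r_def using p0 by (simp add: exp_minus exp_double divide_inverse)
        finally show ?thesis by simp
      qed
      finally show "B2 s + f (b + y s) \<le> exp ((q - 1) * (B s - b * s))" .
    next
      fix v :: 'a assume v: "v \<noteq> 0" "sl v = s1 - d \<or> sl v = s1 + d"
      have "(sl v - s1)\<^sup>2 = d\<^sup>2" using v(2) by auto
      then have "P (sl v) = \<eta>" unfolding P_def power_divide using d(3) by (simp add: power_divide)
      moreover have "b * (s1 + L) \<le> b * sl v" using v(2) d b by (intro mult_left_mono_neg) auto
      moreover have "w v \<le> w z" using v d by (intro z) auto
      ultimately show "w v \<le> B (sl v)" unfolding B_def using \<eta>A by simp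
    qed (use d s1 x in \<open>auto simp: s1_def\<close>)
    then have "w x - b * sl x \<le> c" unfolding B_def P_def s1_def by simp
    then have "exp ((q - 1) * (w x - b * sl x)) \<le> exp ((q - 1) * c)" using q by simp
    then show ?thesis unfolding c .
  qed
  then show ?thesis using L by (intro exI[of _ "a0 + 2 * L"]) auto
qed

text \<open>The blow-down point \<open>s1\<close> is placed at twice the distance, so the
  logarithmic correction costs at most \<open>ln 2\<close> at \<open>s\<close>, uniformly in
  \<open>s\<close>.\<close>

lemma ln_ratio_bound:
  fixes s s0 :: real
  assumes "s0 \<le> s" defines "s1 \<equiv> s0 + 2 * (s - s0) + 1"
  shows "s < s1" "ln ((s1 - s) / (s1 - s0)) \<ge> - ln 2"
proof -
  show "s < s1" using assms by simp
  have "(s1 - s) / (s1 - s0) \<ge> 1 / 2" using assms by (simp add: field_simps)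
  moreover from this have "0 < (s1 - s) / (s1 - s0)" by linarith
  ultimately have "ln ((s1 - s) / (s1 - s0)) \<ge> ln (1 / 2)" by (subst ln_le_cancel_iff) auto
  then show "ln ((s1 - s) / (s1 - s0)) \<ge> - ln 2" by (simp add: ln_div)
qed

lemma DERIV_ln_ratio:
  assumes "s < s1" "s0 < (s1::real)"
  shows "((\<lambda>s. A * ln ((s1 - s) / (s1 - s0))) has_real_derivative - (A / (s1 - s))) (at s)"
proof -
  have "((\<lambda>s. A * (ln (s1 - s) - ln (s1 - s0))) has_real_derivative - (A / (s1 - s))) (at s)"
    using assms by (auto intro!: derivative_eq_intros)
  then show ?thesis
    by (rule has_field_derivative_transform_within_open[of _ _ _ "{..<s1}"]) (use assms in \<open>auto simp: ln_div\<close>)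
qed

lemma blow_down:
  assumes "A > 0" "s0 < (s1::real)" "(g \<longlongrightarrow> l) (at_left s1)"
  shows "filterlim (\<lambda>s. g s + A * ln ((s1 - s) / (s1 - s0))) at_bot (at_left s1)"
proof -
  have 1: "((\<lambda>s. (s1 - s) / (s1 - s0)) \<longlongrightarrow> 0) (at_left s1)" using assms by (auto intro!: tendsto_eq_intros)
  have 2: "\<forall>\<^sub>F s in at_left s1. (s1 - s) / (s1 - s0) > 0"
    using eventually_at_left_real[OF assms(2)] by eventually_elim auto
  have "filterlim (\<lambda>s. (s1 - s) / (s1 - s0)) (at_right 0) (at_left s1)"
    using tendsto_imp_filterlim_at_right[OF 1 2] .
  then have "filterlim (\<lambda>s. ln ((s1 - s) / (s1 - s0))) at_bot (at_left s1)"
    by (rule filterlim_compose[OF ln_at_0])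
  then have "filterlim (\<lambda>s. A * ln ((s1 - s) / (s1 - s0))) at_bot (at_left s1)"
    by (rule filterlim_tendsto_pos_mult_at_bot[OF tendsto_const assms(1)])
  then show ?thesis by (simp add: filterlim_tendsto_add_at_bot_iff[OF assms(3)])
qed

text \<open>The barrier is \<open>b s + c\<close> plus a logarithm that blows down at
  \<open>s1\<close>. With \<open>A = 1 / \<kappa>\<close> the part
  \<open>\<kappa> * y\<^sup>2\<close> of the bound on \<open>f\<close> cancels the second
  derivative, and the remaining \<open>\<kappa>\<close> dominates the exponential by the choice of
  \<open>c\<close>.\<close>

lemma lower_bounded:
  assumes \<kappa>: "\<kappa> > 0" "\<And>y. y \<ge> 0 \<Longrightarrow> f (b - y) \<ge> \<kappa> * (1 + y\<^sup>2)"
  shows "\<exists>C. \<forall>x. x \<noteq> 0 \<longrightarrow> a0 + 1 \<le> sl x \<longrightarrow> w x - b * sl x \<ge> C"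
proof -
  define s0 where "s0 = a0 + 1"
  have cs: "continuous_on {x. x \<noteq> 0 \<and> sl x = s0} w" by (rule continuous_w) (auto simp: s0_def)
  define c where "c = min (smin w s0 - b * s0) (ln \<kappa> / (q - 1))"
  have ck: "exp ((q - 1) * c) \<le> \<kappa>"
  proof -
    have "(q - 1) * c \<le> (q - 1) * (ln \<kappa> / (q - 1))" using q by (intro mult_left_mono) (auto simp: c_def)
    then have "(q - 1) * c \<le> ln \<kappa>" using q by simp
    then have "exp ((q - 1) * c) \<le> exp (ln \<kappa>)" by (subst exp_le_cancel_iff)
    then show ?thesis using \<kappa> by simp
  qed
  define A where "A = 1 / \<kappa>"
  have A: "A > 0" using \<kappa> by (simp add: A_def)
  have "w x - b * sl x \<ge> c - A * ln 2" if x: "x \<noteq> 0" "s0 \<le> sl x" for x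
  proof -
    define s1 where "s1 = s0 + 2 * (sl x - s0) + 1"
    note r = ln_ratio_bound[OF x(2), folded s1_def]
    have s01: "s0 < s1" using r x by simp
    define B where "B = (\<lambda>s. (b * s + c) + A * ln ((s1 - s) / (s1 - s0)))"
    have "w x \<ge> B (sl x)"
    proof (rule radial_lower_blow[where a = s0 and c = s1 and ?B1.0 = "\<lambda>s. b - A / (s1 - s)" and ?B2.0 = "\<lambda>s. - (A / (s1 - s)\<^sup>2)"])
      fix s assume s: "s0 \<le> s" "s < s1"
      show "(B has_real_derivative b - A / (s1 - s)) (at s)"
        unfolding B_def using DERIV_add[OF DERIV_add[OF DERIV_cmult_Id[of b s] DERIV_const[of c]] DERIV_ln_ratio[OF s(2) s01, of A]] by simp
      show "((\<lambda>s. b - A / (s1 - s)) has_real_derivative - (A / (s1 - s)\<^sup>2)) (at s)"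
        using s by (auto intro!: derivative_eq_intros simp: field_simps power2_eq_square)
      have "(s1 - s) / (s1 - s0) \<le> 1" using s by (simp add: divide_le_eq_1)
      then have "ln ((s1 - s) / (s1 - s0)) \<le> 0" using s by (subst ln_le_zero_iff) auto
      then have "A * ln ((s1 - s) / (s1 - s0)) \<le> 0" using A by (simp add: mult_nonneg_nonpos)
      then have "B s - b * s \<le> c" unfolding B_def by simp
      then have "exp ((q - 1) * (B s - b * s)) \<le> exp ((q - 1) * c)" using q by simp
      also have "\<dots> \<le> \<kappa>" by (rule ck)
      also have "\<kappa> \<le> - (A / (s1 - s)\<^sup>2) + f (b - A / (s1 - s))"
      proof -
        have "f (b - A / (s1 - s)) \<ge> \<kappa> * (1 + (A / (s1 - s))\<^sup>2)" using s A by (intro \<kappa>(2)) auto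
        moreover have "\<kappa> * (A / (s1 - s))\<^sup>2 = A / (s1 - s)\<^sup>2"
          unfolding A_def using \<kappa> by (simp add: power_divide) (simp add: power2_eq_square)
        ultimately show ?thesis by (simp add: distrib_left)
      qed
      finally show "exp ((q - 1) * (B s - b * s)) \<le> - (A / (s1 - s)\<^sup>2) + f (b - A / (s1 - s))" .
    next
      show "continuous_on {s0..<s1} (\<lambda>s. - (A / (s1 - s)\<^sup>2))" by (intro continuous_intros) auto
      show "filterlim B at_bot (at_left s1)" unfolding B_def
        by (rule blow_down[OF A s01, where l = "b * s1 + c"]) (auto intro!: tendsto_eq_intros)
      fix v :: 'a assume "v \<noteq> 0" "sl v = s0"
      then have "smin w s0 \<le> w v" by (rule smax_smin(4)[OF cs])
      then show "B s0 \<le> w v" unfolding B_def c_def using s01 by simp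
    qed (use x r in \<open>auto simp: s0_def\<close>)
    moreover have "A * ln ((s1 - sl x) / (s1 - s0)) \<ge> A * (- ln 2)" using r A by (intro mult_left_mono) auto
    ultimately show ?thesis unfolding B_def by simp
  qed
  then show ?thesis unfolding s0_def by blast
qed

text \<open>A concave parabola of height \<open>C'\<close> over a window of half-length
  \<open>L\<close>: at the ends it lies below the known bound \<open>C\<close>, at the centre it has
  the sharp value \<open>c\<close>, and its effect on slope and second derivative tends to 0 as
  \<open>L\<close> grows.\<close>

lemma lower_sharp:
  assumes fb: "f b > 0" and C: "\<And>x. x \<noteq> 0 \<Longrightarrow> s0 < sl x \<Longrightarrow> w x - b * sl x \<ge> C" and E: "0 < E" "E < f b"
  shows "\<exists>s2. \<forall>x. x \<noteq> 0 \<longrightarrow> s2 < sl x \<longrightarrow> exp ((q - 1) * (w x - b * sl x)) \<ge> E"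
proof -
  define c where "c = ln E / (q - 1)"
  have c: "exp ((q - 1) * c) = E" using q E by (simp add: c_def)
  define C' where "C' = max 0 (c - C)"
  have C': "C' \<ge> 0" "c - C' \<le> C" by (auto simp: C'_def)
  have "((\<lambda>y. f (b + y)) \<longlongrightarrow> f (b + 0)) (at 0)"
    by (rule tendsto_f) (use b in \<open>auto intro!: tendsto_eq_intros\<close>)
  then have "\<forall>\<^sub>F y in at 0. f (b + y) > (E + f b) / 2" using E by (intro order_tendstoD) auto
  then obtain d where d: "d > 0" "\<And>y. y \<noteq> 0 \<Longrightarrow> \<bar>y\<bar> < d \<Longrightarrow> f (b + y) > (E + f b) / 2"
    unfolding eventually_at by (auto simp: dist_real_def)
  have d': "f (b + y) \<ge> (E + f b) / 2" if "\<bar>y\<bar> < d" for y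
    using d(2)[of y] that E by (cases "y = 0") auto
  define L where "L = max 1 (max (4 * C' / d + 1) (4 * C' / (f b - E)))"
  have L: "L \<ge> 1" "2 * C' / L < d" "2 * C' / L\<^sup>2 \<le> (f b - E) / 2"
  proof -
    show L1: "L \<ge> 1" by (simp add: L_def)
    have "4 * C' / d < L" by (simp add: L_def)
    then have "4 * C' < L * d" using d by (simp add: field_simps)
    then show "2 * C' / L < d" using L1 C' d by (simp add: field_simps)
    have "4 * C' / (f b - E) \<le> L" by (simp add: L_def)
    then have "4 * C' \<le> L * (f b - E)" using E by (simp add: field_simps)
    moreover have "L * 1 \<le> L * L" using L1 by (intro mult_left_mono) auto
    then have "L * (f b - E) \<le> L\<^sup>2 * (f b - E)" using E by (intro mult_right_mono) (auto simp: power2_eq_square)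
    ultimately show "2 * C' / L\<^sup>2 \<le> (f b - E) / 2" using L1 by (simp add: field_simps)
  qed
  have "exp ((q - 1) * (w x - b * sl x)) \<ge> E" if x: "x \<noteq> 0" "max a0 s0 + L < sl x" for x
  proof -
    define s1 where "s1 = sl x"
    define B where "B = (\<lambda>s. b * s + c - C' * ((s - s1) / L)\<^sup>2)"
    have "w x \<ge> B (sl x)"
    proof (rule radial_lower[where a = "s1 - L" and c = "s1 + L" and ?B1.0 = "\<lambda>s. b + (- 2 * C' / L\<^sup>2) * (s - s1)" and ?B2.0 = "\<lambda>s. - 2 * C' / L\<^sup>2"])
      show "continuous_on {s1 - L..s1 + L} B" unfolding B_def using L by (intro continuous_intros) auto
      fix s assume s: "s1 - L < s" "s < s1 + L"
      show "(B has_real_derivative b + (- 2 * C' / L\<^sup>2) * (s - s1)) (at s)"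
        unfolding B_def using L by (auto intro!: derivative_eq_intros simp: field_simps power2_eq_square)
      show "((\<lambda>s. b + (- 2 * C' / L\<^sup>2) * (s - s1)) has_real_derivative - 2 * C' / L\<^sup>2) (at s)"
        using DERIV_add[OF DERIV_const[of b] DERIV_cmult[OF DERIV_diff[OF DERIV_ident DERIV_const[of s1]], of "- 2 * C' / L\<^sup>2"]] by simp
      have "\<bar>(- 2 * C' / L\<^sup>2) * (s - s1)\<bar> = 2 * C' * \<bar>s - s1\<bar> / L\<^sup>2" using C' by (simp add: abs_mult)
      also have "\<dots> \<le> 2 * C' * L / L\<^sup>2" using C' s by (intro divide_right_mono mult_left_mono) (auto simp: abs_le_iff)
      also have "\<dots> = 2 * C' / L" using L by (simp add: power2_eq_square)
      finally have "f (b + (- 2 * C' / L\<^sup>2) * (s - s1)) \<ge> (E + f b) / 2" using L(2) by (intro d') linarith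
      moreover have "- 2 * C' / L\<^sup>2 = - (2 * C' / L\<^sup>2)" by simp
      ultimately have "- 2 * C' / L\<^sup>2 + f (b + (- 2 * C' / L\<^sup>2) * (s - s1)) \<ge> - ((f b - E) / 2) + (E + f b) / 2" using L(3) by linarith
      also have "- ((f b - E) / 2) + (E + f b) / 2 = E" by (simp add: field_simps)
      finally have 1: "E \<le> - 2 * C' / L\<^sup>2 + f (b + (- 2 * C' / L\<^sup>2) * (s - s1))" .
      have "C' * ((s - s1) / L)\<^sup>2 \<ge> 0" using C' by simp
      then have "B s - b * s \<le> c" unfolding B_def by linarith
      then have "exp ((q - 1) * (B s - b * s)) \<le> exp ((q - 1) * c)" using q by simp
      then show "exp ((q - 1) * (B s - b * s)) \<le> - 2 * C' / L\<^sup>2 + f (b + (- 2 * C' / L\<^sup>2) * (s - s1))" using 1 c by linarith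
    next
      fix v :: 'a assume v: "v \<noteq> 0" "sl v = s1 - L \<or> sl v = s1 + L"
      have "(sl v - s1)\<^sup>2 = L\<^sup>2" using v(2) by auto
      then have "((sl v - s1) / L)\<^sup>2 = 1" using L by (simp add: power_divide)
      then have "B (sl v) = b * sl v + (c - C')" by (simp add: B_def)
      moreover have "w v - b * sl v \<ge> C" using v x L by (intro C) (auto simp: s1_def)
      ultimately show "B (sl v) \<le> w v" using C' by linarith
    qed (use x L in \<open>auto simp: s1_def\<close>)
    then have "c \<le> w x - b * sl x" unfolding B_def s1_def by simp
    then have "exp ((q - 1) * c) \<le> exp ((q - 1) * (w x - b * sl x))" using q by simp
    then show ?thesis unfolding c .
  qed
  then show ?thesis by blast
qed

lemma f_growth_at_b: "\<exists>K\<ge>0. \<forall>y. f (b + y) \<le> f b + K * (\<bar>y\<bar> + y\<^sup>2)"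
  by (rule f_growth[OF b])

text \<open>The crude bound \<open>C\<close> starts \<open>lower_sharp\<close>; together with
  \<open>upper_sharp\<close> it squeezes the exponential to \<open>f b\<close>.\<close>

lemma U_limit:
  assumes fb: "f b > 0" and C: "\<And>x. x \<noteq> 0 \<Longrightarrow> s0 < sl x \<Longrightarrow> w x - b * sl x \<ge> C"
  shows "((\<lambda>x. w x - b * sl x) \<longlongrightarrow> ln (f b) / (q - 1)) (at 0)"
proof -
  obtain K where K: "K \<ge> 0" "\<And>y. f (b + y) \<le> f b + K * (\<bar>y\<bar> + y\<^sup>2)" using f_growth_at_b by blast
  have lim: "((\<lambda>x. exp ((q - 1) * (w x - b * sl x))) \<longlongrightarrow> f b) (at 0)"
  proof (rule order_tendstoI)
    fix e assume e: "e < f b"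
    define E where "E = (max 0 e + f b) / 2"
    have E: "0 < E" "E < f b" "e < E" using e fb by (auto simp: E_def max_def)
    obtain s2 where "\<And>x. x \<noteq> 0 \<Longrightarrow> s2 < sl x \<Longrightarrow> exp ((q - 1) * (w x - b * sl x)) \<ge> E"
      using lower_sharp[OF fb C E(1,2)] by blast
    then show "\<forall>\<^sub>F x in at 0. e < exp ((q - 1) * (w x - b * sl x))"
      using E(3) by (intro eventually_sl[of s2]) (auto intro: less_le_trans)
  next
    fix e assume e: "f b < e"
    define E where "E = (f b + e) / 2"
    have E: "max 0 (f b) < E" "E < e" using e fb by (auto simp: E_def)
    obtain s2 where "\<And>x. x \<noteq> 0 \<Longrightarrow> s2 < sl x \<Longrightarrow> exp ((q - 1) * (w x - b * sl x)) \<le> E"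
      using upper_sharp[OF K E(1)] by blast
    then show "\<forall>\<^sub>F x in at 0. exp ((q - 1) * (w x - b * sl x)) < e"
      using E(2) by (intro eventually_sl[of s2]) (auto intro: le_less_trans)
  qed
  have "((\<lambda>x. ln (exp ((q - 1) * (w x - b * sl x))) / (q - 1)) \<longlongrightarrow> ln (f b) / (q - 1)) (at 0)"
    by (intro tendsto_divide tendsto_ln lim tendsto_const) (use fb q in auto)
  then show ?thesis using q by simp
qed

text \<open>The barriers are \<open>b s - p ln X\<close>, where \<open>X\<close> grows almost like \<open>a s\<close>: for the upper one \<open>X' = a (1 - X / J)\<close>, so that \<open>X\<close>
  stays bounded while \<open>w - b s\<close> tends to \<open>-\<infinity>\<close>; for the lower one \<open>X' = a (1 + X / J) powr (1 + \<mu>)\<close>, so that \<open>X\<close> blows up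
  in finite time. The parameter \<open>J\<close> is chosen proportional to \<open>s\<close> at the point considered.\<close>

lemma upper_power:
  assumes p: "p > 0" and a: "0 < a'" "a' < a" and X0: "X0 > 0"
    and U: "\<And>X \<xi>. X0 \<le> X \<Longrightarrow> 0 < \<xi> \<Longrightarrow> \<xi> \<le> 1 \<Longrightarrow>
      p * a\<^sup>2 * \<xi> / X\<^sup>2 + f (b - p * (a * \<xi>) / X) \<le> X powr - ((q - 1) * p)"
    and Z: "\<And>M. \<exists>s0. \<forall>x. x \<noteq> 0 \<longrightarrow> s0 < sl x \<longrightarrow> w x - b * sl x \<le> M"
  shows "\<exists>s2>0. \<forall>x. x \<noteq> 0 \<longrightarrow> s2 < sl x \<longrightarrow> w x - b * sl x \<le> - (p * ln (a' * sl x))"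
proof -
  obtain s' where s': "\<And>x. x \<noteq> 0 \<Longrightarrow> s' < sl x \<Longrightarrow> w x - b * sl x \<le> - (p * ln X0)" using Z by blast
  define s0 where "s0 = max 0 (max s' a0) + 1"
  have s0: "s0 > 0" "s0 > s'" "s0 > a0" by (auto simp: s0_def)
  define a'' where "a'' = (a + a') / 2"
  have a'': "a' < a''" "a'' < a" "0 < a''" using a by (auto simp: a''_def)
  define \<epsilon> where "\<epsilon> = a / a'' - 1"
  have \<epsilon>: "\<epsilon> > 0" "a / (1 + \<epsilon>) = a''" using a'' by (auto simp: \<epsilon>_def)
  have main: "w x - b * sl x \<le> - (p * ln (a'' * (sl x - s0)))" if x: "x \<noteq> 0" "s0 < sl x" for x
  proof -
    \<comment> \<open>The saturation level of \<open>X\<close>, proportional to the distance of the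
      point considered, so that \<open>X (sl x) \<ge> a'' * (sl x - s0)\<close>.\<close>
    define J where "J = max (X0 + 1) (a * (sl x - s0) / \<epsilon>)"
    have J: "J > X0" "J > 0" "a * (sl x - s0) / J \<le> \<epsilon>"
    proof -
      show J0: "J > X0" "J > 0" using X0 by (auto simp: J_def)
      have "a * (sl x - s0) / \<epsilon> \<le> J" by (simp add: J_def)
      then show "a * (sl x - s0) / J \<le> \<epsilon>" using J0 \<epsilon> by (simp add: field_simps)
    qed
    \<comment> \<open>Describes the solution of \<open>X' = a * (1 - X / J)\<close> with
      \<open>X s0 = X0\<close>, through \<open>\<xi> = 1 - X / J\<close>.\<close>
    define \<xi> where "\<xi> = (\<lambda>s. (J - X0) / J * exp (- (a / J) * (s - s0)))"
    define X where "X = (\<lambda>s. J * (1 - \<xi> s))"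
    have \<xi>: "0 < \<xi> s" "\<xi> s \<le> (J - X0) / J" "\<xi> s \<le> 1" if "s0 \<le> s" for s
    proof -
      show "0 < \<xi> s" unfolding \<xi>_def using J by simp
      have "exp (- (a / J) * (s - s0)) \<le> 1" using that a J by (simp add: mult_nonneg_nonneg)
      then show 1: "\<xi> s \<le> (J - X0) / J" unfolding \<xi>_def using J X0 by (intro mult_left_le) auto
      have "(J - X0) / J \<le> 1" using J X0 by simp
      then show "\<xi> s \<le> 1" using 1 by linarith
    qed
    have X: "X0 \<le> X s" "X s \<le> J" if "s0 \<le> s" for s
    proof -
      have "J * \<xi> s \<le> J * ((J - X0) / J)" using \<xi>(2)[OF that] J by (intro mult_left_mono) auto
      also have "J * ((J - X0) / J) = J - X0" using J by simp
      finally show "X0 \<le> X s" unfolding X_def by (simp add: right_diff_distrib)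
      show "X s \<le> J" unfolding X_def using \<xi>(1)[OF that] J by (simp add: right_diff_distrib)
    qed
    have d\<xi>: "(\<xi> has_real_derivative - (a / J * \<xi> s)) (at s)" for s
      unfolding \<xi>_def using J(2) by (auto intro!: derivative_eq_intros)
    have dX: "(X has_real_derivative a * \<xi> s) (at s)" for s
      using DERIV_cmult[OF DERIV_diff[OF DERIV_const[of 1] d\<xi>], of J] J(2) unfolding X_def by simp
    have ct: "continuous_on T \<xi>" "continuous_on T X" for T
      using d\<xi> dX by (meson DERIV_continuous_on has_field_derivative_at_within)+
    define B where "B = (\<lambda>s. b * s - p * ln (X s))"
    have "w x \<le> B (sl x)"
    proof (rule radial_upper_at_top[where a = s0 and ?B1.0 = "\<lambda>s. b - p * (a * \<xi> s) / X s" and ?B2.0 = "\<lambda>s. p * a\<^sup>2 * \<xi> s / (X s)\<^sup>2"])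
      show "a0 < s0" by (rule s0)
      fix s assume s: "s0 \<le> s"
      have X': "X s > 0" using X[OF s] X0 by linarith
      show "(B has_real_derivative b - p * (a * \<xi> s) / X s) (at s)"
        unfolding B_def using X' by (auto intro!: derivative_eq_intros dX)
      \<comment> \<open>This identity collapses the second derivative of the barrier to
        \<open>p * a\<^sup>2 * \<xi> / X\<^sup>2\<close>.\<close>
      have e: "\<xi> s + X s / J = 1" using J by (simp add: X_def)
      have "((\<lambda>s. b - p * (a * \<xi> s) / X s) has_real_derivative
          - ((p * (a * - (a / J * \<xi> s)) * X s - p * (a * \<xi> s) * (a * \<xi> s)) / (X s * X s))) (at s)"
        using X' by (auto intro!: derivative_eq_intros dX d\<xi>)
      also have "- ((p * (a * - (a / J * \<xi> s)) * X s - p * (a * \<xi> s) * (a * \<xi> s)) / (X s * X s))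
          = p * a\<^sup>2 * \<xi> s * (\<xi> s + X s / J) / (X s)\<^sup>2" using X' J by (simp add: field_simps power2_eq_square)
      finally show "((\<lambda>s. b - p * (a * \<xi> s) / X s) has_real_derivative p * a\<^sup>2 * \<xi> s / (X s)\<^sup>2) (at s)"
        unfolding e by simp
      have "exp ((q - 1) * (B s - b * s)) = X s powr - ((q - 1) * p)"
        unfolding B_def powr_def using X' by (simp add: algebra_simps)
      then show "p * a\<^sup>2 * \<xi> s / (X s)\<^sup>2 + f (b - p * (a * \<xi> s) / X s) \<le> exp ((q - 1) * (B s - b * s))"
        using U[OF X(1)[OF s] \<xi>(1)[OF s] \<xi>(3)[OF s]] by simp
    next
      have "X s \<noteq> 0" if "s \<in> {s0..}" for s using X(1)[of s] X0 that by auto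
      then show "continuous_on {s0..} (\<lambda>s. p * a\<^sup>2 * \<xi> s / (X s)\<^sup>2)" by (intro continuous_intros ct) auto
      fix v :: 'a assume v: "v \<noteq> 0" "sl v = s0"
      have "X s0 = X0" unfolding X_def \<xi>_def using J by (simp add: field_simps)
      then show "w v \<le> B s0" unfolding B_def using s'[of v] v s0 by simp
    next
      fix c :: real
      \<comment> \<open>\<open>X\<close> never exceeds \<open>J\<close>, whereas
        \<open>w - b s\<close> tends to minus infinity; hence the barrier dominates on distant
        spheres.\<close>
      obtain sM where sM: "\<And>x. x \<noteq> 0 \<Longrightarrow> sM < sl x \<Longrightarrow> w x - b * sl x \<le> - (p * ln J)" using Z by blast
      define c' where "c' = max s0 (max sM c) + 1"
      have c': "c' > s0" "c' > sM" "c' > c" by (auto simp: c'_def)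
      have "w v \<le> B c'" if "v \<noteq> 0" "sl v = c'" for v
      proof -
        have "ln (X c') \<le> ln J" using X[of c'] c' X0 by (subst ln_le_cancel_iff) auto
        then have "p * ln (X c') \<le> p * ln J" using p by simp
        then show ?thesis unfolding B_def using sM[of v] that c' by simp
      qed
      then show "\<exists>c'>c. \<forall>x. x \<noteq> 0 \<longrightarrow> sl x = c' \<longrightarrow> w x \<le> B c'" using c' by blast
    qed (use x in auto)
    moreover have "p * ln (a'' * (sl x - s0)) \<le> p * ln (X (sl x))"
    proof -
      define y where "y = a * (sl x - s0) / J"
      have y: "y > 0" "y \<le> \<epsilon>" "J * y = a * (sl x - s0)" using J x a by (auto simp: y_def)
      have "exp (- y) \<le> 1 / (1 + y)"
        using exp_ge_add_one_self[of y] y by (simp add: exp_minus field_simps)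
      moreover have "\<xi> (sl x) \<le> exp (- y)"
      proof -
        have "\<xi> (sl x) \<le> exp (- (a / J) * (sl x - s0))"
          unfolding \<xi>_def by (rule mult_left_le_one_le) (use J X0 in auto)
        then show ?thesis by (simp add: y_def)
      qed
      ultimately have "1 - \<xi> (sl x) \<ge> 1 - 1 / (1 + y)" by linarith
      also have "1 - 1 / (1 + y) = y / (1 + y)" using y by (simp add: field_simps)
      also have "y / (1 + y) \<ge> y / (1 + \<epsilon>)" using y by (intro divide_left_mono) auto
      finally have "J * (y / (1 + \<epsilon>)) \<le> X (sl x)" unfolding X_def using J by (intro mult_left_mono) auto
      moreover have "J * (y / (1 + \<epsilon>)) = a / (1 + \<epsilon>) * (sl x - s0)" using y(3) by (simp add: field_simps)
      ultimately have "a'' * (sl x - s0) \<le> X (sl x)" unfolding \<epsilon>(2) by simp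
      then have "ln (a'' * (sl x - s0)) \<le> ln (X (sl x))" using x a'' by (intro ln_mono) auto
      then show ?thesis using p by simp
    qed
    ultimately show ?thesis unfolding B_def by linarith
  qed
  define s2 where "s2 = max s0 (a'' * s0 / (a'' - a'))"
  have "w x - b * sl x \<le> - (p * ln (a' * sl x))" if x: "x \<noteq> 0" "s2 < sl x" for x
  proof -
    have "a'' * s0 / (a'' - a') < sl x" "s0 < sl x" using x by (auto simp: s2_def)
    then have "a' * sl x \<le> a'' * (sl x - s0)" using a'' by (simp add: field_simps)
    then have "ln (a' * sl x) \<le> ln (a'' * (sl x - s0))" using a \<open>s0 < sl x\<close> s0 by (intro ln_mono) auto
    then have "p * ln (a' * sl x) \<le> p * ln (a'' * (sl x - s0))" using p by simp
    then show ?thesis using main[of x] x(1) \<open>s0 < sl x\<close> by linarith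
  qed
  moreover have "s2 > 0" using s0 by (simp add: s2_def)
  ultimately show ?thesis by blast
qed

lemma lower_power:
  assumes p: "p > 0" and \<mu>: "\<mu> > 0" and a: "0 < a" "a < a'"
    and L: "\<And>X \<xi> V. 0 < X \<Longrightarrow> 1 \<le> \<xi> \<Longrightarrow> 1 \<le> V \<Longrightarrow>
      p * a\<^sup>2 * (\<xi> * V\<^sup>2) * (1 + \<mu> - \<mu> * \<xi>) / X\<^sup>2 + f (b - p * (a * (\<xi> * V)) / X) \<ge> X powr - ((q - 1) * p)"
  shows "\<exists>s2>0. \<forall>x. x \<noteq> 0 \<longrightarrow> s2 < sl x \<longrightarrow> w x - b * sl x \<ge> - (p * ln (a' * sl x))"
proof -
  define s0 where "s0 = max 0 a0 + 1"
  have s0: "s0 > 0" "s0 > a0" by (auto simp: s0_def)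
  have cs: "continuous_on {x. x \<noteq> 0 \<and> sl x = s0} w" by (rule continuous_w) (use s0 in auto)
  define X1 where "X1 = exp (- ((smin w s0 - b * s0) / p))"
  have X1: "X1 > 0" "- (p * ln X1) = smin w s0 - b * s0" using p by (auto simp: X1_def)
  define a'' where "a'' = (a + a') / 2"
  have a'': "a < a''" "a'' < a'" "0 < a''" using a by (auto simp: a''_def)
  define \<epsilon> where "\<epsilon> = a'' / a - 1"
  have \<epsilon>: "\<epsilon> > 0" "a * (1 + \<epsilon>) = a''" using a a'' by (auto simp: \<epsilon>_def)
  \<comment> \<open>Compares the value \<open>(1 - \<mu> * h) powr (- 1 / \<mu>)\<close> of the
    solution with \<open>1 + (1 + \<epsilon>) * h\<close>; \<open>g\<close> vanishes at 0 with
    derivative \<open>\<epsilon>\<close>, so it is positive for small \<open>h > 0\<close>.\<close>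
  define g where "g = (\<lambda>h. 1 + (1 + \<epsilon>) * h - exp (- (ln (1 - \<mu> * h) / \<mu>)))"
  have "(g has_real_derivative \<epsilon>) (at 0)"
    unfolding g_def using \<mu> by (auto intro!: derivative_eq_intros)
  then obtain d where d: "d > 0" "\<And>h. 0 < h \<Longrightarrow> h < d \<Longrightarrow> g 0 < g (0 + h)"
    using DERIV_pos_inc_right[of g \<epsilon> 0] \<epsilon> by blast
  define h where "h = min (d / 2) (1 / (2 * \<mu>))"
  have h: "h > 0" "h < d" "\<mu> * h < 1"
  proof -
    show "h > 0" "h < d" using d \<mu> by (auto simp: h_def)
    have "\<mu> * h \<le> \<mu> * (1 / (2 * \<mu>))" using \<mu> by (intro mult_left_mono) (auto simp: h_def)
    then show "\<mu> * h < 1" using \<mu> by simp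
  qed
  have gh: "exp (- (ln (1 - \<mu> * h) / \<mu>)) \<le> 1 + (1 + \<epsilon>) * h" using d(2)[OF h(1,2)] by (simp add: g_def)
  have main: "w x - b * sl x \<ge> - (p * ln ((1 + \<epsilon>) * (X1 + a * (sl x - s0))))" if x: "x \<noteq> 0" "s0 \<le> sl x" for x
  proof -
    define Y where "Y = X1 + a * (sl x - s0)"
    have Y: "Y > 0" using X1 a x by (simp add: Y_def add_pos_nonneg)
    define J where "J = Y / h"
    have J: "J > 0" "J * h = Y" using Y h by (auto simp: J_def)
    \<comment> \<open>In the variable \<open>\<zeta> = (1 + X / J) powr (- \<mu>)\<close> the
      equation \<open>X' = a * (1 + X / J) powr (1 + \<mu>)\<close> becomes linear with slope
      \<open>- k\<close>; this is the initial value for \<open>X = X1\<close>.\<close>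
    define \<zeta>0 where "\<zeta>0 = exp (- (\<mu> * ln (1 + X1 / J)))"
    have X1J: "X1 / J > 0" using X1 J by simp
    have \<zeta>0: "0 < \<zeta>0" "\<zeta>0 \<le> 1" "\<zeta>0 \<ge> 1 - \<mu> * (X1 / J)"
    proof -
      show "0 < \<zeta>0" by (simp add: \<zeta>0_def)
      show "\<zeta>0 \<le> 1" unfolding \<zeta>0_def using \<mu> X1J by simp
      have "\<mu> * ln (1 + X1 / J) \<le> \<mu> * (X1 / J)" using \<mu> X1J by (intro mult_left_mono ln_add_one_self_le_self) auto
      moreover have "1 + - (\<mu> * ln (1 + X1 / J)) \<le> \<zeta>0" unfolding \<zeta>0_def by (rule exp_ge_add_one_self)
      ultimately show "\<zeta>0 \<ge> 1 - \<mu> * (X1 / J)" by linarith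
    qed
    define k where "k = \<mu> * a / J"
    have k: "k > 0" using \<mu> a J by (simp add: k_def)
    define \<zeta> where "\<zeta> = (\<lambda>s. \<zeta>0 - k * (s - s0))"
    define s1 where "s1 = s0 + \<zeta>0 / k"
    have \<zeta>s1: "\<zeta> s = k * (s1 - s)" for s using k by (simp add: \<zeta>_def s1_def field_simps)
    have s1: "s0 < s1" using \<zeta>0 k by (simp add: s1_def)
    have \<zeta>: "0 < \<zeta> s" "\<zeta> s \<le> \<zeta>0" if "s0 \<le> s" "s < s1" for s
      using that k by (simp add: \<zeta>s1) (use that k in \<open>simp add: \<zeta>_def\<close>)
    define \<xi> where "\<xi> = (\<lambda>s. exp (- (ln (\<zeta> s) / \<mu>)))"
    define X where "X = (\<lambda>s. J * (\<xi> s - 1))"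
    have \<xi>: "\<xi> s \<ge> 1 + X1 / J" if "s0 \<le> s" "s < s1" for s
    proof -
      have "ln (\<zeta> s) \<le> ln \<zeta>0" using \<zeta>[OF that] by (intro ln_mono) auto
      also have "ln \<zeta>0 = - (\<mu> * ln (1 + X1 / J))" by (simp add: \<zeta>0_def)
      finally have "ln (1 + X1 / J) \<le> - (ln (\<zeta> s) / \<mu>)" using \<mu> by (simp add: field_simps)
      then have "exp (ln (1 + X1 / J)) \<le> \<xi> s" unfolding \<xi>_def by (subst exp_le_cancel_iff)
      then show ?thesis using X1J by simp
    qed
    have X: "X s \<ge> X1" if "s0 \<le> s" "s < s1" for s
    proof -
      have "J * (X1 / J) \<le> J * (\<xi> s - 1)" using \<xi>[OF that] J by (intro mult_left_mono) auto
      then show ?thesis unfolding X_def using J by simp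
    qed
    have d\<zeta>: "(\<zeta> has_real_derivative - k) (at s)" for s unfolding \<zeta>_def by (auto intro!: derivative_eq_intros)
    have d\<xi>: "(\<xi> has_real_derivative a / J * (\<xi> s / \<zeta> s)) (at s)" if "s0 \<le> s" "s < s1" for s
      unfolding \<xi>_def using \<zeta>[OF that] \<mu> by (auto intro!: derivative_eq_intros d\<zeta> simp: k_def mult.commute)
    have dX: "(X has_real_derivative a * (\<xi> s / \<zeta> s)) (at s)" if "s0 \<le> s" "s < s1" for s
      unfolding X_def using J by (auto intro!: derivative_eq_intros d\<xi>[OF that])
    have ct: "continuous_on {s0..<s1} \<xi>" "continuous_on {s0..<s1} X" "continuous_on {s0..<s1} \<zeta>"
      by (meson DERIV_isCont continuous_at_imp_continuous_on atLeastLessThan_iff d\<xi> dX d\<zeta>)+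
    define B where "B = (\<lambda>s. b * s - p * ln (X s))"
    define B2 where "B2 = (\<lambda>s. p * a\<^sup>2 * (\<xi> s * (1 / \<zeta> s)\<^sup>2) * (1 + \<mu> - \<mu> * \<xi> s) / (X s)\<^sup>2)"
    have \<zeta>x: "\<zeta> (sl x) \<ge> 1 - \<mu> * h"
    proof -
      have "1 - \<mu> * h = 1 - \<mu> * (Y / J)" using J by (simp add: field_simps)
      also have "\<mu> * (Y / J) = \<mu> * (X1 / J) + k * (sl x - s0)" unfolding Y_def k_def using J by (simp add: field_simps)
      finally have "1 - \<mu> * h = 1 - \<mu> * (X1 / J) - k * (sl x - s0)" by linarith
      then show ?thesis unfolding \<zeta>_def using \<zeta>0 by linarith
    qed
    then have "0 < \<zeta> (sl x)" using h by linarith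
    then have sx: "sl x < s1" using k unfolding \<zeta>s1 by (simp add: zero_less_mult_iff)
    have "w x \<ge> B (sl x)"
    proof (rule radial_lower_blow[where a = s0 and c = s1 and ?B1.0 = "\<lambda>s. b - p * (a * (\<xi> s / \<zeta> s)) / X s" and ?B2.0 = B2])
      show "a0 < s0" by (rule s0)
      fix s assume s: "s0 \<le> s" "s < s1"
      have X': "X s > 0" using X[OF s] X1 by linarith
      have \<zeta>': "\<zeta> s > 0" by (rule \<zeta>[OF s])
      show "(B has_real_derivative b - p * (a * (\<xi> s / \<zeta> s)) / X s) (at s)"
        unfolding B_def using X' by (auto intro!: derivative_eq_intros dX[OF s] simp: mult_ac)
      have e: "X s / J = \<xi> s - 1" using J by (simp add: X_def)
      define V where "V = 1 / \<zeta> s"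
      have dV: "((\<lambda>s. \<xi> s / \<zeta> s) has_real_derivative (1 + \<mu>) * (a / J) * (\<xi> s * V\<^sup>2)) (at s)"
        unfolding V_def using \<zeta>' J by (auto intro!: derivative_eq_intros d\<zeta> d\<xi>[OF s] simp: k_def field_simps power2_eq_square)
      have "((\<lambda>s. b - p * (a * (\<xi> s / \<zeta> s)) / X s) has_real_derivative
          - ((p * (a * ((1 + \<mu>) * (a / J) * (\<xi> s * V\<^sup>2))) * X s - p * (a * (\<xi> s / \<zeta> s)) * (a * (\<xi> s / \<zeta> s))) / (X s * X s))) (at s)"
        by (rule DERIV_cong[OF DERIV_diff[OF DERIV_const DERIV_divide[OF DERIV_cmult[OF DERIV_cmult[OF dV, of a], of p] dX[OF s]]]])
          (use X' in auto)
      also have "- ((p * (a * ((1 + \<mu>) * (a / J) * (\<xi> s * V\<^sup>2))) * X s - p * (a * (\<xi> s / \<zeta> s)) * (a * (\<xi> s / \<zeta> s))) / (X s * X s))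
          = p * a\<^sup>2 * (\<xi> s * V\<^sup>2) * (\<xi> s - (1 + \<mu>) * (X s / J)) / (X s)\<^sup>2"
        unfolding V_def using X' J \<zeta>' by (simp add: field_simps power2_eq_square)
      also have "\<xi> s - (1 + \<mu>) * (X s / J) = 1 + \<mu> - \<mu> * \<xi> s" unfolding e by (simp add: algebra_simps)
      finally show "((\<lambda>s. b - p * (a * (\<xi> s / \<zeta> s)) / X s) has_real_derivative B2 s) (at s)"
        unfolding B2_def V_def by simp
      have "exp ((q - 1) * (B s - b * s)) = X s powr - ((q - 1) * p)"
        unfolding B_def powr_def using X' by (simp add: algebra_simps)
      moreover have "1 / \<zeta> s \<ge> 1" using \<zeta>[OF s] \<zeta>0 by simp
      moreover have "\<xi> s \<ge> 1" using \<xi>[OF s] X1J by linarith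
      ultimately show "exp ((q - 1) * (B s - b * s)) \<le> B2 s + f (b - p * (a * (\<xi> s / \<zeta> s)) / X s)"
        unfolding B2_def using L[OF X', of "\<xi> s" "1 / \<zeta> s"] by simp
    next
      have "X s \<noteq> 0" "\<zeta> s \<noteq> 0" if "s \<in> {s0..<s1}" for s using X[of s] \<zeta>[of s] X1 that by auto
      then show "continuous_on {s0..<s1} B2" unfolding B2_def by (intro continuous_intros ct) auto
      fix v :: 'a assume v: "v \<noteq> 0" "sl v = s0"
      have "ln \<zeta>0 = - (\<mu> * ln (1 + X1 / J))" by (simp add: \<zeta>0_def)
      then have "X s0 = X1" unfolding X_def \<xi>_def \<zeta>_def using J X1J \<mu> by simp
      then show "B s0 \<le> w v" unfolding B_def using smax_smin(4)[OF cs, of v] v X1 by simp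
    next
      have 1: "(\<zeta> \<longlongrightarrow> 0) (at_left s1)" unfolding \<zeta>s1 by (auto intro!: tendsto_eq_intros)
      have 2: "\<forall>\<^sub>F s in at_left s1. \<zeta> s > 0"
        using eventually_at_left_real[OF s1] by eventually_elim (use \<zeta> in auto)
      have "filterlim (\<lambda>s. ln (\<zeta> s)) at_bot (at_left s1)"
        by (rule filterlim_compose[OF ln_at_0 tendsto_imp_filterlim_at_right[OF 1 2]])
      then have "filterlim (\<lambda>s. - (1 / \<mu>) * ln (\<zeta> s)) at_top (at_left s1)"
        using \<mu> by (subst filterlim_tendsto_neg_mult_at_top_iff[OF tendsto_const]) auto
      then have "filterlim (\<lambda>s. - 1 + \<xi> s) at_top (at_left s1)"
        unfolding \<xi>_def by (intro filterlim_tendsto_add_at_top[OF tendsto_const] filterlim_compose[OF exp_at_top]) simp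
      then have "filterlim X at_top (at_left s1)"
        unfolding X_def using filterlim_tendsto_pos_mult_at_top[OF tendsto_const[of J] J(1)] by simp
      then have "filterlim (\<lambda>s. - p * ln (X s)) at_bot (at_left s1)"
        using p by (intro filterlim_tendsto_neg_mult_at_bot[OF tendsto_const] filterlim_compose[OF ln_at_top]) auto
      moreover have "((\<lambda>s. b * s) \<longlongrightarrow> b * s1) (at_left s1)" by (auto intro!: tendsto_eq_intros)
      ultimately show "filterlim B at_bot (at_left s1)"
        unfolding B_def using filterlim_tendsto_add_at_bot_iff[of "\<lambda>s. b * s" "b * s1" "at_left s1" "\<lambda>s. - p * ln (X s)"] by simp
    qed (use x sx in auto)
    moreover have "p * ln (X (sl x)) \<le> p * ln ((1 + \<epsilon>) * Y)"
    proof -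
      have "ln (1 - \<mu> * h) \<le> ln (\<zeta> (sl x))" using \<zeta>x h by (intro ln_mono) auto
      then have "\<xi> (sl x) \<le> exp (- (ln (1 - \<mu> * h) / \<mu>))" unfolding \<xi>_def using \<mu> by (simp add: divide_right_mono)
      then have "\<xi> (sl x) - 1 \<le> (1 + \<epsilon>) * h" using gh by linarith
      then have "X (sl x) \<le> J * ((1 + \<epsilon>) * h)" unfolding X_def using J by (intro mult_left_mono) auto
      also have "\<dots> = (1 + \<epsilon>) * Y" using J(2) by (simp add: algebra_simps)
      finally have "ln (X (sl x)) \<le> ln ((1 + \<epsilon>) * Y)" using X[OF x(2) sx] X1 by (intro ln_mono) auto
      then show ?thesis using p by simp
    qed
    ultimately show ?thesis unfolding B_def Y_def by linarith
  qed
  define s2 where "s2 = max s0 ((1 + \<epsilon>) * X1 / (a' - a''))"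
  have "w x - b * sl x \<ge> - (p * ln (a' * sl x))" if x: "x \<noteq> 0" "s2 < sl x" for x
  proof -
    have sx: "(1 + \<epsilon>) * X1 / (a' - a'') < sl x" "s0 < sl x" using x by (auto simp: s2_def)
    then have "(1 + \<epsilon>) * X1 \<le> (a' - a'') * sl x" using a'' by (simp add: field_simps)
    moreover have "(1 + \<epsilon>) * (X1 + a * (sl x - s0)) = (1 + \<epsilon>) * X1 + a * (1 + \<epsilon>) * (sl x - s0)" by (simp add: algebra_simps)
    moreover have "a'' * (sl x - s0) \<le> a'' * sl x" using a'' s0 by simp
    ultimately have 1: "(1 + \<epsilon>) * (X1 + a * (sl x - s0)) \<le> a' * sl x" unfolding \<epsilon>(2) by (simp add: algebra_simps)
    have "0 < (1 + \<epsilon>) * (X1 + a * (sl x - s0))" using \<epsilon> X1 a sx by (intro mult_pos_pos add_pos_nonneg) auto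
    then have "ln ((1 + \<epsilon>) * (X1 + a * (sl x - s0))) \<le> ln (a' * sl x)" using 1 by (intro ln_mono) auto
    then have "p * ln ((1 + \<epsilon>) * (X1 + a * (sl x - s0))) \<le> p * ln (a' * sl x)" using p by simp
    then show ?thesis using main[of x] x(1) sx by linarith
  qed
  moreover have "s2 > 0" using s0 by (simp add: s2_def)
  ultimately show ?thesis by blast
qed

text \<open>Each barrier loses a factor in \<open>a\<close> that is arbitrarily close to 1, so the
  two families of bounds squeeze the limit.\<close>

lemma power_limit:
  assumes p: "p > 0" and a: "a > 0"
    and up: "\<And>a'. 0 < a' \<Longrightarrow> a' < a \<Longrightarrow> \<exists>s2>0. \<forall>x. x \<noteq> 0 \<longrightarrow> s2 < sl x \<longrightarrow> w x - b * sl x \<le> - (p * ln (a' * sl x))"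
    and lo: "\<And>a'. a < a' \<Longrightarrow> \<exists>s2>0. \<forall>x. x \<noteq> 0 \<longrightarrow> s2 < sl x \<longrightarrow> w x - b * sl x \<ge> - (p * ln (a' * sl x))"
  shows "((\<lambda>x. w x - (b * sl x - p * ln (sl x))) \<longlongrightarrow> - (p * ln a)) (at 0)"
proof (rule order_tendstoI)
  fix e assume "e < - (p * ln a)"
  then have "ln a < - e / p" using p by (simp add: field_simps)
  then obtain l where l: "ln a < l" "l < - e / p" using dense by blast
  have "a < exp l" using l(1) a by (metis exp_less_cancel_iff exp_ln)
  then obtain s2 where s2: "s2 > 0" "\<And>x. x \<noteq> 0 \<Longrightarrow> s2 < sl x \<Longrightarrow> w x - b * sl x \<ge> - (p * ln (exp l * sl x))" using lo by blast
  have pl: "p * l < - e" using l(2) p by (simp add: field_simps)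
  show "\<forall>\<^sub>F x in at 0. e < w x - (b * sl x - p * ln (sl x))"
  proof (rule eventually_sl[of s2])
    fix x :: 'a assume x: "x \<noteq> 0" "s2 < sl x"
    have "p * ln (exp l * sl x) = p * l + p * ln (sl x)" using x s2 by (simp add: ln_mult algebra_simps)
    then show "e < w x - (b * sl x - p * ln (sl x))" using s2(2)[OF x] pl by linarith
  qed
next
  fix e assume "- (p * ln a) < e"
  then have "- e / p < ln a" using p by (simp add: field_simps)
  then obtain l where l: "- e / p < l" "l < ln a" using dense by blast
  have "exp l < a" using l(2) a by (metis exp_less_cancel_iff exp_ln)
  then obtain s2 where s2: "s2 > 0" "\<And>x. x \<noteq> 0 \<Longrightarrow> s2 < sl x \<Longrightarrow> w x - b * sl x \<le> - (p * ln (exp l * sl x))"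
    using up[of "exp l"] by auto
  have pl: "- e < p * l" using l(1) p by (simp add: field_simps)
  show "\<forall>\<^sub>F x in at 0. w x - (b * sl x - p * ln (sl x)) < e"
  proof (rule eventually_sl[of s2])
    fix x :: 'a assume x: "x \<noteq> 0" "s2 < sl x"
    have "p * ln (exp l * sl x) = p * l + p * ln (sl x)" using x s2 by (simp add: ln_mult algebra_simps)
    then show "w x - (b * sl x - p * ln (sl x)) < e" using s2(2)[OF x] pl by linarith
  qed
qed

section \<open>Logarithmic profiles when \<beta> is itself a root\<close>

lemma tends_to_minus_infinity:
  assumes "f b \<le> 0"
  shows "\<exists>s0. \<forall>x. x \<noteq> 0 \<longrightarrow> s0 < sl x \<longrightarrow> w x - b * sl x \<le> M"
proof -
  obtain K where K: "K \<ge> 0" "\<And>y. f (b + y) \<le> f b + K * (\<bar>y\<bar> + y\<^sup>2)" using f_growth_at_b by blast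
  have "exp ((q - 1) * M) > max 0 (f b)" using assms by simp
  from upper_sharp[OF K this] show ?thesis using q by auto
qed

text \<open>With \<open>p = 1 / (q - 1)\<close> the exponential is \<open>1 / X\<close>, and the
  leading part of \<open>f (b - y)\<close> at \<open>y = p * a / X\<close> is
  \<open>k * p * a / X\<close>; they balance for \<open>a = 1 / (k * p)\<close>. The second
  derivative and the quadratic remainder are of order \<open>1 / X\<^sup>2\<close>.\<close>

lemma Z1_limit:
  assumes fb: "ft b = 0" and k: "k = \<bar>b\<bar> * (1 - lam * \<tau> * \<bar>b\<bar> powr (- \<tau> - 1))" "k > 0"
  shows "((\<lambda>x. w x - (b * sl x - 1 / (q - 1) * ln (sl x))) \<longlongrightarrow> - (1 / (q - 1) * ln ((q - 1) / k))) (at 0)"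
proof -
  define p where "p = 1 / (q - 1)"
  have p: "p > 0" "(q - 1) * p = 1" using q by (auto simp: p_def)
  have "f b = 0" using f_rho_ftilde[OF b] fb by simp
  then have Z: "\<exists>s0. \<forall>x. x \<noteq> 0 \<longrightarrow> s0 < sl x \<longrightarrow> w x - b * sl x \<le> M" for M
    by (intro tends_to_minus_infinity) simp
  have kp: "(q - 1) / k = 1 / (k * p)" using k q by (simp add: p_def)
  have "0 < 1 - lam * \<tau> * \<bar>b\<bar> powr (- \<tau> - 1)" using k by (simp add: zero_less_mult_iff)
  then have le1: "lam * \<tau> * \<bar>b\<bar> powr (- \<tau> - 1) \<le> 1" by linarith
  define K where "K = 1 + \<bar>lam\<bar> * \<bar>b\<bar> powr (- \<tau> - 1)"
  have K: "K > 0" by (simp add: K_def add_pos_nonneg)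
  have "((\<lambda>x. w x - (b * sl x - p * ln (sl x))) \<longlongrightarrow> - (p * ln (1 / (k * p)))) (at 0)"
  proof (rule power_limit[OF p(1)])
    show "1 / (k * p) > 0" using k p by simp
    fix a' assume a': "0 < a'" "a' < 1 / (k * p)"
    obtain a where a: "a' < a" "a < 1 / (k * p)" using dense[OF a'(2)] by blast
    have a0: "a > 0" using a a' by linarith
    have kpa: "k * p * a < 1" using a k(2) p(1) by (simp add: pos_less_divide_eq mult.commute)
    define C where "C = p * a\<^sup>2 + K * (p * a)\<^sup>2"
    have C: "C > 0" using p K a0 by (simp add: C_def add_pos_pos)
    show "\<exists>s2>0. \<forall>x. x \<noteq> 0 \<longrightarrow> s2 < sl x \<longrightarrow> w x - b * sl x \<le> - (p * ln (a' * sl x))"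
    proof (rule upper_power[OF p(1) a'(1) a(1) _ _ Z])
      show "C / (1 - k * p * a) > 0" using C kpa by simp
      fix X \<xi> assume X: "C / (1 - k * p * a) \<le> X" and \<xi>: "0 < \<xi>" "\<xi> \<le> (1::real)"
      have X0: "X > 0" using X C kpa by (meson diff_gt_0_iff_gt divide_pos_pos less_le_trans)
      have CX: "C / X\<^sup>2 \<le> (1 - k * p * a) / X"
      proof -
        have "C \<le> (1 - k * p * a) * X" using X kpa by (simp add: field_simps)
        then have "C / X\<^sup>2 \<le> (1 - k * p * a) * X / X\<^sup>2" by (intro divide_right_mono) auto
        then show ?thesis using X0 by (simp add: power2_eq_square)
      qed
      define y where "y = p * (a * \<xi>) / X"
      have y: "y \<ge> 0" "y \<le> p * a / X"
        using p a0 \<xi> X0 by (auto simp: y_def mult_left_le intro!: divide_right_mono mult_left_mono)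
      have "f (b - y) \<le> k * y + K * y\<^sup>2" using f_left_upper[OF b fb y(1)] unfolding k(1) K_def .
      also have "\<dots> \<le> k * (p * a / X) + K * (p * a / X)\<^sup>2"
        using y k K by (intro add_mono mult_left_mono power_mono) auto
      finally have "f (b - y) \<le> k * p * a / X + K * (p * a)\<^sup>2 / X\<^sup>2" by (simp add: power_divide)
      moreover have "p * a\<^sup>2 * \<xi> / X\<^sup>2 \<le> p * a\<^sup>2 / X\<^sup>2" using p \<xi> by (intro divide_right_mono mult_left_le) auto
      moreover have "C / X\<^sup>2 = p * a\<^sup>2 / X\<^sup>2 + K * (p * a)\<^sup>2 / X\<^sup>2" by (simp add: C_def add_divide_distrib)
      moreover have "(1 - k * p * a) / X = 1 / X - k * p * a / X" by (simp add: diff_divide_distrib)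
      ultimately have "p * a\<^sup>2 * \<xi> / X\<^sup>2 + f (b - y) \<le> 1 / X" using CX by linarith
      then show "p * a\<^sup>2 * \<xi> / X\<^sup>2 + f (b - p * (a * \<xi>) / X) \<le> X powr - ((q - 1) * p)"
        unfolding p(2) y_def using X0 by (simp add: powr_minus_divide)
    qed
  next
    fix a' assume a': "1 / (k * p) < a'"
    define a where "a = 1 / (k * p)"
    have a: "0 < a" "a < a'" "k * p * a = 1" using k p a' by (auto simp: a_def)
    define \<kappa> where "\<kappa> = (1 + \<tau>) / 2"
    have \<kappa>: "\<kappa> > 0" using tau by (simp add: \<kappa>_def)
    show "\<exists>s2>0. \<forall>x. x \<noteq> 0 \<longrightarrow> s2 < sl x \<longrightarrow> w x - b * sl x \<ge> - (p * ln (a' * sl x))"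
    \<comment> \<open>The second derivative contains the factor
      \<open>1 + \<mu> - \<mu> * \<xi>\<close>, which turns negative as the barrier accelerates; for
      \<open>\<mu> = \<kappa> * p\<close> the term \<open>\<kappa> * y\<^sup>2\<close> cancels its
      negative part exactly.\<close>
    proof (rule lower_power[OF p(1) _ a(1,2), of "\<kappa> * p"])
      show "\<kappa> * p > 0" using \<kappa> p by simp
      fix X \<xi> V :: real assume X: "0 < X" and \<xi>: "1 \<le> \<xi>" and V: "1 \<le> V"
      define y where "y = p * (a * (\<xi> * V)) / X"
      have "f (b - y) \<ge> k * y + \<kappa> * y\<^sup>2"
        using f_left_lower[OF b fb le1, of y] p a X \<xi> V unfolding k(1) \<kappa>_def by (simp add: y_def)
      moreover have "k * y \<ge> 1 / X"
      proof -
        have "k * y = (k * p * a) * (\<xi> * V) / X" by (simp add: y_def algebra_simps)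
        moreover have "1 * 1 \<le> \<xi> * V" using \<xi> V by (intro mult_mono) auto
        ultimately show ?thesis using X a by (simp add: divide_right_mono)
      qed
      moreover have "p * a\<^sup>2 * (\<xi> * V\<^sup>2) * (1 + \<kappa> * p - \<kappa> * p * \<xi>) / X\<^sup>2 + \<kappa> * y\<^sup>2 = p * a\<^sup>2 * (\<xi> * V\<^sup>2) * (1 + \<kappa> * p) / X\<^sup>2"
        unfolding y_def using X by (simp add: field_simps power2_eq_square)
      moreover have "p * a\<^sup>2 * (\<xi> * V\<^sup>2) * (1 + \<kappa> * p) / X\<^sup>2 \<ge> 0" using p \<kappa> \<xi> by simp
      ultimately have "p * a\<^sup>2 * (\<xi> * V\<^sup>2) * (1 + \<kappa> * p - \<kappa> * p * \<xi>) / X\<^sup>2 + f (b - y) \<ge> 1 / X" by linarith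
      then show "p * a\<^sup>2 * (\<xi> * V\<^sup>2) * (1 + \<kappa> * p - \<kappa> * p * \<xi>) / X\<^sup>2 + f (b - p * (a * (\<xi> * V)) / X) \<ge> X powr - ((q - 1) * p)"
        unfolding p(2) y_def using X by (simp add: powr_minus_divide)
    qed
  qed
  then show ?thesis unfolding p_def[symmetric] kp .
qed

text \<open>At a double root \<open>f\<close> and its first derivative vanish and the second
  derivative is \<open>1 + \<tau>\<close>, so the remainder is cubic.\<close>

lemma f_double:
  assumes \<omega>: "\<omega> < 0" "ft \<omega> = 0" and k: "lam * \<tau> * \<bar>\<omega>\<bar> powr (- \<tau> - 1) = 1" and y: "\<omega> + y < 0"
  shows "\<exists>t. min \<omega> (\<omega> + y) \<le> t \<and> t \<le> max \<omega> (\<omega> + y) \<and> f (\<omega> + y) = (1 + \<tau>) / 2 * y\<^sup>2 + f3 t / 6 * y ^ 3"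
proof -
  have "f \<omega> = 0" "f1 \<omega> = 0" using f_rho_ftilde[OF \<omega>(1)] f1_root[OF \<omega>] \<omega> k by auto
  moreover have "f2 \<omega> = 2 - (1 - \<tau>) * (lam * \<tau> * \<bar>\<omega>\<bar> powr (- \<tau> - 1))" unfolding f2_def using \<omega> by simp
  then have "f2 \<omega> = 1 + \<tau>" unfolding k by simp
  ultimately show ?thesis using f_rho_taylor3[OF \<omega>(1) y] by simp
qed

lemma f_double_left:
  assumes \<omega>: "\<omega> < 0" "ft \<omega> = 0" and k: "lam * \<tau> * \<bar>\<omega>\<bar> powr (- \<tau> - 1) = 1" and y: "0 \<le> y"
  shows "f (\<omega> - y) \<le> (1 + \<tau>) / 2 * y\<^sup>2 + \<bar>lam\<bar> * \<bar>\<omega>\<bar> powr (- \<tau> - 2) * y ^ 3"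
proof -
  obtain t where t: "t \<le> \<omega>" and e: "f (\<omega> - y) = (1 + \<tau>) / 2 * y\<^sup>2 - f3 t / 6 * y ^ 3"
    using f_double[OF \<omega> k, of "- y"] \<omega> y by auto
  have "\<bar>f3 t\<bar> \<le> 2 * \<bar>lam\<bar> * (- \<omega>) powr (- \<tau> - 2)" using f3_abs[OF t \<omega>(1)] .
  moreover have "\<bar>lam\<bar> * \<bar>\<omega>\<bar> powr (- \<tau> - 2) \<ge> 0" by simp
  ultimately have "- (f3 t / 6) \<le> \<bar>lam\<bar> * \<bar>\<omega>\<bar> powr (- \<tau> - 2)" using \<omega> by simp
  then have "- (f3 t / 6) * y ^ 3 \<le> \<bar>lam\<bar> * \<bar>\<omega>\<bar> powr (- \<tau> - 2) * y ^ 3" using y by (intro mult_right_mono) auto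
  then show ?thesis unfolding e by simp
qed

text \<open>Here \<open>f (b - y)\<close> starts with \<open>\<kappa> * y\<^sup>2\<close>, of the
  same order as the second derivative. With \<open>p = 2 / (q - 1)\<close> the exponential is
  \<open>1 / X\<^sup>2\<close>, and the balance reads
  \<open>a\<^sup>2 * (p + \<kappa> * p\<^sup>2) = 1\<close>.\<close>

lemma Z2_limit:
  assumes fb: "ft b = 0" and k: "lam * \<tau> * \<bar>b\<bar> powr (- \<tau> - 1) = 1"
  shows "((\<lambda>x. w x - (b * sl x - 2 / (q - 1) * ln (sl x))) \<longlongrightarrow> 1 / (q - 1) * ln (2 * (q + \<tau>) / (q - 1)\<^sup>2)) (at 0)"
proof -
  define p where "p = 2 / (q - 1)"
  have p: "p > 0" "(q - 1) * p = 2" using q by (auto simp: p_def field_simps)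
  define \<kappa> where "\<kappa> = (1 + \<tau>) / 2"
  have \<kappa>: "\<kappa> > 0" using tau by (simp add: \<kappa>_def)
  define D where "D = p + \<kappa> * p\<^sup>2"
  have D: "D > 0" using p \<kappa> by (simp add: D_def add_pos_pos)
  have D': "D = 2 * (q + \<tau>) / (q - 1)\<^sup>2"
  proof -
    have "2 / r + (1 + \<tau>) / 2 * (2 / r)\<^sup>2 = (2 * r + 2 * (1 + \<tau>)) / r\<^sup>2" if "r > 0" for r
      using that by (simp add: field_simps power2_eq_square)
    from this[of "q - 1"] show ?thesis unfolding D_def p_def \<kappa>_def using q by simp
  qed
  define a1 where "a1 = 1 / sqrt D"
  have a1: "a1 > 0" "a1\<^sup>2 * D = 1" using D by (auto simp: a1_def power_divide)
  have "f b = 0" using f_rho_ftilde[OF b] fb by simp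
  then have Z: "\<exists>s0. \<forall>x. x \<noteq> 0 \<longrightarrow> s0 < sl x \<longrightarrow> w x - b * sl x \<le> M" for M
    by (intro tends_to_minus_infinity) simp
  define K where "K = \<bar>lam\<bar> * \<bar>b\<bar> powr (- \<tau> - 2)"
  have K: "K \<ge> 0" by (simp add: K_def)
  have "((\<lambda>x. w x - (b * sl x - p * ln (sl x))) \<longlongrightarrow> - (p * ln a1)) (at 0)"
  proof (rule power_limit[OF p(1) a1(1)])
    fix a' assume a': "0 < a'" "a' < a1"
    obtain a where a: "a' < a" "a < a1" using dense[OF a'(2)] by blast
    have a0: "a > 0" using a a' by linarith
    have "a\<^sup>2 < a1\<^sup>2" using a a0 by (intro power_strict_mono) auto
    then have aD: "a\<^sup>2 * D < 1" using D a1(2) by (metis mult_strict_right_mono)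
    define C where "C = K * (p * a) ^ 3"
    have C: "C \<ge> 0" using p K a0 by (simp add: C_def)
    show "\<exists>s2>0. \<forall>x. x \<noteq> 0 \<longrightarrow> s2 < sl x \<longrightarrow> w x - b * sl x \<le> - (p * ln (a' * sl x))"
    proof (rule upper_power[OF p(1) a'(1) a(1) _ _ Z])
      show "C / (1 - a\<^sup>2 * D) + 1 > 0" using C aD by (simp add: add_nonneg_pos)
      fix X \<xi> assume X: "C / (1 - a\<^sup>2 * D) + 1 \<le> X" and \<xi>: "0 < \<xi>" "\<xi> \<le> (1::real)"
      have X0: "X > 0" using X C aD by (smt (verit) divide_nonneg_pos)
      have CX: "C / X \<le> 1 - a\<^sup>2 * D"
      proof -
        have "C / (1 - a\<^sup>2 * D) \<le> X" using X by linarith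
        then show ?thesis using aD X0 by (simp add: field_simps)
      qed
      define y where "y = p * (a * \<xi>) / X"
      have y: "y \<ge> 0" "y \<le> p * a / X"
        using p a0 \<xi> X0 by (auto simp: y_def mult_left_le intro!: divide_right_mono mult_left_mono)
      have "f (b - y) \<le> \<kappa> * y\<^sup>2 + K * y ^ 3" using f_double_left[OF b fb k y(1)] unfolding \<kappa>_def K_def .
      also have "\<dots> \<le> \<kappa> * (p * a / X)\<^sup>2 + K * (p * a / X) ^ 3"
        using y \<kappa> K by (intro add_mono mult_left_mono power_mono) auto
      also have "\<dots> = (\<kappa> * (p * a)\<^sup>2 + C / X) / X\<^sup>2"
        unfolding C_def using X0 by (simp add: field_simps power2_eq_square power3_eq_cube)
      finally have 1: "f (b - y) \<le> (\<kappa> * (p * a)\<^sup>2 + C / X) / X\<^sup>2" .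
      have "p * a\<^sup>2 * \<xi> / X\<^sup>2 \<le> p * a\<^sup>2 / X\<^sup>2" using p \<xi> by (intro divide_right_mono mult_left_le) auto
      then have "p * a\<^sup>2 * \<xi> / X\<^sup>2 + f (b - y) \<le> p * a\<^sup>2 / X\<^sup>2 + (\<kappa> * (p * a)\<^sup>2 + C / X) / X\<^sup>2" using 1 by linarith
      also have "\<dots> = (a\<^sup>2 * D + C / X) / X\<^sup>2" unfolding D_def by (simp add: add_divide_distrib[symmetric]) (simp add: algebra_simps power_mult_distrib)
      also have "\<dots> \<le> 1 / X\<^sup>2" using CX by (intro divide_right_mono) auto
      finally have "p * a\<^sup>2 * \<xi> / X\<^sup>2 + f (b - y) \<le> 1 / X\<^sup>2" .
      then show "p * a\<^sup>2 * \<xi> / X\<^sup>2 + f (b - p * (a * \<xi>) / X) \<le> X powr - ((q - 1) * p)"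
        unfolding p(2) y_def using X0 by (simp add: powr_minus_divide)
    qed
  next
    fix a' assume a': "a1 < a'"
    show "\<exists>s2>0. \<forall>x. x \<noteq> 0 \<longrightarrow> s2 < sl x \<longrightarrow> w x - b * sl x \<ge> - (p * ln (a' * sl x))"
    proof (rule lower_power[OF p(1) _ a1(1) a', of "\<kappa> * p"])
      show "\<kappa> * p > 0" using \<kappa> p by simp
      fix X \<xi> V :: real assume X: "0 < X" and \<xi>: "1 \<le> \<xi>" and V: "1 \<le> V"
      define y where "y = p * (a1 * (\<xi> * V)) / X"
      have "f (b - y) \<ge> \<kappa> * y\<^sup>2"
        using f_left_lower[OF b fb, of y] k p a1 X \<xi> V unfolding \<kappa>_def by (simp add: y_def)
      moreover have "p * a1\<^sup>2 * (\<xi> * V\<^sup>2) * (1 + \<kappa> * p - \<kappa> * p * \<xi>) / X\<^sup>2 + \<kappa> * y\<^sup>2 = (a1\<^sup>2 * D) * (\<xi> * V\<^sup>2) / X\<^sup>2"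
        unfolding y_def D_def using X by (simp add: field_simps power2_eq_square)
      moreover have "(a1\<^sup>2 * D) * (\<xi> * V\<^sup>2) / X\<^sup>2 \<ge> 1 / X\<^sup>2"
      proof -
        have "1 * 1\<^sup>2 \<le> \<xi> * V\<^sup>2" using \<xi> V by (intro mult_mono power_mono) auto
        then show ?thesis unfolding a1(2) by (simp add: divide_right_mono)
      qed
      ultimately have "p * a1\<^sup>2 * (\<xi> * V\<^sup>2) * (1 + \<kappa> * p - \<kappa> * p * \<xi>) / X\<^sup>2 + f (b - y) \<ge> 1 / X\<^sup>2" by linarith
      then show "p * a1\<^sup>2 * (\<xi> * V\<^sup>2) * (1 + \<kappa> * p - \<kappa> * p * \<xi>) / X\<^sup>2 + f (b - p * (a1 * (\<xi> * V)) / X) \<ge> X powr - ((q - 1) * p)"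
        unfolding p(2) y_def using X by (simp add: powr_minus_divide)
    qed
  qed
  moreover have "- (p * ln a1) = 1 / (q - 1) * ln D"
    unfolding a1_def p_def using D q by (simp add: ln_div ln_sqrt divide_simps)
  ultimately show ?thesis unfolding p_def[symmetric] D' by simp
qed

end

section \<open>Profiles near a root, with corrections of order 1 / sqrt s\<close>

definition rsqrt :: "real \<Rightarrow> real" where "rsqrt s = 1 / sqrt s"

lemma rsqrt_props:
  assumes "s > 0" shows "rsqrt s > 0" "(rsqrt s)\<^sup>2 = 1 / s" "(rsqrt has_real_derivative - ((rsqrt s) ^ 3 / 2)) (at s)"
proof -
  show 0: "rsqrt s > 0" and 1: "(rsqrt s)\<^sup>2 = 1 / s" using assms by (auto simp: rsqrt_def power_divide)
  have "((\<lambda>s. 1 / sqrt s) has_real_derivative - (1 * (inverse (sqrt s) / 2)) / (sqrt s * sqrt s)) (at s)"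
    using assms by (auto intro!: derivative_eq_intros)
  moreover have "- (1 * (inverse (sqrt s) / 2)) / (sqrt s * sqrt s) = - ((rsqrt s) ^ 3 / 2)"
    unfolding rsqrt_def using assms by (simp add: power3_eq_cube field_simps)
  moreover have "rsqrt = (\<lambda>s. 1 / sqrt s)" by (rule ext) (simp add: rsqrt_def)
  ultimately show "(rsqrt has_real_derivative - ((rsqrt s) ^ 3 / 2)) (at s)" by (simp only:)
qed

lemma tendsto_rsqrt: "(rsqrt \<longlongrightarrow> 0) at_top"
  unfolding rsqrt_def by (intro real_tendsto_divide_at_top[OF tendsto_const] sqrt_at_top)

lemma eventually_rsqrt:
  assumes "r0 > 0" "\<And>r. 0 < r \<Longrightarrow> r < r0 \<Longrightarrow> P r" shows "\<forall>\<^sub>F s in at_top. P (rsqrt s)"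
  using order_tendstoD(2)[OF tendsto_rsqrt assms(1)] eventually_gt_at_top[of 0]
  by eventually_elim (use assms(2) rsqrt_props in auto)

text \<open>For \<open>r = 1 / sqrt s\<close> one has \<open>r' = - r ^ 3 / 2\<close>, and
  \<open>ln s\<close> has derivative \<open>r\<^sup>2\<close>, so both derivatives are polynomials
  in \<open>r\<close>.\<close>

lemma family_derivs:
  assumes "s > 0"
  shows "((\<lambda>s. \<omega> * s + m * ln s + \<epsilon> * rsqrt s) has_real_derivative \<omega> + m * (rsqrt s)\<^sup>2 - \<epsilon> / 2 * rsqrt s ^ 3) (at s)"
    "((\<lambda>s. \<omega> + m * (rsqrt s)\<^sup>2 - \<epsilon> / 2 * rsqrt s ^ 3) has_real_derivative - (m * rsqrt s ^ 4) + 3 * \<epsilon> / 4 * rsqrt s ^ 5) (at s)"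
proof -
  note r = rsqrt_props[OF assms]
  have "((\<lambda>s. \<omega> * s + m * ln s + \<epsilon> * rsqrt s) has_real_derivative \<omega> + m * (1 / s) + \<epsilon> * - ((rsqrt s) ^ 3 / 2)) (at s)"
    using assms by (auto intro!: derivative_eq_intros r(3))
  then show "((\<lambda>s. \<omega> * s + m * ln s + \<epsilon> * rsqrt s) has_real_derivative \<omega> + m * (rsqrt s)\<^sup>2 - \<epsilon> / 2 * rsqrt s ^ 3) (at s)"
    unfolding r(2) by simp
  have "((\<lambda>s. \<omega> + m * (rsqrt s)\<^sup>2 - \<epsilon> / 2 * rsqrt s ^ 3) has_real_derivative
      m * (2 * rsqrt s * - ((rsqrt s) ^ 3 / 2)) - \<epsilon> / 2 * (3 * (rsqrt s)\<^sup>2 * - ((rsqrt s) ^ 3 / 2))) (at s)"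
    by (auto intro!: derivative_eq_intros r(3) simp: power2_eq_square)
  moreover have "m * (2 * rsqrt s * - ((rsqrt s) ^ 3 / 2)) - \<epsilon> / 2 * (3 * (rsqrt s)\<^sup>2 * - ((rsqrt s) ^ 3 / 2))
      = - (m * rsqrt s ^ 4) + 3 * \<epsilon> / 4 * rsqrt s ^ 5"
    by (simp add: eval_nat_numeral)
  ultimately show "((\<lambda>s. \<omega> + m * (rsqrt s)\<^sup>2 - \<epsilon> / 2 * rsqrt s ^ 3) has_real_derivative - (m * rsqrt s ^ 4) + 3 * \<epsilon> / 4 * rsqrt s ^ 5) (at s)"
    by simp
qed

lemma continuous_rsqrt: "continuous_on {0<..} rsqrt"
  unfolding rsqrt_def by (intro continuous_intros) auto

context log_solution
begin

text \<open>Since \<open>\<omega> < b\<close>, the right-hand side decays exponentially along the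
  profile, against a margin that is only a power of \<open>s\<close>.\<close>

lemma exp_dominated:
  assumes \<omega>: "\<omega> < b" and \<delta>: "\<delta> > 0"
  shows "\<forall>\<^sub>F s in at_top. exp ((q - 1) * (\<omega> * s + m * ln s + \<epsilon> * rsqrt s + C - b * s)) \<le> \<delta> * rsqrt s ^ 5"
proof -
  have l: "((\<lambda>s::real. ln s / s) \<longlongrightarrow> 0) at_top" using ln_x_over_x_tendsto_0 by simp
  have i: "((\<lambda>s::real. 1 / s) \<longlongrightarrow> 0) at_top" by (intro real_tendsto_divide_at_top[OF tendsto_const] filterlim_ident)
  have "((\<lambda>s. (q - 1) * ((\<omega> - b) + m * (ln s / s) + \<epsilon> * rsqrt s * (1 / s) + C * (1 / s)) + 5 / 2 * (ln s / s) - ln \<delta> * (1 / s))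
    \<longlongrightarrow> (q - 1) * ((\<omega> - b) + m * 0 + \<epsilon> * 0 * 0 + C * 0) + 5 / 2 * 0 - ln \<delta> * 0) at_top"
    by (intro tendsto_intros l i tendsto_rsqrt)
  moreover have "(q - 1) * ((\<omega> - b) + m * 0 + \<epsilon> * 0 * 0 + C * 0) + 5 / 2 * 0 - ln \<delta> * 0 < 0"
    using q \<omega> by (simp add: mult_pos_neg)
  ultimately have "\<forall>\<^sub>F s in at_top. (q - 1) * ((\<omega> - b) + m * (ln s / s) + \<epsilon> * rsqrt s * (1 / s) + C * (1 / s)) + 5 / 2 * (ln s / s) - ln \<delta> * (1 / s) < 0"
    by (rule order_tendstoD)
  then show ?thesis using eventually_gt_at_top[of 0]
  proof eventually_elim
    case (elim s)
    define Q where "Q = (q - 1) * (\<omega> * s + m * ln s + \<epsilon> * rsqrt s + C - b * s) + 5 / 2 * ln s - ln \<delta>"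
    have "Q = s * ((q - 1) * ((\<omega> - b) + m * (ln s / s) + \<epsilon> * rsqrt s * (1 / s) + C * (1 / s)) + 5 / 2 * (ln s / s) - ln \<delta> * (1 / s))"
      unfolding Q_def using elim(2) by (simp add: field_simps)
    then have "Q < 0" using elim by (simp add: mult_pos_neg)
    moreover have "ln (\<delta> * rsqrt s ^ 5) = ln \<delta> - 5 / 2 * ln s"
    proof -
      have "ln (rsqrt s) = - (ln s / 2)" unfolding rsqrt_def using elim(2) by (simp add: ln_div ln_sqrt)
      then show ?thesis using \<delta> rsqrt_props(1)[OF elim(2)] by (simp add: ln_mult ln_realpow)
    qed
    ultimately have "(q - 1) * (\<omega> * s + m * ln s + \<epsilon> * rsqrt s + C - b * s) \<le> ln (\<delta> * rsqrt s ^ 5)" unfolding Q_def by linarith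
    then have "exp ((q - 1) * (\<omega> * s + m * ln s + \<epsilon> * rsqrt s + C - b * s)) \<le> exp (ln (\<delta> * rsqrt s ^ 5))" by (subst exp_le_cancel_iff)
    then show ?case using \<delta> rsqrt_props(1)[OF elim(2)] by simp
  qed
qed

text \<open>All profiles and their corrections are of the form \<open>\<omega> s + m ln s + \<epsilon> / sqrt s\<close>; in \<open>r = 1 / sqrt s\<close> the conditions
  on their derivatives become polynomial.\<close>

lemma family_converges:
  assumes \<omega>: "\<omega> < b" "f \<omega> = 0"
    and sup: "r0 > 0" "\<And>r. 0 < r \<Longrightarrow> r < r0 \<Longrightarrow> - (m * r ^ 4) + 3 * \<epsilon> / 4 * r ^ 5 + f (\<omega> + m * r\<^sup>2 - \<epsilon> / 2 * r ^ 3) \<le> 0"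
    and sub: "\<delta> > 0" "\<And>r. 0 < r \<Longrightarrow> r < r0 \<Longrightarrow> - (m * r ^ 4) + 3 * \<epsilon>' / 4 * r ^ 5 + f (\<omega> + m * r\<^sup>2 - \<epsilon>' / 2 * r ^ 3) \<ge> \<delta> * r ^ 5"
    and M: "\<And>x. x \<noteq> 0 \<Longrightarrow> s0 < sl x \<Longrightarrow> \<bar>w x - (\<omega> * sl x + m * ln (sl x))\<bar> \<le> M"
  shows "\<exists>L. ((\<lambda>x. w x - (\<omega> * sl x + m * ln (sl x))) \<longlongrightarrow> L) (at 0)" "((\<lambda>x. x \<bullet> Gw x) \<longlongrightarrow> - \<omega>) (at 0)"
proof -
  \<comment> \<open>One family in three roles: \<open>F 0\<close> is the profile,
    \<open>F \<epsilon>\<close> the corrected supersolution and \<open>F \<epsilon>'\<close> the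
    corrected subsolution.\<close>
  define F where "F = (\<lambda>\<epsilon> s. \<omega> * s + m * ln s + \<epsilon> * rsqrt s)"
  define F1 where "F1 = (\<lambda>\<epsilon> s. \<omega> + m * (rsqrt s)\<^sup>2 - \<epsilon> / 2 * rsqrt s ^ 3)"
  define F2 where "F2 = (\<lambda>\<epsilon> s. - (m * rsqrt s ^ 4) + 3 * \<epsilon> / 4 * rsqrt s ^ 5)"
  have d: "(F \<epsilon> has_real_derivative F1 \<epsilon> s) (at s)" "(F1 \<epsilon> has_real_derivative F2 \<epsilon> s) (at s)" if "s > 0" for \<epsilon> s
    unfolding F_def F1_def F2_def using family_derivs[OF that] by blast+
  have c: "continuous_on {0<..} (F2 \<epsilon>)" for \<epsilon> unfolding F2_def by (intro continuous_intros continuous_rsqrt)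
  have lim: "(F1 0 \<longlongrightarrow> \<omega>) at_top" "(F2 0 \<longlongrightarrow> 0) at_top"
    unfolding F1_def F2_def by (rule tendsto_eq_intros tendsto_rsqrt refl | simp)+
  have small: "\<forall>\<^sub>F s in at_top. \<bar>e * rsqrt s\<bar> \<le> 1" for e
  proof -
    have "((\<lambda>s. \<bar>e * rsqrt s\<bar>) \<longlongrightarrow> \<bar>e * 0\<bar>) at_top" by (intro tendsto_intros tendsto_rsqrt)
    then have "\<forall>\<^sub>F s in at_top. \<bar>e * rsqrt s\<bar> < 1" by (rule order_tendstoD) simp
    then show ?thesis by eventually_elim simp
  qed
  have Sup: "\<forall>\<^sub>F s in at_top. F2 \<epsilon> s + f (F1 \<epsilon> s) \<le> 0"
    using eventually_rsqrt[of r0 "\<lambda>r. - (m * r ^ 4) + 3 * \<epsilon> / 4 * r ^ 5 + f (\<omega> + m * r\<^sup>2 - \<epsilon> / 2 * r ^ 3) \<le> 0", OF sup] unfolding F1_def F2_def by simp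
  have rsub: "\<forall>\<^sub>F s in at_top. - (m * rsqrt s ^ 4) + 3 * \<epsilon>' / 4 * rsqrt s ^ 5 + f (\<omega> + m * (rsqrt s)\<^sup>2 - \<epsilon>' / 2 * rsqrt s ^ 3) \<ge> \<delta> * rsqrt s ^ 5"
    by (rule eventually_rsqrt[OF sup(1)]) (rule sub(2))
  have Sub: "\<forall>\<^sub>F s in at_top. F2 \<epsilon>' s + f (F1 \<epsilon>' s) \<ge> exp ((q - 1) * (F \<epsilon>' s + (M + 1) - b * s))"
    using rsub exp_dominated[OF \<omega>(1) sub(1), of m \<epsilon>' "M + 1"]
    by eventually_elim (simp add: F_def F1_def F2_def)
  have r1: "\<forall>\<^sub>F s in at_top. rsqrt s ^ 5 \<le> 1"
    by (rule eventually_rsqrt[of 1]) (auto intro: power_le_one)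
  have Ex: "\<forall>\<^sub>F s in at_top. exp ((q - 1) * (F 0 s + M - b * s)) \<le> 1"
    using exp_dominated[OF \<omega>(1) zero_less_one, of m 0 M] r1 by eventually_elim (unfold F_def, linarith)
  obtain N where N: "\<And>s. s > N \<Longrightarrow> F2 \<epsilon> s + f (F1 \<epsilon> s) \<le> 0 \<and>
      F2 \<epsilon>' s + f (F1 \<epsilon>' s) \<ge> exp ((q - 1) * (F \<epsilon>' s + (M + 1) - b * s)) \<and>
      exp ((q - 1) * (F 0 s + M - b * s)) \<le> 1 \<and> \<bar>\<epsilon> * rsqrt s\<bar> \<le> 1 \<and> \<bar>\<epsilon>' * rsqrt s\<bar> \<le> 1"
    using eventually_conj[OF Sup eventually_conj[OF Sub eventually_conj[OF Ex eventually_conj[OF small[of \<epsilon>] small[of \<epsilon>']]]]]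
    unfolding eventually_at_top_dense by blast
  define a1 where "a1 = max (max N s0) (max a0 0)"
  have a1: "a0 \<le> a1" "N \<le> a1" "s0 \<le> a1" "0 \<le> a1" by (auto simp: a1_def)
  have VM: "\<bar>w x - F 0 (sl x)\<bar> \<le> M" if "x \<noteq> 0" "a1 < sl x" for x using M[of x] that a1 by (simp add: F_def)
  have E: "exp ((q - 1) * (w x - b * sl x)) \<le> 1" if x: "x \<noteq> 0" "a1 < sl x" for x
  proof -
    have "(q - 1) * (w x - b * sl x) \<le> (q - 1) * (F 0 (sl x) + M - b * sl x)"
      using VM[OF x] q by (intro mult_left_mono) auto
    moreover have "(q - 1) * (F 0 (sl x) + M - b * sl x) \<le> 0" using N[of "sl x"] x a1 by simp
    ultimately show ?thesis by simp
  qed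
  have cc: "continuous_on {a1<..} (F2 \<epsilon>)" for \<epsilon> by (rule continuous_on_subset[OF c]) (use a1 in auto)
  have F0: "F \<epsilon> s - F 0 s = \<epsilon> * rsqrt s" for \<epsilon> s by (simp add: F_def)
  have l0: "((\<lambda>s. \<epsilon> * rsqrt s) \<longlongrightarrow> 0) at_top" for \<epsilon> by (rule tendsto_eq_intros tendsto_rsqrt refl | simp)+
  have \<omega>0: "\<omega> < 0" using \<omega> b by linarith
  have "\<exists>L. ((\<lambda>x. w x - F 0 (sl x)) \<longlongrightarrow> L) (at 0)"
    by (rule convergence[where ?a1.0 = a1 and ?W1.0 = "F1 0" and ?W2.0 = "F2 0" and E = 1 and M = M and \<omega> = \<omega>
      and ?S0.0 = "F \<epsilon>" and ?S1.0 = "F1 \<epsilon>" and ?S2.0 = "F2 \<epsilon>" and ?T0.0 = "F \<epsilon>'" and ?T1.0 = "F1 \<epsilon>'" and ?T2.0 = "F2 \<epsilon>'"])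
      (use a1 E d cc lim \<omega>0 \<omega> VM N l0 in \<open>auto simp: F0\<close>)
  then obtain L where L: "((\<lambda>x. w x - F 0 (sl x)) \<longlongrightarrow> L) (at 0)" by blast
  then show "\<exists>L. ((\<lambda>x. w x - (\<omega> * sl x + m * ln (sl x))) \<longlongrightarrow> L) (at 0)" by (auto simp: F_def)
  show "((\<lambda>x. x \<bullet> Gw x) \<longlongrightarrow> - \<omega>) (at 0)"
    by (rule gradient_limit[where ?a1.0 = a1 and E = 1 and ?W0.0 = "F 0" and ?W1.0 = "F1 0" and ?W2.0 = "F2 0" and L = L])
      (use a1 E d cc lim L in auto)
qed

text \<open>As \<open>f\<close> lies below a logistic expression, the slope
  \<open>\<omega> + d * \<theta>\<close> with logistic \<open>\<theta>\<close> gives an explicit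
  supersolution. Its slope tends to \<open>p\<close>, so \<open>Z\<close> settles distant spheres;
  the transition between the slopes is placed at the point considered, where it costs only
  \<open>ln 2 / \<kappa>\<close>.\<close>

lemma upper_simple:
  assumes p: "\<omega> < p" and \<kappa>: "\<kappa> > 0" "\<And>t. \<omega> \<le> t \<Longrightarrow> t \<le> p \<Longrightarrow> f t \<le> - (\<kappa> * (t - \<omega>) * (p - t))"
    and Z: "\<And>M. \<exists>s0. \<forall>x. x \<noteq> 0 \<longrightarrow> s0 < sl x \<longrightarrow> w x - p * sl x \<le> M"
  shows "\<exists>s0 C. \<forall>x. x \<noteq> 0 \<longrightarrow> s0 < sl x \<longrightarrow> w x \<le> \<omega> * sl x + C"
proof -
  define s0 where "s0 = a0 + 1"
  have cs: "continuous_on {x. x \<noteq> 0 \<and> sl x = s0} w" by (rule continuous_w) (auto simp: s0_def)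
  define c where "c = smax w s0 - \<omega> * s0"
  define d where "d = p - \<omega>"
  have d: "d > 0" using p by (simp add: d_def)
  have "w x \<le> \<omega> * sl x + (c + ln 2 / \<kappa>)" if x: "x \<noteq> 0" "s0 < sl x" for x
  proof -
    define \<epsilon> where "\<epsilon> = exp (- (\<kappa> * d * (sl x - s0)))"
    define e where "e = (\<lambda>s. \<epsilon> * exp (\<kappa> * d * (s - s0)))"
    have e: "e s > 0" for s by (simp add: e_def \<epsilon>_def)
    have de: "(e has_real_derivative \<kappa> * d * e s) (at s)" for s
      unfolding e_def by (auto intro!: derivative_eq_intros)
    define \<theta> where "\<theta> = (\<lambda>s. e s / (1 + e s))"
    have \<theta>: "0 \<le> \<theta> s" "\<theta> s \<le> 1" for s using e[of s] by (auto simp: \<theta>_def)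
    have d\<theta>: "(\<theta> has_real_derivative \<kappa> * d * \<theta> s * (1 - \<theta> s)) (at s)" for s
    proof -
      have "1 + e s \<noteq> 0" using e[of s] by linarith
      then show ?thesis unfolding \<theta>_def
        by (auto intro!: derivative_eq_intros de simp: field_simps)
    qed
    have c\<theta>: "continuous_on T \<theta>" for T using d\<theta> by (meson DERIV_isCont continuous_at_imp_continuous_on)
    define B where "B = (\<lambda>s. \<omega> * s + c + ln (1 + e s) / \<kappa>)"
    have "w x \<le> B (sl x)"
    proof (rule radial_upper_at_top[where a = s0 and ?B1.0 = "\<lambda>s. \<omega> + d * \<theta> s" and ?B2.0 = "\<lambda>s. \<kappa> * d\<^sup>2 * \<theta> s * (1 - \<theta> s)"])
      fix s assume s: "s0 \<le> s"
      have "1 + e s > 0" using e[of s] by linarith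
      then have "(B has_real_derivative \<omega> + \<kappa> * d * e s / (1 + e s) / \<kappa>) (at s)"
        unfolding B_def using \<kappa>(1) by (auto intro!: derivative_eq_intros de)
      also have "\<omega> + \<kappa> * d * e s / (1 + e s) / \<kappa> = \<omega> + d * \<theta> s" unfolding \<theta>_def using \<kappa>(1) by simp
      finally show "(B has_real_derivative \<omega> + d * \<theta> s) (at s)" .
      show "((\<lambda>s. \<omega> + d * \<theta> s) has_real_derivative \<kappa> * d\<^sup>2 * \<theta> s * (1 - \<theta> s)) (at s)"
        by (auto intro!: derivative_eq_intros d\<theta> simp: power2_eq_square)
      have "d * \<theta> s \<le> d" using d \<theta>[of s] by (simp add: mult_left_le)
      then have "f (\<omega> + d * \<theta> s) \<le> - (\<kappa> * (\<omega> + d * \<theta> s - \<omega>) * (p - (\<omega> + d * \<theta> s)))"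
        using d \<theta>[of s] by (intro \<kappa>(2)) (simp, use \<open>d * \<theta> s \<le> d\<close> d_def in linarith)
      also have "\<dots> = - (\<kappa> * d\<^sup>2 * \<theta> s * (1 - \<theta> s))" by (simp add: d_def power2_eq_square algebra_simps)
      finally show "\<kappa> * d\<^sup>2 * \<theta> s * (1 - \<theta> s) + f (\<omega> + d * \<theta> s) \<le> exp ((q - 1) * (B s - b * s))"
        using exp_ge_zero[of "(q - 1) * (B s - b * s)"] by linarith
    next
      show "continuous_on {s0..} (\<lambda>s. \<kappa> * d\<^sup>2 * \<theta> s * (1 - \<theta> s))" by (intro continuous_intros c\<theta>)
      fix v :: 'a assume v: "v \<noteq> 0" "sl v = s0"
      have "ln (1 + e s0) / \<kappa> \<ge> 0" using e[of s0] \<kappa>(1) by simp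
      then show "w v \<le> B s0" unfolding B_def c_def using smax_smin(2)[OF cs v] by linarith
    next
      fix c' :: real
      define K where "K = c + ln \<epsilon> / \<kappa> - d * s0"
      obtain sM where sM: "\<And>x. x \<noteq> 0 \<Longrightarrow> sM < sl x \<Longrightarrow> w x - p * sl x \<le> K" using Z by blast
      define c'' where "c'' = max sM c' + 1"
      have c'': "c'' > sM" "c'' > c'" by (auto simp: c''_def)
      have "w v \<le> B c''" if "v \<noteq> 0" "sl v = c''" for v
      proof -
        have "ln (e c'') \<le> ln (1 + e c'')" using e[of c''] by (intro ln_mono) auto
        moreover have "ln (e c'') = ln \<epsilon> + \<kappa> * d * (c'' - s0)" by (simp add: e_def \<epsilon>_def ln_mult)
        ultimately have "(ln \<epsilon> + \<kappa> * d * (c'' - s0)) / \<kappa> \<le> ln (1 + e c'') / \<kappa>" using \<kappa>(1) by (simp add: divide_right_mono)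
        moreover have "(ln \<epsilon> + \<kappa> * d * (c'' - s0)) / \<kappa> = ln \<epsilon> / \<kappa> + d * c'' - d * s0" using \<kappa>(1) by (simp add: field_simps)
        moreover have "p * c'' = \<omega> * c'' + d * c''" by (simp add: d_def algebra_simps)
        ultimately show ?thesis unfolding B_def using sM[of v] that c'' K_def by auto
      qed
      then show "\<exists>c''>c'. \<forall>x. x \<noteq> 0 \<longrightarrow> sl x = c'' \<longrightarrow> w x \<le> B c''" using c'' by blast
    qed (use x in \<open>auto simp: s0_def\<close>)
    moreover have "e (sl x) = 1" by (simp add: e_def \<epsilon>_def exp_minus)
    ultimately show ?thesis unfolding B_def by simp
  qed
  then show ?thesis by blast
qed

text \<open>Because \<open>\<kappa> * m = 1\<close>, \<open>y = m / s\<close> solves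
  \<open>y' + \<kappa> * y\<^sup>2 = 0\<close>; the term \<open>2 * rsqrt\<close> creates the room
  for a supersolution. Far out the part \<open>m * ln\<close> dominates by \<open>Z\<close>. The
  argument is shifted by \<open>e\<close> so that the logarithm gains only a bounded amount up to
  the point considered.\<close>

lemma upper_double:
  assumes \<kappa>: "\<kappa> * m = 1" "m > 0" and y0: "y0 > 0" "\<And>y. 0 \<le> y \<Longrightarrow> y \<le> y0 \<Longrightarrow> f (\<omega> + y) \<le> \<kappa> * y\<^sup>2"
    and Z: "\<And>M. \<exists>s0. \<forall>x. x \<noteq> 0 \<longrightarrow> s0 < sl x \<longrightarrow> w x - (\<omega> * sl x + m * ln (sl x)) \<le> M"
  shows "\<exists>s0 C. \<forall>x. x \<noteq> 0 \<longrightarrow> s0 < sl x \<longrightarrow> w x \<le> \<omega> * sl x + C"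
proof -
  define s0 where "s0 = max 0 a0 + 1"
  have s0: "s0 \<ge> 1" "s0 > a0" by (auto simp: s0_def)
  have cs: "continuous_on {x. x \<noteq> 0 \<and> sl x = s0} w" by (rule continuous_w) (use s0 in auto)
  define c where "c = smax w s0 - \<omega> * s0"
  have \<kappa>0: "\<kappa> > 0" using \<kappa> by (metis zero_less_mult_pos2 zero_less_one)
  have "\<forall>\<^sub>F s in at_top. m * (rsqrt s)\<^sup>2 \<le> y0 \<and> rsqrt s \<le> m \<and> rsqrt s \<le> 1 \<and> \<kappa> * rsqrt s \<le> 1 / 2"
  proof (rule eventually_rsqrt)
    show "min (min 1 m) (min (y0 / m) (1 / (2 * \<kappa>))) > 0" using \<kappa> \<kappa>0 y0 by simp
    fix r assume r: "0 < r" "r < min (min 1 m) (min (y0 / m) (1 / (2 * \<kappa>)))"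
    then have "m * r \<le> y0" "\<kappa> * r \<le> 1 / 2" using \<kappa> \<kappa>0 by (auto simp: field_simps)
    moreover have "r * r \<le> r * 1" using r by (intro mult_left_mono) auto
    then have "m * r\<^sup>2 \<le> m * r" using \<kappa>(2) by (simp add: power2_eq_square)
    ultimately have "m * r\<^sup>2 \<le> y0" "\<kappa> * r \<le> 1 / 2" by linarith+
    then show "m * r\<^sup>2 \<le> y0 \<and> r \<le> m \<and> r \<le> 1 \<and> \<kappa> * r \<le> 1 / 2" using r by simp
  qed
  then obtain \<sigma>0 where \<sigma>0: "\<And>s. s > \<sigma>0 \<Longrightarrow> m * (rsqrt s)\<^sup>2 \<le> y0 \<and> rsqrt s \<le> m \<and> rsqrt s \<le> 1 \<and> \<kappa> * rsqrt s \<le> 1 / 2"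
    unfolding eventually_at_top_dense by blast
  have "w x \<le> \<omega> * sl x + (c + m * ln 2 + 2)" if x: "x \<noteq> 0" "s0 < sl x" for x
  proof -
    \<comment> \<open>\<open>T \<ge> sl x - s0\<close> gives \<open>sl x + e \<le> 2 * T\<close>, so
      the logarithm exceeds \<open>ln T\<close> by at most \<open>ln 2\<close>; the bound by
      \<open>\<sigma>0\<close> makes the barrier valid from \<open>s0\<close> on.\<close>
    define T where "T = max (max s0 (sl x - s0)) (max \<sigma>0 0 + 1)"
    have T: "T \<ge> s0" "T \<ge> sl x - s0" "T > \<sigma>0" "T > 0" by (auto simp: T_def)
    define e where "e = T - s0"
    have e: "e \<ge> 0" "s + e > \<sigma>0" "s + e > 0" if "s0 \<le> s" for s using T that by (auto simp: e_def)
    define B where "B = (\<lambda>s. (\<omega> * (s + e) + m * ln (s + e) + 2 * rsqrt (s + e)) + (c - \<omega> * e - m * ln T))"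
    define B1 where "B1 = (\<lambda>s. \<omega> + m * (rsqrt (s + e))\<^sup>2 - 2 / 2 * rsqrt (s + e) ^ 3)"
    define B2 where "B2 = (\<lambda>s. - (m * rsqrt (s + e) ^ 4) + 3 * 2 / 4 * rsqrt (s + e) ^ 5)"
    have "w x \<le> B (sl x)"
    proof (rule radial_upper_at_top[where a = s0 and ?B1.0 = B1 and ?B2.0 = B2])
      fix s assume s: "s0 \<le> s"
      note es = e[OF s]
      show "(B has_real_derivative B1 s) (at s)"
        using DERIV_add[OF family_derivs(1)[OF es(3), of \<omega> m 2, unfolded DERIV_shift] DERIV_const] unfolding B_def B1_def by simp
      show "(B1 has_real_derivative B2 s) (at s)"
        using family_derivs(2)[OF es(3), of \<omega> m 2, unfolded DERIV_shift] unfolding B1_def B2_def .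
      define r where "r = rsqrt (s + e)"
      have r: "r > 0" "m * r\<^sup>2 \<le> y0" "r \<le> m" "r \<le> 1" "\<kappa> * r \<le> 1 / 2"
        unfolding r_def using rsqrt_props(1)[OF es(3)] \<sigma>0[OF es(2)] by auto
      have y: "0 \<le> m * r\<^sup>2 - r ^ 3" "m * r\<^sup>2 - r ^ 3 \<le> y0"
      proof -
        have "r * r\<^sup>2 \<le> m * r\<^sup>2" using r by (intro mult_right_mono) auto
        then show "0 \<le> m * r\<^sup>2 - r ^ 3" by (simp add: power3_eq_cube power2_eq_square)
        have "r ^ 3 > 0" using r by simp
        then show "m * r\<^sup>2 - r ^ 3 \<le> y0" using r by linarith
      qed
      have "f (B1 s) \<le> \<kappa> * (m * r\<^sup>2 - r ^ 3)\<^sup>2" using y0(2)[OF y] unfolding B1_def r_def[symmetric] by (simp add: algebra_simps)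
      also have "\<dots> = (\<kappa> * m) * m * r ^ 4 - 2 * (\<kappa> * m) * r ^ 5 + (\<kappa> * r) * r ^ 5" by (simp add: eval_nat_numeral algebra_simps)
      also have "\<dots> \<le> m * r ^ 4 - 2 * r ^ 5 + 1 / 2 * r ^ 5"
      proof -
        have "\<kappa> * r * r ^ 5 \<le> 1 / 2 * r ^ 5" using r by (intro mult_right_mono) auto
        then show ?thesis unfolding \<kappa>(1) by linarith
      qed
      also have "\<dots> = - B2 s" unfolding B2_def r_def[symmetric] by simp
      finally show "B2 s + f (B1 s) \<le> exp ((q - 1) * (B s - b * s))"
        using exp_ge_zero[of "(q - 1) * (B s - b * s)"] by linarith
    next
      show "continuous_on {s0..} B2"
        unfolding B2_def by (intro continuous_intros continuous_on_compose2[OF continuous_rsqrt]) (use e in auto)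
      fix v :: 'a assume v: "v \<noteq> 0" "sl v = s0"
      have "rsqrt T > 0" using rsqrt_props(1) T by blast
      then have "B s0 \<ge> \<omega> * s0 + c" unfolding B_def e_def by (simp add: algebra_simps)
      then show "w v \<le> B s0" unfolding c_def using smax_smin(2)[OF cs v] by linarith
    next
      fix c' :: real
      obtain sM where sM: "\<And>x. x \<noteq> 0 \<Longrightarrow> sM < sl x \<Longrightarrow> w x - (\<omega> * sl x + m * ln (sl x)) \<le> c - m * ln T" using Z by blast
      define c'' where "c'' = max s0 (max sM c') + 1"
      have c'': "c'' > sM" "c'' > c'" "c'' > s0" by (auto simp: c''_def)
      have "w v \<le> B c''" if "v \<noteq> 0" "sl v = c''" for v
      proof -
        have "ln c'' \<le> ln (c'' + e)" using c'' s0 e[of c''] by (intro ln_mono) auto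
        then have "m * ln c'' \<le> m * ln (c'' + e)" using \<kappa> by simp
        moreover have "rsqrt (c'' + e) > 0" using rsqrt_props(1) e[of c''] c'' by simp
        ultimately show ?thesis unfolding B_def using sM[of v] that c'' by (simp add: algebra_simps)
      qed
      then show "\<exists>c''>c'. \<forall>x. x \<noteq> 0 \<longrightarrow> sl x = c'' \<longrightarrow> w x \<le> B c''" using c'' by blast
    qed (use x s0 in auto)
    moreover have "m * ln (sl x + e) \<le> m * ln T + m * ln 2"
    proof -
      have "ln (sl x + e) \<le> ln (T * 2)" using T e[of "sl x"] x by (intro ln_mono) (auto simp: e_def)
      also have "\<dots> = ln T + ln 2" using T by (simp add: ln_mult)
      finally have "m * ln (sl x + e) \<le> m * (ln T + ln 2)" using \<kappa> by simp
      then show ?thesis by (simp add: algebra_simps)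
    qed
    moreover have "rsqrt (sl x + e) \<le> 1" using \<sigma>0[OF e(2)] x by auto
    ultimately show ?thesis unfolding B_def by (simp add: algebra_simps)
  qed
  then show ?thesis by blast
qed

text \<open>Two corrections to \<open>\<omega> s + c\<close>: the logarithm blows down at
  \<open>s1\<close> as in \<open>lower_bounded\<close>, with \<open>\<kappa> * A = 1\<close>, and
  the term \<open>e\<close> decays at the rate \<open>\<mu>\<close> of the exponential right-hand
  side, so that its second derivative \<open>\<mu>\<^sup>2 * e\<close> dominates the latter.\<close>

lemma root_lower:
  assumes \<omega>: "\<omega> < b" and \<kappa>: "\<kappa> > 0" "\<And>y. 0 \<le> y \<Longrightarrow> f (\<omega> - y) \<ge> \<kappa> * y\<^sup>2"
  shows "\<exists>s0 C. \<forall>x. x \<noteq> 0 \<longrightarrow> s0 < sl x \<longrightarrow> w x \<ge> \<omega> * sl x - C"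
proof -
  define s0 where "s0 = max 0 a0 + 1"
  have s0: "s0 \<ge> 1" "s0 > a0" by (auto simp: s0_def)
  have cs: "continuous_on {x. x \<noteq> 0 \<and> sl x = s0} w" by (rule continuous_w) (use s0 in auto)
  define \<mu> where "\<mu> = (q - 1) * (b - \<omega>)"
  have \<mu>: "\<mu> > 0" using q \<omega> by (simp add: \<mu>_def)
  define c where "c = min (smin w s0 - \<omega> * s0 - 1) (ln (\<mu>\<^sup>2) / (q - 1) - 1)"
  have c: "c \<le> smin w s0 - \<omega> * s0 - 1" "exp ((q - 1) * (c + 1)) \<le> \<mu>\<^sup>2"
  proof -
    have "c + 1 \<le> ln (\<mu>\<^sup>2) / (q - 1)" by (simp add: c_def)
    then have "(q - 1) * (c + 1) \<le> ln (\<mu>\<^sup>2)" using q by (simp add: pos_le_divide_eq mult.commute)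
    then have "exp ((q - 1) * (c + 1)) \<le> exp (ln (\<mu>\<^sup>2))" by (subst exp_le_cancel_iff)
    then show "exp ((q - 1) * (c + 1)) \<le> \<mu>\<^sup>2" using \<mu> by simp
  qed (simp add: c_def)
  define A where "A = 1 / \<kappa>"
  have A: "A > 0" "\<kappa> * A = 1" using \<kappa>(1) by (auto simp: A_def)
  have "w x \<ge> \<omega> * sl x - (A * ln 2 - c)" if x: "x \<noteq> 0" "s0 < sl x" for x
  proof -
    define s1 where "s1 = s0 + 2 * (sl x - s0) + 1"
    note r = ln_ratio_bound[OF less_imp_le[OF x(2)], folded s1_def]
    have s01: "s0 < s1" using r x by simp
    define e where "e = (\<lambda>s. exp (- (\<mu> * (s - s0))))"
    have de: "(e has_real_derivative - (\<mu> * e s)) (at s)" for s unfolding e_def by (auto intro!: derivative_eq_intros)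
    have e: "e s > 0" "s0 \<le> s \<Longrightarrow> e s \<le> 1" for s using \<mu> by (auto simp: e_def)
    have ce: "continuous_on U e" for U unfolding e_def by (intro continuous_intros)
    define B where "B = (\<lambda>s. (\<omega> * s + c + e s) + A * ln ((s1 - s) / (s1 - s0)))"
    have "w x \<ge> B (sl x)"
    proof (rule radial_lower_blow[where a = s0 and c = s1 and ?B1.0 = "\<lambda>s. \<omega> - (\<mu> * e s + A / (s1 - s))"
          and ?B2.0 = "\<lambda>s. \<mu>\<^sup>2 * e s - A / (s1 - s)\<^sup>2"])
      fix s assume s: "s0 \<le> s" "s < s1"
      have "((\<lambda>s. \<omega> * s + c + e s) has_real_derivative \<omega> - \<mu> * e s) (at s)" by (auto intro!: derivative_eq_intros de)
      from DERIV_add[OF this DERIV_ln_ratio[OF s(2) s01, of A]]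
      show "(B has_real_derivative \<omega> - (\<mu> * e s + A / (s1 - s))) (at s)" unfolding B_def by (simp add: algebra_simps)
      show "((\<lambda>s. \<omega> - (\<mu> * e s + A / (s1 - s))) has_real_derivative \<mu>\<^sup>2 * e s - A / (s1 - s)\<^sup>2) (at s)"
        using s by (auto intro!: derivative_eq_intros de simp: field_simps power2_eq_square)
      have "(s1 - s) / (s1 - s0) \<le> 1" using s by (simp add: divide_le_eq_1)
      then have "ln ((s1 - s) / (s1 - s0)) \<le> 0" using s by (subst ln_le_zero_iff) auto
      then have "A * ln ((s1 - s) / (s1 - s0)) \<le> 0" using A by (simp add: mult_nonneg_nonpos)
      then have "B s - b * s \<le> (c + 1) - (b - \<omega>) * s" unfolding B_def using e(2)[OF s(1)] by (simp add: algebra_simps)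
      also have "\<dots> \<le> (c + 1) - (b - \<omega>) * (s - s0)" using \<omega> s0 by (simp add: algebra_simps mult_mono)
      finally have "(q - 1) * (B s - b * s) \<le> (q - 1) * ((c + 1) - (b - \<omega>) * (s - s0))" using q by (intro mult_left_mono) auto
      also have "\<dots> = (q - 1) * (c + 1) + - (\<mu> * (s - s0))" by (simp add: \<mu>_def algebra_simps)
      finally have "exp ((q - 1) * (B s - b * s)) \<le> exp ((q - 1) * (c + 1)) * e s" unfolding e_def by (simp add: exp_add[symmetric])
      also have "\<dots> \<le> \<mu>\<^sup>2 * e s" using c(2) e(1)[of s] by (intro mult_right_mono) auto
      also have "\<dots> \<le> \<mu>\<^sup>2 * e s - A / (s1 - s)\<^sup>2 + f (\<omega> - (\<mu> * e s + A / (s1 - s)))"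
      proof -
        have y: "0 \<le> A / (s1 - s)" "0 \<le> \<mu> * e s" using A s \<mu> e(1)[of s] by auto
        have "A / (s1 - s)\<^sup>2 = (\<kappa> * A) * A / (s1 - s)\<^sup>2" using A by simp
        also have "\<dots> = \<kappa> * (A / (s1 - s))\<^sup>2" by (simp add: power_divide power2_eq_square)
        also have "\<dots> \<le> \<kappa> * (\<mu> * e s + A / (s1 - s))\<^sup>2" using y \<kappa>(1) by (intro mult_left_mono power_mono) auto
        also have "\<dots> \<le> f (\<omega> - (\<mu> * e s + A / (s1 - s)))" using y by (intro \<kappa>(2)) auto
        finally show ?thesis by simp
      qed
      finally show "exp ((q - 1) * (B s - b * s)) \<le> \<mu>\<^sup>2 * e s - A / (s1 - s)\<^sup>2 + f (\<omega> - (\<mu> * e s + A / (s1 - s)))" .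
    next
      show "continuous_on {s0..<s1} (\<lambda>s. \<mu>\<^sup>2 * e s - A / (s1 - s)\<^sup>2)" by (intro continuous_intros ce) auto
      show "filterlim B at_bot (at_left s1)" unfolding B_def
        by (rule blow_down[OF A(1) s01, where l = "\<omega> * s1 + c + e s1"]) (auto intro!: tendsto_eq_intros simp: e_def)
      fix v :: 'a assume v: "v \<noteq> 0" "sl v = s0"
      then have "smin w s0 \<le> w v" by (rule smax_smin(4)[OF cs])
      then show "B s0 \<le> w v" unfolding B_def using c(1) s01 by (simp add: e_def)
    qed (use x r s0 in auto)
    moreover have "A * ln ((s1 - sl x) / (s1 - s0)) \<ge> A * (- ln 2)" using r A by (intro mult_left_mono) auto
    ultimately show ?thesis unfolding B_def using e(1)[of "sl x"] by simp
  qed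
  then show ?thesis by blast
qed

text \<open>The corrections are \<open>- rsqrt\<close> above and \<open>rsqrt\<close> below. Their
  second derivatives have size \<open>r ^ 5\<close>, while to the right of \<open>\<omega>\<close>
  the function \<open>f\<close> is at most \<open>K * y\<^sup>2\<close>, of order
  \<open>r ^ 6\<close> at \<open>y = r ^ 3 / 2\<close>, and to the left it is nonnegative.\<close>

lemma root_converges:
  assumes \<omega>: "\<omega> < b" "ft \<omega> = 0" and k: "lam * \<tau> * \<bar>\<omega>\<bar> powr (- \<tau> - 1) \<le> 1"
    and up: "\<exists>s0 C. \<forall>x. x \<noteq> 0 \<longrightarrow> s0 < sl x \<longrightarrow> w x \<le> \<omega> * sl x + C"
  shows "\<exists>L. ((\<lambda>x. w x - \<omega> * sl x) \<longlongrightarrow> L) (at 0)" "((\<lambda>x. x \<bullet> Gw x) \<longlongrightarrow> - \<omega>) (at 0)"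
proof -
  have \<omega>0: "\<omega> < 0" using \<omega> b by linarith
  have f\<omega>: "f \<omega> = 0" using f_rho_ftilde[OF \<omega>0] \<omega> by simp
  define \<kappa> where "\<kappa> = (1 + \<tau>) / 2"
  have \<kappa>: "\<kappa> > 0" using tau by (simp add: \<kappa>_def)
  define k where "k = \<bar>\<omega>\<bar> * (1 - lam * \<tau> * \<bar>\<omega>\<bar> powr (- \<tau> - 1))"
  have k0: "k \<ge> 0" unfolding k_def using k by (intro mult_nonneg_nonneg) auto
  have left: "f (\<omega> - y) \<ge> \<kappa> * y\<^sup>2" if "0 \<le> y" for y
    using f_left_lower[OF \<omega>0 \<omega>(2) k that] k0 that unfolding k_def[symmetric] \<kappa>_def
    by (meson add_increasing mult_nonneg_nonneg order_refl order_trans)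
  define K where "K = 1 + \<bar>lam\<bar> * (\<bar>\<omega>\<bar> / 2) powr (- \<tau> - 1)"
  have K: "K > 0" by (simp add: K_def add_pos_nonneg)
  have right: "f (\<omega> + y) \<le> K * y\<^sup>2" if "0 \<le> y" "y \<le> \<bar>\<omega>\<bar> / 2" for y
  proof -
    have "f (\<omega> + y) \<le> - k * y + K * y\<^sup>2" using f_right_upper[OF \<omega>0 \<omega>(2) that] unfolding k_def K_def .
    moreover have "k * y \<ge> 0" using k0 that by simp
    ultimately show ?thesis by simp
  qed
  obtain s1 C1 where u: "\<And>x. x \<noteq> 0 \<Longrightarrow> s1 < sl x \<Longrightarrow> w x \<le> \<omega> * sl x + C1" using up by blast
  obtain s2 C2 where l: "\<And>x. x \<noteq> 0 \<Longrightarrow> s2 < sl x \<Longrightarrow> w x \<ge> \<omega> * sl x - C2" using root_lower[OF \<omega>(1) \<kappa> left] by blast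
  define r0 where "r0 = min 1 (min \<bar>\<omega>\<bar> (3 / K))"
  have r0: "r0 > 0" using \<omega>0 K by (simp add: r0_def)
  have sup: "- (0 * r ^ 4) + 3 * (- 1) / 4 * r ^ 5 + f (\<omega> + 0 * r\<^sup>2 - (- 1) / 2 * r ^ 3) \<le> 0" if r: "0 < r" "r < r0" for r
  proof -
    have r1: "r \<le> 1" "r \<le> \<bar>\<omega>\<bar>" "K * r \<le> 3" using r K by (auto simp: r0_def field_simps)
    have "r ^ 3 \<le> r" using r r1 by (simp add: power_le_imp_le_exp power_decreasing[of 1 3 r, simplified])
    then have "f (\<omega> + r ^ 3 / 2) \<le> K * (r ^ 3 / 2)\<^sup>2" using r r1 by (intro right) auto
    also have "\<dots> = (K * r) * (r ^ 5 / 4)" by (simp add: eval_nat_numeral)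
    also have "\<dots> \<le> 3 * (r ^ 5 / 4)" using r1 r by (intro mult_right_mono) auto
    finally show ?thesis by simp
  qed
  have sub: "- (0 * r ^ 4) + 3 * 1 / 4 * r ^ 5 + f (\<omega> + 0 * r\<^sup>2 - 1 / 2 * r ^ 3) \<ge> 3 / 4 * r ^ 5" if r: "0 < r" "r < r0" for r
  proof -
    have "f (\<omega> - r ^ 3 / 2) \<ge> \<kappa> * (r ^ 3 / 2)\<^sup>2" using r by (intro left) auto
    moreover have "\<kappa> * (r ^ 3 / 2)\<^sup>2 \<ge> 0" using \<kappa> by simp
    ultimately show ?thesis by simp
  qed
  have M: "\<bar>w x - (\<omega> * sl x + 0 * ln (sl x))\<bar> \<le> max C1 C2" if "x \<noteq> 0" "max s1 s2 < sl x" for x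
    using u[of x] l[of x] that unfolding abs_le_iff by auto
  have \<delta>: "(3 / 4 :: real) > 0" by simp
  note fc = family_converges[where m = 0 and \<epsilon> = "- 1" and \<epsilon>' = 1 and \<delta> = "3 / 4" and ?r0.0 = r0 and ?s0.0 = "max s1 s2" and M = "max C1 C2", OF \<omega>(1) f\<omega> r0 sup \<delta> sub M]
  show "\<exists>L. ((\<lambda>x. w x - \<omega> * sl x) \<longlongrightarrow> L) (at 0)" "((\<lambda>x. x \<bullet> Gw x) \<longlongrightarrow> - \<omega>) (at 0)"
    using fc(1) by simp (rule fc(2), assumption+)
qed

end

section \<open>The alternatives behind the trichotomy of case P_0\<close>

lemma quasiconcave_dichotomy:
  fixes E :: "real \<Rightarrow> real"
  assumes "\<And>a s c. A < a \<Longrightarrow> a \<le> s \<Longrightarrow> s \<le> c \<Longrightarrow> min (E a) (E c) \<le> E s"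
  shows "(\<exists>C t. \<forall>s\<ge>t. E s \<ge> C) \<or> (\<forall>M. \<exists>t. \<forall>s\<ge>t. E s \<le> M)"
proof -
  have "\<exists>t>A. (\<forall>r s. t \<le> r \<longrightarrow> r \<le> s \<longrightarrow> - E r \<le> - E s) \<or> (\<forall>r s. t \<le> r \<longrightarrow> r \<le> s \<longrightarrow> - E s \<le> - E r)"
    by (rule quasiconvex_eventually_monotone) (use assms in \<open>fastforce simp: min_def max_def split: if_splits\<close>)
  then obtain t where "(\<forall>r s. t \<le> r \<longrightarrow> r \<le> s \<longrightarrow> E s \<le> E r) \<or> (\<forall>r s. t \<le> r \<longrightarrow> r \<le> s \<longrightarrow> E r \<le> E s)" by auto
  then show ?thesis
  proof
    assume d: "\<forall>r s. t \<le> r \<longrightarrow> r \<le> s \<longrightarrow> E s \<le> E r"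
    show ?thesis
    proof (cases "\<exists>C. \<forall>s\<ge>t. E s \<ge> C")
      case False
      have "\<exists>t. \<forall>s\<ge>t. E s \<le> M" for M
      proof -
        obtain s where "s \<ge> t" "E s < M" using False by (meson not_le)
        then show ?thesis using d by (meson dual_order.trans less_imp_le)
      qed
      then show ?thesis by blast
    qed blast
  next
    assume "\<forall>r s. t \<le> r \<longrightarrow> r \<le> s \<longrightarrow> E r \<le> E s"
    then show ?thesis by blast
  qed
qed

context log_solution
begin

text \<open>\<open>upper_sharp\<close> supplies the bounded potential that the Harnack inequality
  assumes.\<close>

lemma harnack_sphere: "\<exists>C s0. \<forall>x y. x \<noteq> 0 \<longrightarrow> y \<noteq> 0 \<longrightarrow> s0 < sl y \<longrightarrow> sl x = sl y \<longrightarrow> w x \<le> w y + C"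
proof -
  obtain K where K: "K \<ge> 0" "\<And>y. f (b + y) \<le> f b + K * (\<bar>y\<bar> + y\<^sup>2)" using f_growth_at_b by blast
  have "max 0 (f b) + 1 > max 0 (f b)" by simp
  from upper_sharp[OF K this] obtain a1 where a1: "a1 \<ge> a0"
    "\<And>x. x \<noteq> 0 \<Longrightarrow> a1 < sl x \<Longrightarrow> exp ((q - 1) * (w x - b * sl x)) \<le> max 0 (f b) + 1" by blast
  obtain H where H: "H > 0" "\<And>x y. x \<noteq> 0 \<Longrightarrow> y \<noteq> 0 \<Longrightarrow> a1 + 6 < sl y \<Longrightarrow> \<bar>sl x - sl y\<bar> \<le> 1 / 2 \<Longrightarrow> exp (w x) \<le> H * exp (w y)"
    using harnack[OF a1] by blast
  have "w x \<le> w y + ln H" if "x \<noteq> 0" "y \<noteq> 0" "a1 + 6 < sl y" "sl x = sl y" for x y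
  proof -
    have "exp (w x) \<le> exp (w y + ln H)" using H(2)[of x y] that H(1) by (simp add: exp_add mult.commute)
    then show ?thesis by simp
  qed
  then show ?thesis by blast
qed

text \<open>The minima are cut off at \<open>C\<close> because only translates of \<open>T\<close>
  up to \<open>C\<close> are subsolutions. The truncated function is quasiconcave, hence eventually
  monotone; if it tends to minus infinity, the cut-off is inactive and the Harnack inequality passes
  from the minimum to the whole sphere.\<close>

lemma sub_dichotomy:
  assumes A: "a0 \<le> A"
    and T: "\<And>s. A < s \<Longrightarrow> (T has_real_derivative T1 s) (at s)" "\<And>s. A < s \<Longrightarrow> (T1 has_real_derivative T2 s) (at s)"
      "continuous_on {A<..} T2"
    and sub: "\<And>s. A < s \<Longrightarrow> T2 s + f (T1 s) \<ge> exp ((q - 1) * (T s + C - b * s))"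
  shows "(\<exists>c s0. \<forall>x. x \<noteq> 0 \<longrightarrow> s0 < sl x \<longrightarrow> w x - T (sl x) \<ge> c) \<or>
    (\<forall>M. \<exists>s0. \<forall>x. x \<noteq> 0 \<longrightarrow> s0 < sl x \<longrightarrow> w x - T (sl x) \<le> M)"
proof -
  define E where "E = (\<lambda>s. min (smin w s - T s) C)"
  have "min (E a) (E c) \<le> E s" if "A < a" "a \<le> s" "s \<le> c" for a s c
    using smin_quasiconcave[OF A T sub that, of "min (E a) (E c)"] by (simp add: E_def min_le_iff_disj)
  from quasiconcave_dichotomy[OF this]
  show ?thesis
  proof
    assume "\<exists>C t. \<forall>s\<ge>t. C \<le> E s"
    then obtain c t where c: "\<And>s. s \<ge> t \<Longrightarrow> E s \<ge> c" by blast
    have "w x - T (sl x) \<ge> c" if x: "x \<noteq> 0" "max t A < sl x" for x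
      using c[of "sl x"] smin_bounds(2)[of "sl x" x] x A by (auto simp: E_def)
    then show ?thesis by blast
  next
    assume e: "\<forall>M. \<exists>t. \<forall>s\<ge>t. E s \<le> M"
    obtain H s1 where H: "\<And>x y. x \<noteq> 0 \<Longrightarrow> y \<noteq> 0 \<Longrightarrow> s1 < sl y \<Longrightarrow> sl x = sl y \<Longrightarrow> w x \<le> w y + H" using harnack_sphere by blast
    have "\<exists>s0. \<forall>x. x \<noteq> 0 \<longrightarrow> s0 < sl x \<longrightarrow> w x - T (sl x) \<le> M" for M
    proof -
      obtain t where t: "\<And>s. s \<ge> t \<Longrightarrow> E s \<le> min (M - H) (C - 1)" using e by blast
      have "w x - T (sl x) \<le> M" if x: "x \<noteq> 0" "max (max t A) s1 < sl x" for x
      proof -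
        have xs: "t \<le> sl x" "A < sl x" "s1 < sl x" using x by auto
        obtain y where y: "y \<noteq> 0" "sl y = sl x" "w y = smin w (sl x)" using smin_bounds(1)[of "sl x"] xs A by auto
        have "smin w (sl x) - T (sl x) \<le> M - H" using t[OF xs(1)] by (auto simp: E_def min_def split: if_splits)
        moreover have "w x \<le> w y + H" using H[OF x(1) y(1) _ y(2)[symmetric]] xs by (simp add: y(2))
        ultimately show ?thesis using y by linarith
      qed
      then show ?thesis by blast
    qed
    then show ?thesis by blast
  qed
qed

text \<open>If every increment over a step \<open>h\<close> exceeded \<open>p * h\<close>, their sum
  would keep \<open>w - p s\<close> bounded below along a sequence of spheres, against
  \<open>Z\<close>.\<close>

lemma small_increment:
  assumes h: "h > 0" and Z: "\<And>M. \<exists>s0. \<forall>x. x \<noteq> 0 \<longrightarrow> s0 < sl x \<longrightarrow> w x - p * sl x \<le> M" and A: "a0 < A"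
  shows "\<exists>a\<ge>A. smin w (a + h) - smin w a \<le> p * h"
proof (rule ccontr)
  assume "\<not> ?thesis"
  then have n: "smin w (a + h) - smin w a > p * h" if "a \<ge> A" for a using that by (meson not_le)
  have i: "smin w (A + real n * h) - p * (A + real n * h) \<ge> smin w A - p * A" for n
  proof (induction n)
    case (Suc n)
    have "smin w ((A + real n * h) + h) - smin w (A + real n * h) > p * h" using h by (intro n) simp
    moreover have "A + real (Suc n) * h = (A + real n * h) + h" by (simp add: algebra_simps)
    moreover have "p * ((A + real n * h) + h) = p * (A + real n * h) + p * h" by (simp add: algebra_simps)
    ultimately show ?case using Suc by (simp only:)
  qed simp
  obtain s0 where s0: "\<And>x. x \<noteq> 0 \<Longrightarrow> s0 < sl x \<Longrightarrow> w x - p * sl x \<le> smin w A - p * A - 1" using Z by blast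
  obtain n where n: "real n > (s0 - A) / h" using reals_Archimedean2 by blast
  then have "s0 < A + real n * h" using h by (simp add: field_simps)
  moreover obtain y where "y \<noteq> 0" "sl y = A + real n * h" "w y = smin w (A + real n * h)"
  proof -
    have "0 \<le> real n * h" using h by simp
    then have "a0 < A + real n * h" using A by linarith
    then show ?thesis using that smin_bounds(1) by blast
  qed
  ultimately show False using s0[of y] i[of n] by simp
qed

text \<open>A subsolution leaving the sphere minimum of \<open>w\<close> faster than this minimum grows can never be
  caught up with again, by comparison on the annulus up to the meeting point.\<close>

lemma growth_of_subsolution:
  assumes p: "p < H1 c"
    and H: "\<And>s. c \<le> s \<Longrightarrow> (H has_real_derivative H1 s) (at s)" "\<And>s. c \<le> s \<Longrightarrow> (H1 has_real_derivative H2 s) (at s)"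
      "continuous_on {c..} H2"
    and sub: "\<And>s. c \<le> s \<Longrightarrow> H2 s + f (H1 s) \<ge> exp ((q - 1) * (H s - b * s + K))"
    and Zp: "\<And>M. \<exists>s0. \<forall>x. x \<noteq> 0 \<longrightarrow> s0 < sl x \<longrightarrow> w x - p * sl x \<le> M"
    and Zb: "\<And>M. \<exists>s0. \<forall>x. x \<noteq> 0 \<longrightarrow> s0 < sl x \<longrightarrow> w x - b * sl x \<le> M"
  shows "\<exists>s0 a C. s0 \<ge> c + a \<and> (\<forall>x. x \<noteq> 0 \<longrightarrow> s0 < sl x \<longrightarrow> w x \<le> H (sl x - a) + C)"
proof -
  \<comment> \<open>The initial slope of \<open>H\<close> exceeds \<open>p\<close>, so
    \<open>H\<close> gains more than \<open>p * h\<close> over a short step \<open>h\<close>; by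
    \<open>small_increment\<close> the minimum of \<open>w\<close> does not, from a suitable
    starting sphere.\<close>
  obtain hd where hd: "hd > 0" "\<And>h. 0 < h \<Longrightarrow> h < hd \<Longrightarrow> H c - p * c < H (c + h) - p * (c + h)"
    using DERIV_pos_inc_right[of "\<lambda>s. H s - p * s" "H1 c - p" c] DERIV_diff[OF H(1)[OF order_refl] DERIV_cmult_Id[of p c]] p by auto
  define h where "h = hd / 2"
  have h: "h > 0" "H (c + h) - H c > p * h" using hd(1) hd(2)[of h] by (auto simp: h_def algebra_simps)
  obtain s1 where s1: "\<And>x. x \<noteq> 0 \<Longrightarrow> s1 < sl x \<Longrightarrow> w x - b * sl x \<le> K + H c - b * c" using Zb by blast
  obtain HC s2 where HC: "\<And>x y. x \<noteq> 0 \<Longrightarrow> y \<noteq> 0 \<Longrightarrow> s2 < sl y \<Longrightarrow> sl x = sl y \<Longrightarrow> w x \<le> w y + HC" using harnack_sphere by blast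
  have "a0 < max (max a0 s1) s2 + 1" by linarith
  then obtain a where a: "a \<ge> max (max a0 s1) s2 + 1" "smin w (a + h) - smin w a \<le> p * h"
    using small_increment[OF h(1) Zp, of "max (max a0 s1) s2 + 1"] by blast
  have a': "a0 < a" "s1 < a" "s2 < a" using a by auto
  have va: "smin w a - b * a \<le> K + H c - b * c"
  proof -
    obtain z where "z \<noteq> 0" "sl z = a" "w z = smin w a" using smin_bounds(1)[OF a'(1)] by blast
    then show ?thesis using s1[of z] a' by simp
  qed
  define e where "e = a - c"
  \<comment> \<open>If the minimum caught up at \<open>s\<close>, comparison on the annulus from
    \<open>a\<close> to \<open>s\<close> would force it to have grown by at least
    \<open>H (c + h) - H c\<close> already at \<open>a + h\<close>.\<close>
  have main: "smin w s < smin w a + (H (s - e) - H c)" if s: "a + h < s" for s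
  proof (rule ccontr)
    assume n: "\<not> ?thesis"
    obtain x where x: "x \<noteq> 0" "sl x = a + h" "w x = smin w (a + h)" using smin_bounds(1)[of "a + h"] a' h by auto
    have "w x \<ge> H (sl x - e) + (smin w a - H c)"
    proof (rule radial_lower[where a = a and c = s and B = "\<lambda>t. H (t - e) + (smin w a - H c)" and ?B1.0 = "\<lambda>t. H1 (t - e)" and ?B2.0 = "\<lambda>t. H2 (t - e)"])
      have cH: "continuous_on {c..} H"
        by (rule DERIV_continuous_on[of _ H H1]) (use H(1) in \<open>auto intro: has_field_derivative_at_within\<close>)
      show "continuous_on {a..s} (\<lambda>t. H (t - e) + (smin w a - H c))"
        by (intro continuous_intros continuous_on_compose2[OF cH]) (auto simp: e_def)
      show "continuous_on {a<..<s} (\<lambda>t. H2 (t - e))"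
        by (intro continuous_intros continuous_on_compose2[OF H(3)]) (auto simp: e_def)
      fix t assume t: "a < t" "t < s"
      then have t': "c \<le> t + (- e)" by (simp add: e_def)
      show "((\<lambda>t. H (t - e) + (smin w a - H c)) has_real_derivative H1 (t - e)) (at t)"
        using DERIV_add[OF H(1)[OF t', unfolded DERIV_shift] DERIV_const] by simp
      show "((\<lambda>t. H1 (t - e)) has_real_derivative H2 (t - e)) (at t)"
        using H(2)[OF t', unfolded DERIV_shift] by simp
      have "H (t - e) + (smin w a - H c) - b * t \<le> H (t - e) - b * (t - e) + K"
        using va by (simp add: e_def algebra_simps)
      then have "(q - 1) * (H (t - e) + (smin w a - H c) - b * t) \<le> (q - 1) * (H (t - e) - b * (t - e) + K)"
        using q by (intro mult_left_mono) auto
      then have "exp ((q - 1) * (H (t - e) + (smin w a - H c) - b * t)) \<le> exp ((q - 1) * (H (t - e) - b * (t - e) + K))" by (subst exp_le_cancel_iff)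
      also have "\<dots> \<le> H2 (t - e) + f (H1 (t - e))" using t' by (intro sub) simp
      finally show "exp ((q - 1) * (H (t - e) + (smin w a - H c) - b * t)) \<le> H2 (t - e) + f (H1 (t - e))" .
    next
      fix v :: 'a assume v: "v \<noteq> 0" "sl v = a \<or> sl v = s"
      then show "H (sl v - e) + (smin w a - H c) \<le> w v"
        using smin_bounds(2)[of "sl v" v] n a' s h by (auto simp: e_def)
    qed (use s a' h x in auto)
    then show False using x a(2) h by (simp add: e_def add.commute)
  qed
  have "w x \<le> H (sl x - e) + (smin w a - H c + HC)" if x: "x \<noteq> 0" "a + h < sl x" for x
  proof -
    obtain y where y: "y \<noteq> 0" "sl y = sl x" "w y = smin w (sl x)" using smin_bounds(1)[of "sl x"] x a' h by auto
    have "w x \<le> w y + HC" using HC[OF x(1) y(1) _ y(2)[symmetric]] x a' h by (simp add: y(2))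
    then show ?thesis using main[OF x(2)] y by linarith
  qed
  then show ?thesis using h by (intro exI[of _ "a + h"] exI[of _ e] exI[of _ "smin w a - H c + HC"]) (auto simp: e_def)
qed

text \<open>The subsolution has slope \<open>\<omega> + y\<close> with \<open>y\<close> decaying at
  rate \<open>k\<close>: since \<open>2 * k \<le> \<kappa>\<close>, a surplus \<open>k * y\<close>
  remains after the second derivative, and \<open>k \<le> (q - 1) * (b - \<omega>)\<close> lets it
  dominate the exponential. The initial slope \<open>p\<close> exceeds \<open>b\<close>, as
  \<open>growth_of_subsolution\<close> requires, and \<open>H\<close> stays below
  \<open>\<omega> s\<close>.\<close>

lemma growth_linear:
  assumes \<omega>: "\<omega> < b" "b < p" and \<kappa>: "\<kappa> > 0" "\<And>t. \<omega> \<le> t \<Longrightarrow> t \<le> p \<Longrightarrow> f t \<ge> \<kappa> * (t - \<omega>)"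
    and Zb: "\<And>M. \<exists>s0. \<forall>x. x \<noteq> 0 \<longrightarrow> s0 < sl x \<longrightarrow> w x - b * sl x \<le> M"
  shows "\<exists>s0 C. \<forall>x. x \<noteq> 0 \<longrightarrow> s0 < sl x \<longrightarrow> w x \<le> \<omega> * sl x + C"
proof -
  define k where "k = min (\<kappa> / 2) ((q - 1) * (b - \<omega>))"
  have k: "k > 0" "2 * k \<le> \<kappa>" "k \<le> (q - 1) * (b - \<omega>)" using \<kappa>(1) q \<omega> by (auto simp: k_def)
  define y0 where "y0 = p - \<omega>"
  have y0: "y0 > 0" using \<omega> by (simp add: y0_def)
  define y where "y = (\<lambda>s. y0 * exp (- (k * s)))"
  have dy: "(y has_real_derivative - (k * y s)) (at s)" for s unfolding y_def by (auto intro!: derivative_eq_intros)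
  define H where "H = (\<lambda>s. \<omega> * s - y s / k)"
  have "\<exists>s0 a C. s0 \<ge> 0 + a \<and> (\<forall>x. x \<noteq> 0 \<longrightarrow> s0 < sl x \<longrightarrow> w x \<le> H (sl x - a) + C)"
  proof (rule growth_of_subsolution[where p = b and c = 0 and ?H1.0 = "\<lambda>s. \<omega> + y s" and ?H2.0 = "\<lambda>s. - (k * y s)" and K = "ln (k * y0) / (q - 1)"])
    show "b < \<omega> + y 0" using \<omega> by (simp add: y_def y0_def)
    fix s :: real assume s: "0 \<le> s"
    show "(H has_real_derivative \<omega> + y s) (at s)" unfolding H_def using k(1) by (auto intro!: derivative_eq_intros dy)
    show "((\<lambda>s. \<omega> + y s) has_real_derivative - (k * y s)) (at s)" by (auto intro!: derivative_eq_intros dy)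
    have ys: "0 < y s" "y s \<le> y0" using y0 k s by (auto simp: y_def mult_left_le)
    have "H s - b * s \<le> - ((b - \<omega>) * s)" unfolding H_def using ys k by (simp add: algebra_simps)
    then have "(q - 1) * (H s - b * s + ln (k * y0) / (q - 1)) \<le> (q - 1) * (- ((b - \<omega>) * s) + ln (k * y0) / (q - 1))"
      using q by (intro mult_left_mono) auto
    also have "\<dots> = ln (k * y0) - ((q - 1) * (b - \<omega>)) * s" unfolding distrib_left using q by simp
    also have "\<dots> \<le> ln (k * y0) + - (k * s)" using mult_right_mono[OF k(3) s] by simp
    finally have "exp ((q - 1) * (H s - b * s + ln (k * y0) / (q - 1))) \<le> exp (ln (k * y0) + - (k * s))" by (subst exp_le_cancel_iff)
    also have "\<dots> = k * y s" unfolding exp_add y_def using k y0 by simp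
    also have "\<dots> \<le> - (k * y s) + f (\<omega> + y s)"
    proof -
      have "f (\<omega> + y s) \<ge> \<kappa> * (\<omega> + y s - \<omega>)" using ys by (intro \<kappa>(2)) (auto simp: y0_def)
      moreover have "2 * k * y s \<le> \<kappa> * y s" using k ys by (intro mult_right_mono) auto
      ultimately show ?thesis by simp
    qed
    finally show "exp ((q - 1) * (H s - b * s + ln (k * y0) / (q - 1))) \<le> - (k * y s) + f (\<omega> + y s)" .
  next
    show "continuous_on {0..} (\<lambda>s. - (k * y s))" unfolding y_def by (intro continuous_intros)
  qed (rule Zb)+
  then obtain s0 a C where C: "\<And>x. x \<noteq> 0 \<Longrightarrow> s0 < sl x \<Longrightarrow> w x \<le> H (sl x - a) + C" by blast
  have "w x \<le> \<omega> * sl x + (C - \<omega> * a)" if x: "x \<noteq> 0" "s0 < sl x" for x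
  proof -
    have "y (sl x - a) / k > 0" using y0 k by (simp add: y_def)
    then show ?thesis using C[OF x] by (simp add: H_def right_diff_distrib)
  qed
  then show ?thesis by blast
qed

lemma below_slope:
  assumes "\<omega> < p" and "\<exists>s0 C. \<forall>x. x \<noteq> 0 \<longrightarrow> s0 < sl x \<longrightarrow> w x \<le> \<omega> * sl x + C"
  shows "\<exists>s0. \<forall>x. x \<noteq> 0 \<longrightarrow> s0 < sl x \<longrightarrow> w x - p * sl x \<le> M"
proof -
  obtain s0 C where C: "\<And>x. x \<noteq> 0 \<Longrightarrow> s0 < sl x \<Longrightarrow> w x \<le> \<omega> * sl x + C" using assms(2) by blast
  have "w x - p * sl x \<le> M" if x: "x \<noteq> 0" "max s0 ((C - M) / (p - \<omega>)) < sl x" for x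
  proof -
    have "(C - M) / (p - \<omega>) < sl x" using x by simp
    then have "C - M < (p - \<omega>) * sl x" using assms(1) by (simp add: field_simps)
    then show ?thesis using C[of x] x by (simp add: algebra_simps)
  qed
  then show ?thesis by blast
qed

text \<open>The line of slope \<open>b\<close> and height \<open>ln (f b) / (q - 1)\<close> solves
  the equation, so its lower translates are subsolutions and \<open>sub_dichotomy\<close>
  applies.\<close>

lemma U_or_small:
  assumes fb: "f b > 0"
  shows "((\<lambda>x. w x - b * sl x) \<longlongrightarrow> ln (f b) / (q - 1)) (at 0) \<or>
    (\<forall>M. \<exists>s0. \<forall>x. x \<noteq> 0 \<longrightarrow> s0 < sl x \<longrightarrow> w x - b * sl x \<le> M)"
proof -
  have "(\<exists>c s0. \<forall>x. x \<noteq> 0 \<longrightarrow> s0 < sl x \<longrightarrow> w x - b * sl x \<ge> c) \<or>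
    (\<forall>M. \<exists>s0. \<forall>x. x \<noteq> 0 \<longrightarrow> s0 < sl x \<longrightarrow> w x - b * sl x \<le> M)"
    by (rule sub_dichotomy[where A = a0 and ?T1.0 = "\<lambda>s. b" and ?T2.0 = "\<lambda>s. 0" and C = "ln (f b) / (q - 1)"])
      (use fb q in \<open>auto intro!: derivative_eq_intros\<close>)
  then show ?thesis using U_limit[OF fb] by blast
qed

text \<open>\<open>sub_dichotomy\<close> is applied to the lower correction. In its first
  alternative \<open>up\<close> supplies the other half of the bound for
  \<open>family_converges\<close>; in the second, the bounded correction can be removed
  again.\<close>

lemma family_dichotomy:
  assumes \<omega>: "\<omega> < b" "f \<omega> = 0"
    and sup: "r0 > 0" "\<And>r. 0 < r \<Longrightarrow> r < r0 \<Longrightarrow> - (m * r ^ 4) + 3 * \<epsilon> / 4 * r ^ 5 + f (\<omega> + m * r\<^sup>2 - \<epsilon> / 2 * r ^ 3) \<le> 0"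
    and sub: "\<delta> > 0" "\<And>r. 0 < r \<Longrightarrow> r < r0 \<Longrightarrow> - (m * r ^ 4) + 3 * \<epsilon>' / 4 * r ^ 5 + f (\<omega> + m * r\<^sup>2 - \<epsilon>' / 2 * r ^ 3) \<ge> \<delta> * r ^ 5"
    and up: "\<exists>s0 C. \<forall>x. x \<noteq> 0 \<longrightarrow> s0 < sl x \<longrightarrow> w x \<le> \<omega> * sl x + m * ln (sl x) + C"
  shows "(\<exists>L. ((\<lambda>x. w x - (\<omega> * sl x + m * ln (sl x))) \<longlongrightarrow> L) (at 0)) \<and> ((\<lambda>x. x \<bullet> Gw x) \<longlongrightarrow> - \<omega>) (at 0)
    \<or> (\<forall>M. \<exists>s0. \<forall>x. x \<noteq> 0 \<longrightarrow> s0 < sl x \<longrightarrow> w x - (\<omega> * sl x + m * ln (sl x)) \<le> M)"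
proof -
  define F where "F = (\<lambda>s. \<omega> * s + m * ln s + \<epsilon>' * rsqrt s)"
  define F1 where "F1 = (\<lambda>s. \<omega> + m * (rsqrt s)\<^sup>2 - \<epsilon>' / 2 * rsqrt s ^ 3)"
  define F2 where "F2 = (\<lambda>s. - (m * rsqrt s ^ 4) + 3 * \<epsilon>' / 4 * rsqrt s ^ 5)"
  have rsub: "\<forall>\<^sub>F s in at_top. - (m * rsqrt s ^ 4) + 3 * \<epsilon>' / 4 * rsqrt s ^ 5 + f (\<omega> + m * (rsqrt s)\<^sup>2 - \<epsilon>' / 2 * rsqrt s ^ 3) \<ge> \<delta> * rsqrt s ^ 5"
    by (rule eventually_rsqrt[OF sup(1)]) (rule sub(2))
  have Sub: "\<forall>\<^sub>F s in at_top. F2 s + f (F1 s) \<ge> exp ((q - 1) * (F s + 0 - b * s))"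
    using rsub exp_dominated[OF \<omega>(1) sub(1), of m \<epsilon>' 0]
    by eventually_elim (simp add: F_def F1_def F2_def)
  have r1: "\<forall>\<^sub>F s in at_top. \<bar>rsqrt s\<bar> \<le> 1"
    by (rule eventually_rsqrt[of 1]) auto
  obtain N where N: "\<And>s. s > N \<Longrightarrow> F2 s + f (F1 s) \<ge> exp ((q - 1) * (F s + 0 - b * s)) \<and> \<bar>rsqrt s\<bar> \<le> 1"
    using eventually_conj[OF Sub r1] unfolding eventually_at_top_dense by blast
  define A where "A = max (max N a0) 0"
  have A: "a0 \<le> A" "N \<le> A" "0 \<le> A" by (auto simp: A_def)
  have er: "\<bar>\<epsilon>' * rsqrt s\<bar> \<le> \<bar>\<epsilon>'\<bar>" if "N < s" for s
    using N[OF that] by (simp add: abs_mult mult_left_le)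
  have "(\<exists>c s0. \<forall>x. x \<noteq> 0 \<longrightarrow> s0 < sl x \<longrightarrow> w x - F (sl x) \<ge> c) \<or>
    (\<forall>M. \<exists>s0. \<forall>x. x \<noteq> 0 \<longrightarrow> s0 < sl x \<longrightarrow> w x - F (sl x) \<le> M)"
  proof (rule sub_dichotomy[where A = A and ?T1.0 = F1 and ?T2.0 = F2 and C = 0])
    show "continuous_on {A<..} F2" unfolding F2_def
      by (intro continuous_intros continuous_on_subset[OF continuous_rsqrt]) (use A in auto)
    fix s assume s: "A < s"
    show "(F has_real_derivative F1 s) (at s)" "(F1 has_real_derivative F2 s) (at s)"
      unfolding F_def F1_def F2_def by (rule family_derivs; use s A in linarith)+
    show "exp ((q - 1) * (F s + 0 - b * s)) \<le> F2 s + f (F1 s)" using N[of s] s A by simp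
  qed (use A in auto)
  then show ?thesis
  proof
    assume "\<exists>c s0. \<forall>x. x \<noteq> 0 \<longrightarrow> s0 < sl x \<longrightarrow> w x - F (sl x) \<ge> c"
    then obtain c s1 where c: "\<And>x. x \<noteq> 0 \<Longrightarrow> s1 < sl x \<Longrightarrow> w x - F (sl x) \<ge> c" by blast
    obtain C s2 where C: "\<And>x. x \<noteq> 0 \<Longrightarrow> s2 < sl x \<Longrightarrow> w x \<le> \<omega> * sl x + m * ln (sl x) + C" using up by blast
    have M: "\<bar>w x - (\<omega> * sl x + m * ln (sl x))\<bar> \<le> \<bar>c\<bar> + \<bar>\<epsilon>'\<bar> + \<bar>C\<bar>" if "x \<noteq> 0" "max N (max s1 s2) < sl x" for x
      using c[of x] C[of x] er[of "sl x"] that unfolding F_def by auto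
    show ?thesis using family_converges[OF \<omega> sup sub M] by blast
  next
    assume e: "\<forall>M. \<exists>s0. \<forall>x. x \<noteq> 0 \<longrightarrow> s0 < sl x \<longrightarrow> w x - F (sl x) \<le> M"
    have "\<exists>s0. \<forall>x. x \<noteq> 0 \<longrightarrow> s0 < sl x \<longrightarrow> w x - (\<omega> * sl x + m * ln (sl x)) \<le> M" for M
    proof -
      obtain s1 where s1: "\<And>x. x \<noteq> 0 \<Longrightarrow> s1 < sl x \<Longrightarrow> w x - F (sl x) \<le> M - \<bar>\<epsilon>'\<bar>" using e by blast
      have "w x - (\<omega> * sl x + m * ln (sl x)) \<le> M" if "x \<noteq> 0" "max N s1 < sl x" for x
        using s1[of x] er[of "sl x"] that unfolding F_def by auto
      then show ?thesis by blast
    qed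
    then show ?thesis by blast
  qed
qed

text \<open>Successive alternatives: unless the last behaviour holds, \<open>w - b s\<close> tends
  to minus infinity, and \<open>growth_linear\<close> brings \<open>w\<close> below the profile of
  \<open>\<omega>2\<close>. If \<open>w\<close> does not converge to that profile, it falls
  infinitely far below it; then \<open>upper_simple\<close> brings it below the profile of
  \<open>\<omega>1\<close>, where \<open>root_converges\<close> applies.\<close>

lemma trichotomy_simple:
  assumes \<omega>2: "\<omega>2 < b" "ft \<omega>2 = 0" "\<omega>1 < \<omega>2"
    and \<omega>1: "ft \<omega>1 = 0" "lam * \<tau> * \<bar>\<omega>1\<bar> powr (- \<tau> - 1) \<le> 1"
    and right: "b < p" "\<kappa> > 0" "\<And>t. \<omega>2 \<le> t \<Longrightarrow> t \<le> p \<Longrightarrow> f t \<ge> \<kappa> * (t - \<omega>2)"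
    and left: "\<kappa>' > 0" "\<And>t. \<omega>1 \<le> t \<Longrightarrow> t \<le> \<omega>2 \<Longrightarrow> f t \<le> - (\<kappa>' * (t - \<omega>1) * (\<omega>2 - t))"
    and fb: "f b > 0"
  shows "(\<exists>L. ((\<lambda>x. w x - \<omega>1 * sl x) \<longlongrightarrow> L) (at 0)) \<and> ((\<lambda>x. x \<bullet> Gw x) \<longlongrightarrow> - \<omega>1) (at 0)
    \<or> (\<exists>L. ((\<lambda>x. w x - (\<omega>2 * sl x + 0 * ln (sl x))) \<longlongrightarrow> L) (at 0)) \<and> ((\<lambda>x. x \<bullet> Gw x) \<longlongrightarrow> - \<omega>2) (at 0)
    \<or> ((\<lambda>x. w x - b * sl x) \<longlongrightarrow> ln (f b) / (q - 1)) (at 0)"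
  using U_or_small[OF fb]
proof
  assume small: "\<forall>M. \<exists>s0. \<forall>x. x \<noteq> 0 \<longrightarrow> s0 < sl x \<longrightarrow> w x - b * sl x \<le> M"
  obtain s0 C where up: "\<And>x. x \<noteq> 0 \<Longrightarrow> s0 < sl x \<Longrightarrow> w x \<le> \<omega>2 * sl x + C"
    using growth_linear[OF \<omega>2(1) right] small by blast
  have "f \<omega>2 = 0" using f_rho_ftilde[of \<omega>2] \<omega>2 b by simp
  note fd = family_dichotomy[OF \<omega>2(1) this]
  define d where "d = \<omega>2 - \<omega>1"
  have d: "d > 0" using \<omega>2 by (simp add: d_def)
  define r0 where "r0 = min (min 1 d) (min (min (p - \<omega>2) (2 * \<kappa> / 7)) (\<kappa>' * d / 3))"
  have r0: "r0 > 0" using d right left \<omega>2 by (simp add: r0_def)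
  have bounds: "r \<le> 1" "r \<le> d" "r \<le> p - \<omega>2" "7 / 4 * r\<^sup>2 \<le> \<kappa> / 2" "3 / 4 * r\<^sup>2 \<le> \<kappa>' * d / 4" "r ^ 3 \<le> r"
    if r: "0 < r" "r < r0" for r
  proof -
    have r': "r \<le> 1" "r \<le> d" "r \<le> p - \<omega>2" "7 * r \<le> 2 * \<kappa>" "3 * r \<le> \<kappa>' * d" using r by (auto simp: r0_def)
    then show "r \<le> 1" "r \<le> d" "r \<le> p - \<omega>2" by blast+
    have "r\<^sup>2 \<le> r" using r r' by (simp add: power2_eq_square mult_left_le)
    then show "7 / 4 * r\<^sup>2 \<le> \<kappa> / 2" "3 / 4 * r\<^sup>2 \<le> \<kappa>' * d / 4" using r' by linarith+
    show "r ^ 3 \<le> r" using r r' power_decreasing[of 1 3 r] by simp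
  qed
  \<comment> \<open>The signs of the corrections are opposite to those in
    \<open>root_converges\<close>: \<open>f\<close> is negative just to the left of
    \<open>\<omega>2\<close> and positive to the right.\<close>
  have sup: "- (0 * r ^ 4) + 3 * 1 / 4 * r ^ 5 + f (\<omega>2 + 0 * r\<^sup>2 - 1 / 2 * r ^ 3) \<le> 0" if r: "0 < r" "r < r0" for r
  proof -
    note bd = bounds[OF r]
    define y where "y = r ^ 3 / 2"
    have y: "y > 0" "y \<le> d / 2" using r bd by (auto simp: y_def)
    have "f (\<omega>2 - y) \<le> - (\<kappa>' * (\<omega>2 - y - \<omega>1) * (\<omega>2 - (\<omega>2 - y)))" using y by (intro left(2)) (auto simp: d_def)
    also have "\<dots> = - (\<kappa>' * (d - y) * y)" by (simp add: d_def algebra_simps)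
    also have "\<dots> \<le> - (\<kappa>' * (d / 2) * y)" using y left(1) by (intro le_imp_neg_le mult_right_mono mult_left_mono) auto
    also have "\<dots> = - (\<kappa>' * d / 4 * r ^ 3)" by (simp add: y_def)
    finally have 1: "f (\<omega>2 - y) \<le> - (\<kappa>' * d / 4 * r ^ 3)" .
    have "3 / 4 * r\<^sup>2 * r ^ 3 \<le> \<kappa>' * d / 4 * r ^ 3" using bd r by (intro mult_right_mono) auto
    moreover have "r\<^sup>2 * r ^ 3 = r ^ 5" by (simp add: eval_nat_numeral)
    ultimately show ?thesis using 1 unfolding y_def by simp
  qed
  have sub: "- (0 * r ^ 4) + 3 * (- 1) / 4 * r ^ 5 + f (\<omega>2 + 0 * r\<^sup>2 - (- 1) / 2 * r ^ 3) \<ge> 1 * r ^ 5" if r: "0 < r" "r < r0" for r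
  proof -
    note bd = bounds[OF r]
    define y where "y = r ^ 3 / 2"
    have y: "y > 0" "y \<le> p - \<omega>2" using r bd by (auto simp: y_def)
    have "f (\<omega>2 + y) \<ge> \<kappa> * (\<omega>2 + y - \<omega>2)" using y by (intro right(3)) auto
    moreover have "\<kappa> * (\<omega>2 + y - \<omega>2) = \<kappa> / 2 * r ^ 3" by (simp add: y_def)
    moreover have "7 / 4 * r\<^sup>2 * r ^ 3 \<le> \<kappa> / 2 * r ^ 3" using bd r by (intro mult_right_mono) auto
    moreover have "r\<^sup>2 * r ^ 3 = r ^ 5" by (simp add: eval_nat_numeral)
    ultimately show ?thesis unfolding y_def by simp
  qed
  have up': "\<exists>s0 C. \<forall>x. x \<noteq> 0 \<longrightarrow> s0 < sl x \<longrightarrow> w x \<le> \<omega>2 * sl x + 0 * ln (sl x) + C"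
    using up by auto
  have "(\<exists>L. ((\<lambda>x. w x - (\<omega>2 * sl x + 0 * ln (sl x))) \<longlongrightarrow> L) (at 0)) \<and> ((\<lambda>x. x \<bullet> Gw x) \<longlongrightarrow> - \<omega>2) (at 0)
    \<or> (\<forall>M. \<exists>s0. \<forall>x. x \<noteq> 0 \<longrightarrow> s0 < sl x \<longrightarrow> w x - (\<omega>2 * sl x + 0 * ln (sl x)) \<le> M)"
    by (rule fd[OF r0 sup zero_less_one sub up'])
  then show ?thesis
  proof
    assume "\<forall>M. \<exists>s0. \<forall>x. x \<noteq> 0 \<longrightarrow> s0 < sl x \<longrightarrow> w x - (\<omega>2 * sl x + 0 * ln (sl x)) \<le> M"
    then have "\<exists>s0 C. \<forall>x. x \<noteq> 0 \<longrightarrow> s0 < sl x \<longrightarrow> w x \<le> \<omega>1 * sl x + C"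
      by (intro upper_simple[OF \<omega>2(3) left]) auto
    from root_converges[OF less_trans[OF \<omega>2(3,1)] \<omega>1 this] show ?thesis by blast
  qed blast
qed blast

text \<open>For \<open>lam > 0\<close> the third derivative is nonpositive, so the quadratic Taylor
  polynomial is an upper bound with the exact coefficient.\<close>

lemma f_double_right:
  assumes \<omega>: "\<omega> < 0" "ft \<omega> = 0" and k: "lam * \<tau> * \<bar>\<omega>\<bar> powr (- \<tau> - 1) = 1" and lam: "lam > 0"
    and y: "0 \<le> y" "y \<le> \<bar>\<omega>\<bar> / 2"
  shows "f (\<omega> + y) \<le> (1 + \<tau>) / 2 * y\<^sup>2"
    "f (\<omega> + y) \<ge> (1 + \<tau>) / 2 * y\<^sup>2 - \<bar>lam\<bar> * (\<bar>\<omega>\<bar> / 2) powr (- \<tau> - 2) * y ^ 3"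
proof -
  have y': "\<omega> + y \<le> \<omega> / 2" using y \<omega> by simp
  obtain t where t: "t \<le> \<omega> + y" and e': "f (\<omega> + y) = (1 + \<tau>) / 2 * y\<^sup>2 + f3 t / 6 * y ^ 3"
    using f_double[OF \<omega> k, of y] \<omega> y y' by auto
  have "f3 t \<le> 0" unfolding f3_def using lam tau by simp
  then have "f3 t / 6 * y ^ 3 \<le> 0" using y by (intro mult_nonpos_nonneg) auto
  then show "f (\<omega> + y) \<le> (1 + \<tau>) / 2 * y\<^sup>2" unfolding e' by linarith
  have "\<bar>f3 t\<bar> \<le> 2 * \<bar>lam\<bar> * (- (\<omega> / 2)) powr (- \<tau> - 2)" using f3_abs[of t "\<omega> / 2"] t y y' \<omega> by auto
  moreover have "\<bar>lam\<bar> * (\<bar>\<omega>\<bar> / 2) powr (- \<tau> - 2) \<ge> 0" by simp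
  ultimately have "- (\<bar>lam\<bar> * (\<bar>\<omega>\<bar> / 2) powr (- \<tau> - 2)) \<le> f3 t / 6" using \<omega> by simp
  then have "- (\<bar>lam\<bar> * (\<bar>\<omega>\<bar> / 2) powr (- \<tau> - 2)) * y ^ 3 \<le> f3 t / 6 * y ^ 3" using y by (intro mult_right_mono) auto
  then show "f (\<omega> + y) \<ge> (1 + \<tau>) / 2 * y\<^sup>2 - \<bar>lam\<bar> * (\<bar>\<omega>\<bar> / 2) powr (- \<tau> - 2) * y ^ 3" unfolding e' by simp
qed

text \<open>The upper bound \<open>\<omega> s + m ln s + C\<close> takes two stages. First
  \<open>growth_linear\<close>, at a slope \<open>\<omega>'\<close> slightly above
  \<open>\<omega>\<close>, makes \<open>w\<close> fall behind the slope \<open>\<omega>''\<close>;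
  then the subsolution \<open>H\<close>, whose slope at \<open>c\<close> exceeds
  \<open>\<omega>''\<close>, can be used in \<open>growth_of_subsolution\<close>. The rest follows
  the pattern of the simple root, with \<open>upper_double\<close> in place of
  \<open>upper_simple\<close>.\<close>

lemma trichotomy_double:
  assumes \<omega>: "\<omega> < b" "ft \<omega> = 0" and k: "lam * \<tau> * \<bar>\<omega>\<bar> powr (- \<tau> - 1) = 1" and lam: "lam > 0"
    and right: "b < p" "\<And>\<omega>'. \<omega> < \<omega>' \<Longrightarrow> \<omega>' < b \<Longrightarrow> \<exists>\<kappa>>0. \<forall>t. \<omega>' \<le> t \<longrightarrow> t \<le> p \<longrightarrow> f t \<ge> \<kappa> * (t - \<omega>')"
    and fb: "f b > 0"
  shows "(\<exists>L. ((\<lambda>x. w x - \<omega> * sl x) \<longlongrightarrow> L) (at 0)) \<and> ((\<lambda>x. x \<bullet> Gw x) \<longlongrightarrow> - \<omega>) (at 0)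
    \<or> (\<exists>L. ((\<lambda>x. w x - (\<omega> * sl x + 2 / (1 + \<tau>) * ln (sl x))) \<longlongrightarrow> L) (at 0)) \<and> ((\<lambda>x. x \<bullet> Gw x) \<longlongrightarrow> - \<omega>) (at 0)
    \<or> ((\<lambda>x. w x - b * sl x) \<longlongrightarrow> ln (f b) / (q - 1)) (at 0)"
  using U_or_small[OF fb]
proof
  assume small: "\<forall>M. \<exists>s0. \<forall>x. x \<noteq> 0 \<longrightarrow> s0 < sl x \<longrightarrow> w x - b * sl x \<le> M"
  have \<omega>0: "\<omega> < 0" using \<omega> b by linarith
  have f\<omega>: "f \<omega> = 0" using f_rho_ftilde[OF \<omega>0] \<omega> by simp
  define m where "m = 2 / (1 + \<tau>)"
  define \<kappa> where "\<kappa> = (1 + \<tau>) / 2"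
  have m: "m > 0" "\<kappa> * m = 1" "\<kappa> > 0" using tau by (auto simp: m_def \<kappa>_def)
  define K where "K = \<bar>lam\<bar> * (\<bar>\<omega>\<bar> / 2) powr (- \<tau> - 2)"
  have K: "K \<ge> 0" by (simp add: K_def)
  note fr = f_double_right[OF \<omega>0 \<omega>(2) k lam, folded \<kappa>_def K_def]
  define r0 where "r0 = min (min 1 m) (min (min (\<bar>\<omega>\<bar> / (2 * (m + 1))) (1 / (2 * \<kappa>))) (1 / (4 * (K * (m + 1) ^ 3 + 1))))"
  have Km: "K * (m + 1) ^ 3 + 1 > 0" using K m by (simp add: add_nonneg_pos)
  have "\<bar>\<omega>\<bar> / (2 * (m + 1)) > 0" using \<omega>0 m by (intro divide_pos_pos) auto
  then have r0: "r0 > 0" using m Km by (simp add: r0_def)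
  have bounds: "r \<le> 1" "r \<le> m" "m * r\<^sup>2 + r ^ 3 \<le> \<bar>\<omega>\<bar> / 2" "\<kappa> * r \<le> 1 / 2" "K * (m + 1) ^ 3 * r \<le> 1 / 4" "r ^ 3 \<le> m * r\<^sup>2"
    "m * r\<^sup>2 + r ^ 3 \<le> (m + 1) * r\<^sup>2"
    if r: "0 < r" "r < r0" for r
  proof -
    have r': "r \<le> 1" "r \<le> m" "r \<le> \<bar>\<omega>\<bar> / (2 * (m + 1))" "r \<le> 1 / (2 * \<kappa>)" "r \<le> 1 / (4 * (K * (m + 1) ^ 3 + 1))" using r by (auto simp: r0_def)
    show "r \<le> 1" "r \<le> m" by (fact r')+
    show "\<kappa> * r \<le> 1 / 2" using r'(4) m by (simp add: field_simps)
    have "r * (4 * (K * (m + 1) ^ 3 + 1)) \<le> 1" using r'(5) Km by (subst (asm) pos_le_divide_eq) auto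
    then show "K * (m + 1) ^ 3 * r \<le> 1 / 4" using r by (simp add: algebra_simps)
    have r2: "r\<^sup>2 \<le> r" using r r' by (simp add: power2_eq_square mult_left_le)
    have r3: "r ^ 3 = r * r\<^sup>2" by (simp add: eval_nat_numeral)
    show "r ^ 3 \<le> m * r\<^sup>2" unfolding r3 using r' by (intro mult_right_mono) auto
    have "r * r\<^sup>2 \<le> 1 * r\<^sup>2" using r' by (intro mult_right_mono) auto
    then show 1: "m * r\<^sup>2 + r ^ 3 \<le> (m + 1) * r\<^sup>2" unfolding r3 by (simp add: algebra_simps)
    also have "\<dots> \<le> (m + 1) * r" using r2 m by (intro mult_left_mono) auto
    also have "\<dots> \<le> \<bar>\<omega>\<bar> / 2"
    proof -
      have "r * (2 * (m + 1)) \<le> \<bar>\<omega>\<bar>" using r'(3) m by (subst (asm) pos_le_divide_eq) auto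
      then show ?thesis by (simp add: algebra_simps)
    qed
    finally show "m * r\<^sup>2 + r ^ 3 \<le> \<bar>\<omega>\<bar> / 2" .
  qed
  \<comment> \<open>\<open>\<kappa> * m = 1\<close> cancels the terms of order \<open>r ^ 4\<close>;
    the coefficient 2 of the correction leaves a definite sign at order
    \<open>r ^ 5\<close>.\<close>
  have sup: "- (m * r ^ 4) + 3 * 2 / 4 * r ^ 5 + f (\<omega> + m * r\<^sup>2 - 2 / 2 * r ^ 3) \<le> 0" if r: "0 < r" "r < r0" for r
  proof -
    note bd = bounds[OF r]
    have r3: "r ^ 3 > 0" using r by simp
    have "f (\<omega> + (m * r\<^sup>2 - r ^ 3)) \<le> \<kappa> * (m * r\<^sup>2 - r ^ 3)\<^sup>2" using bd r3 by (intro fr(1)) linarith+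
    also have "\<dots> = (\<kappa> * m) * m * r ^ 4 - 2 * (\<kappa> * m) * r ^ 5 + (\<kappa> * r) * r ^ 5" by (simp add: eval_nat_numeral algebra_simps)
    also have "\<dots> \<le> m * r ^ 4 - 2 * r ^ 5 + 1 / 2 * r ^ 5"
    proof -
      have "\<kappa> * r * r ^ 5 \<le> 1 / 2 * r ^ 5" using r bd by (intro mult_right_mono) auto
      then show ?thesis unfolding m(2) by linarith
    qed
    finally have "f (\<omega> + (m * r\<^sup>2 - r ^ 3)) \<le> m * r ^ 4 - 2 * r ^ 5 + 1 / 2 * r ^ 5" .
    then show ?thesis by (simp add: algebra_simps)
  qed
  have sub: "- (m * r ^ 4) + 3 * (- 2) / 4 * r ^ 5 + f (\<omega> + m * r\<^sup>2 - (- 2) / 2 * r ^ 3) \<ge> 1 / 4 * r ^ 5" if r: "0 < r" "r < r0" for r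
  proof -
    note bd = bounds[OF r]
    have r3: "r ^ 3 > 0" using r by simp
    have y0: "0 \<le> m * r\<^sup>2 + r ^ 3" using r m by simp
    have "f (\<omega> + (m * r\<^sup>2 + r ^ 3)) \<ge> \<kappa> * (m * r\<^sup>2 + r ^ 3)\<^sup>2 - K * (m * r\<^sup>2 + r ^ 3) ^ 3" using bd y0 by (intro fr(2)) linarith+
    moreover have "\<kappa> * (m * r\<^sup>2 + r ^ 3)\<^sup>2 \<ge> m * r ^ 4 + 2 * r ^ 5"
    proof -
      have "\<kappa> * (m * r\<^sup>2 + r ^ 3)\<^sup>2 = (\<kappa> * m) * m * r ^ 4 + 2 * (\<kappa> * m) * r ^ 5 + (\<kappa> * r) * r ^ 5" by (simp add: eval_nat_numeral algebra_simps)
      moreover have "(\<kappa> * r) * r ^ 5 \<ge> 0" using m r by simp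
      ultimately show ?thesis unfolding m(2) by linarith
    qed
    moreover have "K * (m * r\<^sup>2 + r ^ 3) ^ 3 \<le> 1 / 4 * r ^ 5"
    proof -
      have "K * (m * r\<^sup>2 + r ^ 3) ^ 3 \<le> K * ((m + 1) * r\<^sup>2) ^ 3" using bd y0 K by (intro mult_left_mono power_mono) auto
      also have "\<dots> = (K * (m + 1) ^ 3 * r) * r ^ 5" by (simp add: power_mult_distrib) (simp add: eval_nat_numeral)
      also have "\<dots> \<le> 1 / 4 * r ^ 5" using bd r by (intro mult_right_mono) auto
      finally show ?thesis .
    qed
    ultimately have "f (\<omega> + (m * r\<^sup>2 + r ^ 3)) \<ge> m * r ^ 4 + 2 * r ^ 5 - 1 / 4 * r ^ 5" by linarith
    then show ?thesis by (simp add: algebra_simps)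
  qed
  have d4: "(1 / 4 :: real) > 0" by simp
  define H where "H = (\<lambda>s. \<omega> * s + m * ln s + (- 2) * rsqrt s)"
  define H1 where "H1 = (\<lambda>s. \<omega> + m * (rsqrt s)\<^sup>2 - (- 2) / 2 * rsqrt s ^ 3)"
  define H2 where "H2 = (\<lambda>s. - (m * rsqrt s ^ 4) + 3 * (- 2) / 4 * rsqrt s ^ 5)"
  have rsub: "\<forall>\<^sub>F s in at_top. - (m * rsqrt s ^ 4) + 3 * (- 2) / 4 * rsqrt s ^ 5 + f (\<omega> + m * (rsqrt s)\<^sup>2 - (- 2) / 2 * rsqrt s ^ 3) \<ge> 1 / 4 * rsqrt s ^ 5"
    by (rule eventually_rsqrt[OF r0]) (rule sub)
  have "\<forall>\<^sub>F s in at_top. H2 s + f (H1 s) \<ge> exp ((q - 1) * (H s + 0 - b * s))"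
    using rsub exp_dominated[OF \<omega>(1) d4, of m "- 2" 0]
    by eventually_elim (simp add: H_def H1_def H2_def)
  then obtain N where N: "\<And>s. s > N \<Longrightarrow> H2 s + f (H1 s) \<ge> exp ((q - 1) * (H s + 0 - b * s))"
    unfolding eventually_at_top_dense by blast
  define c where "c = max N 0 + 1"
  have c: "c > N" "c \<ge> 1" by (auto simp: c_def)
  have rc: "rsqrt c > 0" using rsqrt_props(1) c by simp
  obtain \<omega>' where \<omega>': "\<omega> < \<omega>'" "\<omega>' < min b (\<omega> + m * (rsqrt c)\<^sup>2)"
    using dense[of \<omega> "min b (\<omega> + m * (rsqrt c)\<^sup>2)"] \<omega> m rc by auto
  obtain \<kappa>1 where \<kappa>1: "\<kappa>1 > 0" "\<And>t. \<omega>' \<le> t \<Longrightarrow> t \<le> p \<Longrightarrow> f t \<ge> \<kappa>1 * (t - \<omega>')"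
    using right(2)[of \<omega>'] \<omega>' by auto
  obtain \<omega>'' where \<omega>'': "\<omega>' < \<omega>''" "\<omega>'' < min b (\<omega> + m * (rsqrt c)\<^sup>2)"
    using dense[OF \<omega>'(2)] by blast
  have "\<exists>s0 C. \<forall>x. x \<noteq> 0 \<longrightarrow> s0 < sl x \<longrightarrow> w x \<le> \<omega>' * sl x + C"
    using growth_linear[OF _ right(1) \<kappa>1] small \<omega>' by auto
  note z = below_slope[OF \<omega>''(1) this]
  have "\<exists>s0 a C. s0 \<ge> c + a \<and> (\<forall>x. x \<noteq> 0 \<longrightarrow> s0 < sl x \<longrightarrow> w x \<le> H (sl x - a) + C)"
  proof (rule growth_of_subsolution[where p = \<omega>'' and ?H1.0 = H1 and ?H2.0 = H2 and K = 0])
    have "rsqrt c ^ 3 > 0" using rc by simp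
    moreover have "\<omega>'' < \<omega> + m * (rsqrt c)\<^sup>2" using \<omega>'' by simp
    ultimately show "\<omega>'' < H1 c" unfolding H1_def by linarith
    fix s assume s: "c \<le> s"
    show "(H has_real_derivative H1 s) (at s)" "(H1 has_real_derivative H2 s) (at s)"
      unfolding H_def H1_def H2_def by (rule family_derivs; use s c in linarith)+
    show "exp ((q - 1) * (H s - b * s + 0)) \<le> H2 s + f (H1 s)" using N[of s] s c by simp
  next
    show "continuous_on {c..} H2" unfolding H2_def
      by (intro continuous_intros continuous_on_subset[OF continuous_rsqrt]) (use c in auto)
  qed (use z small in blast)+
  then obtain s0 a C where C: "s0 \<ge> c + a" "\<And>x. x \<noteq> 0 \<Longrightarrow> s0 < sl x \<Longrightarrow> w x \<le> H (sl x - a) + C" by blast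
  have up: "w x \<le> \<omega> * sl x + m * ln (sl x) + (C - \<omega> * a + m * ln (1 + \<bar>a\<bar>))" if x: "x \<noteq> 0" "max 1 s0 < sl x" for x
  proof -
    have sa: "sl x - a > 0" "sl x > 1" using x C(1) c by auto
    have "\<bar>a\<bar> * 1 \<le> \<bar>a\<bar> * sl x" using sa by (intro mult_left_mono) auto
    then have "sl x - a \<le> sl x * (1 + \<bar>a\<bar>)" by (simp add: algebra_simps) 
    then have "ln (sl x - a) \<le> ln (sl x * (1 + \<bar>a\<bar>))" using sa by (intro ln_mono) auto
    also have "\<dots> = ln (sl x) + ln (1 + \<bar>a\<bar>)" using sa by (intro ln_mult_pos) auto
    finally have "m * ln (sl x - a) \<le> m * (ln (sl x) + ln (1 + \<bar>a\<bar>))" using m(1) by simp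
    moreover have "rsqrt (sl x - a) > 0" using rsqrt_props(1) sa by simp
    moreover have "w x \<le> H (sl x - a) + C" using C(2) x by simp
    ultimately show ?thesis unfolding H_def by (simp add: algebra_simps)
  qed
  have "(\<exists>L. ((\<lambda>x. w x - (\<omega> * sl x + m * ln (sl x))) \<longlongrightarrow> L) (at 0)) \<and> ((\<lambda>x. x \<bullet> Gw x) \<longlongrightarrow> - \<omega>) (at 0)
    \<or> (\<forall>M. \<exists>s0. \<forall>x. x \<noteq> 0 \<longrightarrow> s0 < sl x \<longrightarrow> w x - (\<omega> * sl x + m * ln (sl x)) \<le> M)"
    by (rule family_dichotomy[OF \<omega>(1) f\<omega> r0 sup d4 sub]) (use up in blast)+
  then show ?thesis
  proof
    assume "\<forall>M. \<exists>s0. \<forall>x. x \<noteq> 0 \<longrightarrow> s0 < sl x \<longrightarrow> w x - (\<omega> * sl x + m * ln (sl x)) \<le> M"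
    then have "\<exists>s0 C. \<forall>x. x \<noteq> 0 \<longrightarrow> s0 < sl x \<longrightarrow> w x \<le> \<omega> * sl x + C"
      by (intro upper_double[OF m(2,1), of "\<bar>\<omega>\<bar> / 2"] fr(1)) (use \<omega>0 in auto)
    from root_converges[OF \<omega> _ this] show ?thesis using k by simp
  qed (simp add: m_def)
qed blast

lemma U_of_positive_left:
  assumes "\<And>t. t \<le> b \<Longrightarrow> ft t > 0"
  shows "((\<lambda>x. w x - b * sl x) \<longlongrightarrow> ln (f b) / (q - 1)) (at 0)"
proof -
  obtain \<kappa> where \<kappa>: "\<kappa> > 0" "\<And>y. y \<ge> 0 \<Longrightarrow> f (b - y) \<ge> \<kappa> * (1 + y\<^sup>2)" using f_positive_left[OF b assms] by blast
  then obtain C where C: "\<And>x. x \<noteq> 0 \<Longrightarrow> a0 + 1 \<le> sl x \<Longrightarrow> w x - b * sl x \<ge> C" using lower_bounded by blast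
  have "f b > 0" using f_rho_ftilde[OF b] assms[of b] b by (simp add: mult_neg_pos)
  from U_limit[OF this, of "a0 + 1" C] C show ?thesis by simp
qed

lemma root_limit_of_between:
  assumes \<omega>: "\<omega> < b" "ft \<omega> = 0" and k: "lam * \<tau> * \<bar>\<omega>\<bar> powr (- \<tau> - 1) \<le> 1" and fb: "f b \<le> 0"
    and between: "\<exists>\<kappa>>0. \<forall>t. \<omega> \<le> t \<longrightarrow> t \<le> b \<longrightarrow> f t \<le> - (\<kappa> * (t - \<omega>) * (b - t))"
  shows "(\<exists>L. ((\<lambda>x. w x - \<omega> * sl x) \<longlongrightarrow> L) (at 0)) \<and> ((\<lambda>x. x \<bullet> Gw x) \<longlongrightarrow> - \<omega>) (at 0)"
proof -
  obtain \<kappa> where "\<kappa> > 0" "\<And>t. \<omega> \<le> t \<Longrightarrow> t \<le> b \<Longrightarrow> f t \<le> - (\<kappa> * (t - \<omega>) * (b - t))" using between by blast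
  from upper_simple[OF \<omega>(1) this tends_to_minus_infinity[OF fb]] root_converges[OF \<omega> k] show ?thesis by blast
qed

end

section \<open>Proof of the theorem\<close>

lemma exp_sl: "x \<noteq> 0 \<Longrightarrow> exp (c * sl x) = norm x powr (- c)"
  by (simp add: sl_def powr_def)

lemma exp_sl_ln: "x \<noteq> 0 \<Longrightarrow> 0 < sl x \<Longrightarrow> exp (c * sl x + m * ln (sl x)) = norm x powr (- c) * \<bar>ln (norm x)\<bar> powr m"
  by (simp add: exp_add exp_sl) (simp add: sl_def powr_def)

text \<open>Both profiles would be equivalent to each other, but their quotient is a multiple of
  \<open>exp (G - H)\<close> and tends to 0.\<close>

lemma profiles_exclusive:
  fixes u :: "'a::euclidean_space \<Rightarrow> real"
  assumes u: "u \<sim>[at 0] g" "u \<sim>[at 0] h"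
    and g: "\<And>x. x \<noteq> 0 \<Longrightarrow> 0 < sl x \<Longrightarrow> g x = c * exp (G (sl x))"
    and h: "\<And>x. x \<noteq> 0 \<Longrightarrow> 0 < sl x \<Longrightarrow> h x = d * exp (H (sl x))" "d \<noteq> 0"
    and GH: "filterlim (\<lambda>s. G s - H s) at_bot at_top"
  shows False
proof -
  have "g \<sim>[at 0] h" using u asymp_equiv_trans asymp_equiv_sym by blast
  then have l1: "((\<lambda>x. if g x = 0 \<and> h x = 0 then 1 else g x / h x) \<longlongrightarrow> 1) (at 0)" by (simp add: asymp_equiv_def)
  have "filterlim (\<lambda>x::'a. G (sl x) - H (sl x)) at_bot (at 0)" by (rule filterlim_compose[OF GH filterlim_sl])
  then have "((\<lambda>x::'a. exp (G (sl x) - H (sl x))) \<longlongrightarrow> 0) (at 0)" by (rule filterlim_compose[OF exp_at_bot])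
  then have l2: "((\<lambda>x::'a. c / d * exp (G (sl x) - H (sl x))) \<longlongrightarrow> c / d * 0) (at 0)" by (intro tendsto_intros)
  have "\<forall>\<^sub>F x in at 0. (if g x = 0 \<and> h x = 0 then 1 else g x / h x) = c / d * exp (G (sl x) - H (sl x))"
    by (rule eventually_sl[of 0]) (use g h in \<open>simp add: exp_diff\<close>)
  from tendsto_cong[OF this] l1 have "((\<lambda>x::'a. c / d * exp (G (sl x) - H (sl x))) \<longlongrightarrow> 1) (at 0)" by blast
  from tendsto_unique[OF _ this l2] show False by simp
qed

lemma ln_at_bot_dominated:
  assumes "c < (0::real)" shows "filterlim (\<lambda>s. c * s + m * ln s) at_bot at_top"
proof -
  have "((\<lambda>s. c + m * (ln s / s)) \<longlongrightarrow> c + m * 0) at_top" by (intro tendsto_intros ln_x_over_x_tendsto_0)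
  then have "filterlim (\<lambda>s. (c + m * (ln s / s)) * s) at_bot at_top"
    by (intro filterlim_tendsto_neg_mult_at_bot[where c = c] assms filterlim_ident) simp
  moreover have "\<forall>\<^sub>F s in at_top. (c + m * (ln s / s)) * s = c * s + m * ln s"
    using eventually_gt_at_top[of 0] by eventually_elim (simp add: field_simps)
  ultimately show ?thesis by (simp add: filterlim_cong[OF refl refl])
qed

theorem theorem1p4:
  fixes \<Omega> :: "'a::euclidean_space set" and u :: "'a \<Rightarrow> real"
    and q \<tau> \<rho> lam \<theta> :: real
  assumes dim: "DIM('a) \<ge> 2"
    and q: "q > 1" and tau: "0 \<le> \<tau>" "\<tau> < 1" and theta: "\<theta> < -2"
    and domain: "open \<Omega>" "connected \<Omega>" "0 \<in> \<Omega>"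
    and sol: "positive_solution \<rho> lam \<tau> \<theta> q \<Omega> u"
  shows
    "let \<beta> = beta_exp \<theta> q;
         w1 = varpi1 \<rho> lam \<tau>;
         w2 = varpi2 \<rho> lam \<tau>;
         Ups = Upsilon lam \<tau>;
         N1 = case_N1 \<rho> lam \<tau>;
         N2 = case_N2 \<rho> lam \<tau>;
         P0 = (N2 \<and> w2 < \<beta> \<and> \<beta> < 0);
         Z1 = ((N1 \<or> N2) \<and> \<beta> = w1 \<and> (N2 \<longrightarrow> \<rho> \<noteq> Ups));
         Z2 = (N2 \<and> \<rho> = Ups \<and> \<beta> = w1 \<and> w1 = w2 \<and> w2 = - ((lam * \<tau>) powr (1 / (\<tau> + 1))));
         behaviour_w1 = (\<exists>a>0. u \<sim>[at 0] (\<lambda>x. a * norm x powr (- w1)) \<and>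
             (\<lambda>x. x \<bullet> grad u x) \<sim>[at 0] (\<lambda>x. - a * w1 * norm x powr (- w1)));
         behaviour_w2 = (\<exists>b>0. u \<sim>[at 0] (\<lambda>x. b * Phi_varpi2 \<rho> lam \<tau> (norm x)) \<and>
             (\<lambda>x. x \<bullet> grad u x) \<sim>[at 0] (\<lambda>x. - b * w2 * Phi_varpi2 \<rho> lam \<tau> (norm x)));
         behaviour_U = (u \<sim>[at 0] (\<lambda>x. U_prof \<rho> lam \<tau> \<theta> q (norm x)))
     in
       (f_rho \<rho> lam \<tau> \<beta> > 0 \<longrightarrow>
          (P0 \<longrightarrow>
             (behaviour_w1 \<or> behaviour_w2 \<or> behaviour_U) \<and>
             \<not> (behaviour_w1 \<and> behaviour_w2) \<and>
             \<not> (behaviour_w1 \<and> behaviour_U) \<and>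
             \<not> (behaviour_w2 \<and> behaviour_U)) \<and>
          (\<not> P0 \<longrightarrow> behaviour_U)) \<and>
       (f_rho \<rho> lam \<tau> \<beta> \<le> 0 \<longrightarrow>
          (Z1 \<longrightarrow>
             u \<sim>[at 0] (\<lambda>x.
               (\<bar>w1\<bar> * (1 - lam * \<tau> * \<bar>w1\<bar> powr (- \<tau> - 1)) / (q - 1)) powr (1 / (q - 1))
               * (norm x powr (- w1) / \<bar>ln (norm x)\<bar> powr (1 / (q - 1))))) \<and>
          (Z2 \<longrightarrow>
             u \<sim>[at 0] (\<lambda>x.
               (2 * (q + \<tau>) / (q - 1)\<^sup>2) powr (1 / (q - 1))
               * (norm x powr (- w1) / \<bar>ln (norm x)\<bar> powr (2 / (q - 1))))) \<and>
          (\<not> Z1 \<and> \<not> Z2 \<longrightarrow> behaviour_w1))"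
proof -
  define b where "b = beta_exp \<theta> q"
  define w1 where "w1 = varpi1 \<rho> lam \<tau>"
  define w2 where "w2 = varpi2 \<rho> lam \<tau>"
  define F where "F = f_rho \<rho> lam \<tau>"
  define \<Phi> where "\<Phi> = (\<lambda>x::'a. Phi_varpi2 \<rho> lam \<tau> (norm x))"
  define BW1 where "BW1 \<longleftrightarrow> (\<exists>a>0. u \<sim>[at 0] (\<lambda>x. a * norm x powr (- w1)) \<and>
    (\<lambda>x. x \<bullet> grad u x) \<sim>[at 0] (\<lambda>x. - a * w1 * norm x powr (- w1)))"
  define BW2 where "BW2 \<longleftrightarrow> (\<exists>a>0. u \<sim>[at 0] (\<lambda>x. a * \<Phi> x) \<and>
    (\<lambda>x. x \<bullet> grad u x) \<sim>[at 0] (\<lambda>x. - a * w2 * \<Phi> x))"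
  define BU where "BU \<longleftrightarrow> u \<sim>[at 0] (\<lambda>x. U_prof \<rho> lam \<tau> \<theta> q (norm x))"
  define k where "k = \<bar>b\<bar> * (1 - lam * \<tau> * \<bar>b\<bar> powr (- \<tau> - 1))"
  define BZ1 where "BZ1 \<longleftrightarrow> u \<sim>[at 0] (\<lambda>x. (k / (q - 1)) powr (1 / (q - 1))
    * (norm x powr (- b) / \<bar>ln (norm x)\<bar> powr (1 / (q - 1))))"
  define BZ2 where "BZ2 \<longleftrightarrow> u \<sim>[at 0] (\<lambda>x. (2 * (q + \<tau>) / (q - 1)\<^sup>2) powr (1 / (q - 1))
    * (norm x powr (- b) / \<bar>ln (norm x)\<bar> powr (2 / (q - 1))))"
  \<comment> \<open>With this exponent both branches of \<open>Phi_varpi2\<close> take the form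
    \<open>exp (w2 * s + m * ln s)\<close>.\<close>
  define m where "m = (if \<rho> = Upsilon lam \<tau> then 2 / (1 + \<tau>) else 0)"

  obtain gw a0 where S: "log_solution \<rho> lam \<tau> (\<lambda>x. ln (u x)) (\<lambda>x. inverse (u x) *\<^sub>R grad u x) gw q b a0"
    and upos: "\<And>x. x \<noteq> 0 \<Longrightarrow> a0 < sl x \<Longrightarrow> u x > 0"
    using positive_solution_log[OF dim q tau theta domain(1,3) sol] unfolding b_def by blast
  interpret log_solution \<rho> lam \<tau> "\<lambda>x. ln (u x)" "\<lambda>x. inverse (u x) *\<^sub>R grad u x" gw q b a0 by (rule S)
  have b0: "b < 0" by (rule b)
  have fb: "F b = - b * ft b" unfolding F_def by (rule f_rho_ftilde[OF b0])
  have fb_iff: "F b > 0 \<longleftrightarrow> ft b > 0" unfolding fb using b0 by (auto simp: zero_less_mult_iff mult_less_0_iff)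

  have \<Phi>: "\<Phi> x = exp (w2 * sl x + m * ln (sl x))" if "x \<noteq> 0" "0 < sl x" for x
    using exp_sl_ln[OF that, of w2] exp_sl[OF that(1), of w2] that unfolding \<Phi>_def Phi_varpi2_def m_def w2_def by (auto simp: sl_def)
  have U: "U_prof \<rho> lam \<tau> \<theta> q (norm x) = F b powr (1 / (q - 1)) * exp (b * sl x)" if "x \<noteq> 0" for x :: 'a
    using exp_sl[OF that, of b] unfolding U_prof_def b_def F_def by simp

  have to_BW1: BW1 if lim: "(\<exists>L. ((\<lambda>x. ln (u x) - w1 * sl x) \<longlongrightarrow> L) (at 0)) \<and>
    ((\<lambda>x. x \<bullet> (inverse (u x) *\<^sub>R grad u x)) \<longlongrightarrow> - w1) (at 0)" and w1: "w1 < 0"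
  proof -
    obtain L where L: "((\<lambda>x. ln (u x) - w1 * sl x) \<longlongrightarrow> L) (at 0)" using lim by blast
    have u: "u \<sim>[at 0] (\<lambda>x. exp L * norm x powr (- w1))"
      by (rule asymp_equiv_of_log[where c = 0 and ?a0.0 = a0 and ?W0.0 = "\<lambda>s. w1 * s", OF L upos]) (simp_all add: exp_sl)
    from asymp_equiv_gradient[OF _ _ this, of "grad u" w1] lim w1
    have "(\<lambda>x. x \<bullet> grad u x) \<sim>[at 0] (\<lambda>x. - w1 * (exp L * norm x powr (- w1)))" by blast
    then show BW1 unfolding BW1_def using u by (intro exI[of _ "exp L"]) (simp add: mult_ac)
  qed
  have to_BW2: BW2 if lim: "(\<exists>L. ((\<lambda>x. ln (u x) - (w2 * sl x + m * ln (sl x))) \<longlongrightarrow> L) (at 0)) \<and>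
    ((\<lambda>x. x \<bullet> (inverse (u x) *\<^sub>R grad u x)) \<longlongrightarrow> - w2) (at 0)" and w2: "w2 < 0"
  proof -
    obtain L where L: "((\<lambda>x. ln (u x) - (w2 * sl x + m * ln (sl x))) \<longlongrightarrow> L) (at 0)" using lim by blast
    have u: "u \<sim>[at 0] (\<lambda>x. exp L * \<Phi> x)"
      by (rule asymp_equiv_of_log[where c = 0 and ?a0.0 = a0 and ?W0.0 = "\<lambda>s. w2 * s + m * ln s", OF L upos]) (simp_all add: \<Phi>)
    from asymp_equiv_gradient[OF _ _ this, of "grad u" w2] lim w2
    have "(\<lambda>x. x \<bullet> grad u x) \<sim>[at 0] (\<lambda>x. - w2 * (exp L * \<Phi> x))" by blast
    then show BW2 unfolding BW2_def using u by (intro exI[of _ "exp L"]) (simp add: mult_ac)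
  qed
  have to_BU: BU if lim: "((\<lambda>x. ln (u x) - b * sl x) \<longlongrightarrow> ln (F b) / (q - 1)) (at 0)" and "F b > 0"
    unfolding BU_def by (rule asymp_equiv_of_log[where c = 0 and ?a0.0 = a0 and ?W0.0 = "\<lambda>s. b * s", OF lim upos]) (use that(2) in \<open>simp_all add: U powr_def\<close>)
  have excl: "\<not> (BW1 \<and> BW2)" "\<not> (BW1 \<and> BU)" "\<not> (BW2 \<and> BU)"
    if N2: "case_N2 \<rho> lam \<tau>" and ord: "w1 \<le> w2" "\<rho> \<noteq> Upsilon lam \<tau> \<Longrightarrow> w1 < w2" "w2 < b" "F b > 0"
  proof -
    \<comment> \<open>At a double root the first two profiles differ only by the logarithmic factor,
      whose exponent is then positive.\<close>
    have m: "w1 - w2 < 0 \<or> w1 = w2 \<and> m > 0" using ord tau unfolding m_def by auto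
    have l12: "filterlim (\<lambda>s. w1 * s - (w2 * s + m * ln s)) at_bot at_top"
    proof (cases "w1 - w2 < 0")
      case True
      then show ?thesis using ln_at_bot_dominated[of "w1 - w2" "- m"] by (simp add: algebra_simps)
    next
      case False
      then have "w1 = w2" "- m < 0" using m by auto
      then show ?thesis using filterlim_tendsto_neg_mult_at_bot[OF tendsto_const _ ln_at_top, of "- m"] by simp
    qed
    have l1U: "filterlim (\<lambda>s. w1 * s - b * s) at_bot at_top"
      using ln_at_bot_dominated[of "w1 - b" 0] ord by (simp add: algebra_simps)
    have l2U: "filterlim (\<lambda>s. w2 * s + m * ln s - b * s) at_bot at_top"
      using ln_at_bot_dominated[of "w2 - b" m] ord by (simp add: algebra_simps)
    show "\<not> (BW1 \<and> BW2)"
    proof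
      assume "BW1 \<and> BW2"
      then obtain a c where "c > 0" and uu: "u \<sim>[at 0] (\<lambda>x. a * norm x powr (- w1))" "u \<sim>[at 0] (\<lambda>x. c * \<Phi> x)"
        unfolding BW1_def BW2_def by blast
      then show False
        by (intro profiles_exclusive[OF uu, of a "\<lambda>s. w1 * s" c "\<lambda>s. w2 * s + m * ln s"]) (simp_all add: exp_sl \<Phi> l12)
    qed
    show "\<not> (BW1 \<and> BU)"
    proof
      assume "BW1 \<and> BU"
      then obtain a where uu: "u \<sim>[at 0] (\<lambda>x. a * norm x powr (- w1))" "u \<sim>[at 0] (\<lambda>x. U_prof \<rho> lam \<tau> \<theta> q (norm x))"
        unfolding BW1_def BU_def by blast
      show False
        by (rule profiles_exclusive[OF uu, of a "\<lambda>s. w1 * s" "F b powr (1 / (q - 1))" "\<lambda>s. b * s"])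
          (use ord in \<open>simp_all add: exp_sl U l1U\<close>)
    qed
    show "\<not> (BW2 \<and> BU)"
    proof
      assume "BW2 \<and> BU"
      then obtain a where uu: "u \<sim>[at 0] (\<lambda>x. a * \<Phi> x)" "u \<sim>[at 0] (\<lambda>x. U_prof \<rho> lam \<tau> \<theta> q (norm x))"
        unfolding BW2_def BU_def by blast
      show False
        by (rule profiles_exclusive[OF uu, of a "\<lambda>s. w2 * s + m * ln s" "F b powr (1 / (q - 1))" "\<lambda>s. b * s"])
          (use ord in \<open>simp_all add: \<Phi> U l2U\<close>)
    qed
  qed
  have to_BZ1: BZ1 if "ft b = 0" "lam * \<tau> * \<bar>b\<bar> powr (- \<tau> - 1) < 1"
  proof -
    have k: "k > 0" unfolding k_def using b0 that by (intro mult_pos_pos) auto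
    show ?thesis unfolding BZ1_def
    proof (rule asymp_equiv_of_log[where c = 0 and ?a0.0 = a0 and ?W0.0 = "\<lambda>s. b * s - 1 / (q - 1) * ln s", OF Z1_limit[OF that(1) k_def k] upos])
      fix x :: 'a assume x: "x \<noteq> 0" "0 < sl x"
      have "exp (- (1 / (q - 1) * ln ((q - 1) / k))) = (k / (q - 1)) powr (1 / (q - 1))"
        unfolding powr_def using k q by (simp add: ln_div algebra_simps)
      moreover have "exp (b * sl x - 1 / (q - 1) * ln (sl x)) = norm x powr (- b) / \<bar>ln (norm x)\<bar> powr (1 / (q - 1))"
        using exp_sl_ln[OF x, of b "- (1 / (q - 1))"] by (simp add: powr_minus_divide)
      ultimately show "(k / (q - 1)) powr (1 / (q - 1)) * (norm x powr (- b) / \<bar>ln (norm x)\<bar> powr (1 / (q - 1)))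
        = exp (- (1 / (q - 1) * ln ((q - 1) / k))) * exp (b * sl x - 1 / (q - 1) * ln (sl x))" by simp
    qed
  qed
  have to_BZ2: BZ2 if "ft b = 0" "lam * \<tau> * \<bar>b\<bar> powr (- \<tau> - 1) = 1"
    unfolding BZ2_def
  proof (rule asymp_equiv_of_log[where c = 0 and ?a0.0 = a0 and ?W0.0 = "\<lambda>s. b * s - 2 / (q - 1) * ln s", OF Z2_limit[OF that] upos])
    fix x :: 'a assume x: "x \<noteq> 0" "0 < sl x"
    have "2 * (q + \<tau>) / (q - 1)\<^sup>2 \<noteq> 0" using q tau by simp
    then have "exp (1 / (q - 1) * ln (2 * (q + \<tau>) / (q - 1)\<^sup>2)) = (2 * (q + \<tau>) / (q - 1)\<^sup>2) powr (1 / (q - 1))"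
      unfolding powr_def by (simp only: if_False)
    moreover have "exp (b * sl x - 2 / (q - 1) * ln (sl x)) = norm x powr (- b) / \<bar>ln (norm x)\<bar> powr (2 / (q - 1))"
      using exp_sl_ln[OF x, of b "- (2 / (q - 1))"] by (simp add: powr_minus_divide)
    ultimately show "(2 * (q + \<tau>) / (q - 1)\<^sup>2) powr (1 / (q - 1)) * (norm x powr (- b) / \<bar>ln (norm x)\<bar> powr (2 / (q - 1)))
      = exp (1 / (q - 1) * ln (2 * (q + \<tau>) / (q - 1)\<^sup>2)) * exp (b * sl x - 2 / (q - 1) * ln (sl x))" by simp
  qed

  let ?N1 = "case_N1 \<rho> lam \<tau>" and ?N2 = "case_N2 \<rho> lam \<tau>"
  let ?P0 = "?N2 \<and> w2 < b \<and> b < 0"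
  let ?Z1 = "(?N1 \<or> ?N2) \<and> b = w1 \<and> (?N2 \<longrightarrow> \<rho> \<noteq> Upsilon lam \<tau>)"
  let ?Z2 = "?N2 \<and> \<rho> = Upsilon lam \<tau> \<and> b = w1 \<and> w1 = w2 \<and> w2 = - ((lam * \<tau>) powr (1 / (\<tau> + 1)))"
  have main: "(F b > 0 \<longrightarrow> (?P0 \<longrightarrow> (BW1 \<or> BW2 \<or> BU) \<and> \<not> (BW1 \<and> BW2) \<and> \<not> (BW1 \<and> BU) \<and> \<not> (BW2 \<and> BU)) \<and> (\<not> ?P0 \<longrightarrow> BU))
    \<and> (F b \<le> 0 \<longrightarrow> (?Z1 \<longrightarrow> BZ1) \<and> (?Z2 \<longrightarrow> BZ2) \<and> (\<not> ?Z1 \<and> \<not> ?Z2 \<longrightarrow> BW1))"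
  proof -
    consider "?N2" | "?N1" "\<not> ?N2" | "\<not> ?N1" "\<not> ?N2" by blast
    then show ?thesis
    proof cases
      case 1
      then have l: "lam > 0" "0 < \<tau>" "\<tau> < 1" by (auto simp: case_N2_def)
      note xs = xstar[OF l]
      obtain \<omega>1 \<omega>2 where \<omega>: "\<omega>1 \<le> - xstar" "- xstar \<le> \<omega>2" "\<omega>2 < 0" "negative_roots \<rho> lam \<tau> = {\<omega>1, \<omega>2}"
        and sgn: "\<And>t. t < \<omega>1 \<Longrightarrow> ft t > 0" "\<And>t. t < 0 \<Longrightarrow> \<omega>2 < t \<Longrightarrow> ft t > 0"
          "\<And>t. \<omega>1 < t \<Longrightarrow> t < \<omega>2 \<Longrightarrow> ft t < 0"
        and dbl: "\<rho> = Upsilon lam \<tau> \<Longrightarrow> \<omega>1 = - xstar \<and> \<omega>2 = - xstar"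
        and smp: "\<rho> \<noteq> Upsilon lam \<tau> \<Longrightarrow> \<omega>1 < - xstar \<and> - xstar < \<omega>2"
        using N2_roots[OF 1] by blast
      have "\<omega>1 \<le> \<omega>2" using \<omega> by linarith
      then have w: "w1 = \<omega>1" "w2 = \<omega>2" unfolding w1_def w2_def varpi1_def varpi2_def \<omega>(4) by (auto simp: max_def)
      have root: "ft \<omega>1 = 0" "ft \<omega>2 = 0" "\<omega>1 < 0" using \<omega>(4) unfolding negative_roots_def by auto
      have k1: "lam * \<tau> * \<bar>\<omega>1\<bar> powr (- \<tau> - 1) \<le> 1"
        using xs(2) xs(4)[of \<omega>1] \<omega>(1) root(3) xs(1) by (cases "\<omega>1 = - xstar") auto
      have "F b > 0 \<longrightarrow> (?P0 \<longrightarrow> (BW1 \<or> BW2 \<or> BU)) \<and> (\<not> ?P0 \<longrightarrow> BU)"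
      proof (intro impI conjI)
        assume pos: "F b > 0" and P0: ?P0
        \<comment> \<open>\<open>b / 2\<close> is the right end \<open>p\<close> of the slope
          interval on which \<open>f\<close> is bounded below: larger than \<open>b\<close>, but
          still negative.\<close>
        have pb: "b < b / 2" "b / 2 < 0" using b0 by auto
        show "BW1 \<or> BW2 \<or> BU"
        proof (cases "\<rho> = Upsilon lam \<tau>")
          case True
          have \<omega>x: "\<omega>1 = - xstar" "\<omega>2 = \<omega>1" using dbl[OF True] by auto
          have "\<exists>\<kappa>>0. \<forall>t. \<omega>' \<le> t \<longrightarrow> t \<le> b / 2 \<longrightarrow> f t \<ge> \<kappa> * (t - \<omega>')" if "\<omega>1 < \<omega>'" "\<omega>' < b" for \<omega>'
            using that pb \<omega>x sgn(2)[of \<omega>'] b0 by (intro N2_right[OF l]) auto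
          from trichotomy_double[OF _ root(1) _ l(1) pb(1) this] P0 pos xs(1,2)
          show ?thesis using to_BW1 to_BW2 to_BU root(3) True unfolding w \<omega>x F_def m_def by auto
        next
          case False
          note \<omega>x = smp[OF False]
          obtain \<kappa> where \<kappa>: "\<kappa> > 0" "\<And>t. \<omega>2 \<le> t \<Longrightarrow> t \<le> b / 2 \<Longrightarrow> f t \<ge> \<kappa> * (t - \<omega>2)"
            using N2_right[OF l, of \<omega>2 "b / 2"] \<omega>x P0 pb root unfolding w by fastforce
          obtain \<kappa>' where \<kappa>': "\<kappa>' > 0" "\<And>t. \<omega>1 \<le> t \<Longrightarrow> t \<le> \<omega>2 \<Longrightarrow> f t \<le> - (\<kappa>' * (t - \<omega>1) * (\<omega>2 - t))"
            using N2_between[OF l root(1), of \<omega>2] \<omega>x \<omega>(3) root by fastforce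
          have "\<omega>2 < b" "\<omega>1 < \<omega>2" using P0 \<omega>x unfolding w by auto
          from trichotomy_simple[OF this(1) root(2) this(2) root(1) k1 pb(1) \<kappa> \<kappa>'] pos
          show ?thesis using to_BW1 to_BW2 to_BU root(3) \<omega>(3) False unfolding w F_def m_def by auto
        qed
      next
        assume pos: "F b > 0" and P0: "\<not> ?P0"
        \<comment> \<open>\<open>ft\<close> vanishes at the roots and is negative between them, so
          its positivity at \<open>b \<le> \<omega>2\<close> leaves only the region to the left of
          \<open>\<omega>1\<close>.\<close>
        then have "b \<le> \<omega>2" "ft b > 0" using 1 b0 fb_iff unfolding w by auto
        then have "b < \<omega>1" using sgn(3)[of b] root by (cases b \<omega>1 rule: linorder_cases; cases "b = \<omega>2") auto
        then have "\<And>t. t \<le> b \<Longrightarrow> ft t > 0" using sgn(1) by simp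
        then show BU using to_BU[OF _ pos] U_of_positive_left unfolding F_def by blast
      qed
      moreover have "F b \<le> 0 \<longrightarrow> (?Z1 \<longrightarrow> BZ1) \<and> (?Z2 \<longrightarrow> BZ2) \<and> (\<not> ?Z1 \<and> \<not> ?Z2 \<longrightarrow> BW1)"
      proof (intro impI conjI)
        assume "F b \<le> 0" and Z: ?Z1
        then have "\<omega>1 < - xstar" "b = \<omega>1" using 1 smp unfolding w by auto
        then show BZ1 using to_BZ1 root xs(4)[of \<omega>1] by simp
      next
        assume "F b \<le> 0" and Z: ?Z2
        then have "b = - xstar" "b = \<omega>1" using dbl unfolding w by auto
        then show BZ2 using to_BZ2 root xs(1,2) by simp
      next
        assume F: "F b \<le> 0" and Z: "\<not> ?Z1 \<and> \<not> ?Z2"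
        \<comment> \<open>Equality would be Z_1 for distinct roots and Z_2 for the double
          root.\<close>
        have "b \<noteq> \<omega>1"
        proof
          assume b: "b = \<omega>1"
          then have "\<rho> = Upsilon lam \<tau>" using Z 1 unfolding w by blast
          with dbl b 1 have ?Z2 unfolding w xstar_def by (metis (no_types))
          then show False using Z by blast
        qed
        moreover have "\<not> b < \<omega>1" "\<not> \<omega>2 < b" using sgn(1,2)[of b] F fb_iff b0 by auto
        \<comment> \<open>The case \<open>b = \<omega>2\<close> is included:
          \<open>N2_between\<close> asks only for \<open>ft p \<le> 0\<close> at its right end, here
          \<open>p = b\<close>.\<close>
        ultimately have b\<omega>: "\<omega>1 < b" "b \<le> \<omega>2" by auto
        have "ft b \<le> 0" using F fb_iff by auto
        from N2_between[OF l root(1) this b\<omega>(1) b0] root_limit_of_between[OF b\<omega>(1) root(1) k1]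
        show BW1 using F to_BW1 root(3) unfolding w F_def by blast
      qed
      moreover have "F b > 0 \<longrightarrow> ?P0 \<longrightarrow> \<not> (BW1 \<and> BW2) \<and> \<not> (BW1 \<and> BU) \<and> \<not> (BW2 \<and> BU)"
        using excl[OF 1] \<open>\<omega>1 \<le> \<omega>2\<close> smp unfolding w by fastforce
      ultimately show ?thesis by blast
    next
      case 2
      obtain \<omega> where \<omega>: "\<omega> < 0" "negative_roots \<rho> lam \<tau> = {\<omega>}"
        and sgn: "\<And>t. t < 0 \<Longrightarrow> t < \<omega> \<Longrightarrow> ft t > 0"
          "\<And>t. t < 0 \<Longrightarrow> \<omega> \<le> t \<Longrightarrow> ft t \<le> - (t - \<omega>)" and lt: "lam * \<tau> \<le> 0"
        using N1_roots[OF 2(1)] by blast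
      have w: "w1 = \<omega>" unfolding w1_def varpi1_def \<omega>(2) by simp
      have root: "ft \<omega> = 0" using \<omega>(2) unfolding negative_roots_def by blast
      have k: "lam * \<tau> * \<bar>\<omega>\<bar> powr (- \<tau> - 1) < 1"
        using lt mult_nonpos_nonneg[of "lam * \<tau>" "\<bar>\<omega>\<bar> powr (- \<tau> - 1)"] by simp
      have "F b > 0 \<longrightarrow> BU"
      proof
        assume pos: "F b > 0"
        then have "b < \<omega>" using fb_iff sgn(2)[of b] b0 by force
        then have "\<And>t. t \<le> b \<Longrightarrow> ft t > 0" using sgn(1) b0 by simp
        then show BU using to_BU[OF _ pos] U_of_positive_left unfolding F_def by blast
      qed
      moreover have "F b \<le> 0 \<longrightarrow> (b = \<omega> \<longrightarrow> BZ1) \<and> (b \<noteq> \<omega> \<longrightarrow> BW1)"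
      proof (intro impI conjI)
        assume "b = \<omega>"
        then show BZ1 using to_BZ1 root k by simp
      next
        assume F: "F b \<le> 0" and "b \<noteq> \<omega>"
        then have b\<omega>: "\<omega> < b" using fb_iff sgn(1)[of b] b0 by force
        from N1_between[OF sgn(2) b\<omega> b0] root_limit_of_between[OF b\<omega> root less_imp_le[OF k]]
        show BW1 using F to_BW1 \<omega>(1) unfolding w F_def by blast
      qed
      ultimately show ?thesis using 2 w by blast
    next
      case 3
      \<comment> \<open>In the absence of negative roots \<open>f\<close> is positive on the whole
        negative axis, so the second half of the statement is vacuous.\<close>
      have pos: "ft t > 0" if "t < 0" for t by (rule N0_positive[OF 3 that])
      then have Fb: "F b > 0" using fb_iff b0 by blast
      have "\<And>t. t \<le> b \<Longrightarrow> ft t > 0" using pos b0 by simp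
      then have BU using to_BU[OF _ Fb] U_of_positive_left unfolding F_def by blast
      then show ?thesis using 3 Fb by simp
    qed
  qed
  show ?thesis
    unfolding Let_def b_def[symmetric] w1_def[symmetric] w2_def[symmetric] F_def[symmetric]
    using main unfolding BW1_def BW2_def BU_def BZ1_def BZ2_def k_def \<Phi>_def by auto
qed

end
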